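(* Let $M$ be a $7$-manifold with a $G_2$-structure $\tilde\varphi$, let $a,\lambda,b_1,b_2\in\mathbb{R}$, and let $\hat P:\Omega^3_+(M)\to\Omega^3(M)$ be the quasilinear differential operator $$\hat P(\varphi)=(-\mathrm{Rc}+a\,\mathcal{L}_{\mathsf{V}T}g+\lambda F)\diamond\varphi+(b_1\,\mathrm{div}\,T+b_2\,\mathrm{div}\,T^t)\lrcorner\psi.$$ Let $W(\varphi,\tilde\varphi)$ be the vector field $W^k=g^{ij}(\Gamma^k_{ij}-\tilde\Gamma^k_{ij})-2a(\mathsf{V}T)^k$, where $\Gamma$ and $\tilde\Gamma$ are the Christoffel symbols of the Riemannian metrics $g$ and $\tilde g$ induced by $\varphi$ and $\tilde\varphi$. Suppose that $$b_1+b_2\ge1,\qquad 0\le b_1-a-1<4,\qquad |\lambda|<\tfrac14\big(1-\tfrac14(b_1-a-1)\big).$$ Then the differential operator $\hat Q(\varphi)=\hat P(\varphi)+\mathcal{L}_{W(\varphi,\tilde\varphi)}\varphi$ is strongly elliptic at $\tilde\varphi$.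
   Context: A $G_2$-structure on a smooth $7$-manifold $M$ is a smooth $3$-form $\varphi$ which is nondegenerate: it determines a Riemannian metric $g$ and volume form $\mathrm{vol}$ by $(X\lrcorner\varphi)\wedge(Y\lrcorner\varphi)\wedge\varphi=-6\,g(X,Y)\,\mathrm{vol}$. $\Omega^3_+(M)$ is the (open) set of $G_2$-structures in $\Omega^3(M)$. Let $\nabla$ be the Levi-Civita connection of $g$ and $\psi=\star\varphi$. Subscript indices refer to a local $g$-orthonormal frame, repeated indices are summed, and $\varphi_{ijk}\varphi_{abk}=g_{ia}g_{jb}-g_{ib}g_{ja}-\psi_{ijab}$. The torsion is the unique $2$-tensor $T$ with $\nabla_m\varphi_{ijk}=T_{mp}\psi_{pijk}$; $(T^t)_{ij}=T_{ji}$; $(\mathsf{V}T)_k=T_{ij}\varphi_{ijk}$; $(\mathrm{div}\,T)_k=\nabla_iT_{ik}$, $(\mathrm{div}\,T^t)_k=\nabla_iT_{ki}$. Curvature: $R_{ijkl}=g(\nabla_{e_i}\nabla_{e_j}e_k-\nabla_{e_j}\nabla_{e_i}e_k-\nabla_{[e_i,e_j]}e_k,e_l)$, $\mathrm{Rc}_{jk}=R_{ljkl}$, $F_{pq}=R_{ijkl}\varphi_{ijp}\varphi_{klq}$. For a $2$-tensor $A$, $(A\diamond\varphi)_{ijk}=A_{ip}\varphi_{pjk}+A_{jp}\varphi_{ipk}+A_{kp}\varphi_{ijp}$; $(X\lrcorner\psi)_{ijk}=X_m\psi_{mijk}$. Strong ellipticity at $\tilde\varphi$: identify $\Lambda^3(T^*M)$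 with $\mathrm{Sym}^2(T^*M)\oplus T^*M$ via $(h,X)\mapsto h\diamond\tilde\varphi+X\lrcorner\tilde\psi$ (using the metric of $\tilde\varphi$), with fibre inner product $\langle(h_1,X_1),(h_2,X_2)\rangle=(h_1)_{ij}(h_2)_{ij}+(X_1)_i(X_2)_i$. Let $D_{\tilde\varphi}\hat Q$ be the linearization at $\tilde\varphi$ and $\sigma_\xi(D_{\tilde\varphi}\hat Q)$ its principal symbol (keep second-order terms, replace $\nabla_i\nabla_j$ by $\xi_i\xi_j$). $\hat Q$ is strongly elliptic at $\tilde\varphi$ if there is a constant $c>0$ such that $\langle\sigma_\xi(D_{\tilde\varphi}\hat Q)(h,X),(h,X)\rangle\ge c|\xi|^2|(h,X)|^2$ for all $x\in M$, all nonzero $\xi\in T_x^*M$ and all $(h,X)$. *)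

theory Defs
  imports "HOL-Analysis.Analysis"
begin

text \<open>
  All tensors are given by their components in coordinate charts. The orthonormal-frame
  formulas of G2-geometry are written in coordinates by contracting with the inverse metric.
  The coordinate indices are the elements 0, ..., 6 of type 7, in this order.
\<close>

type_synonym 'm chart = "'m set \<times> ('m \<Rightarrow> real^7)"
type_synonym vec7 = "real^7"
type_synonym tens2 = "real^7^7"
type_synonym tens3 = "real^7^7^7"
type_synonym tens4 = "real^7^7^7^7"


section \<open>Smooth 7-manifolds and smooth 3-forms\<close>

definition pd :: "7 \<Rightarrow> (vec7 \<Rightarrow> 'b) \<Rightarrow> vec7 \<Rightarrow> 'b::real_normed_vector" where
  "pd i f y = frechet_derivative f (at y) (axis i 1)"

primrec iter_pd :: "7 list \<Rightarrow> (vec7 \<Rightarrow> 'b) \<Rightarrow> vec7 \<Rightarrow> 'b::real_normed_vector" where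
  "iter_pd [] f = f"
| "iter_pd (i # is) f = pd i (iter_pd is f)"

text \<open>
  \<open>C\<^sup>\<infinity>\<close> on an open set: all iterated partial derivatives exist and are differentiable
  (hence continuous).
\<close>
definition smooth_on :: "vec7 set \<Rightarrow> (vec7 \<Rightarrow> 'b::real_normed_vector) \<Rightarrow> bool" where
  "smooth_on S f \<longleftrightarrow> (\<forall>is. \<forall>y\<in>S. iter_pd is f differentiable (at y))"

definition chart_image :: "'m chart \<Rightarrow> vec7 set" where
  "chart_image C = snd C ` fst C"

definition chart_inv :: "'m chart \<Rightarrow> vec7 \<Rightarrow> 'm" where
  "chart_inv C = the_inv_into (fst C) (snd C)"

definition topological_chart :: "'m::topological_space chart \<Rightarrow> bool" where
  "topological_chart C \<longleftrightarrow> open (fst C) \<and> open (chart_image C) \<and> inj_on (snd C) (fst C)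
     \<and> homeomorphism (fst C) (chart_image C) (snd C) (chart_inv C)"

definition transition :: "'m chart \<Rightarrow> 'm chart \<Rightarrow> vec7 \<Rightarrow> vec7" where
  "transition C D = snd D \<circ> chart_inv C"

text \<open>A smooth atlas on the whole (Hausdorff, second countable) space \<open>'m\<close>.\<close>
definition smooth_atlas ::
    "'m::{t2_space, second_countable_topology} chart set \<Rightarrow> bool" where
  "smooth_atlas A \<longleftrightarrow> (\<forall>C\<in>A. topological_chart C) \<and> (\<Union>C\<in>A. fst C) = UNIV
     \<and> (\<forall>C\<in>A. \<forall>D\<in>A. smooth_on (snd C ` (fst C \<inter> fst D)) (transition C D))"

definition alternating :: "tens3 \<Rightarrow> bool" where
  "alternating w \<longleftrightarrow> (\<forall>i j k. w$i$j$k = - w$j$i$k \<and> w$i$j$k = - w$i$k$j)"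

text \<open>
  A 3-form assigns to each chart its components as a function on the image of the chart;
  values at points outside the image are irrelevant.
\<close>
type_synonym 'm form3 = "'m chart \<Rightarrow> vec7 \<Rightarrow> tens3"

definition smooth_form3 :: "'m::topological_space chart set \<Rightarrow> 'm form3 \<Rightarrow> bool" where
  "smooth_form3 A w \<longleftrightarrow>
     (\<forall>C\<in>A. smooth_on (chart_image C) (w C) \<and> (\<forall>y\<in>chart_image C. alternating (w C y))) \<and>
     (\<forall>C\<in>A. \<forall>D\<in>A. \<forall>y \<in> snd C ` (fst C \<inter> fst D). \<forall>i j k.
        w C y $i$j$k = (\<Sum>a\<in>UNIV. \<Sum>b\<in>UNIV. \<Sum>c\<in>UNIV.
          pd i (transition C D) y $ a * pd j (transition C D) y $ b
            * pd k (transition C D) y $ c * w D (transition C D y) $a$b$c))"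


section \<open>Pointwise algebra of G2-structures\<close>

text \<open>
  The coefficient of \<open>dx\<^sup>0 \<and> \<dots> \<and> dx\<^sup>6\<close> in the 7-form
  \<open>(\<partial>\<^sub>i \<lrcorner> w) \<and> (\<partial>\<^sub>j \<lrcorner> w) \<and> w\<close>; the factor is \<open>1 / (2! 2! 3!)\<close>.
\<close>
definition hook_wedge :: "tens3 \<Rightarrow> tens2" where
  "hook_wedge w = (\<chi> i j. (\<Sum>p | p permutes (UNIV :: 7 set).
      of_int (sign p) * w$i$(p 0)$(p 1) * w$j$(p 2)$(p 3) * w$(p 4)$(p 5)$(p 6)) / 24)"

definition inner_product_matrix :: "tens2 \<Rightarrow> bool" where
  "inner_product_matrix g \<longleftrightarrow> transpose g = g \<and> (\<forall>x. x \<noteq> 0 \<longrightarrow> 0 < x \<bullet> (g *v x))"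

text \<open>
  \<open>(X \<lrcorner> w) \<and> (Y \<lrcorner> w) \<and> w = -6 g(X,Y) vol\<close>, where \<open>vol = v dx\<^sup>0 \<and> \<dots> \<and> dx\<^sup>6\<close> is one of the
  two volume forms of \<open>g\<close>; its sign (the orientation) is determined by \<open>w\<close>.
\<close>
definition induces :: "tens3 \<Rightarrow> tens2 \<Rightarrow> real \<Rightarrow> bool" where
  "induces w g v \<longleftrightarrow> inner_product_matrix g \<and> v\<^sup>2 = det g
     \<and> (\<forall>i j. hook_wedge w $i$j = - 6 * g$i$j * v)"

definition nondegenerate :: "tens3 \<Rightarrow> bool" where
  "nondegenerate w \<longleftrightarrow> (\<exists>g v. induces w g v)"

definition metric_of :: "tens3 \<Rightarrow> tens2" where
  "metric_of w = (THE g. \<exists>v. induces w g v)"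

definition vol_of :: "tens3 \<Rightarrow> real" where
  "vol_of w = (THE v. \<exists>g. induces w g v)"

definition hodge_star3 :: "tens2 \<Rightarrow> real \<Rightarrow> tens3 \<Rightarrow> tens4" where
  "hodge_star3 g v w = (\<chi> a b c d.
     (\<Sum>p | p permutes (UNIV :: 7 set) \<and> p 3 = a \<and> p 4 = b \<and> p 5 = c \<and> p 6 = d.
        of_int (sign p) * v *
        (\<Sum>i\<in>UNIV. \<Sum>j\<in>UNIV. \<Sum>k\<in>UNIV. matrix_inv g $(p 0)$i * matrix_inv g $(p 1)$j
            * matrix_inv g $(p 2)$k * w$i$j$k)) / 6)"

definition psi_of :: "tens3 \<Rightarrow> tens4" where
  "psi_of w = hodge_star3 (metric_of w) (vol_of w) w"

definition G2_structure :: "'m::topological_space chart set \<Rightarrow> 'm form3 \<Rightarrow> bool" where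
  "G2_structure A w \<longleftrightarrow>
     smooth_form3 A w \<and> (\<forall>C\<in>A. \<forall>y\<in>chart_image C. nondegenerate (w C y))"

definition diamond :: "tens2 \<Rightarrow> tens2 \<Rightarrow> tens3 \<Rightarrow> tens3" where
  "diamond g B w = (let M = B ** matrix_inv g in
     \<chi> i j k. \<Sum>p\<in>UNIV. M$i$p * w$p$j$k + M$j$p * w$i$p$k + M$k$p * w$i$j$p)"

definition hook4 :: "vec7 \<Rightarrow> tens4 \<Rightarrow> tens3" where
  "hook4 X u = (\<chi> i j k. \<Sum>m\<in>UNIV. X$m * u$m$i$j$k)"

definition sharp :: "tens2 \<Rightarrow> vec7 \<Rightarrow> vec7" where
  "sharp g X = matrix_inv g *v X"

text \<open>Raises the first two indices.\<close>
definition raise12 :: "tens2 \<Rightarrow> tens3 \<Rightarrow> tens3" where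
  "raise12 g w = (\<chi> i j k. \<Sum>a\<in>UNIV. \<Sum>b\<in>UNIV.
     matrix_inv g $i$a * matrix_inv g $j$b * w$a$b$k)"


section \<open>Riemannian geometry in a chart\<close>

text \<open>\<open>christoffel g y $k$i$j\<close> is \<open>\<Gamma>\<^sup>k\<^sub>i\<^sub>j\<close>.\<close>
definition christoffel :: "(vec7 \<Rightarrow> tens2) \<Rightarrow> vec7 \<Rightarrow> tens3" where
  "christoffel g y = (\<chi> k i j. (\<Sum>l\<in>UNIV. matrix_inv (g y) $k$l *
      (pd i g y $j$l + pd j g y $i$l - pd l g y $i$j)) / 2)"

text \<open>For \<open>nabla2\<close> and \<open>nabla3\<close> the first index is the direction of differentiation.\<close>
definition nabla2 :: "(vec7 \<Rightarrow> tens2) \<Rightarrow> (vec7 \<Rightarrow> tens2) \<Rightarrow> vec7 \<Rightarrow> tens3" where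
  "nabla2 g B y = (\<chi> m i j. pd m B y $i$j - (\<Sum>l\<in>UNIV.
      christoffel g y $l$m$i * B y $l$j + christoffel g y $l$m$j * B y $i$l))"

definition nabla3 :: "(vec7 \<Rightarrow> tens2) \<Rightarrow> (vec7 \<Rightarrow> tens3) \<Rightarrow> vec7 \<Rightarrow> tens4" where
  "nabla3 g w y = (\<chi> m i j k. pd m w y $i$j$k - (\<Sum>l\<in>UNIV.
      christoffel g y $l$m$i * w y $l$j$k + christoffel g y $l$m$j * w y $i$l$k
        + christoffel g y $l$m$k * w y $i$j$l))"

text \<open>
  \<open>R\<^sub>i\<^sub>j\<^sub>k\<^sub>l = g(\<nabla>\<^sub>i\<nabla>\<^sub>j\<partial>\<^sub>k - \<nabla>\<^sub>j\<nabla>\<^sub>i\<partial>\<^sub>k, \<partial>\<^sub>l)\<close>; the bracket term vanishes for coordinate fields.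
\<close>
definition riemann :: "(vec7 \<Rightarrow> tens2) \<Rightarrow> vec7 \<Rightarrow> tens4" where
  "riemann g y = (\<chi> i j k l. \<Sum>m\<in>UNIV. g y $m$l *
     (pd i (christoffel g) y $m$j$k - pd j (christoffel g) y $m$i$k
      + (\<Sum>q\<in>UNIV. christoffel g y $m$i$q * christoffel g y $q$j$k
                  - christoffel g y $m$j$q * christoffel g y $q$i$k)))"

definition ricci :: "(vec7 \<Rightarrow> tens2) \<Rightarrow> vec7 \<Rightarrow> tens2" where
  "ricci g y = (\<chi> j k. \<Sum>l\<in>UNIV. \<Sum>m\<in>UNIV. matrix_inv (g y) $l$m * riemann g y $l$j$k$m)"

definition lie2 :: "(vec7 \<Rightarrow> vec7) \<Rightarrow> (vec7 \<Rightarrow> tens2) \<Rightarrow> vec7 \<Rightarrow> tens2" where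
  "lie2 X B y = (\<chi> i j. \<Sum>l\<in>UNIV.
     X y $ l * pd l B y $i$j + pd i X y $ l * B y $l$j + pd j X y $ l * B y $i$l)"

definition lie3 :: "(vec7 \<Rightarrow> vec7) \<Rightarrow> (vec7 \<Rightarrow> tens3) \<Rightarrow> vec7 \<Rightarrow> tens3" where
  "lie3 X w y = (\<chi> i j k. \<Sum>l\<in>UNIV.
     X y $ l * pd l w y $i$j$k + pd i X y $ l * w y $l$j$k
       + pd j X y $ l * w y $i$l$k + pd k X y $ l * w y $i$j$l)"


section \<open>Torsion and the differential operators\<close>

definition metric_field :: "(vec7 \<Rightarrow> tens3) \<Rightarrow> vec7 \<Rightarrow> tens2" where
  "metric_field w y = metric_of (w y)"

definition torsion :: "(vec7 \<Rightarrow> tens3) \<Rightarrow> vec7 \<Rightarrow> tens2" where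
  "torsion w y = (THE T. \<forall>m i j k. nabla3 (metric_field w) w y $m$i$j$k =
     (\<Sum>p\<in>UNIV. \<Sum>q\<in>UNIV. T$m$p * matrix_inv (metric_field w y) $p$q * psi_of (w y) $q$i$j$k))"

text \<open>The vector field \<open>(VT)\<^sup>k\<close>, with the index raised.\<close>
definition VT :: "(vec7 \<Rightarrow> tens3) \<Rightarrow> vec7 \<Rightarrow> vec7" where
  "VT w y = sharp (metric_field w y) (\<chi> k. \<Sum>i\<in>UNIV. \<Sum>j\<in>UNIV.
     torsion w y $i$j * raise12 (metric_field w y) (w y) $i$j$k)"

definition divergence2 :: "(vec7 \<Rightarrow> tens2) \<Rightarrow> (vec7 \<Rightarrow> tens2) \<Rightarrow> vec7 \<Rightarrow> vec7" where
  "divergence2 g B y = (\<chi> k. \<Sum>i\<in>UNIV. \<Sum>j\<in>UNIV. matrix_inv (g y) $i$j * nabla2 g B y $i$j$k)"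

definition F_tensor :: "(vec7 \<Rightarrow> tens3) \<Rightarrow> vec7 \<Rightarrow> tens2" where
  "F_tensor w y = (let u = raise12 (metric_field w y) (w y) in
     \<chi> p q. \<Sum>i\<in>UNIV. \<Sum>j\<in>UNIV. \<Sum>k\<in>UNIV. \<Sum>l\<in>UNIV.
       riemann (metric_field w) y $i$j$k$l * u$i$j$p * u$k$l$q)"

definition P_local ::
    "real \<Rightarrow> real \<Rightarrow> real \<Rightarrow> real \<Rightarrow> (vec7 \<Rightarrow> tens3) \<Rightarrow> vec7 \<Rightarrow> tens3" where
  "P_local a l b1 b2 w y =
     diamond (metric_field w y)
       (- ricci (metric_field w) y + a *\<^sub>R lie2 (VT w) (metric_field w) y + l *\<^sub>R F_tensor w y)
       (w y)
     + hook4 (sharp (metric_field w y)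
         (b1 *\<^sub>R divergence2 (metric_field w) (torsion w) y
          + b2 *\<^sub>R divergence2 (metric_field w) (\<lambda>z. transpose (torsion w z)) y))
       (psi_of (w y))"

definition W_local :: "real \<Rightarrow> (vec7 \<Rightarrow> tens3) \<Rightarrow> (vec7 \<Rightarrow> tens3) \<Rightarrow> vec7 \<Rightarrow> vec7" where
  "W_local a w wt y = (\<chi> k. \<Sum>i\<in>UNIV. \<Sum>j\<in>UNIV. matrix_inv (metric_field w y) $i$j *
       (christoffel (metric_field w) y $k$i$j - christoffel (metric_field wt) y $k$i$j))
     - (2 * a) *\<^sub>R VT w y"

definition P_hat :: "real \<Rightarrow> real \<Rightarrow> real \<Rightarrow> real \<Rightarrow> 'm form3 \<Rightarrow> 'm form3" where
  "P_hat a l b1 b2 w C = P_local a l b1 b2 (w C)"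

definition Q_hat :: "real \<Rightarrow> real \<Rightarrow> real \<Rightarrow> real \<Rightarrow> 'm form3 \<Rightarrow> 'm form3 \<Rightarrow> 'm form3" where
  "Q_hat a l b1 b2 wt w C y =
     P_hat a l b1 b2 w C y + lie3 (W_local a (w C) (wt C)) (w C) y"


section \<open>Linearization, principal symbol, strong ellipticity\<close>

text \<open>
  The derivative is taken pointwise: the operators above are local, and near a given point
  \<open>w + t h\<close> is nondegenerate for small \<open>t\<close>, even if \<open>M\<close> is not compact.
\<close>
definition is_linearization ::
    "'m::topological_space chart set \<Rightarrow> ('m form3 \<Rightarrow> 'm form3) \<Rightarrow> 'm form3
       \<Rightarrow> ('m form3 \<Rightarrow> 'm form3) \<Rightarrow> bool" where
  "is_linearization A Q w L \<longleftrightarrow> (\<forall>h. smooth_form3 A h \<longrightarrow>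
     (\<forall>C\<in>A. \<forall>y\<in>chart_image C.
        ((\<lambda>t. Q (\<lambda>D z. w D z + t *\<^sub>R h D z) C y) has_vector_derivative L h C y) (at 0)))"

text \<open>
  \<open>L\<close> is a linear second-order differential operator, and \<open>\<sigma>\<close> is obtained from it by keeping the
  second-order terms and replacing \<open>\<partial>\<^sub>i\<partial>\<^sub>j\<close> by \<open>\<xi>\<^sub>i\<xi>\<^sub>j\<close>. Replacing partial by covariant derivatives
  changes only the lower-order terms. Since smooth 3-forms have arbitrary 2-jets at a point, \<open>\<sigma>\<close>
  is uniquely determined on alternating tensors at the points of the charts in \<open>A\<close>.
\<close>
definition is_principal_symbol ::
    "'m::topological_space chart set \<Rightarrow> ('m form3 \<Rightarrow> 'm form3)
       \<Rightarrow> ('m chart \<Rightarrow> vec7 \<Rightarrow> vec7 \<Rightarrow> tens3 \<Rightarrow> tens3) \<Rightarrow> bool" where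
  "is_principal_symbol A L \<sigma> \<longleftrightarrow> (\<forall>C\<in>A.
     \<exists>(c2 :: vec7 \<Rightarrow> 7 \<Rightarrow> 7 \<Rightarrow> tens3 \<Rightarrow> tens3) (c1 :: vec7 \<Rightarrow> 7 \<Rightarrow> tens3 \<Rightarrow> tens3)
      (c0 :: vec7 \<Rightarrow> tens3 \<Rightarrow> tens3). \<forall>y\<in>chart_image C.
       (\<forall>i j. linear (c2 y i j)) \<and> (\<forall>i. linear (c1 y i)) \<and> linear (c0 y) \<and>
       (\<forall>h. smooth_form3 A h \<longrightarrow> L h C y =
          (\<Sum>i\<in>UNIV. \<Sum>j\<in>UNIV. c2 y i j (pd i (pd j (h C)) y))
          + (\<Sum>i\<in>UNIV. c1 y i (pd i (h C) y)) + c0 y (h C y)) \<and>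
       (\<forall>\<xi> u. \<sigma> C y \<xi> u = (\<Sum>i\<in>UNIV. \<Sum>j\<in>UNIV. (\<xi>$i * \<xi>$j) *\<^sub>R c2 y i j u)))"

text \<open>The identification of symmetric 2-tensors plus covectors with 3-forms, and its inverse.\<close>
definition form_of_pair :: "tens3 \<Rightarrow> tens2 \<times> vec7 \<Rightarrow> tens3" where
  "form_of_pair w = (\<lambda>(h, X).
     diamond (metric_of w) h w + hook4 (sharp (metric_of w) X) (psi_of w))"

definition sym_pairs :: "(tens2 \<times> vec7) set" where
  "sym_pairs = {(h, X). transpose h = h}"

definition pair_of_form :: "tens3 \<Rightarrow> tens3 \<Rightarrow> tens2 \<times> vec7" where
  "pair_of_form w = inv_into sym_pairs (form_of_pair w)"

definition covector_inner :: "tens2 \<Rightarrow> vec7 \<Rightarrow> vec7 \<Rightarrow> real" where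
  "covector_inner g X Y = (\<Sum>i\<in>UNIV. \<Sum>j\<in>UNIV. matrix_inv g $i$j * X$i * Y$j)"

definition pair_inner :: "tens2 \<Rightarrow> tens2 \<times> vec7 \<Rightarrow> tens2 \<times> vec7 \<Rightarrow> real" where
  "pair_inner g = (\<lambda>(h1, X1) (h2, X2).
     (\<Sum>i\<in>UNIV. \<Sum>j\<in>UNIV. \<Sum>a\<in>UNIV. \<Sum>b\<in>UNIV.
        matrix_inv g $i$a * matrix_inv g $j$b * h1$i$j * h2$a$b)
     + covector_inner g X1 X2)"

definition strongly_elliptic_at ::
    "'m::topological_space chart set \<Rightarrow> ('m form3 \<Rightarrow> 'm form3) \<Rightarrow> 'm form3 \<Rightarrow> bool" where
  "strongly_elliptic_at A Q w \<longleftrightarrow> (\<exists>L \<sigma>. is_linearization A Q w L \<and> is_principal_symbol A L \<sigma> \<and>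
     (\<exists>c>0. \<forall>C\<in>A. \<forall>y\<in>chart_image C. \<forall>\<xi>. \<xi> \<noteq> 0 \<longrightarrow> (\<forall>s\<in>sym_pairs.
        let g = metric_of (w C y) in
        pair_inner g (pair_of_form (w C y) (\<sigma> C y \<xi> (form_of_pair (w C y) s))) s
          \<ge> c * covector_inner g \<xi> \<xi> * pair_inner g s s)))"

end

theory Submission
  imports Defs
begin

text \<open>
  In a chart, a G2-structure has at each point a frame in which it is the model form; it is found by
  maximising the form on orthonormal triples. The contraction identities of the model form and the
  smoothness of metric and Hodge dual as functions of the form follow. The derivative at \<open>t = 0\<close> of
  a tensor built from the 2-jet of \<open>w + t h\<close> is linear in the 2-jet of \<open>h\<close>, and its symbol is computed
  by the product and chain rules. For \<open>u = h \<diamond> \<phi> + hook4 X \<psi>\<close> the symbols of the metric and the torsion are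
  \<open>2h\<close> and \<open>\<xi>\<^sub>m X\<^sub>p + (\<xi> \<times> h\<^sub>m)\<^sub>p\<close>, and the gauge term cancels everything but
  \<open>h \<mapsto> |\<xi>|\<^sup>2 h + \<lambda> F\<close> and \<open>X \<mapsto> (b\<^sub>1 - a) |\<xi>|\<^sup>2 X + (b\<^sub>2 + a) \<langle>\<xi>,X\<rangle> \<xi> + (b\<^sub>1 - a - 1) \<xi> \<times> h \<xi>\<close>.
  Since \<open>\<xi> \<times> _\<close> is skew of norm at most \<open>|\<xi>|\<close>, \<open>|\<langle>F, h\<rangle>| \<le> 4 |\<xi>|\<^sup>2 |h|\<^sup>2\<close>, and the mixed term is absorbed by
  completing a square, with \<open>c = 1 - 4 |\<lambda>| - (b\<^sub>1 - a - 1) / 4\<close>.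
\<close>

section \<open>Pullbacks and the Hodge star of 3-forms\<close>

text \<open>Derivatives are taken on open sets, but the 3-forms are a proper linear subspace of
  \<open>tens3\<close>. Metric, volume and \<psi> are therefore written as explicit functions of all
  components of an arbitrary tensor, rational up to one ninth root, and alternation is used only at
  the points where the algebra needs it. The torsion is a definite description; inverting a Gram
  matrix replaces it by a formula of the same explicit kind. That the description has a value needs
  an argument: every 3-form is the infinitesimal action of some matrix on \<phi>, the Levi-Civita
  connection annihilates the metric, so \<nabla>\<phi> is the action of a skew matrix, and such an
  action is a contraction of \<psi>. The gauge term enters the symbol as the matrix \<xi> \<otimes>
  W. Its symmetric half removes the degenerate directions of the Ricci and Lie derivative terms; its
  skew half acts as a contraction of \<psi> and so alters the X-equation. The 4 in the bound on
  \<lambda> counts four equal contributions in the curvature symbol. The 1/4 on b1 - a - 1 comes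
  from the completed square, and the leftover multiple of \<langle>\<xi>,X\<rangle> squared is b1 +
  b2 - 1.\<close>

lemma UNIV_7: "(UNIV :: 7 set) = {0,1,2,3,4,5,6}"
proof -
  have "card {0,1,2,3,4,5,6::7} = CARD(7)" by simp
  then show ?thesis
    using card_subset_eq[of "UNIV::7 set" "{0,1,2,3,4,5,6}"] by simp
qed

lemma exhaust_7: "(x::7) = 0 \<or> x = 1 \<or> x = 2 \<or> x = 3 \<or> x = 4 \<or> x = 5 \<or> x = 6"
  using UNIV_7 UNIV_I[of x] by auto

lemma forall_7: "(\<forall>i::7. P i) \<longleftrightarrow> P 0 \<and> P 1 \<and> P 2 \<and> P 3 \<and> P 4 \<and> P 5 \<and> P 6"
  by (metis exhaust_7)

lemma sum_7: "sum f (UNIV::7 set) = f 0 + f 1 + f 2 + f 3 + f 4 + f 5 + f 6"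
  unfolding UNIV_7 by (simp add: ac_simps)

lemma prod_7: "prod f (UNIV::7 set) = f 0 * f 1 * f 2 * f 3 * f 4 * f 5 * f 6"
  unfolding UNIV_7 by (simp add: ac_simps)

section \<open>The Levi-Civita symbol in seven dimensions\<close>

definition tup :: "'a \<Rightarrow> 'a \<Rightarrow> 'a \<Rightarrow> 'a \<Rightarrow> 'a \<Rightarrow> 'a \<Rightarrow> 'a \<Rightarrow> 7 \<Rightarrow> 'a" where
  "tup a b c d e f g k = (if k = 0 then a else if k = 1 then b else if k = 2 then c
     else if k = 3 then d else if k = 4 then e else if k = 5 then f else g)"

lemma tup_simps [simp]:
  "tup a b c d e f g 0 = a" "tup a b c d e f g 1 = b" "tup a b c d e f g 2 = c"
  "tup a b c d e f g 3 = d" "tup a b c d e f g 4 = e" "tup a b c d e f g 5 = f"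
  "tup a b c d e f g 6 = g"
  by (simp_all add: tup_def)

lemma tup_eta: "tup (h 0) (h 1) (h 2) (h 3) (h 4) (h 5) (h 6) = h"
proof (rule ext)
  fix k
  show "tup (h 0) (h 1) (h 2) (h 3) (h 4) (h 5) (h 6) k = h k"
    using exhaust_7[of k] by (elim disjE) simp_all
qed

text \<open>The Levi-Civita symbol. Extending the sign by zero to all maps turns sums over
  permutations into unrestricted sums, which can then be iterated, swapped and factored.\<close>

definition eps7 :: "(7 \<Rightarrow> 7) \<Rightarrow> real" where
  "eps7 f = (if f permutes UNIV then of_int (sign f) else 0)"

lemma sum_fun7:
  fixes G :: "(7 \<Rightarrow> 7) \<Rightarrow> real"
  shows "(\<Sum>f\<in>UNIV. G f) = (\<Sum>a\<in>UNIV. \<Sum>b\<in>UNIV. \<Sum>c\<in>UNIV. \<Sum>d\<in>UNIV. \<Sum>e\<in>UNIV. \<Sum>f\<in>UNIV. \<Sum>g\<in>UNIV. G (tup a b c d e f g))"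
proof -
  have "(\<Sum>f\<in>UNIV. G f) = (\<Sum>(a,b,c,d,e,f,g)\<in>UNIV. G (tup a b c d e f g))"
    by (rule sum.reindex_bij_witness[where j="\<lambda>h. (h 0, h 1, h 2, h 3, h 4, h 5, h 6)"
          and i="\<lambda>(a,b,c,d,e,f,g). tup a b c d e f g"]) (auto simp: tup_eta)
  then show ?thesis
    by (simp add: sum.cartesian_product flip: UNIV_Times_UNIV)
qed

lemma sum_perms_eps7:
  "(\<Sum>p | p permutes (UNIV :: 7 set). of_int (sign p) * G p) = (\<Sum>p\<in>UNIV. eps7 p * G p)"
  unfolding eps7_def by (rule sum.mono_neutral_cong_left) auto

text \<open>The left side is the Leibniz expansion of the matrix whose k-th row is row
  \<open>a k\<close> of \<open>E\<close>: permuting rows costs the sign, and a repeated row gives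
  zero. This is the transformation law of the Levi-Civita symbol.\<close>

lemma sum_eps7_rows:
  "(\<Sum>b\<in>UNIV. eps7 b * (\<Prod>k\<in>UNIV. E $ a k $ b k)) = det E * eps7 a"
proof -
  have "(\<Sum>b\<in>UNIV. eps7 b * (\<Prod>k\<in>UNIV. E $ a k $ b k)) = det (\<chi> k. E $ a k)"
    unfolding det_def by (subst sum_perms_eps7[symmetric]) simp
  also have "\<dots> = det E * eps7 a"
  proof (cases "a permutes UNIV")
    case True
    then show ?thesis by (simp add: det_permute_rows eps7_def mult.commute)
  next
    case False
    have "\<not> inj a"
    proof
      assume "inj a"
      then have "bij a" by (simp add: bij_def finite_UNIV_inj_surj)
      then have "a permutes UNIV" by (intro bij_imp_permutes) auto
      with False show False by simp
    qed
    then obtain i j where "i \<noteq> j" "a i = a j" by (auto simp: inj_def)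
    then have "det (\<chi> k. E $ a k) = 0"
      by (intro det_identical_rows[of i j]) (auto simp: row_def vec_eq_iff)
    with False show ?thesis by (simp add: eps7_def)
  qed
  finally show ?thesis .
qed

lemma sum_eps7_columns:
  "(\<Sum>b\<in>UNIV. eps7 b * (\<Prod>k\<in>UNIV. E $ b k $ a k)) = det E * eps7 a"
  using sum_eps7_rows[of "transpose E" a] by (simp add: transpose_def det_transpose[unfolded transpose_def])

lemma eps7_comp_right:
  assumes "q permutes UNIV" shows "eps7 (f \<circ> q) = of_int (sign q) * eps7 f"
proof (cases "f permutes UNIV")
  case True
  with assms show ?thesis
    by (simp add: eps7_def permutes_compose sign_compose permutes_imp_permutation mult.commute)
next
  case False
  have "\<not> (f \<circ> q) permutes UNIV"
  proof
    assume "(f \<circ> q) permutes UNIV"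
    then have "(f \<circ> q \<circ> inv q) permutes UNIV"
      by (rule permutes_compose[OF permutes_inv[OF assms]])
    moreover have "f \<circ> q \<circ> inv q = f"
      by (rule ext) (simp add: permutes_inverses[OF assms])
    ultimately have "f permutes UNIV" by (simp only:)
    then show False using False by simp
  qed
  with False show ?thesis by (simp add: eps7_def)
qed

lemma eps7_swap:
  assumes "i \<noteq> j" shows "eps7 (f \<circ> Transposition.transpose i j) = - eps7 f"
  using assms eps7_comp_right[of "Transposition.transpose i j" f]
  by (simp add: permutes_swap_id sign_swap_id)

lemma eps7_swap_0: "eps7 (tup b a c d e f g) = - eps7 (tup a b c d e f g)"
proof -
  have "tup b a c d e f g = tup a b c d e f g \<circ> Transposition.transpose 0 1" (is "?l = ?r")
  proof (rule ext)
    fix k show "?l k = ?r k" using exhaust_7[of k] by (elim disjE) (simp_all add: transpose_def)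
  qed
  then show ?thesis using eps7_swap[of 0 1 "tup a b c d e f g"] by simp
qed

lemma eps7_swap_1: "eps7 (tup a c b d e f g) = - eps7 (tup a b c d e f g)"
proof -
  have "tup a c b d e f g = tup a b c d e f g \<circ> Transposition.transpose 1 2" (is "?l = ?r")
  proof (rule ext)
    fix k show "?l k = ?r k" using exhaust_7[of k] by (elim disjE) (simp_all add: transpose_def)
  qed
  then show ?thesis using eps7_swap[of 1 2 "tup a b c d e f g"] by simp
qed

lemma eps7_swap_2: "eps7 (tup a b d c e f g) = - eps7 (tup a b c d e f g)"
proof -
  have "tup a b d c e f g = tup a b c d e f g \<circ> Transposition.transpose 2 3" (is "?l = ?r")
  proof (rule ext)
    fix k show "?l k = ?r k" using exhaust_7[of k] by (elim disjE) (simp_all add: transpose_def)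
  qed
  then show ?thesis using eps7_swap[of 2 3 "tup a b c d e f g"] by simp
qed

lemma eps7_swap_3: "eps7 (tup a b c e d f g) = - eps7 (tup a b c d e f g)"
proof -
  have "tup a b c e d f g = tup a b c d e f g \<circ> Transposition.transpose 3 4" (is "?l = ?r")
  proof (rule ext)
    fix k show "?l k = ?r k" using exhaust_7[of k] by (elim disjE) (simp_all add: transpose_def)
  qed
  then show ?thesis using eps7_swap[of 3 4 "tup a b c d e f g"] by simp
qed

lemma eps7_swap_4: "eps7 (tup a b c d f e g) = - eps7 (tup a b c d e f g)"
proof -
  have "tup a b c d f e g = tup a b c d e f g \<circ> Transposition.transpose 4 5" (is "?l = ?r")
  proof (rule ext)
    fix k show "?l k = ?r k" using exhaust_7[of k] by (elim disjE) (simp_all add: transpose_def)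
  qed
  then show ?thesis using eps7_swap[of 4 5 "tup a b c d e f g"] by simp
qed

lemma eps7_swap_5: "eps7 (tup a b c d e g f) = - eps7 (tup a b c d e f g)"
proof -
  have "tup a b c d e g f = tup a b c d e f g \<circ> Transposition.transpose 5 6" (is "?l = ?r")
  proof (rule ext)
    fix k show "?l k = ?r k" using exhaust_7[of k] by (elim disjE) (simp_all add: transpose_def)
  qed
  then show ?thesis using eps7_swap[of 5 6 "tup a b c d e f g"] by simp
qed

text \<open>A cyclic shift of seven places is a product of six adjacent transpositions, hence
  even.\<close>

lemma eps7_rot: "eps7 (tup z a b c d e f) = eps7 (tup a b c d e f z)"
  by (simp only: eps7_swap_0[of z a b c d e f] eps7_swap_1[of a z b c d e f] eps7_swap_2[of a b z c d e f]
      eps7_swap_3[of a b c z d e f] eps7_swap_4[of a b c d z e f] eps7_swap_5[of a b c d e z f] minus_minus)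

lemma eps7_not_inj: "i \<noteq> j \<Longrightarrow> f i = f j \<Longrightarrow> eps7 f = 0"
  unfolding eps7_def using permutes_inj by (auto dest: injD)

lemma eps7_repeat [simp]:
  "eps7 (tup a a c d e f g) = 0"
  "eps7 (tup a b a d e f g) = 0"
  "eps7 (tup a b c a e f g) = 0"
  "eps7 (tup a b c d a f g) = 0"
  "eps7 (tup a b c d e a g) = 0"
  "eps7 (tup a b c d e f a) = 0"
  "eps7 (tup a b b d e f g) = 0"
  "eps7 (tup a b c b e f g) = 0"
  "eps7 (tup a b c d b f g) = 0"
  "eps7 (tup a b c d e b g) = 0"
  "eps7 (tup a b c d e f b) = 0"
  "eps7 (tup a b c c e f g) = 0"
  "eps7 (tup a b c d c f g) = 0"
  "eps7 (tup a b c d e c g) = 0"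
  "eps7 (tup a b c d e f c) = 0"
  "eps7 (tup a b c d d f g) = 0"
  "eps7 (tup a b c d e d g) = 0"
  "eps7 (tup a b c d e f d) = 0"
  "eps7 (tup a b c d e e g) = 0"
  "eps7 (tup a b c d e f e) = 0"
  "eps7 (tup a b c d e f f) = 0"
    by ((rule eps7_not_inj[of 0 1] eps7_not_inj[of 0 2] eps7_not_inj[of 0 3] eps7_not_inj[of 0 4] eps7_not_inj[of 0 5] eps7_not_inj[of 0 6]
      eps7_not_inj[of 1 2] eps7_not_inj[of 1 3] eps7_not_inj[of 1 4] eps7_not_inj[of 1 5] eps7_not_inj[of 1 6]
      eps7_not_inj[of 2 3] eps7_not_inj[of 2 4] eps7_not_inj[of 2 5] eps7_not_inj[of 2 6]
      eps7_not_inj[of 3 4] eps7_not_inj[of 3 5] eps7_not_inj[of 3 6]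
      eps7_not_inj[of 4 5] eps7_not_inj[of 4 6] eps7_not_inj[of 5 6]; simp; fail)+)

text \<open>Decides the side conditions of the rules \<open>eps7_sort\<close>,
  \<open>star_sort\<close> and \<open>alternating_sort\<close>. Restricting swaps to decreasing
  neighbours makes them terminate as rewrite rules and brings every component into sorted
  form.\<close>

definition rank7 :: "7 \<Rightarrow> nat" where "rank7 = tup 0 1 2 3 4 5 6"

lemma rank7_simps [simp]: "rank7 0 = 0" "rank7 1 = 1" "rank7 2 = 2" "rank7 3 = 3" "rank7 4 = 4"
  "rank7 5 = 5" "rank7 6 = 6"
  by (simp_all add: rank7_def)

lemma eps7_sort:
  "rank7 a < rank7 b \<Longrightarrow> eps7 (tup b a c d e f g) = - eps7 (tup a b c d e f g)"
  "rank7 b < rank7 c \<Longrightarrow> eps7 (tup a c b d e f g) = - eps7 (tup a b c d e f g)"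
  "rank7 c < rank7 d \<Longrightarrow> eps7 (tup a b d c e f g) = - eps7 (tup a b c d e f g)"
  "rank7 d < rank7 e \<Longrightarrow> eps7 (tup a b c e d f g) = - eps7 (tup a b c d e f g)"
  "rank7 e < rank7 f \<Longrightarrow> eps7 (tup a b c d f e g) = - eps7 (tup a b c d e f g)"
  "rank7 f < rank7 g \<Longrightarrow> eps7 (tup a b c d e g f) = - eps7 (tup a b c d e f g)"
  by (rule eps7_swap_0 eps7_swap_1 eps7_swap_2 eps7_swap_3 eps7_swap_4 eps7_swap_5)+

lemma eps7_id: "eps7 (tup 0 1 2 3 4 5 6) = 1"
  using tup_eta[of "id"] by (simp add: eps7_def sign_id permutes_id)

text \<open>The Hodge star of the Euclidean metric with unit volume. The metric enters
  \<open>hodge_star3\<close> only by raising indices and by a factor, so this flat version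
  suffices.\<close>

definition star :: "tens3 \<Rightarrow> 7 \<Rightarrow> 7 \<Rightarrow> 7 \<Rightarrow> 7 \<Rightarrow> real" where
  "star w a b c d = (\<Sum>x\<in>UNIV. \<Sum>y\<in>UNIV. \<Sum>z\<in>UNIV. eps7 (tup x y z a b c d) * w$x$y$z) / 6"

text \<open>The seven indices split as 2 + 2 + 3. Contracting the last three with the Levi-Civita
  symbol gives 6 times the star, which leaves 24 / 6 = 4 in the denominator.\<close>

lemma hook_wedge_eq_star:
  "hook_wedge w $i$j = (\<Sum>a\<in>UNIV. \<Sum>b\<in>UNIV. \<Sum>c\<in>UNIV. \<Sum>d\<in>UNIV. w$i$a$b * w$j$c$d * star w a b c d) / 4"
proof -
  have "hook_wedge w $i$j = (\<Sum>p\<in>UNIV. eps7 p * (w$i$(p 0)$(p 1) * w$j$(p 2)$(p 3) * w$(p 4)$(p 5)$(p 6))) / 24"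
    unfolding hook_wedge_def by (subst sum_perms_eps7[symmetric]) (simp add: mult.assoc)
  also have "\<dots> = (\<Sum>a\<in>UNIV. \<Sum>b\<in>UNIV. \<Sum>c\<in>UNIV. \<Sum>d\<in>UNIV. \<Sum>x\<in>UNIV. \<Sum>y\<in>UNIV. \<Sum>z\<in>UNIV.
     w$i$a$b * w$j$c$d * (eps7 (tup a b c d x y z) * w$x$y$z)) / 24"
    by (simp only: sum_fun7 tup_simps mult.left_commute)
  also have "\<dots> = (\<Sum>a\<in>UNIV. \<Sum>b\<in>UNIV. \<Sum>c\<in>UNIV. \<Sum>d\<in>UNIV. w$i$a$b * w$j$c$d * star w a b c d) / 4"
  proof -
    have "(\<Sum>x\<in>UNIV. \<Sum>y\<in>UNIV. \<Sum>z\<in>UNIV. w$i$a$b * w$j$c$d * (eps7 (tup a b c d x y z) * w$x$y$z))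
        = 6 * (w$i$a$b * w$j$c$d * star w a b c d)" for a b c d
    proof -
      have "eps7 (tup a b c d x y z) = eps7 (tup x y z a b c d)" for x y z
        using eps7_rot[of z a b c d x y] eps7_rot[of y z a b c d x] eps7_rot[of x y z a b c d] by simp
      then have "(\<Sum>x\<in>UNIV. \<Sum>y\<in>UNIV. \<Sum>z\<in>UNIV. eps7 (tup a b c d x y z) * w$x$y$z)
        = (\<Sum>x\<in>UNIV. \<Sum>y\<in>UNIV. \<Sum>z\<in>UNIV. eps7 (tup x y z a b c d) * w$x$y$z)"
        by (intro sum.cong refl arg_cong2[where f="(*)"])
      then show ?thesis unfolding star_def sum_distrib_left[symmetric] by simp
    qed
    then show ?thesis by (simp only: sum_distrib_left[symmetric])
  qed
  finally show ?thesis .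
qed

lemma star_swap:
  "star w b a c d = - star w a b c d" "star w a c b d = - star w a b c d" "star w a b d c = - star w a b c d"
proof -
  show "star w b a c d = - star w a b c d"
    unfolding star_def by (subst eps7_swap_3) (simp add: sum_negf)
  show "star w a c b d = - star w a b c d"
    unfolding star_def by (subst eps7_swap_4) (simp add: sum_negf)
  show "star w a b d c = - star w a b c d"
    unfolding star_def by (subst eps7_swap_5) (simp add: sum_negf)
qed

lemma star_repeat [simp]: "star w a a c d = 0" "star w a b a d = 0" "star w a b c a = 0"
  "star w a b b d = 0" "star w a b c b = 0" "star w a b c c = 0"
  unfolding star_def by simp_all

lemma star_sort:
  "rank7 a < rank7 b \<Longrightarrow> star w b a c d = - star w a b c d"
  "rank7 b < rank7 c \<Longrightarrow> star w a c b d = - star w a b c d"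
  "rank7 c < rank7 d \<Longrightarrow> star w a b d c = - star w a b c d"
  by (rule star_swap)+

lemma alternating_swap:
  assumes "alternating w"
  shows "w$j$i$k = - w$i$j$k" "w$i$k$j = - w$i$j$k"
  using assms unfolding alternating_def by metis+

lemma alternating_repeat:
  assumes "alternating w"
  shows "w$i$i$k = 0" "w$i$k$k = 0" "w$i$k$i = 0"
proof -
  show 1: "w$i$i$k = 0" for i k using alternating_swap(1)[OF assms, of i i k] by simp
  show "w$i$k$k = 0" using alternating_swap(2)[OF assms, of i k k] by simp
  show "w$i$k$i = 0" using alternating_swap(2)[OF assms, of i k i] 1 by simp
qed

lemma alternating_sort:
  assumes "alternating w"
  shows "rank7 i < rank7 j \<Longrightarrow> w$j$i$k = - w$i$j$k" "rank7 j < rank7 k \<Longrightarrow> w$i$k$j = - w$i$j$k"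
  by (rule alternating_swap[OF assms])+

text \<open>Only the 3! orderings of the complementary triple contribute, and they contribute
  equally because the signs of \<open>eps7\<close> and of the form cancel; this absorbs the division
  by 6.\<close>

lemma star_eq:
  assumes w: "alternating w" and f: "tup x y z a b c d permutes UNIV"
  shows "star w a b c d = eps7 (tup x y z a b c d) * w$x$y$z"
proof -
  have S: "(\<Sum>k\<in>UNIV. G k) = G x + G y + G z + G a + G b + G c + G d" for G :: "7 \<Rightarrow> real"
    using sum.permute[OF f, of G] by (simp add: sum_7)
  note sw = alternating_swap[OF w]
  have e: "eps7 (tup y x z a b c d) = - eps7 (tup x y z a b c d)"
     "eps7 (tup x z y a b c d) = - eps7 (tup x y z a b c d)"
     "eps7 (tup z x y a b c d) = eps7 (tup x y z a b c d)"
     "eps7 (tup y z x a b c d) = eps7 (tup x y z a b c d)"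
     "eps7 (tup z y x a b c d) = - eps7 (tup x y z a b c d)"
    using eps7_swap_0[of y x z a b c d] eps7_swap_1[of x z y a b c d] eps7_swap_0[of z x y a b c d]
      eps7_swap_1[of y z x a b c d] eps7_swap_0[of z y x a b c d] by auto
  have v: "w$y$x$z = - w$x$y$z" "w$x$z$y = - w$x$y$z" "w$z$x$y = w$x$y$z" "w$y$z$x = w$x$y$z"
    "w$z$y$x = - w$x$y$z"
    using sw(1)[of x y z] sw(2)[of x y z] sw(1)[of x z y] sw(2)[of y x z] sw(1)[of z y x] by auto
  show ?thesis unfolding star_def S by (simp add: e v)
qed

text \<open>The table of complements with their shuffle signs. Together with
  \<open>star_sort\<close> and \<open>star_repeat\<close> it lets simp evaluate every
  component.\<close>

lemma star_values:
  assumes w: "alternating w"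
  shows
  "star w 3 4 5 6 = w$0$1$2"
  "star w 2 4 5 6 = - w$0$1$3"
  "star w 2 3 5 6 = w$0$1$4"
  "star w 2 3 4 6 = - w$0$1$5"
  "star w 2 3 4 5 = w$0$1$6"
  "star w 1 4 5 6 = w$0$2$3"
  "star w 1 3 5 6 = - w$0$2$4"
  "star w 1 3 4 6 = w$0$2$5"
  "star w 1 3 4 5 = - w$0$2$6"
  "star w 1 2 5 6 = w$0$3$4"
  "star w 1 2 4 6 = - w$0$3$5"
  "star w 1 2 4 5 = w$0$3$6"
  "star w 1 2 3 6 = w$0$4$5"
  "star w 1 2 3 5 = - w$0$4$6"
  "star w 1 2 3 4 = w$0$5$6"
  "star w 0 4 5 6 = - w$1$2$3"
  "star w 0 3 5 6 = w$1$2$4"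
  "star w 0 3 4 6 = - w$1$2$5"
  "star w 0 3 4 5 = w$1$2$6"
  "star w 0 2 5 6 = - w$1$3$4"
  "star w 0 2 4 6 = w$1$3$5"
  "star w 0 2 4 5 = - w$1$3$6"
  "star w 0 2 3 6 = - w$1$4$5"
  "star w 0 2 3 5 = w$1$4$6"
  "star w 0 2 3 4 = - w$1$5$6"
  "star w 0 1 5 6 = w$2$3$4"
  "star w 0 1 4 6 = - w$2$3$5"
  "star w 0 1 4 5 = w$2$3$6"
  "star w 0 1 3 6 = w$2$4$5"
  "star w 0 1 3 5 = - w$2$4$6"
  "star w 0 1 3 4 = w$2$5$6"
  "star w 0 1 2 6 = - w$3$4$5"
  "star w 0 1 2 5 = w$3$4$6"
  "star w 0 1 2 4 = - w$3$5$6"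
  "star w 0 1 2 3 = w$4$5$6"
proof -
  have P: "tup x y z a b c d permutes UNIV" if "eps7 (tup x y z a b c d) \<noteq> 0" for x y z a b c d
    using that by (simp add: eps7_def split: if_splits)
  show "star w 3 4 5 6 = w$0$1$2"
    using star_eq[OF w P, of 0 1 2 3 4 5 6] by (simp add: eps7_sort eps7_id)
  show "star w 2 4 5 6 = - w$0$1$3"
    using star_eq[OF w P, of 0 1 3 2 4 5 6] by (simp add: eps7_sort eps7_id)
  show "star w 2 3 5 6 = w$0$1$4"
    using star_eq[OF w P, of 0 1 4 2 3 5 6] by (simp add: eps7_sort eps7_id)
  show "star w 2 3 4 6 = - w$0$1$5"
    using star_eq[OF w P, of 0 1 5 2 3 4 6] by (simp add: eps7_sort eps7_id)
  show "star w 2 3 4 5 = w$0$1$6"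
    using star_eq[OF w P, of 0 1 6 2 3 4 5] by (simp add: eps7_sort eps7_id)
  show "star w 1 4 5 6 = w$0$2$3"
    using star_eq[OF w P, of 0 2 3 1 4 5 6] by (simp add: eps7_sort eps7_id)
  show "star w 1 3 5 6 = - w$0$2$4"
    using star_eq[OF w P, of 0 2 4 1 3 5 6] by (simp add: eps7_sort eps7_id)
  show "star w 1 3 4 6 = w$0$2$5"
    using star_eq[OF w P, of 0 2 5 1 3 4 6] by (simp add: eps7_sort eps7_id)
  show "star w 1 3 4 5 = - w$0$2$6"
    using star_eq[OF w P, of 0 2 6 1 3 4 5] by (simp add: eps7_sort eps7_id)
  show "star w 1 2 5 6 = w$0$3$4"
    using star_eq[OF w P, of 0 3 4 1 2 5 6] by (simp add: eps7_sort eps7_id)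
  show "star w 1 2 4 6 = - w$0$3$5"
    using star_eq[OF w P, of 0 3 5 1 2 4 6] by (simp add: eps7_sort eps7_id)
  show "star w 1 2 4 5 = w$0$3$6"
    using star_eq[OF w P, of 0 3 6 1 2 4 5] by (simp add: eps7_sort eps7_id)
  show "star w 1 2 3 6 = w$0$4$5"
    using star_eq[OF w P, of 0 4 5 1 2 3 6] by (simp add: eps7_sort eps7_id)
  show "star w 1 2 3 5 = - w$0$4$6"
    using star_eq[OF w P, of 0 4 6 1 2 3 5] by (simp add: eps7_sort eps7_id)
  show "star w 1 2 3 4 = w$0$5$6"
    using star_eq[OF w P, of 0 5 6 1 2 3 4] by (simp add: eps7_sort eps7_id)
  show "star w 0 4 5 6 = - w$1$2$3"
    using star_eq[OF w P, of 1 2 3 0 4 5 6] by (simp add: eps7_sort eps7_id)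
  show "star w 0 3 5 6 = w$1$2$4"
    using star_eq[OF w P, of 1 2 4 0 3 5 6] by (simp add: eps7_sort eps7_id)
  show "star w 0 3 4 6 = - w$1$2$5"
    using star_eq[OF w P, of 1 2 5 0 3 4 6] by (simp add: eps7_sort eps7_id)
  show "star w 0 3 4 5 = w$1$2$6"
    using star_eq[OF w P, of 1 2 6 0 3 4 5] by (simp add: eps7_sort eps7_id)
  show "star w 0 2 5 6 = - w$1$3$4"
    using star_eq[OF w P, of 1 3 4 0 2 5 6] by (simp add: eps7_sort eps7_id)
  show "star w 0 2 4 6 = w$1$3$5"
    using star_eq[OF w P, of 1 3 5 0 2 4 6] by (simp add: eps7_sort eps7_id)
  show "star w 0 2 4 5 = - w$1$3$6"
    using star_eq[OF w P, of 1 3 6 0 2 4 5] by (simp add: eps7_sort eps7_id)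
  show "star w 0 2 3 6 = - w$1$4$5"
    using star_eq[OF w P, of 1 4 5 0 2 3 6] by (simp add: eps7_sort eps7_id)
  show "star w 0 2 3 5 = w$1$4$6"
    using star_eq[OF w P, of 1 4 6 0 2 3 5] by (simp add: eps7_sort eps7_id)
  show "star w 0 2 3 4 = - w$1$5$6"
    using star_eq[OF w P, of 1 5 6 0 2 3 4] by (simp add: eps7_sort eps7_id)
  show "star w 0 1 5 6 = w$2$3$4"
    using star_eq[OF w P, of 2 3 4 0 1 5 6] by (simp add: eps7_sort eps7_id)
  show "star w 0 1 4 6 = - w$2$3$5"
    using star_eq[OF w P, of 2 3 5 0 1 4 6] by (simp add: eps7_sort eps7_id)
  show "star w 0 1 4 5 = w$2$3$6"
    using star_eq[OF w P, of 2 3 6 0 1 4 5] by (simp add: eps7_sort eps7_id)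
  show "star w 0 1 3 6 = w$2$4$5"
    using star_eq[OF w P, of 2 4 5 0 1 3 6] by (simp add: eps7_sort eps7_id)
  show "star w 0 1 3 5 = - w$2$4$6"
    using star_eq[OF w P, of 2 4 6 0 1 3 5] by (simp add: eps7_sort eps7_id)
  show "star w 0 1 3 4 = w$2$5$6"
    using star_eq[OF w P, of 2 5 6 0 1 3 4] by (simp add: eps7_sort eps7_id)
  show "star w 0 1 2 6 = - w$3$4$5"
    using star_eq[OF w P, of 3 4 5 0 1 2 6] by (simp add: eps7_sort eps7_id)
  show "star w 0 1 2 5 = w$3$4$6"
    using star_eq[OF w P, of 3 4 6 0 1 2 5] by (simp add: eps7_sort eps7_id)
  show "star w 0 1 2 4 = - w$3$5$6"
    using star_eq[OF w P, of 3 5 6 0 1 2 4] by (simp add: eps7_sort eps7_id)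
  show "star w 0 1 2 3 = w$4$5$6"
    using star_eq[OF w P, of 4 5 6 0 1 2 3] by (simp add: eps7_sort eps7_id)
qed

section \<open>Behaviour of 3-forms, \<open>hook_wedge\<close> and the star under a change of
  frame\<close>

lemma sum_rotate3:
  fixes F :: "'a \<Rightarrow> 'b \<Rightarrow> 'c \<Rightarrow> 'd \<Rightarrow> 'e::comm_monoid_add"
  shows "(\<Sum>f\<in>A. \<Sum>t\<in>B. \<Sum>s\<in>C. \<Sum>r\<in>D. F f t s r) = (\<Sum>t\<in>B. \<Sum>s\<in>C. \<Sum>r\<in>D. \<Sum>f\<in>A. F f t s r)"
proof -
  have "(\<Sum>f\<in>A. \<Sum>t\<in>B. \<Sum>s\<in>C. \<Sum>r\<in>D. F f t s r) = (\<Sum>t\<in>B. \<Sum>f\<in>A. \<Sum>s\<in>C. \<Sum>r\<in>D. F f t s r)"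
    by (rule sum.swap)
  also have "\<dots> = (\<Sum>t\<in>B. \<Sum>s\<in>C. \<Sum>f\<in>A. \<Sum>r\<in>D. F f t s r)"
    by (intro sum.cong refl sum.swap)
  also have "\<dots> = (\<Sum>t\<in>B. \<Sum>s\<in>C. \<Sum>r\<in>D. \<Sum>f\<in>A. F f t s r)"
    by (intro sum.cong refl sum.swap)
  finally show ?thesis .
qed

lemma sum_product3:
  fixes f :: "'a \<Rightarrow> real"
  shows "sum f A * sum g B * sum h C = (\<Sum>x\<in>A. \<Sum>y\<in>B. \<Sum>z\<in>C. f x * g y * h z)"
  by (simp only: sum_distrib_left[symmetric] sum_distrib_right[symmetric])

text \<open>The components with respect to the frame formed by the columns of \<open>E\<close>; this
  explains the order of the factors in \<open>pull3_pull3\<close>.\<close>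

definition pull3 :: "tens2 \<Rightarrow> tens3 \<Rightarrow> tens3" where
  "pull3 E w = (\<chi> a b c. \<Sum>i\<in>UNIV. \<Sum>j\<in>UNIV. \<Sum>k\<in>UNIV. w$i$j$k * (E$i$a * E$j$b * E$k$c))"

lemma pull3_nth: "pull3 E w $a$b$c = (\<Sum>i\<in>UNIV. \<Sum>j\<in>UNIV. \<Sum>k\<in>UNIV. w$i$j$k * (E$i$a * E$j$b * E$k$c))"
  by (simp add: pull3_def)

lemma sum_triple: "(\<Sum>t\<in>UNIV. F t) = (\<Sum>i\<in>UNIV. \<Sum>j\<in>UNIV. \<Sum>k\<in>UNIV. F (i,j,k))"
  for F :: "'a::finite \<times> 'b::finite \<times> 'c::finite \<Rightarrow> 'd::comm_monoid_add"
  by (simp add: sum.cartesian_product flip: UNIV_Times_UNIV)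

lemma sum_quadruple: "(\<Sum>t\<in>UNIV. F t) = (\<Sum>i\<in>UNIV. \<Sum>j\<in>UNIV. \<Sum>k\<in>UNIV. \<Sum>l\<in>UNIV. F (i,j,k,l))"
  for F :: "'a::finite \<times> 'b::finite \<times> 'c::finite \<times> 'e::finite \<Rightarrow> 'd::comm_monoid_add"
  by (simp add: sum.cartesian_product flip: UNIV_Times_UNIV)

lemma pull3_triple: "pull3 E w $a$b$c = (\<Sum>(i,j,k)\<in>UNIV. w$i$j$k * (E$i$a * E$j$b * E$k$c))"
  by (simp add: pull3_def sum.cartesian_product flip: UNIV_Times_UNIV)

lemma pull3_pull3: "pull3 F (pull3 E w) = pull3 (E ** F) w"
proof -
  have "pull3 F (pull3 E w) $a$b$c = pull3 (E ** F) w $a$b$c" for a b c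
  proof -
    have "pull3 F (pull3 E w) $a$b$c = (\<Sum>(i,j,k)\<in>UNIV. \<Sum>(p,q,r)\<in>UNIV. w$p$q$r * (E$p$i * E$q$j * E$r$k) * (F$i$a * F$j$b * F$k$c))"
      unfolding pull3_triple by (simp add: sum_distrib_right case_prod_unfold)
    also have "\<dots> = (\<Sum>(p,q,r)\<in>UNIV. \<Sum>(i,j,k)\<in>UNIV. w$p$q$r * ((E$p$i * F$i$a) * (E$q$j * F$j$b) * (E$r$k * F$k$c)))"
      unfolding case_prod_unfold by (subst sum.swap) (simp add: mult_ac)
    also have "\<dots> = (\<Sum>(p,q,r)\<in>UNIV. w$p$q$r * ((E ** F)$p$a * (E ** F)$q$b * (E ** F)$r$c))"
    proof -
      have M: "(E ** F)$p$a = (\<Sum>i\<in>UNIV. E$p$i * F$i$a)" for p a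
        by (simp add: matrix_matrix_mult_def)
      show ?thesis
        unfolding M sum_product3 by (simp only: sum_triple prod.case sum_distrib_left)
    qed
    finally show ?thesis by (simp add: pull3_triple)
  qed
  then show ?thesis by (simp add: vec_eq_iff)
qed

lemma sum_mat1: "(\<Sum>k\<in>UNIV. f k * (mat 1 :: real^'n^'n)$k$c) = f c"
proof -
  have "(\<Sum>k\<in>UNIV. f k * (mat 1 :: real^'n^'n)$k$c) = (\<Sum>k\<in>UNIV. if k = c then f k else 0)"
    by (rule sum.cong) (simp_all add: mat_def)
  then show ?thesis by simp
qed

lemma pull3_id [simp]: "pull3 (mat 1) w = w"
  by (simp add: vec_eq_iff pull3_nth mult.assoc[symmetric] sum_mat1)

lemma hook_wedge_eq_eps7:
  "hook_wedge w $i$j = (\<Sum>p\<in>UNIV. eps7 p * (w$i$(p 0)$(p 1) * w$j$(p 2)$(p 3) * w$(p 4)$(p 5)$(p 6))) / 24"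
  unfolding hook_wedge_def by (subst sum_perms_eps7[symmetric]) (simp add: mult.assoc)

text \<open>Three pulled-back forms carry nine factors of \<open>E\<close>. Two of them sit at the
  free indices and remain; the other seven meet the Levi-Civita symbol and produce the
  determinant.\<close>

lemma hook_wedge_pull3:
  "hook_wedge (pull3 E w) $x$y = det E * (\<Sum>i\<in>UNIV. \<Sum>j\<in>UNIV. E$i$x * E$j$y * hook_wedge w $i$j)"
proof -
  let ?W = "\<lambda>i a0 a1 j a2 a3 a4 a5 a6. w$i$a0$a1 * w$j$a2$a3 * w$a4$a5$a6"
  have "24 * hook_wedge (pull3 E w) $x$y = (\<Sum>p\<in>UNIV. \<Sum>t\<in>UNIV. \<Sum>s\<in>UNIV. \<Sum>r\<in>UNIV.
      (case t of (i,a0,a1) \<Rightarrow> case s of (j,a2,a3) \<Rightarrow> case r of (a4,a5,a6) \<Rightarrow>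
        E$i$x * E$j$y * ?W i a0 a1 j a2 a3 a4 a5 a6 * (eps7 p * (\<Prod>k\<in>UNIV. E $ tup a0 a1 a2 a3 a4 a5 a6 k $ p k))))"
    unfolding hook_wedge_eq_eps7 pull3_triple sum_product3
    by (simp add: sum_distrib_left case_prod_unfold prod_7 mult_ac)
  also have "\<dots> = (\<Sum>t\<in>UNIV. \<Sum>s\<in>UNIV. \<Sum>r\<in>UNIV.
      (case t of (i,a0,a1) \<Rightarrow> case s of (j,a2,a3) \<Rightarrow> case r of (a4,a5,a6) \<Rightarrow>
        E$i$x * E$j$y * ?W i a0 a1 j a2 a3 a4 a5 a6 * (det E * eps7 (tup a0 a1 a2 a3 a4 a5 a6))))"
    by (subst sum_rotate3) (simp add: case_prod_unfold sum_eps7_rows sum_distrib_left[symmetric])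
  also have "\<dots> = (\<Sum>i\<in>UNIV. \<Sum>a0\<in>UNIV. \<Sum>a1\<in>UNIV. \<Sum>j\<in>UNIV. \<Sum>a2\<in>UNIV. \<Sum>a3\<in>UNIV. \<Sum>a4\<in>UNIV. \<Sum>a5\<in>UNIV. \<Sum>a6\<in>UNIV.
        E$i$x * E$j$y * ?W i a0 a1 j a2 a3 a4 a5 a6 * (det E * eps7 (tup a0 a1 a2 a3 a4 a5 a6)))"
    by (simp only: sum_triple prod.case)
  also have "\<dots> = (\<Sum>i\<in>UNIV. \<Sum>j\<in>UNIV. \<Sum>a0\<in>UNIV. \<Sum>a1\<in>UNIV. \<Sum>a2\<in>UNIV. \<Sum>a3\<in>UNIV. \<Sum>a4\<in>UNIV. \<Sum>a5\<in>UNIV. \<Sum>a6\<in>UNIV.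
        E$i$x * E$j$y * ?W i a0 a1 j a2 a3 a4 a5 a6 * (det E * eps7 (tup a0 a1 a2 a3 a4 a5 a6)))"
    (is "(\<Sum>i\<in>UNIV. \<Sum>a0\<in>UNIV. \<Sum>a1\<in>UNIV. \<Sum>j\<in>UNIV. ?F i j a0 a1) = _")
  proof (rule sum.cong[OF refl])
    fix i :: 7
    have "(\<Sum>a0\<in>UNIV. \<Sum>a1\<in>UNIV. \<Sum>j\<in>UNIV. ?F i j a0 a1) = (\<Sum>a0\<in>UNIV. \<Sum>j\<in>UNIV. \<Sum>a1\<in>UNIV. ?F i j a0 a1)"
      by (intro sum.cong refl sum.swap)
    also have "\<dots> = (\<Sum>j\<in>UNIV. \<Sum>a0\<in>UNIV. \<Sum>a1\<in>UNIV. ?F i j a0 a1)"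
      by (rule sum.swap)
    finally show "(\<Sum>a0\<in>UNIV. \<Sum>a1\<in>UNIV. \<Sum>j\<in>UNIV. ?F i j a0 a1) = (\<Sum>j\<in>UNIV. \<Sum>a0\<in>UNIV. \<Sum>a1\<in>UNIV. ?F i j a0 a1)" .
  qed
  also have "\<dots> = 24 * (det E * (\<Sum>i\<in>UNIV. \<Sum>j\<in>UNIV. E$i$x * E$j$y * hook_wedge w $i$j))"
    unfolding hook_wedge_eq_eps7 sum_fun7 tup_simps
    by (simp add: sum_distrib_left sum_divide_distrib mult_ac)
  finally show ?thesis by simp
qed

text \<open>\<open>det T\<close> times the Levi-Civita symbol is expanded by
  \<open>sum_eps7_columns\<close> into seven factors of \<open>T\<close>. Three of them undo the
  pullback by \<open>transpose E\<close>, the other four are those on the right.\<close>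

lemma star_pull3_transpose:
  assumes "T ** E = mat 1"
  shows "det T * star (pull3 (transpose E) w) a b c d = (\<Sum>i\<in>UNIV. \<Sum>j\<in>UNIV. \<Sum>k\<in>UNIV. \<Sum>l\<in>UNIV.
    star w i j k l * (T$i$a * T$j$b * T$k$c * T$l$d))"
proof -
  let ?R = "pull3 (transpose E) w"
  have inv: "pull3 (transpose T) ?R = w"
    using assms by (simp add: pull3_pull3 flip: matrix_transpose_mul)
  have R: "(\<Sum>p\<in>UNIV. \<Sum>q\<in>UNIV. \<Sum>r\<in>UNIV. ?R$p$q$r * (T$x$p * T$y$q * T$z$r)) = w$x$y$z" for x y z
    using arg_cong[OF inv, of "\<lambda>u. u$x$y$z"] by (simp only: pull3_nth[of "transpose T"]) (simp add: transpose_def)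
  have "6 * (det T * star ?R a b c d) = (\<Sum>p\<in>UNIV. \<Sum>q\<in>UNIV. \<Sum>r\<in>UNIV. ?R$p$q$r * (det T * eps7 (tup p q r a b c d)))"
    unfolding star_def by (simp add: sum_distrib_left mult_ac)
  also have "\<dots> = (\<Sum>p\<in>UNIV. \<Sum>q\<in>UNIV. \<Sum>r\<in>UNIV. \<Sum>f\<in>UNIV.
     (eps7 f * (T$(f 3)$a * T$(f 4)$b * T$(f 5)$c * T$(f 6)$d)) * (?R$p$q$r * (T$(f 0)$p * T$(f 1)$q * T$(f 2)$r)))"
    unfolding sum_eps7_columns[symmetric] by (simp add: sum_distrib_left prod_7 mult_ac)
  also have "\<dots> = (\<Sum>f\<in>UNIV. (eps7 f * (T$(f 3)$a * T$(f 4)$b * T$(f 5)$c * T$(f 6)$d)) * w$(f 0)$(f 1)$(f 2))"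
    by (subst sum_rotate3[symmetric]) (simp only: sum_distrib_left[symmetric] R)
  also have "\<dots> = (\<Sum>x\<in>UNIV. \<Sum>y\<in>UNIV. \<Sum>z\<in>UNIV. \<Sum>i\<in>UNIV. \<Sum>j\<in>UNIV. \<Sum>k\<in>UNIV. \<Sum>l\<in>UNIV.
     (T$i$a * T$j$b * T$k$c * T$l$d) * (eps7 (tup x y z i j k l) * w$x$y$z))"
    by (simp only: sum_fun7 tup_simps mult_ac)
  also have "\<dots> = (\<Sum>i\<in>UNIV. \<Sum>j\<in>UNIV. \<Sum>k\<in>UNIV. \<Sum>l\<in>UNIV. \<Sum>x\<in>UNIV. \<Sum>y\<in>UNIV. \<Sum>z\<in>UNIV.
     (T$i$a * T$j$b * T$k$c * T$l$d) * (eps7 (tup x y z i j k l) * w$x$y$z))"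
    (is "?A = ?B")
  proof -
    have "?A = (\<Sum>(x,y,z)\<in>UNIV. \<Sum>(i,j,k,l)\<in>UNIV. (T$i$a * T$j$b * T$k$c * T$l$d) * (eps7 (tup x y z i j k l) * w$x$y$z))"
      by (simp only: sum_quadruple prod.case) (simp only: sum_triple prod.case)
    also have "\<dots> = (\<Sum>(i,j,k,l)\<in>UNIV. \<Sum>(x,y,z)\<in>UNIV. (T$i$a * T$j$b * T$k$c * T$l$d) * (eps7 (tup x y z i j k l) * w$x$y$z))"
      unfolding case_prod_unfold by (rule sum.swap)
    also have "\<dots> = ?B"
      by (simp only: sum_quadruple prod.case) (simp only: sum_triple prod.case)
    finally show ?thesis .
  qed
  also have "\<dots> = 6 * (\<Sum>i\<in>UNIV. \<Sum>j\<in>UNIV. \<Sum>k\<in>UNIV. \<Sum>l\<in>UNIV.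
    star w i j k l * (T$i$a * T$j$b * T$k$c * T$l$d))"
    unfolding star_def by (simp add: sum_distrib_left sum_divide_distrib mult_ac)
  finally show ?thesis by simp
qed

section \<open>The induced metric\<close>

lemma inner_product_matrix_invertible:
  assumes "inner_product_matrix g" shows "invertible g"
proof -
  have "x = 0" if "g *v x = 0" for x
    using assms that unfolding inner_product_matrix_def by (metis inner_zero_right less_irrefl)
  then show ?thesis
    by (simp add: invertible_left_inverse matrix_left_invertible_ker)
qed

lemma inner_product_matrix_det:
  "inner_product_matrix g \<Longrightarrow> det g \<noteq> 0"
  using inner_product_matrix_invertible invertible_det_nz by blast

lemma inner_product_matrix_swap:
  assumes "inner_product_matrix g"
  shows "x \<bullet> (g *v y) = y \<bullet> (g *v x)"
  using assms unfolding inner_product_matrix_def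
  by (metis dot_lmul_matrix inner_commute transpose_matrix_vector)

text \<open>The only candidate for the volume coefficient: taking determinants in
  \<open>hook_wedge w = (- 6 * v) *\<^sub>R g\<close> with \<open>v\<^sup>2 = det g\<close> gives -
  6^7 v^9. Since 9 is odd, the root is unique and also fixes the orientation.\<close>

definition volx :: "tens3 \<Rightarrow> real" where
  "volx w = - root 9 (det (hook_wedge w) / 6^7)"

lemma det_scaleR7: "det (c *\<^sub>R A) = c ^ 7 * det (A :: real^7^7)"
proof -
  have "c *\<^sub>R A = mat c ** A"
    by (simp add: vec_eq_iff matrix_matrix_mult_def mat_def if_distrib if_distribR sum.delta cong: if_cong)
  moreover have "det (mat c :: real^7^7) = c ^ 7"
    by (subst det_diagonal) (simp_all add: mat_def)
  ultimately show ?thesis by (simp add: det_mul)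
qed

lemma induces_nz: "induces w g v \<Longrightarrow> v \<noteq> 0"
  using inner_product_matrix_det unfolding induces_def by force

lemma induces_hook: "induces w g v \<Longrightarrow> hook_wedge w = (- 6 * v) *\<^sub>R g"
  unfolding induces_def by (simp add: vec_eq_iff)

lemma induces_vol:
  assumes "induces w g v" shows "v = volx w"
proof -
  have "det (hook_wedge w) = - (6^7 * v^7 * det g)"
    unfolding induces_hook[OF assms] det_scaleR7 by (simp add: power_mult_distrib)
  also have "det g = v^2" using assms by (simp add: induces_def)
  finally have "det (hook_wedge w) / 6^7 = - (v ^ 9)"
    by (simp flip: power_add)
  then show ?thesis by (simp add: volx_def real_root_minus odd_real_root_power_cancel)
qed

lemma induces_metric:
  assumes "induces w g v" shows "g = (- 1 / (6 * volx w)) *\<^sub>R hook_wedge w"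
  using induces_hook[OF assms] induces_nz[OF assms] induces_vol[OF assms] by (simp add: field_simps)

lemma induces_unique:
  assumes "induces w g v" shows "metric_of w = g" "vol_of w = v"
proof -
  have *: "g' = g \<and> v' = v" if "induces w g' v'" for g' v'
    using induces_vol[OF assms] induces_vol[OF that] induces_metric[OF assms] induces_metric[OF that] by metis
  show "metric_of w = g" unfolding metric_of_def using assms * by blast
  show "vol_of w = v" unfolding vol_of_def using assms * by blast
qed

lemma nondegenerate_induces:
  "nondegenerate w \<Longrightarrow> induces w (metric_of w) (vol_of w)"
  unfolding nondegenerate_def using induces_unique by metis

lemma congruence_nth:
  fixes E g :: tens2
  shows "(transpose E ** g ** E) $ x $ y = (\<Sum>i\<in>UNIV. \<Sum>j\<in>UNIV. E$i$x * E$j$y * g$i$j)"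
proof -
  have "(transpose E ** g ** E) $ x $ y = (\<Sum>j\<in>UNIV. \<Sum>i\<in>UNIV. E$i$x * E$j$y * g$i$j)"
    by (simp add: matrix_matrix_mult_def transpose_def sum_distrib_right)
      (intro sum.cong refl, simp add: mult_ac)
  then show ?thesis by (subst sum.swap)
qed

lemma induces_pull3:
  assumes "induces w g v" "det E \<noteq> 0"
  shows "induces (pull3 E w) (transpose E ** g ** E) (det E * v)"
proof -
  have g: "inner_product_matrix g" "v\<^sup>2 = det g" "\<And>i j. hook_wedge w $i$j = - 6 * g$i$j * v"
    using assms(1) by (auto simp: induces_def)
  have "transpose (transpose E ** g ** E) = transpose E ** g ** E"
    using g(1) unfolding inner_product_matrix_def by (simp add: matrix_transpose_mul matrix_mul_assoc)
  moreover have "0 < x \<bullet> ((transpose E ** g ** E) *v x)" if "x \<noteq> 0" for x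
  proof -
    have "E *v x \<noteq> 0"
      using assms(2) that by (metis invertible_det_nz invertible_left_inverse matrix_left_invertible_ker)
    then have "0 < (E *v x) \<bullet> (g *v (E *v x))" using g(1) by (auto simp: inner_product_matrix_def)
    also have "\<dots> = x \<bullet> ((transpose E ** g ** E) *v x)"
    proof -
      have "(E *v x) \<bullet> u = x \<bullet> (transpose E *v u)" for u
        using dot_lmul_matrix[of u E x] by (simp only: transpose_matrix_vector inner_commute)
      then show ?thesis by (simp only: matrix_vector_mul_assoc[symmetric])
    qed
    finally show ?thesis .
  qed
  moreover have "hook_wedge (pull3 E w) $x$y = - 6 * (transpose E ** g ** E)$x$y * (det E * v)" for x y
    unfolding hook_wedge_pull3 congruence_nth g(3) by (simp add: sum_distrib_left sum_distrib_right mult_ac flip: sum_negf)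
  ultimately show ?thesis
    unfolding induces_def using g(2) by (simp add: inner_product_matrix_def det_mul power_mult_distrib power2_eq_square)
qed

lemma alternating_pull3:
  assumes "alternating w" shows "alternating (pull3 E w)"
proof -
  note sw = alternating_swap[OF assms]
  have "pull3 E w $j$i$k = - pull3 E w $i$j$k" for i j k
  proof -
    have "pull3 E w $j$i$k = (\<Sum>b\<in>UNIV. \<Sum>a\<in>UNIV. \<Sum>c\<in>UNIV. w$a$b$c * (E$a$j * E$b$i * E$c$k))"
      unfolding pull3_nth by (rule sum.swap)
    also have "\<dots> = - pull3 E w $i$j$k"
      unfolding pull3_nth sum_negf[symmetric] by (intro sum.cong refl) (subst sw(1), simp)
    finally show ?thesis .
  qed
  moreover have "pull3 E w $i$k$j = - pull3 E w $i$j$k" for i j k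
  proof -
    have "pull3 E w $i$k$j = (\<Sum>a\<in>UNIV. \<Sum>c\<in>UNIV. \<Sum>b\<in>UNIV. w$a$b$c * (E$a$i * E$b$k * E$c$j))"
      unfolding pull3_nth by (intro sum.cong refl sum.swap)
    also have "\<dots> = - pull3 E w $i$j$k"
      unfolding pull3_nth sum_negf[symmetric] by (intro sum.cong refl) (subst sw(2), simp)
    finally show ?thesis .
  qed
  ultimately show ?thesis unfolding alternating_def by (metis minus_minus)
qed

lemma gram_schmidt:
  assumes "inner_product_matrix g"
  obtains E :: tens2 where "transpose E ** g ** E = mat 1"
proof -
  have "\<exists>x :: 7 \<Rightarrow> vec7. \<forall>i\<in>S. \<forall>j\<in>S. x i \<bullet> (g *v x j) = (if i = j then 1 else 0)" for S :: "7 set"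
  proof (induction S rule: finite_induct[OF finite])
    case (2 a S)
    then obtain x :: "7 \<Rightarrow> vec7" where x: "\<And>i j. i \<in> S \<Longrightarrow> j \<in> S \<Longrightarrow> x i \<bullet> (g *v x j) = (if i = j then 1 else 0)"
      by blast
    have "card S < CARD(7)"
      using 2 by (metis card_mono card_insert_disjoint finite_class.finite_UNIV less_eq_Suc_le subset_UNIV)
    moreover have "dim (x ` S) \<le> card S"
      using card_image_le[of S x] dim_le_card'[of "x ` S"] 2 by auto
    ultimately have "dim (span (x ` S)) < DIM(vec7)" by simp
    then have "span (x ` S) \<noteq> UNIV" using dim_UNIV by (metis less_irrefl)
    then obtain y where y: "y \<notin> span (x ` S)" by auto
    define z where "z = y - (\<Sum>i\<in>S. (x i \<bullet> (g *v y)) *\<^sub>R x i)"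
    have "(\<Sum>i\<in>S. (x i \<bullet> (g *v y)) *\<^sub>R x i) \<in> span (x ` S)"
      by (intro span_sum span_scale span_base) auto
    then have "z \<noteq> 0" using y by (auto simp: z_def)
    then have n: "z \<bullet> (g *v z) > 0" using assms by (auto simp: inner_product_matrix_def)
    have xz: "x j \<bullet> (g *v z) = 0" if "j \<in> S" for j
    proof -
      have "g *v z = g *v y - (\<Sum>i\<in>S. (x i \<bullet> (g *v y)) *\<^sub>R (g *v x i))"
        unfolding z_def by (simp add: matrix_vector_mult_diff_distrib linear_sum[OF matrix_vector_mul_linear] matrix_vector_mult_scaleR)
      then have "x j \<bullet> (g *v z) = x j \<bullet> (g *v y) - (\<Sum>i\<in>S. (x i \<bullet> (g *v y)) * (if j = i then 1 else 0))"
        using that by (simp add: inner_diff_right inner_sum_right x)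
      also have "\<dots> = 0" using that by (simp add: if_distrib cong: if_cong)
      finally show ?thesis .
    qed
    define c where "c = 1 / sqrt (z \<bullet> (g *v z))"
    have c: "c * c * (z \<bullet> (g *v z)) = 1"
      using n by (simp add: c_def)
    have zx: "z \<bullet> (g *v x j) = 0" if "j \<in> S" for j
      using xz[OF that] inner_product_matrix_swap[OF assms] by metis
    show ?case
    proof (intro exI[of _ "x(a := c *\<^sub>R z)"] ballI)
      fix i j assume "i \<in> insert a S" "j \<in> insert a S"
      then show "(x(a := c *\<^sub>R z)) i \<bullet> (g *v (x(a := c *\<^sub>R z)) j) = (if i = j then 1 else 0)"
        using 2(2) c by (auto simp: x xz zx matrix_vector_mult_scaleR mult.assoc)
    qed
  qed auto
  then obtain x :: "7 \<Rightarrow> vec7" where x: "\<And>i j. x i \<bullet> (g *v x j) = (if i = j then 1 else 0)"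
    by (metis UNIV_I)
  define E :: tens2 where "E = (\<chi> r c. x c $ r)"
  have "(transpose E ** g ** E) $ i $ j = x i \<bullet> (g *v x j)" for i j
    unfolding congruence_nth by (simp add: E_def inner_vec_def matrix_vector_mult_def sum_distrib_left mult_ac)
  then have "transpose E ** g ** E = mat 1"
    by (simp add: vec_eq_iff x mat_def)
  then show ?thesis by (rule that)
qed

section \<open>Independent components, reflections and compactness of the orthogonal group\<close>

lemma alternating_eqI:
  assumes u: "alternating u" and w: "alternating w"
    and "\<And>i j k. rank7 i < rank7 j \<Longrightarrow> rank7 j < rank7 k \<Longrightarrow> u$i$j$k = w$i$j$k"
  shows "u = w"
proof -
  have "u$i$j$k = w$i$j$k" for i j k
  proof -
    have inj: "rank7 a = rank7 b \<Longrightarrow> a = b" for a b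
      using exhaust_7[of a] exhaust_7[of b] by (elim disjE) simp_all
    note su = alternating_swap[OF u] and sw = alternating_swap[OF w]
    note ru = alternating_repeat[OF u] and rw = alternating_repeat[OF w]
    consider "i = j" | "j = k" | "i = k" | "rank7 i < rank7 j \<and> rank7 j < rank7 k"
      | "rank7 j < rank7 i \<and> rank7 i < rank7 k" | "rank7 i < rank7 k \<and> rank7 k < rank7 j"
      | "rank7 k < rank7 i \<and> rank7 i < rank7 j" | "rank7 j < rank7 k \<and> rank7 k < rank7 i"
      | "rank7 k < rank7 j \<and> rank7 j < rank7 i"
      using inj[of i j] inj[of i k] inj[of j k] by linarith
    then show ?thesis
    proof cases
      case 5 then show ?thesis using assms(3)[of j i k] su(1)[of j i k] sw(1)[of j i k] by simp
    next
      case 6 then show ?thesis using assms(3)[of i k j] su(2)[of i k j] sw(2)[of i k j] by simp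
    next
      case 7 then show ?thesis using assms(3)[of k i j] su(1)[of k i j] sw(1)[of k i j] su(2)[of i k j] sw(2)[of i k j] by simp
    next
      case 8 then show ?thesis using assms(3)[of j k i] su(2)[of j k i] sw(2)[of j k i] su(1)[of j i k] sw(1)[of j i k] by simp
    next
      case 9 then show ?thesis using assms(3)[of k j i] su(1)[of k j i] sw(1)[of k j i] su(2)[of j k i] sw(2)[of j k i]
          su(1)[of j i k] sw(1)[of j i k] by simp
    qed (simp_all add: ru rw assms(3))
  qed
  then show ?thesis by (simp add: vec_eq_iff)
qed

lemma sum_symmetric7:
  fixes f :: "7 \<Rightarrow> 7 \<Rightarrow> real"
  assumes "\<And>a b. f b a = f a b" "\<And>a. f a a = 0"
  shows "(\<Sum>a\<in>UNIV. \<Sum>b\<in>UNIV. f a b) = 2 * (f 0 1 + f 0 2 + f 0 3 + f 0 4 + f 0 5 + f 0 6 + f 1 2 + f 1 3 + f 1 4 + f 1 5 + f 1 6 + f 2 3 + f 2 4 + f 2 5 + f 2 6 + f 3 4 + f 3 5 + f 3 6 + f 4 5 + f 4 6 + f 5 6)"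
  using assms(1)[of 1 0] assms(1)[of 2 0] assms(1)[of 3 0] assms(1)[of 4 0] assms(1)[of 5 0] assms(1)[of 6 0]
    assms(1)[of 2 1] assms(1)[of 3 1] assms(1)[of 4 1] assms(1)[of 5 1] assms(1)[of 6 1]
    assms(1)[of 3 2] assms(1)[of 4 2] assms(1)[of 5 2] assms(1)[of 6 2]
    assms(1)[of 4 3] assms(1)[of 5 3] assms(1)[of 6 3] assms(1)[of 5 4] assms(1)[of 6 4] assms(1)[of 6 5]
  by (simp add: sum_7 assms(2))

text \<open>Half of the inner double sum in \<open>hook_wedge_eq_star\<close>, taken over the 21
  unordered pairs. Keeping it folded lets simp discard the rows whose outer coefficient vanishes
  before any of them is expanded.\<close>

definition wedge_row :: "tens3 \<Rightarrow> 7 \<Rightarrow> 7 \<Rightarrow> 7 \<Rightarrow> real" where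
  "wedge_row w y a b = w$y$0$1 * star w a b 0 1 + w$y$0$2 * star w a b 0 2 + w$y$0$3 * star w a b 0 3 + w$y$0$4 * star w a b 0 4 + w$y$0$5 * star w a b 0 5 + w$y$0$6 * star w a b 0 6 + w$y$1$2 * star w a b 1 2 + w$y$1$3 * star w a b 1 3 + w$y$1$4 * star w a b 1 4 + w$y$1$5 * star w a b 1 5 + w$y$1$6 * star w a b 1 6 + w$y$2$3 * star w a b 2 3 + w$y$2$4 * star w a b 2 4 + w$y$2$5 * star w a b 2 5 + w$y$2$6 * star w a b 2 6 + w$y$3$4 * star w a b 3 4 + w$y$3$5 * star w a b 3 5 + w$y$3$6 * star w a b 3 6 + w$y$4$5 * star w a b 4 5 + w$y$4$6 * star w a b 4 6 + w$y$5$6 * star w a b 5 6"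

lemma hook_wedge_expand:
  assumes w: "alternating w"
  shows "hook_wedge w $x$y = w$x$0$1 * wedge_row w y 0 1 + w$x$0$2 * wedge_row w y 0 2 + w$x$0$3 * wedge_row w y 0 3 + w$x$0$4 * wedge_row w y 0 4 + w$x$0$5 * wedge_row w y 0 5 + w$x$0$6 * wedge_row w y 0 6 + w$x$1$2 * wedge_row w y 1 2 + w$x$1$3 * wedge_row w y 1 3 + w$x$1$4 * wedge_row w y 1 4 + w$x$1$5 * wedge_row w y 1 5 + w$x$1$6 * wedge_row w y 1 6 + w$x$2$3 * wedge_row w y 2 3 + w$x$2$4 * wedge_row w y 2 4 + w$x$2$5 * wedge_row w y 2 5 + w$x$2$6 * wedge_row w y 2 6 + w$x$3$4 * wedge_row w y 3 4 + w$x$3$5 * wedge_row w y 3 5 + w$x$3$6 * wedge_row w y 3 6 + w$x$4$5 * wedge_row w y 4 5 + w$x$4$6 * wedge_row w y 4 6 + w$x$5$6 * wedge_row w y 5 6"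
proof -
  note sw = alternating_swap[OF w] and rp = alternating_repeat[OF w]
  have 1: "(\<Sum>c\<in>UNIV. \<Sum>d\<in>UNIV. w$y$c$d * star w a b c d) = 2 * wedge_row w y a b" for a b
    unfolding wedge_row_def
    by (rule sum_symmetric7) (subst sw(2), subst star_swap(3), simp, simp)
  have "hook_wedge w $x$y = (\<Sum>a\<in>UNIV. \<Sum>b\<in>UNIV. w$x$a$b * (\<Sum>c\<in>UNIV. \<Sum>d\<in>UNIV. w$y$c$d * star w a b c d)) / 4"
    unfolding hook_wedge_eq_star by (simp add: sum_distrib_left mult.assoc)
  also have "\<dots> = (\<Sum>a\<in>UNIV. \<Sum>b\<in>UNIV. w$x$a$b * wedge_row w y a b) / 2"
    unfolding 1 by (simp add: mult.left_commute flip: sum_distrib_left)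
  also have "(\<Sum>a\<in>UNIV. \<Sum>b\<in>UNIV. w$x$a$b * wedge_row w y a b) = 2 * (w$x$0$1 * wedge_row w y 0 1 + w$x$0$2 * wedge_row w y 0 2 + w$x$0$3 * wedge_row w y 0 3 + w$x$0$4 * wedge_row w y 0 4 + w$x$0$5 * wedge_row w y 0 5 + w$x$0$6 * wedge_row w y 0 6 + w$x$1$2 * wedge_row w y 1 2 + w$x$1$3 * wedge_row w y 1 3 + w$x$1$4 * wedge_row w y 1 4 + w$x$1$5 * wedge_row w y 1 5 + w$x$1$6 * wedge_row w y 1 6 + w$x$2$3 * wedge_row w y 2 3 + w$x$2$4 * wedge_row w y 2 4 + w$x$2$5 * wedge_row w y 2 5 + w$x$2$6 * wedge_row w y 2 6 + w$x$3$4 * wedge_row w y 3 4 + w$x$3$5 * wedge_row w y 3 5 + w$x$3$6 * wedge_row w y 3 6 + w$x$4$5 * wedge_row w y 4 5 + w$x$4$6 * wedge_row w y 4 6 + w$x$5$6 * wedge_row w y 5 6)"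
  proof (rule sum_symmetric7)
    fix a b
    have "wedge_row w y b a = - wedge_row w y a b"
      by (simp only: wedge_row_def star_swap(1)[of w b a])
    then show "w$x$b$a * wedge_row w y b a = w$x$a$b * wedge_row w y a b"
      using sw(2)[of x b a] by simp
  qed (simp add: wedge_row_def rp)
  finally show ?thesis by simp
qed

definition householder :: "vec7 \<Rightarrow> tens2" where
  "householder u = (\<chi> i j. (if i = j then 1 else 0) - 2 * u$i * u$j / (u \<bullet> u))"

lemma householder_orthogonal:
  assumes "u \<noteq> 0" shows "transpose (householder u) ** householder u = mat 1"
proof -
  have q: "(\<Sum>k\<in>UNIV. u$k * u$k) = u \<bullet> u" "u \<bullet> u \<noteq> 0"
    using assms by (simp add: inner_vec_def, simp)
  have "(\<Sum>k\<in>UNIV. householder u $k$i * householder u $k$j) = (if i = j then 1 else 0)" for i j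
  proof -
    have "(\<Sum>k\<in>UNIV. householder u $k$i * householder u $k$j)
       = (\<Sum>k\<in>UNIV. (if k = i then if i = j then 1 else 0 else 0) - (if k = i then 2 * u$i * u$j / (u \<bullet> u) else 0)
           - (if k = j then 2 * u$i * u$j / (u \<bullet> u) else 0) + 4 * u$i * u$j / (u \<bullet> u)^2 * (u$k * u$k))"
      by (rule sum.cong) (auto simp: householder_def algebra_simps power2_eq_square)
    also have "\<dots> = (if i = j then 1 else 0) - 4 * u$i * u$j / (u \<bullet> u) + 4 * u$i * u$j / (u \<bullet> u)^2 * (u \<bullet> u)"
      unfolding q(1)[symmetric] sum_distrib_left by (simp add: sum.distrib sum_subtractf)
    also have "\<dots> = (if i = j then 1 else 0)"
      using q(2) by (simp add: power2_eq_square)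
    finally show ?thesis .
  qed
  then show ?thesis by (simp add: vec_eq_iff matrix_matrix_mult_def transpose_def mat_def)
qed

lemma det_orthogonal7:
  assumes "transpose E ** E = (mat 1 :: real^7^7)" shows "(det E)\<^sup>2 = 1" "det E \<noteq> 0"
proof -
  have "det (transpose E ** E) = 1" by (simp add: assms)
  then show "(det E)\<^sup>2 = 1" by (simp add: det_mul power2_eq_square)
  then show "det E \<noteq> 0" by auto
qed

lemma continuous_pull3_nth: "continuous_on S (\<lambda>E. pull3 E w $a$b$c)"
  unfolding pull3_nth by (intro continuous_intros)

lemma compact_orthogonal: "compact {E :: real^7^7. transpose E ** E = mat 1}"
proof -
  have eq: "{E :: real^7^7. transpose E ** E = mat 1} = (\<Inter>i. \<Inter>j. {E. (\<Sum>k\<in>UNIV. E$k$i * E$k$j) = mat 1$i$j})"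
    by (auto simp: vec_eq_iff matrix_matrix_mult_def transpose_def)
  have "closed {E :: real^7^7. transpose E ** E = mat 1}"
    unfolding eq by (intro closed_INT ballI closed_Collect_eq continuous_intros)
  moreover have "norm E \<le> 7 * 7" if "transpose E ** E = mat 1" for E :: "real^7^7"
  proof -
    have "(transpose E ** E)$c$c = 1" for c using that by (simp add: mat_def)
    then have s: "(\<Sum>k\<in>UNIV. (E$k$c)\<^sup>2) = 1" for c
      by (simp add: matrix_matrix_mult_def transpose_def power2_eq_square)
    have "\<bar>E$r$c\<bar> \<le> 1" for r c
    proof -
      have "(E$r$c)\<^sup>2 \<le> (\<Sum>k\<in>UNIV. (E$k$c)\<^sup>2)" by (rule member_le_sum) auto
      then show ?thesis by (simp add: s abs_square_le_1)
    qed
    then have "norm (E$r) \<le> 7" for r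
      by (intro order_trans[OF norm_le_l1_cart] order_trans[OF sum_bounded_above[of _ _ 1]]) auto
    then have "(\<Sum>r\<in>UNIV. norm (E$r)) \<le> of_nat (card (UNIV::7 set)) * 7"
      by (intro sum_bounded_above)
    then show ?thesis
      using order_trans[OF norm_vec_def[THEN eq_refl] L2_set_le_sum[of UNIV "\<lambda>r. norm (E$r)"]] by simp
  qed
  then have "bounded {E :: real^7^7. transpose E ** E = mat 1}"
    unfolding bounded_iff by blast
  ultimately show ?thesis by (simp add: compact_eq_bounded_closed)
qed

text \<open>The frame is chosen so that the value of the form on its first three vectors is maximal; the
  first-order conditions at the maximum, tested with reflections, are the vanishing components.\<close>

lemma exists_adapted_frame:
  assumes w: "alternating w" and ind: "induces w g v"
  obtains E where "det E \<noteq> 0" "transpose E ** g ** E = mat 1" "det E * v = 1"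
    "0 \<le> pull3 E w $0$1$2"
    "\<And>a. a \<in> {3,4,5,6} \<Longrightarrow> pull3 E w $0$1$a = 0"
    "\<And>a. a \<in> {3,4,5,6} \<Longrightarrow> pull3 E w $0$2$a = 0"
    "\<And>a. a \<in> {3,4,5,6} \<Longrightarrow> pull3 E w $1$2$a = 0"
proof -
  have g: "inner_product_matrix g" "v\<^sup>2 = det g" using ind by (auto simp: induces_def)
  obtain E0 :: tens2 where E0: "transpose E0 ** g ** E0 = mat 1" using gram_schmidt[OF g(1)] .
  let ?K = "{E :: real^7^7. transpose E ** E = mat 1}"
  have "mat 1 \<in> ?K" by (simp add: transpose_mat)
  then have ne: "?K \<noteq> {}" by blast
  obtain O1 where O1: "transpose O1 ** O1 = mat 1"
    and max: "\<And>E. transpose E ** E = mat 1 \<Longrightarrow> pull3 E (pull3 E0 w) $0$1$2 \<le> pull3 O1 (pull3 E0 w) $0$1$2"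
    using continuous_attains_sup[OF compact_orthogonal ne continuous_pull3_nth[of _ "pull3 E0 w" 0 1 2]] by blast
  define u where "u = pull3 (E0 ** O1) w"
  have alt: "alternating u" using w by (simp add: u_def alternating_pull3)
  have max': "pull3 E u $0$1$2 \<le> u$0$1$2" if "transpose E ** E = mat 1" for E
  proof -
    have "transpose (O1 ** E) ** (O1 ** E) = transpose E ** (transpose O1 ** O1) ** E"
      by (simp add: matrix_transpose_mul matrix_mul_assoc)
    then have "transpose (O1 ** E) ** (O1 ** E) = mat 1" using O1 that by simp
    from max[OF this] show ?thesis by (simp add: u_def pull3_pull3 matrix_mul_assoc)
  qed
  have small: "t = 0" if "\<And>x. - 2 * x * t \<le> 2 * x\<^sup>2 * m" for t m :: real
  proof (rule ccontr)
    assume t: "t \<noteq> 0"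
    \<comment> \<open>The test value - t / M, with M larger than m, makes the linear term win over
      the quadratic one unless t vanishes.\<close>
    define M where "M = \<bar>m\<bar> + 1"
    have "M > 0" "m < M" by (auto simp: M_def)
    have "- 2 * (- (t / M)) * t \<le> 2 * (- (t / M))\<^sup>2 * m" by (rule that)
    then have "t\<^sup>2 * M \<le> t\<^sup>2 * m" using \<open>M > 0\<close> by (simp add: field_simps power2_eq_square)
    then show False using t \<open>m < M\<close> by (simp add: mult_le_cancel_left)
  qed
  \<comment> \<open>Reflections depend rationally on the parameter, so the first-order condition at
    the maximum is a polynomial inequality and no curve of rotations has to be
    differentiated.\<close>
  have reflection: "(b\<^sup>2 - x\<^sup>2) * u$0$1$2 - 2 * x * b * t \<le> (x\<^sup>2 + b\<^sup>2) * u$0$1$2"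
    if "pull3 (householder z) u $0$1$2 = ((b\<^sup>2 - x\<^sup>2) * u$0$1$2 - 2 * x * b * t) / (x\<^sup>2 + b\<^sup>2)"
      and "z \<noteq> 0" and "b \<noteq> 0" for x b t :: real and z
  proof -
    have p: "x\<^sup>2 + b\<^sup>2 > 0" using that(3) by (simp add: add_nonneg_pos)
    show ?thesis
      using max'[OF householder_orthogonal[OF that(2)]] p unfolding that(1) by (simp add: field_simps)
  qed
  have fin: "t = 0"
    if hyp: "\<And>x. \<exists>z. z \<noteq> 0 \<and> pull3 (householder z) u $0$1$2 = ((1\<^sup>2 - x\<^sup>2) * u$0$1$2 - 2 * x * 1 * t) / (x\<^sup>2 + 1\<^sup>2)" for t
  proof (rule small[of t "u$0$1$2"])
    fix x
    obtain z where "z \<noteq> 0" "pull3 (householder z) u $0$1$2 = ((1\<^sup>2 - x\<^sup>2) * u$0$1$2 - 2 * x * 1 * t) / (x\<^sup>2 + 1\<^sup>2)"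
      using hyp[of x] by blast
    from reflection[OF this(2,1)] show "- 2 * x * t \<le> 2 * x\<^sup>2 * u$0$1$2" by (simp add: algebra_simps)
  qed
  have H: "householder z $ i $ j = (if i = j then 1 else 0) - 2 * z$i * z$j / (x\<^sup>2 + 1)"
    if "z = x *\<^sub>R axis s 1 + axis a 1" "s \<noteq> a" for z x s a i j
  proof -
    have "z \<bullet> z = x\<^sup>2 + 1" unfolding that(1)
      using that(2) by (simp add: inner_add_left inner_add_right inner_axis_axis power2_eq_square)
    then show ?thesis by (simp add: householder_def)
  qed
  have col: "pull3 E u $0$1$2 = (\<Sum>k\<in>UNIV. u$0$1$k * E$k$2)"
    if "\<And>i. E$i$0 = (if i = 0 then 1 else 0)" "\<And>i. E$i$1 = (if i = 1 then 1 else 0)" for E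
    unfolding pull3_nth by (simp add: sum_7 that)
  have col': "pull3 E u $0$1$2 = (\<Sum>k\<in>UNIV. u$0$k$2 * E$k$1)"
    if "\<And>i. E$i$0 = (if i = 0 then 1 else 0)" "\<And>i. E$i$2 = (if i = 2 then 1 else 0)" for E
    unfolding pull3_nth by (simp add: sum_7 that)
  have col'': "pull3 E u $0$1$2 = (\<Sum>k\<in>UNIV. u$k$1$2 * E$k$0)"
    if "\<And>i. E$i$1 = (if i = 1 then 1 else 0)" "\<And>i. E$i$2 = (if i = 2 then 1 else 0)" for E
    unfolding pull3_nth by (simp add: sum_7 that)
  \<comment> \<open>The reflection in the direction x e_s + e_a sends e_s to ((1 - x^2) e_s - 2 x
    e_a) / (x^2 + 1) and fixes the other two of the first three basis vectors. Hence only one slot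
    of the form changes.\<close>
  have ax: "(\<Sum>k\<in>UNIV. f k * ((if k = s then 1 else 0) - 2 * (x *\<^sub>R axis s 1 + axis a 1 :: vec7)$k * (x *\<^sub>R axis s 1 + axis a 1 :: vec7)$s / (x\<^sup>2+1)))
      = ((1\<^sup>2 - x\<^sup>2) * f s - 2 * x * 1 * f a) / (x\<^sup>2 + 1\<^sup>2)" if "s \<noteq> a" for f :: "7 \<Rightarrow> real" and x s a
  proof -
    have p: "x\<^sup>2 + 1 \<noteq> 0" by (smt (verit) zero_le_power2)
    have "(\<Sum>k\<in>UNIV. f k * ((if k = s then 1 else 0) - 2 * (x *\<^sub>R axis s 1 + axis a 1 :: vec7)$k * (x *\<^sub>R axis s 1 + axis a 1 :: vec7)$s / (x\<^sup>2+1)))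
      = (\<Sum>k\<in>UNIV. (if k = s then f s - 2 * x\<^sup>2 * f s / (x\<^sup>2+1) else 0) - (if k = a then 2 * x * f a / (x\<^sup>2+1) else 0))"
      using that by (intro sum.cong) (auto simp: axis_def algebra_simps power2_eq_square)
    also have "\<dots> = f s - 2 * x\<^sup>2 * f s / (x\<^sup>2+1) - 2 * x * f a / (x\<^sup>2+1)"
      by (simp add: sum_subtractf)
    also have "\<dots> = ((1\<^sup>2 - x\<^sup>2) * f s - 2 * x * 1 * f a) / (x\<^sup>2 + 1\<^sup>2)"
    proof -
      define q where "q = x\<^sup>2 + 1"
      have "q \<noteq> 0" using p by (simp add: q_def)
      then have "f s - 2 * x\<^sup>2 * f s / q - 2 * x * f a / q = (f s * q - 2 * x\<^sup>2 * f s - 2 * x * f a) / q"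
        by (simp add: diff_divide_distrib)
      then show ?thesis by (simp add: q_def algebra_simps)
    qed
    finally show ?thesis .
  qed
  have nz: "x *\<^sub>R axis s 1 + axis a 1 \<noteq> (0 :: vec7)" if "s \<noteq> a" for x s a
    using that by (auto simp: vec_eq_iff axis_def)
  have 2: "u$0$1$a = 0" if a: "a \<in> {3,4,5,6}" for a
  proof (rule fin)
    fix x
    let ?z = "x *\<^sub>R axis 2 1 + axis a 1 :: vec7"
    have s: "2 \<noteq> a" using a by auto
    have "pull3 (householder ?z) u $0$1$2 = (\<Sum>k\<in>UNIV. u$0$1$k * householder ?z $k$2)"
      by (rule col; subst H[OF refl s]; use a in \<open>auto simp: axis_def\<close>)
    then show "\<exists>z. z \<noteq> 0 \<and> pull3 (householder z) u $0$1$2 = ((1\<^sup>2 - x\<^sup>2) * u$0$1$2 - 2 * x * 1 * u$0$1$a) / (x\<^sup>2 + 1\<^sup>2)"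
      unfolding H[OF refl s] ax[OF s] using nz[OF s] by blast
  qed
  have 1: "u$0$a$2 = 0" if a: "a \<in> {3,4,5,6}" for a
  proof (rule fin)
    fix x
    let ?z = "x *\<^sub>R axis 1 1 + axis a 1 :: vec7"
    have s: "1 \<noteq> a" using a by auto
    have "pull3 (householder ?z) u $0$1$2 = (\<Sum>k\<in>UNIV. u$0$k$2 * householder ?z $k$1)"
      by (rule col'; subst H[OF refl s]; use a in \<open>auto simp: axis_def\<close>)
    then show "\<exists>z. z \<noteq> 0 \<and> pull3 (householder z) u $0$1$2 = ((1\<^sup>2 - x\<^sup>2) * u$0$1$2 - 2 * x * 1 * u$0$a$2) / (x\<^sup>2 + 1\<^sup>2)"
      unfolding H[OF refl s] ax[OF s] using nz[OF s] by blast
  qed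
  have 0: "u$a$1$2 = 0" if a: "a \<in> {3,4,5,6}" for a
  proof (rule fin)
    fix x
    let ?z = "x *\<^sub>R axis 0 1 + axis a 1 :: vec7"
    have s: "0 \<noteq> a" using a by auto
    have "pull3 (householder ?z) u $0$1$2 = (\<Sum>k\<in>UNIV. u$k$1$2 * householder ?z $k$0)"
      by (rule col''; subst H[OF refl s]; use a in \<open>auto simp: axis_def\<close>)
    then show "\<exists>z. z \<noteq> 0 \<and> pull3 (householder z) u $0$1$2 = ((1\<^sup>2 - x\<^sup>2) * u$0$1$2 - 2 * x * 1 * u$a$1$2) / (x\<^sup>2 + 1\<^sup>2)"
      unfolding H[OF refl s] ax[OF s] using nz[OF s] by blast
  qed
  have dsum: "(\<Sum>k\<in>UNIV. f k * (if k = c then s k else 0)) = f c * s c" for f s :: "7 \<Rightarrow> real" and c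
  proof -
    have "(\<Sum>k\<in>UNIV. f k * (if k = c then s k else 0)) = (\<Sum>k\<in>UNIV. if k = c then f k * s k else 0)"
      by (rule sum.cong) auto
    then show ?thesis by simp
  qed
  have diag: "pull3 (\<chi> i j. if i = j then s i else 0) u $a$b$c = s a * s b * s c * u$a$b$c" for s :: "7 \<Rightarrow> real" and a b c
    unfolding pull3_nth
    by (simp only: vec_lambda_beta mult.assoc[symmetric] dsum sum_distrib_right[symmetric]) (simp only: mult_ac)
  have diag_orth: "transpose (\<chi> i j. if i = j then s i else 0) ** (\<chi> i j. if i = j then s i else 0) = (mat 1 :: tens2)"
    if "\<And>i. s i * s i = 1" for s :: "7 \<Rightarrow> real"
    by (simp add: vec_eq_iff matrix_matrix_mult_def transpose_def mat_def dsum that)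
  \<comment> \<open>Reversing the first vector gives a competitor with the opposite value, so the
    maximum cannot be negative.\<close>
  have pos: "0 \<le> u$0$1$2"
    using max'[OF diag_orth[of "\<lambda>i. if i = 0 then -1 else 1"]] unfolding diag by simp
  define E1 where "E1 = E0 ** O1"
  have E1: "transpose E1 ** g ** E1 = mat 1"
  proof -
    have "transpose E1 ** g ** E1 = transpose O1 ** (transpose E0 ** g ** E0) ** O1"
      by (simp add: E1_def matrix_transpose_mul matrix_mul_assoc)
    then show ?thesis by (simp add: E0 O1)
  qed
  have dv: "(det E1 * v)\<^sup>2 = 1"
    unfolding power_mult_distrib g(2) power2_eq_square[of "det E1"]
    using arg_cong[OF E1, of det] by (simp add: det_mul mult_ac)
  then consider "det E1 * v = 1" | "det E1 * v = -1" by (auto simp: power2_eq_1_iff)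
  then show ?thesis
  proof cases
    case a: 1
    then have "det E1 \<noteq> 0" by auto
    then show ?thesis
      using that[of E1] E1 a pos 0 1 2 alternating_swap[OF alt] unfolding u_def[folded E1_def]
      by (metis minus_zero neg_equal_0_iff_equal)
  next
    case a: 2
    \<comment> \<open>If the orientation is wrong, the vector of index 3 is reversed. This leaves
      the value on the first three vectors alone and changes the vanishing components at most by a
      sign.\<close>
    define D :: tens2 where "D = (\<chi> i j. if i = j then (if i = 3 then -1 else 1) else 0)"
    have detD: "det D = -1"
      unfolding D_def by (subst det_diagonal) (simp_all add: prod_7)
    have D: "transpose D ** D = mat 1" unfolding D_def by (rule diag_orth) simp
    have "pull3 (E1 ** D) w = pull3 D u" by (simp add: u_def E1_def pull3_pull3)
    then have pD: "pull3 (E1 ** D) w $a$b$c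
        = (if a = 3 then -1 else 1) * (if b = 3 then -1 else 1) * (if c = 3 then -1 else 1) * u$a$b$c" for a b c
      unfolding D_def by (simp only: diag)
    have "transpose (E1 ** D) ** g ** (E1 ** D) = transpose D ** (transpose E1 ** g ** E1) ** D"
      by (simp add: matrix_transpose_mul matrix_mul_assoc)
    then have g1: "transpose (E1 ** D) ** g ** (E1 ** D) = mat 1" by (simp add: E1 D)
    have d1: "det (E1 ** D) * v = 1" using a by (simp add: det_mul detD)
    then have "det (E1 ** D) \<noteq> 0" by auto
    then show ?thesis
    proof (rule that[OF _ g1 d1])
      show "0 \<le> pull3 (E1 ** D) w $0$1$2" using pos unfolding pD by simp
      fix a :: 7 assume a: "a \<in> {3,4,5,6}"
      show "pull3 (E1 ** D) w $0$1$a = 0" using 2[OF a] unfolding pD by simp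
      show "pull3 (E1 ** D) w $0$2$a = 0" using 1[OF a] alternating_swap(2)[OF alt, of 0 2 a] unfolding pD by simp
      show "pull3 (E1 ** D) w $1$2$a = 0"
        using 0[OF a] alternating_swap(2)[OF alt, of 1 2 a] alternating_swap(1)[OF alt, of 1 a 2] unfolding pD by simp
    qed
  qed
qed

section \<open>The normal form of a G2-structure\<close>

definition det3 :: "real \<Rightarrow> real \<Rightarrow> real \<Rightarrow> real \<Rightarrow> real \<Rightarrow> real \<Rightarrow> real \<Rightarrow> real \<Rightarrow> real \<Rightarrow> real" where
  "det3 a b c d e f g h i = a * e * i + b * f * g + c * d * h - a * f * h - b * d * i - c * e * g"

text \<open>The wedge product of three coordinate covectors, as a determinant of Kronecker deltas,
  so that alternation is a matter of simp.\<close>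

definition e3 :: "7 \<Rightarrow> 7 \<Rightarrow> 7 \<Rightarrow> tens3" where
  "e3 x y z = (\<chi> a b c. det3 (of_bool (a = x)) (of_bool (a = y)) (of_bool (a = z))
     (of_bool (b = x)) (of_bool (b = y)) (of_bool (b = z)) (of_bool (c = x)) (of_bool (c = y)) (of_bool (c = z)))"

text \<open>The volume form of the first three indices plus the sum of e_i wedge \<omega>_i, where
  the \<omega>_i are orthogonal anti-self-dual 2-forms on the last four. The signs belong to the
  normalisation -6 in \<open>induces\<close> with positive orientation.\<close>

definition phi0 :: tens3 where
  "phi0 = e3 0 1 2 + e3 0 3 4 - e3 0 5 6 + e3 1 3 5 + e3 1 4 6 + e3 2 3 6 - e3 2 4 5"

lemma alternating_phi0: "alternating phi0"
  unfolding alternating_def phi0_def e3_def det3_def by simp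

lemma phi0_values:
  "phi0$0$1$2 = 1"
  "phi0$0$1$3 = 0"
  "phi0$0$1$4 = 0"
  "phi0$0$1$5 = 0"
  "phi0$0$1$6 = 0"
  "phi0$0$2$3 = 0"
  "phi0$0$2$4 = 0"
  "phi0$0$2$5 = 0"
  "phi0$0$2$6 = 0"
  "phi0$0$3$4 = 1"
  "phi0$0$3$5 = 0"
  "phi0$0$3$6 = 0"
  "phi0$0$4$5 = 0"
  "phi0$0$4$6 = 0"
  "phi0$0$5$6 = -1"
  "phi0$1$2$3 = 0"
  "phi0$1$2$4 = 0"
  "phi0$1$2$5 = 0"
  "phi0$1$2$6 = 0"
  "phi0$1$3$4 = 0"
  "phi0$1$3$5 = 1"
  "phi0$1$3$6 = 0"
  "phi0$1$4$5 = 0"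
  "phi0$1$4$6 = 1"
  "phi0$1$5$6 = 0"
  "phi0$2$3$4 = 0"
  "phi0$2$3$5 = 0"
  "phi0$2$3$6 = 1"
  "phi0$2$4$5 = -1"
  "phi0$2$4$6 = 0"
  "phi0$2$5$6 = 0"
  "phi0$3$4$5 = 0"
  "phi0$3$4$6 = 0"
  "phi0$3$5$6 = 0"
  "phi0$4$5$6 = 0"
  by (simp_all add: phi0_def e3_def det3_def)

text \<open>\<open>skew4\<close> is the general skew 4-by-4 matrix; exchanging the two triples of parameters is the Hodge
  star on \<open>\<Lambda>\<^sup>2(\<real>\<^sup>4)\<close> and yields, up to sign, the Pfaffian adjugate.\<close>

definition skew4 :: "real \<Rightarrow> real \<Rightarrow> real \<Rightarrow> real \<Rightarrow> real \<Rightarrow> real \<Rightarrow> real^4^4" where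
  "skew4 p q r P Q R = vector [vector [0, p, q, r], vector [- p, 0, R, - Q], vector [- q, - R, 0, P], vector [- r, Q, - P, 0]]"

lemma vector_4_nth[simp]:
  "(vector [a,b,c,d] :: ('a::zero)^4)$1 = a" "(vector [a,b,c,d] :: 'a^4)$2 = b"
  "(vector [a,b,c,d] :: 'a^4)$3 = c" "(vector [a,b,c,d] :: 'a^4)$4 = d"
  unfolding vector_def by simp_all

text \<open>The polarised form of the identity that a skew 4-by-4 matrix times its dual is minus the
  Pfaffian times the identity.\<close>

lemma skew4_polarised:
  "skew4 p q r P Q R ** skew4 P' Q' R' p' q' r' + skew4 p' q' r' P' Q' R' ** skew4 P Q R p q r
    = mat (- (p * P' + q * Q' + r * R' + P * p' + Q * q' + R * r'))"
  unfolding vec_eq_iff forall_4 matrix_matrix_mult_def skew4_def mat_def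
  by (simp add: sum_4 algebra_simps)

lemma mat_mult_left: "mat c ** A = c *\<^sub>R A" for A :: "real^'n^'m"
  by (simp add: vec_eq_iff matrix_matrix_mult_def mat_def if_distrib if_distribR sum.delta cong: if_cong)

lemma mat_mult_right: "A ** mat c = c *\<^sub>R A" for A :: "real^'n^'m"
  by (simp add: vec_eq_iff matrix_matrix_mult_def mat_def if_distrib if_distribR sum.delta' cong: if_cong)

lemma scaleR_mat1: "mat c = c *\<^sub>R (mat 1 :: real^'n^'n)"
  by (simp add: vec_eq_iff mat_def)

lemma scaleR_matrix_left: "(c *\<^sub>R A) ** B = c *\<^sub>R (A ** B)" for A :: "real^'n^'m"
  by (simp add: vec_eq_iff matrix_matrix_mult_def sum_distrib_left mult.assoc)

text \<open>From \<open>A' ** A = mat s\<close> and the triple product, \<open>A'\<close> is s times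
  \<open>B' ** C\<close>. Cancelling \<open>C ** C'\<close> and \<open>B' ** B\<close> in the triple
  product followed by \<open>C' ** B\<close> shows that \<open>C' ** B\<close> is s^2 times
  \<open>A\<close>. Anticommutation makes the two products opposite. In the application primes are
  Hodge duals, so each 2-form is a multiple of its own dual.\<close>

lemma quaternionic_star:
  fixes A B C A' B' C' :: "real^'n^'n"
  assumes ABC: "A ** B' ** C = mat 1" and s: "s \<noteq> 0"
    and sq: "A' ** A = mat s" "B' ** B = mat s" "C' ** C = mat s" "C ** C' = mat s" "B ** B' = mat s"
    and anti: "C' ** B = - (B' ** C)"
  shows "A' = - (s ^ 3) *\<^sub>R A"
proof -
  have "A' = A' ** (A ** B' ** C)" by (simp add: ABC)
  also have "\<dots> = s *\<^sub>R (B' ** C)" by (simp add: matrix_mul_assoc sq mat_mult_left scaleR_matrix_left)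
  finally have A': "A' = s *\<^sub>R (B' ** C)" .
  have "A ** B' ** C ** (C' ** B) = s\<^sup>2 *\<^sub>R A"
  proof -
    have "A ** B' ** C ** (C' ** B) = A ** B' ** (C ** C') ** B" by (simp add: matrix_mul_assoc)
    also have "\<dots> = s *\<^sub>R (A ** (B' ** B))" by (simp only: sq(4) mat_mult_right scaleR_matrix_left matrix_mul_assoc)
    also have "\<dots> = s\<^sup>2 *\<^sub>R A" by (simp add: sq mat_mult_right power2_eq_square)
    finally show ?thesis .
  qed
  then have "C' ** B = s\<^sup>2 *\<^sub>R A" by (simp add: ABC)
  then have "B' ** C = - (s\<^sup>2 *\<^sub>R A)" using anti by (metis minus_minus)
  then show ?thesis by (simp add: A' power3_eq_cube power2_eq_square)
qed

lemma mat_double: "X + X = mat (2 * c) \<longleftrightarrow> X = mat c" for X :: "real^'n^'n"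
  by (auto simp: vec_eq_iff mat_def split: if_splits)

lemma skew4_square:
  assumes "p * P + q * Q + r * R + P * p + Q * q + R * r = - 2 * s"
  shows "skew4 p q r P Q R ** skew4 P Q R p q r = mat s"
  using skew4_polarised[of p q r P Q R P Q R p q r] unfolding assms
  by - (rule iffD1[OF mat_double], simp)

lemma skew4_anticommute:
  assumes "p * P' + q * Q' + r * R' + P * p' + Q * q' + R * r' = 0"
  shows "skew4 p' q' r' P' Q' R' ** skew4 P Q R p q r = - (skew4 p q r P Q R ** skew4 P' Q' R' p' q' r')"
  using skew4_polarised[of p q r P Q R P' Q' R' p' q' r'] unfolding assms
  by (simp add: scaleR_mat1[of 0] eq_neg_iff_add_eq_0 add.commute)

text \<open>The form is m e_012 plus the sum of e_i wedge \<omega>_i plus a cubic part on the last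
  four indices. The entries of \<open>hook_wedge\<close> on the first three indices fix the pairings
  of the \<omega>_i, the mixed entries kill the cubic part, and the last block is a cubic matrix
  relation. The three skew matrices then behave like imaginary quaternions, which forces the
  \<omega>_i to be anti-self-dual and m = 1.\<close>

lemma adapted_components:
  assumes alt: "alternating u" and hook: "\<And>x y. hook_wedge u $x$y = (if x = y then -6 else 0)"
    and m0: "0 \<le> u$0$1$2"
    and z: "\<forall>a\<in>{3,4,5,6}. u$0$1$a = 0" "\<forall>a\<in>{3,4,5,6}. u$0$2$a = 0" "\<forall>a\<in>{3,4,5,6}. u$1$2$a = 0"
  shows "u$0$1$2 = 1" "u$3$4$5 = 0" "u$3$4$6 = 0" "u$3$5$6 = 0" "u$4$5$6 = 0"
    "\<And>i. i \<in> {0,1,2} \<Longrightarrow> u$i$5$6 = - u$i$3$4 \<and> u$i$4$6 = u$i$3$5 \<and> u$i$4$5 = - u$i$3$6"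
    "\<And>i j. i \<in> {0,1,2} \<Longrightarrow> j \<in> {0,1,2} \<Longrightarrow> u$i$3$4 * u$j$3$4 + u$i$3$5 * u$j$3$5 + u$i$3$6 * u$j$3$6 = (if i = j then 1 else 0)"
proof -
  define m where "m = u$0$1$2"
  define p0 where "p0 = u$0$3$4"
  define p1 where "p1 = u$1$3$4"
  define p2 where "p2 = u$2$3$4"
  define q0 where "q0 = u$0$3$5"
  define q1 where "q1 = u$1$3$5"
  define q2 where "q2 = u$2$3$5"
  define r0 where "r0 = u$0$3$6"
  define r1 where "r1 = u$1$3$6"
  define r2 where "r2 = u$2$3$6"
  define P0 where "P0 = u$0$5$6"
  define P1 where "P1 = u$1$5$6"
  define P2 where "P2 = u$2$5$6"
  \<comment> \<open>With this sign the Hodge star of the last four indices exchanges the triples (p,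
    q, r) and (P, Q, R), in accordance with \<open>skew4\<close>.\<close>
  define Q0 where "Q0 = - u$0$4$6"
  define Q1 where "Q1 = - u$1$4$6"
  define Q2 where "Q2 = - u$2$4$6"
  define R0 where "R0 = u$0$4$5"
  define R1 where "R1 = u$1$4$5"
  define R2 where "R2 = u$2$4$5"
  \<comment> \<open>The components of the cubic part, each named after the index it omits.\<close>
  define t3 t4 t5 t6 where "t3 = u$4$5$6" and "t4 = u$3$5$6" and "t5 = u$3$4$6" and "t6 = u$3$4$5"
  have c: "u$0$1$2 = m"
    "u$0$3$4 = p0"
    "u$1$3$4 = p1"
    "u$2$3$4 = p2"
    "u$0$3$5 = q0"
    "u$1$3$5 = q1"
    "u$2$3$5 = q2"
    "u$0$3$6 = r0"
    "u$1$3$6 = r1"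
    "u$2$3$6 = r2"
    "u$0$5$6 = P0"
    "u$1$5$6 = P1"
    "u$2$5$6 = P2"
    "u$0$4$6 = - Q0"
    "u$1$4$6 = - Q1"
    "u$2$4$6 = - Q2"
    "u$0$4$5 = R0"
    "u$1$4$5 = R1"
    "u$2$4$5 = R2"
    "u$4$5$6 = t3" "u$3$5$6 = t4" "u$3$4$6 = t5" "u$3$4$5 = t6"
    "u$0$1$3 = 0" "u$0$1$4 = 0" "u$0$1$5 = 0" "u$0$1$6 = 0"
    "u$0$2$3 = 0" "u$0$2$4 = 0" "u$0$2$5 = 0" "u$0$2$6 = 0"
    "u$1$2$3 = 0" "u$1$2$4 = 0" "u$1$2$5 = 0" "u$1$2$6 = 0"
    by (simp_all add: m_def p0_def p1_def p2_def q0_def q1_def q2_def r0_def r1_def r2_def P0_def P1_def P2_def Q0_def Q1_def Q2_def R0_def R1_def R2_def t3_def t4_def t5_def t6_def z)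
  have z34: "m \<ge> 0" using m0 by (simp add: m_def)
  note vals = c alternating_repeat[OF alt] alternating_sort[OF alt]
  note hk = hook_wedge_expand[OF alt]
  note st = wedge_row_def star_sort star_values[OF alt] vals
  have "hook_wedge u $0$0 = 3 * (m * (p0 * P0 + q0 * Q0 + r0 * R0 + P0 * p0 + Q0 * q0 + R0 * r0))"
    unfolding hk by (simp add: vals) (simp add: st algebra_simps)
  then have d00: "m * (p0 * P0 + q0 * Q0 + r0 * R0 + P0 * p0 + Q0 * q0 + R0 * r0) = -2" using hook[of 0 0] by simp
  have "hook_wedge u $0$1 = 3 * (m * (p0 * P1 + q0 * Q1 + r0 * R1 + P0 * p1 + Q0 * q1 + R0 * r1))"
    unfolding hk by (simp add: vals) (simp add: st algebra_simps)
  then have d01: "m * (p0 * P1 + q0 * Q1 + r0 * R1 + P0 * p1 + Q0 * q1 + R0 * r1) = 0" using hook[of 0 1] by simp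
  have "hook_wedge u $0$2 = 3 * (m * (p0 * P2 + q0 * Q2 + r0 * R2 + P0 * p2 + Q0 * q2 + R0 * r2))"
    unfolding hk by (simp add: vals) (simp add: st algebra_simps)
  then have d02: "m * (p0 * P2 + q0 * Q2 + r0 * R2 + P0 * p2 + Q0 * q2 + R0 * r2) = 0" using hook[of 0 2] by simp
  have "hook_wedge u $1$1 = 3 * (m * (p1 * P1 + q1 * Q1 + r1 * R1 + P1 * p1 + Q1 * q1 + R1 * r1))"
    unfolding hk by (simp add: vals) (simp add: st algebra_simps)
  then have d11: "m * (p1 * P1 + q1 * Q1 + r1 * R1 + P1 * p1 + Q1 * q1 + R1 * r1) = -2" using hook[of 1 1] by simp
  have "hook_wedge u $1$2 = 3 * (m * (p1 * P2 + q1 * Q2 + r1 * R2 + P1 * p2 + Q1 * q2 + R1 * r2))"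
    unfolding hk by (simp add: vals) (simp add: st algebra_simps)
  then have d12: "m * (p1 * P2 + q1 * Q2 + r1 * R2 + P1 * p2 + Q1 * q2 + R1 * r2) = 0" using hook[of 1 2] by simp
  have "hook_wedge u $2$2 = 3 * (m * (p2 * P2 + q2 * Q2 + r2 * R2 + P2 * p2 + Q2 * q2 + R2 * r2))"
    unfolding hk by (simp add: vals) (simp add: st algebra_simps)
  then have d22: "m * (p2 * P2 + q2 * Q2 + r2 * R2 + P2 * p2 + Q2 * q2 + R2 * r2) = -2" using hook[of 2 2] by simp
  \<comment> \<open>The mixed entries say that the skew matrix of the first 2-form annihilates the
    vector (- t3, t4, - t5, t6). Its Pfaffian is nonzero by \<open>d00\<close>, so this vector
    vanishes.\<close>
  have "hook_wedge u $0$3 = 3 * (m * ((0) * (- t3) + (p0) * (t4) + (q0) * (- t5) + (r0) * (t6)))"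
    unfolding hk by (simp add: vals) (simp add: st algebra_simps)
  then have n0: "m * ((0) * (- t3) + (p0) * (t4) + (q0) * (- t5) + (r0) * (t6)) = 0" using hook[of 0 3] by simp
  have "hook_wedge u $0$4 = 3 * (m * ((- p0) * (- t3) + (0) * (t4) + (R0) * (- t5) + (- Q0) * (t6)))"
    unfolding hk by (simp add: vals) (simp add: st algebra_simps)
  then have n1: "m * ((- p0) * (- t3) + (0) * (t4) + (R0) * (- t5) + (- Q0) * (t6)) = 0" using hook[of 0 4] by simp
  have "hook_wedge u $0$5 = 3 * (m * ((- q0) * (- t3) + (- R0) * (t4) + (0) * (- t5) + (P0) * (t6)))"
    unfolding hk by (simp add: vals) (simp add: st algebra_simps)
  then have n2: "m * ((- q0) * (- t3) + (- R0) * (t4) + (0) * (- t5) + (P0) * (t6)) = 0" using hook[of 0 5] by simp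
  have "hook_wedge u $0$6 = 3 * (m * ((- r0) * (- t3) + (Q0) * (t4) + (- P0) * (- t5) + (0) * (t6)))"
    unfolding hk by (simp add: vals) (simp add: st algebra_simps)
  then have n3: "m * ((- r0) * (- t3) + (Q0) * (t4) + (- P0) * (- t5) + (0) * (t6)) = 0" using hook[of 0 6] by simp
  have m: "m \<noteq> 0" using d00 by auto
  show t: "u$3$4$5 = 0" "u$3$4$6 = 0" "u$3$5$6 = 0" "u$4$5$6 = 0"
  proof -
    have l: "x * (p0 * P0 + q0 * Q0 + r0 * R0) = 0 \<Longrightarrow> x = 0" for x :: real
    proof -
      have "p0 * P0 + q0 * Q0 + r0 * R0 \<noteq> 0"
      proof
        assume "p0 * P0 + q0 * Q0 + r0 * R0 = 0"
        then have "p0 * P0 + q0 * Q0 + r0 * R0 + P0 * p0 + Q0 * q0 + R0 * r0 = 0" by algebra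
        with d00 show False by simp
      qed
      then show "x * (p0 * P0 + q0 * Q0 + r0 * R0) = 0 \<Longrightarrow> x = 0" by simp
    qed
    have n': "p0 * t4 - q0 * t5 + r0 * t6 = 0" "p0 * t3 - R0 * t5 - Q0 * t6 = 0"
      "q0 * t3 - R0 * t4 + P0 * t6 = 0" "r0 * t3 + Q0 * t4 + P0 * t5 = 0"
      using n0 n1 n2 n3 m unfolding mult_eq_0_iff by (simp_all add: algebra_simps)
    have "t3 * (p0 * P0 + q0 * Q0 + r0 * R0) = 0" using n'(2-4) by algebra
    moreover have "t4 * (p0 * P0 + q0 * Q0 + r0 * R0) = 0" using n'(1,3,4) by algebra
    moreover have "t5 * (p0 * P0 + q0 * Q0 + r0 * R0) = 0" using n'(1,2,4) by algebra
    moreover have "t6 * (p0 * P0 + q0 * Q0 + r0 * R0) = 0" using n'(1,2,3) by algebra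
    ultimately show "u$3$4$5 = 0" "u$3$4$6 = 0" "u$3$5$6 = 0" "u$4$5$6 = 0"
      unfolding c by (blast dest: l)+
  qed
  then have t': "t3 = 0" "t4 = 0" "t5 = 0" "t6 = 0" by (simp_all add: c)
  define A0 where "A0 = skew4 p0 q0 r0 P0 Q0 R0"
  define H0 where "H0 = skew4 P0 Q0 R0 p0 q0 r0"
  define A1 where "A1 = skew4 p1 q1 r1 P1 Q1 R1"
  define H1 where "H1 = skew4 P1 Q1 R1 p1 q1 r1"
  define A2 where "A2 = skew4 p2 q2 r2 P2 Q2 R2"
  define H2 where "H2 = skew4 P2 Q2 R2 p2 q2 r2"
  note AH = A0_def H0_def A1_def H1_def A2_def H2_def
  \<comment> \<open>The last block of \<open>hook_wedge\<close> is minus the antisymmetrised product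
    of the three skew matrices with the middle factor dualised.\<close>
  have six: "A0 ** H1 ** A2 - A0 ** H2 ** A1 - A1 ** H0 ** A2 + A1 ** H2 ** A0 + A2 ** H0 ** A1 - A2 ** H1 ** A0 = mat 6"
  proof -
    let ?M = "A0 ** H1 ** A2 - A0 ** H2 ** A1 - A1 ** H0 ** A2 + A1 ** H2 ** A0 + A2 ** H0 ** A1 - A2 ** H1 ** A0"
    note mm = AH skew4_def matrix_matrix_mult_def sum_4
    have "?M$1$1 = - hook_wedge u $3$3"
      unfolding hk by (simp add: vals t') (simp add: st t' mm algebra_simps)
    then have M00: "?M$1$1 = 6" by (simp add: hook)
    have "?M$1$2 = - hook_wedge u $3$4"
      unfolding hk by (simp add: vals t') (simp add: st t' mm algebra_simps)
    then have M01: "?M$1$2 = 0" by (simp add: hook)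
    have "?M$1$3 = - hook_wedge u $3$5"
      unfolding hk by (simp add: vals t') (simp add: st t' mm algebra_simps)
    then have M02: "?M$1$3 = 0" by (simp add: hook)
    have "?M$1$4 = - hook_wedge u $3$6"
      unfolding hk by (simp add: vals t') (simp add: st t' mm algebra_simps)
    then have M03: "?M$1$4 = 0" by (simp add: hook)
    have "?M$2$1 = - hook_wedge u $4$3"
      unfolding hk by (simp add: vals t') (simp add: st t' mm algebra_simps)
    then have M10: "?M$2$1 = 0" by (simp add: hook)
    have "?M$2$2 = - hook_wedge u $4$4"
      unfolding hk by (simp add: vals t') (simp add: st t' mm algebra_simps)
    then have M11: "?M$2$2 = 6" by (simp add: hook)
    have "?M$2$3 = - hook_wedge u $4$5"
      unfolding hk by (simp add: vals t') (simp add: st t' mm algebra_simps)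
    then have M12: "?M$2$3 = 0" by (simp add: hook)
    have "?M$2$4 = - hook_wedge u $4$6"
      unfolding hk by (simp add: vals t') (simp add: st t' mm algebra_simps)
    then have M13: "?M$2$4 = 0" by (simp add: hook)
    have "?M$3$1 = - hook_wedge u $5$3"
      unfolding hk by (simp add: vals t') (simp add: st t' mm algebra_simps)
    then have M20: "?M$3$1 = 0" by (simp add: hook)
    have "?M$3$2 = - hook_wedge u $5$4"
      unfolding hk by (simp add: vals t') (simp add: st t' mm algebra_simps)
    then have M21: "?M$3$2 = 0" by (simp add: hook)
    have "?M$3$3 = - hook_wedge u $5$5"
      unfolding hk by (simp add: vals t') (simp add: st t' mm algebra_simps)
    then have M22: "?M$3$3 = 6" by (simp add: hook)
    have "?M$3$4 = - hook_wedge u $5$6"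
      unfolding hk by (simp add: vals t') (simp add: st t' mm algebra_simps)
    then have M23: "?M$3$4 = 0" by (simp add: hook)
    have "?M$4$1 = - hook_wedge u $6$3"
      unfolding hk by (simp add: vals t') (simp add: st t' mm algebra_simps)
    then have M30: "?M$4$1 = 0" by (simp add: hook)
    have "?M$4$2 = - hook_wedge u $6$4"
      unfolding hk by (simp add: vals t') (simp add: st t' mm algebra_simps)
    then have M31: "?M$4$2 = 0" by (simp add: hook)
    have "?M$4$3 = - hook_wedge u $6$5"
      unfolding hk by (simp add: vals t') (simp add: st t' mm algebra_simps)
    then have M32: "?M$4$3 = 0" by (simp add: hook)
    have "?M$4$4 = - hook_wedge u $6$6"
      unfolding hk by (simp add: vals t') (simp add: st t' mm algebra_simps)
    then have M33: "?M$4$4 = 6" by (simp add: hook)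
    show ?thesis unfolding vec_eq_iff forall_4 by (simp add: mat_def M00 M01 M02 M03 M10 M11 M12 M13 M20 M21 M22 M23 M30 M31 M32 M33 del: vector_minus_component vector_add_component)
  qed
  \<comment> \<open>By \<open>d00\<close>, \<open>d11\<close> and \<open>d22\<close> the Pfaffian of
    each of the three matrices is - 1 / m, so \<open>s\<close> is its negative.\<close>
  define s where "s = 1 / m"
  have s: "s > 0" using z34 m by (simp add: s_def)
  have D00: "(p0 * P0 + q0 * Q0 + r0 * R0 + P0 * p0 + Q0 * q0 + R0 * r0) = - 2 * s"
    using d00 m by (simp add: s_def field_simps)
  have D01: "(p0 * P1 + q0 * Q1 + r0 * R1 + P0 * p1 + Q0 * q1 + R0 * r1) = 0"
    using d01 m by simp
  have D02: "(p0 * P2 + q0 * Q2 + r0 * R2 + P0 * p2 + Q0 * q2 + R0 * r2) = 0"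
    using d02 m by simp
  have D11: "(p1 * P1 + q1 * Q1 + r1 * R1 + P1 * p1 + Q1 * q1 + R1 * r1) = - 2 * s"
    using d11 m by (simp add: s_def field_simps)
  have D12: "(p1 * P2 + q1 * Q2 + r1 * R2 + P1 * p2 + Q1 * q2 + R1 * r2) = 0"
    using d12 m by simp
  have D22: "(p2 * P2 + q2 * Q2 + r2 * R2 + P2 * p2 + Q2 * q2 + R2 * r2) = - 2 * s"
    using d22 m by (simp add: s_def field_simps)
  have sq0: "A0 ** H0 = mat s" "H0 ** A0 = mat s"
    unfolding AH by (rule skew4_square, use D00 in linarith)+
  have sq1: "A1 ** H1 = mat s" "H1 ** A1 = mat s"
    unfolding AH by (rule skew4_square, use D11 in linarith)+
  have sq2: "A2 ** H2 = mat s" "H2 ** A2 = mat s"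
    unfolding AH by (rule skew4_square, use D22 in linarith)+
  have an01: "A1 ** H0 = - (A0 ** H1)" "H1 ** A0 = - (H0 ** A1)"
    unfolding AH by (rule skew4_anticommute, use D01 in linarith)+
  have an02: "A2 ** H0 = - (A0 ** H2)" "H2 ** A0 = - (H0 ** A2)"
    unfolding AH by (rule skew4_anticommute, use D02 in linarith)+
  have an12: "A2 ** H1 = - (A1 ** H2)" "H2 ** A1 = - (H1 ** A2)"
    unfolding AH by (rule skew4_anticommute, use D12 in linarith)+
  have neg: "(- X) ** Y = - (X ** Y)" "X ** (- Y) = - (X ** Y)" for X Y :: "real^4^4"
    by (simp_all add: vec_eq_iff matrix_matrix_mult_def sum_negf)
  \<comment> \<open>Each exchange of neighbouring factors costs a sign, which cancels the sign of
    the permutation; so all six terms of \<open>six\<close> coincide.\<close>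
  have K: "A0 ** H2 ** A1 = - (A0 ** H1 ** A2)" "A1 ** H0 ** A2 = - (A0 ** H1 ** A2)"
      "A2 ** H0 ** A1 = A0 ** H1 ** A2" "A2 ** H1 ** A0 = - (A0 ** H1 ** A2)" "A1 ** H2 ** A0 = A0 ** H1 ** A2"
  proof -
    show 1: "A0 ** H2 ** A1 = - (A0 ** H1 ** A2)" using an12(2) by (simp add: neg flip: matrix_mul_assoc)
    show 2: "A1 ** H0 ** A2 = - (A0 ** H1 ** A2)" using an01(1) by (simp add: neg)
    show 3: "A2 ** H0 ** A1 = A0 ** H1 ** A2" using an02(1) 1 by (simp add: neg)
    show 4: "A2 ** H1 ** A0 = - (A0 ** H1 ** A2)" using an01(2) 3 by (simp add: neg flip: matrix_mul_assoc)
    show "A1 ** H2 ** A0 = A0 ** H1 ** A2" using an12(1) 4 by (simp add: neg)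
  qed
  have e: "X - (- X) - (- X) + X + X - (- X) = 6 *\<^sub>R X" for X :: "real^4^4"
    by (simp add: vec_eq_iff)
  have "6 *\<^sub>R (A0 ** H1 ** A2) = 6 *\<^sub>R mat 1"
    using six unfolding K scaleR_mat1[of 6] e .
  then have K0: "A0 ** H1 ** A2 = mat 1" by (simp only: scaleR_cancel_left) simp
  have "s \<noteq> 0" using s by simp
  note qs = quaternionic_star[OF _ \<open>s \<noteq> 0\<close>]
  have h0: "H0 = - (s ^ 3) *\<^sub>R A0"
    by (rule qs[OF K0 sq0(2) sq1(2) sq2(2) sq2(1) sq1(1)]) (rule an12(2))
  have h1: "H1 = - (s ^ 3) *\<^sub>R A1"
    by (rule qs[OF _ sq1(2) sq2(2) sq0(2) sq0(1) sq2(1)]) (simp_all add: K K0 an02(2))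
  have h2: "H2 = - (s ^ 3) *\<^sub>R A2"
    by (rule qs[OF _ sq2(2) sq0(2) sq1(2) sq1(1) sq0(1)]) (simp_all add: K K0 an01(2))
  have v0: "P0 = - (s^3) * p0" "Q0 = - (s^3) * q0" "R0 = - (s^3) * r0"
    using arg_cong[OF h0, of "\<lambda>M. M$1$2"] arg_cong[OF h0, of "\<lambda>M. M$1$3"] arg_cong[OF h0, of "\<lambda>M. M$1$4"]
    unfolding AH skew4_def by simp_all
  have w0: "p0 = - (s^3) * P0" "q0 = - (s^3) * Q0" "r0 = - (s^3) * R0"
    using arg_cong[OF h0, of "\<lambda>M. M$3$4"] arg_cong[OF h0, of "\<lambda>M. M$4$2"] arg_cong[OF h0, of "\<lambda>M. M$2$3"]
    unfolding AH skew4_def by simp_all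
  have v1: "P1 = - (s^3) * p1" "Q1 = - (s^3) * q1" "R1 = - (s^3) * r1"
    using arg_cong[OF h1, of "\<lambda>M. M$1$2"] arg_cong[OF h1, of "\<lambda>M. M$1$3"] arg_cong[OF h1, of "\<lambda>M. M$1$4"]
    unfolding AH skew4_def by simp_all
  have w1: "p1 = - (s^3) * P1" "q1 = - (s^3) * Q1" "r1 = - (s^3) * R1"
    using arg_cong[OF h1, of "\<lambda>M. M$3$4"] arg_cong[OF h1, of "\<lambda>M. M$4$2"] arg_cong[OF h1, of "\<lambda>M. M$2$3"]
    unfolding AH skew4_def by simp_all
  have v2: "P2 = - (s^3) * p2" "Q2 = - (s^3) * q2" "R2 = - (s^3) * r2"
    using arg_cong[OF h2, of "\<lambda>M. M$1$2"] arg_cong[OF h2, of "\<lambda>M. M$1$3"] arg_cong[OF h2, of "\<lambda>M. M$1$4"]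
    unfolding AH skew4_def by simp_all
  have w2: "p2 = - (s^3) * P2" "q2 = - (s^3) * Q2" "r2 = - (s^3) * R2"
    using arg_cong[OF h2, of "\<lambda>M. M$3$4"] arg_cong[OF h2, of "\<lambda>M. M$4$2"] arg_cong[OF h2, of "\<lambda>M. M$2$3"]
    unfolding AH skew4_def by simp_all
  \<comment> \<open>The star on 2-forms in four dimensions is an involution: applying the
    proportionality factor - s^3 twice returns the original coefficients, so s^6 = 1, and s is
    positive.\<close>
  have "s = 1"
  proof -
    have nz: "p0 \<noteq> 0 \<or> q0 \<noteq> 0 \<or> r0 \<noteq> 0" using D00 v0 s by auto
    have "x = s ^ 6 * x" if "y = - (s^3) * x" "x = - (s^3) * y" for x y
    proof -
      have "- (s^3) * (- (s^3) * x) = s ^ 6 * x" by (simp add: eval_nat_numeral)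
      then show ?thesis using that by metis
    qed
    from this[OF v0(1) w0(1)] this[OF v0(2) w0(2)] this[OF v0(3) w0(3)]
    have "s ^ 6 = 1" using nz by auto
    then show ?thesis using s power_eq_1_iff[of s 6] by simp
  qed
  then have "m = 1" by (simp add: s_def)
  then show "u$0$1$2 = 1" by (simp add: m_def)
  note V = v0[unfolded \<open>s = 1\<close>] v1[unfolded \<open>s = 1\<close>] v2[unfolded \<open>s = 1\<close>]
  show "u$i$5$6 = - u$i$3$4 \<and> u$i$4$6 = u$i$3$5 \<and> u$i$4$5 = - u$i$3$6" if "i \<in> {0,1,2}" for i
    using that V by (auto simp: c)
  show "u$i$3$4 * u$j$3$4 + u$i$3$5 * u$j$3$5 + u$i$3$6 * u$j$3$6 = (if i = j then 1 else 0)"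
    if "i \<in> {0,1,2}" "j \<in> {0,1,2}" for i j
    using that D00 D01 D02 D11 D12 D22 V \<open>s = 1\<close> by (auto simp: c algebra_simps)
qed

text \<open>In the adapted frame the three anti-self-dual 2-forms are orthonormal, so a rotation of
  the first three vectors carries them to the standard ones. Nothing else remains free.\<close>

theorem G2_frame:
  assumes w: "alternating w" and ind: "induces w g v"
  obtains E where "det E \<noteq> 0" "pull3 E w = phi0" "transpose E ** g ** E = mat 1" "det E * v = 1"
proof -
  obtain E1 where E1: "det E1 \<noteq> 0" "transpose E1 ** g ** E1 = mat 1" "det E1 * v = 1"
    "0 \<le> pull3 E1 w $0$1$2"
    "\<And>a. a \<in> {3,4,5,6} \<Longrightarrow> pull3 E1 w $0$1$a = 0"
    "\<And>a. a \<in> {3,4,5,6} \<Longrightarrow> pull3 E1 w $0$2$a = 0"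
    "\<And>a. a \<in> {3,4,5,6} \<Longrightarrow> pull3 E1 w $1$2$a = 0"
    using exists_adapted_frame[OF w ind] by blast
  define u where "u = pull3 E1 w"
  have alt: "alternating u" using w by (simp add: u_def alternating_pull3)
  have iu: "induces u (mat 1) 1"
    using induces_pull3[OF ind E1(1)] by (simp add: E1 u_def)
  have "hook_wedge u $x$y = (if x = y then -6 else 0)" for x y
    using iu by (simp add: induces_def mat_def)
  moreover have z: "\<forall>a\<in>{3,4,5,6}. u$0$1$a = 0" "\<forall>a\<in>{3,4,5,6}. u$0$2$a = 0" "\<forall>a\<in>{3,4,5,6}. u$1$2$a = 0"
    using E1(5-7) unfolding u_def by blast+
  moreover have "0 \<le> u$0$1$2" using E1(4) by (simp add: u_def)
  ultimately have comp: "u$0$1$2 = 1" "u$3$4$5 = 0" "u$3$4$6 = 0" "u$3$5$6 = 0" "u$4$5$6 = 0"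
    "\<And>i. i \<in> {0,1,2} \<Longrightarrow> u$i$5$6 = - u$i$3$4 \<and> u$i$4$6 = u$i$3$5 \<and> u$i$4$5 = - u$i$3$6"
    "\<And>i j. i \<in> {0,1,2} \<Longrightarrow> j \<in> {0,1,2} \<Longrightarrow> u$i$3$4 * u$j$3$4 + u$i$3$5 * u$j$3$5 + u$i$3$6 * u$j$3$6 = (if i = j then 1 else 0)"
    using adapted_components[OF alt] by blast+
  define p0 where "p0 = u$0$3$4"
  define p1 where "p1 = u$1$3$4"
  define p2 where "p2 = u$2$3$4"
  define q0 where "q0 = u$0$3$5"
  define q1 where "q1 = u$1$3$5"
  define q2 where "q2 = u$2$3$5"
  define r0 where "r0 = u$0$3$6"
  define r1 where "r1 = u$1$3$6"
  define r2 where "r2 = u$2$3$6"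
  have c: "u$0$1$2 = 1" "u$3$4$5 = 0" "u$3$4$6 = 0" "u$3$5$6 = 0" "u$4$5$6 = 0"
    "u$0$3$4 = p0" "u$0$3$5 = q0" "u$0$3$6 = r0" "u$0$5$6 = - p0" "u$0$4$6 = q0" "u$0$4$5 = - r0"
    "u$1$3$4 = p1" "u$1$3$5 = q1" "u$1$3$6 = r1" "u$1$5$6 = - p1" "u$1$4$6 = q1" "u$1$4$5 = - r1"
    "u$2$3$4 = p2" "u$2$3$5 = q2" "u$2$3$6 = r2" "u$2$5$6 = - p2" "u$2$4$6 = q2" "u$2$4$5 = - r2"
    "u$0$1$3 = 0" "u$0$1$4 = 0" "u$0$1$5 = 0" "u$0$1$6 = 0"
    "u$0$2$3 = 0" "u$0$2$4 = 0" "u$0$2$5 = 0" "u$0$2$6 = 0"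
    "u$1$2$3 = 0" "u$1$2$4 = 0" "u$1$2$5 = 0" "u$1$2$6 = 0"
    using comp(6)[of 0] comp(6)[of 1] comp(6)[of 2]
    by (simp_all add: comp(1-5) p0_def p1_def p2_def q0_def q1_def q2_def r0_def r1_def r2_def z)
  have ro: "p0 * p0 + q0 * q0 + r0 * r0 = 1" "p0 * p1 + q0 * q1 + r0 * r1 = 0" "p0 * p2 + q0 * q2 + r0 * r2 = 0" "p1 * p0 + q1 * q0 + r1 * r0 = 0" "p1 * p1 + q1 * q1 + r1 * r1 = 1" "p1 * p2 + q1 * q2 + r1 * r2 = 0" "p2 * p0 + q2 * q0 + r2 * r0 = 0" "p2 * p1 + q2 * q1 + r2 * r1 = 0" "p2 * p2 + q2 * q2 + r2 * r2 = 1"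
    using comp(7)[of 0 0] comp(7)[of 0 1] comp(7)[of 0 2] comp(7)[of 1 0] comp(7)[of 1 1] comp(7)[of 1 2] comp(7)[of 2 0] comp(7)[of 2 1] comp(7)[of 2 2] by (simp_all add: c)
  \<comment> \<open>The rows are the coefficient vectors of the three 2-forms. Their orthonormality
    makes \<open>F\<close> orthogonal, and the relations \<open>co\<close> among its columns are
    what evaluates the new components.\<close>
  define F :: tens2 where "F = (\<chi> i j. if i = 0 then tup p0 q0 r0 0 0 0 0 j else if i = 1 then tup p1 q1 r1 0 0 0 0 j
    else if i = 2 then tup p2 q2 r2 0 0 0 0 j else if i = j then 1 else 0)"
  have "F ** transpose F = mat 1"
    unfolding vec_eq_iff forall_7 matrix_matrix_mult_def transpose_def F_def mat_def by (simp add: sum_7 ro)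
  then have F: "transpose F ** F = mat 1" by (simp add: matrix_left_right_inverse)
  have co: "p0 * p0 + p1 * p1 + p2 * p2 = 1" "p0 * q0 + p1 * q1 + p2 * q2 = 0" "p0 * r0 + p1 * r1 + p2 * r2 = 0" "q0 * p0 + q1 * p1 + q2 * p2 = 0" "q0 * q0 + q1 * q1 + q2 * q2 = 1" "q0 * r0 + q1 * r1 + q2 * r2 = 0" "r0 * p0 + r1 * p1 + r2 * p2 = 0" "r0 * q0 + r1 * q1 + r2 * q2 = 0" "r0 * r0 + r1 * r1 + r2 * r2 = 1"
    using arg_cong[OF F, of "\<lambda>M. M$0$0"] arg_cong[OF F, of "\<lambda>M. M$0$1"] arg_cong[OF F, of "\<lambda>M. M$0$2"] arg_cong[OF F, of "\<lambda>M. M$1$0"] arg_cong[OF F, of "\<lambda>M. M$1$1"] arg_cong[OF F, of "\<lambda>M. M$1$2"] arg_cong[OF F, of "\<lambda>M. M$2$0"] arg_cong[OF F, of "\<lambda>M. M$2$1"] arg_cong[OF F, of "\<lambda>M. M$2$2"]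
    by (simp_all add: matrix_matrix_mult_def transpose_def F_def mat_def sum_7)
  define y where "y = pull3 F u"
  have alty: "alternating y" using alt by (simp add: y_def alternating_pull3)
  note vals = c alternating_repeat[OF alt] alternating_sort[OF alt]
  define d where "d = y$0$1$2"
  have yc: "y$0$1$2 = d"
    "y$0$1$3 = 0"
    "y$0$1$4 = 0"
    "y$0$1$5 = 0"
    "y$0$1$6 = 0"
    "y$0$2$3 = 0"
    "y$0$2$4 = 0"
    "y$0$2$5 = 0"
    "y$0$2$6 = 0"
    "y$0$3$4 = 1"
    "y$0$3$5 = 0"
    "y$0$3$6 = 0"
    "y$0$4$5 = 0"
    "y$0$4$6 = 0"
    "y$0$5$6 = -1"
    "y$1$2$3 = 0"
    "y$1$2$4 = 0"
    "y$1$2$5 = 0"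
    "y$1$2$6 = 0"
    "y$1$3$4 = 0"
    "y$1$3$5 = 1"
    "y$1$3$6 = 0"
    "y$1$4$5 = 0"
    "y$1$4$6 = 1"
    "y$1$5$6 = 0"
    "y$2$3$4 = 0"
    "y$2$3$5 = 0"
    "y$2$3$6 = 1"
    "y$2$4$5 = -1"
    "y$2$4$6 = 0"
    "y$2$5$6 = 0"
    "y$3$4$5 = 0"
    "y$3$4$6 = 0"
    "y$3$5$6 = 0"
    "y$4$5$6 = 0"
  proof -
    show "y$0$1$2 = d" by (simp add: d_def)
    note ev = y_def pull3_nth sum_7 F_def vals
    show "y$0$1$3 = 0"
      by (simp add: ev)
    show "y$0$1$4 = 0"
      by (simp add: ev)
    show "y$0$1$5 = 0"
      by (simp add: ev)
    show "y$0$1$6 = 0"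
      by (simp add: ev)
    show "y$0$2$3 = 0"
      by (simp add: ev)
    show "y$0$2$4 = 0"
      by (simp add: ev)
    show "y$0$2$5 = 0"
      by (simp add: ev)
    show "y$0$2$6 = 0"
      by (simp add: ev)
    show "y$0$3$4 = 1"
      using co(1) by (simp add: ev algebra_simps)
    show "y$0$3$5 = 0"
      using co(2) by (simp add: ev algebra_simps)
    show "y$0$3$6 = 0"
      using co(3) by (simp add: ev algebra_simps)
    show "y$0$4$5 = 0"
      using co(3) by (simp add: ev algebra_simps)
    show "y$0$4$6 = 0"
      using co(2) by (simp add: ev algebra_simps)
    show "y$0$5$6 = -1"
      using co(1) by (simp add: ev algebra_simps)
    show "y$1$2$3 = 0"
      by (simp add: ev)
    show "y$1$2$4 = 0"
      by (simp add: ev)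
    show "y$1$2$5 = 0"
      by (simp add: ev)
    show "y$1$2$6 = 0"
      by (simp add: ev)
    show "y$1$3$4 = 0"
      using co(4) by (simp add: ev algebra_simps)
    show "y$1$3$5 = 1"
      using co(5) by (simp add: ev algebra_simps)
    show "y$1$3$6 = 0"
      using co(6) by (simp add: ev algebra_simps)
    show "y$1$4$5 = 0"
      using co(6) by (simp add: ev algebra_simps)
    show "y$1$4$6 = 1"
      using co(5) by (simp add: ev algebra_simps)
    show "y$1$5$6 = 0"
      using co(4) by (simp add: ev algebra_simps)
    show "y$2$3$4 = 0"
      using co(7) by (simp add: ev algebra_simps)
    show "y$2$3$5 = 0"
      using co(8) by (simp add: ev algebra_simps)
    show "y$2$3$6 = 1"
      using co(9) by (simp add: ev algebra_simps)
    show "y$2$4$5 = -1"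
      using co(9) by (simp add: ev algebra_simps)
    show "y$2$4$6 = 0"
      using co(8) by (simp add: ev algebra_simps)
    show "y$2$5$6 = 0"
      using co(7) by (simp add: ev algebra_simps)
    show "y$3$4$5 = 0"
      by (simp add: ev)
    show "y$3$4$6 = 0"
      by (simp add: ev)
    show "y$3$5$6 = 0"
      by (simp add: ev)
    show "y$4$5$6 = 0"
      by (simp add: ev)
  qed
  note yv = yc alternating_repeat[OF alty] alternating_sort[OF alty]
  have iy: "induces y (mat 1) (det F)"
    using induces_pull3[OF iu det_orthogonal7(2)[OF F]] by (simp add: y_def F)
  \<comment> \<open>Both entries equal - 6 \<open>det F\<close>. The second one excludes a
    reflection, and then the first one gives d = 1.\<close>
  have "hook_wedge y $0$0 = - 6 * d"
    unfolding hook_wedge_expand[OF alty] by (simp add: yv) (simp add: wedge_row_def star_sort star_values[OF alty] yv)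
  moreover have "hook_wedge y $3$3 = - 6"
    unfolding hook_wedge_expand[OF alty] by (simp add: yv) (simp add: wedge_row_def star_sort star_values[OF alty] yv)
  ultimately have dF: "det F = 1" and d: "d = 1"
    using iy by (auto simp: induces_def mat_def)
  have "y = phi0"
  proof (rule alternating_eqI[OF alty alternating_phi0])
    fix i j k assume "rank7 i < rank7 j" "rank7 j < rank7 k"
    then show "y$i$j$k = phi0$i$j$k"
      using exhaust_7[of i] exhaust_7[of j] exhaust_7[of k]
      by (elim disjE) (simp_all add: yc phi0_values d)
  qed
  then have "pull3 (E1 ** F) w = phi0" by (simp add: y_def u_def pull3_pull3)
  moreover have "transpose (E1 ** F) ** g ** (E1 ** F) = mat 1"
  proof -
    have "transpose (E1 ** F) ** g ** (E1 ** F) = transpose F ** (transpose E1 ** g ** E1) ** F"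
      by (simp add: matrix_transpose_mul matrix_mul_assoc)
    then show ?thesis by (simp add: E1 F)
  qed
  moreover have "det (E1 ** F) * v = 1" using E1(3) by (simp add: det_mul dF)
  moreover have "det (E1 ** F) \<noteq> 0" using E1(1) by (simp add: det_mul dF)
  ultimately show ?thesis using that by blast
qed

section \<open>Contraction identities\<close>

text \<open>The infinitesimal action of matrices on 3-tensors. It is \<open>diamond\<close> with the
  index of the matrix already raised, hence independent of any metric.\<close>

definition act :: "tens2 \<Rightarrow> tens3 \<Rightarrow> tens3" where
  "act M w = (\<chi> i j k. \<Sum>p\<in>UNIV. M$i$p * w$p$j$k + M$j$p * w$i$p$k + M$k$p * w$i$j$p)"

lemma act_nth: "act M w $i$j$k = (\<Sum>p\<in>UNIV. M$i$p * w$p$j$k + M$j$p * w$i$p$k + M$k$p * w$i$j$p)"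
  by (simp add: act_def)

lemma diamond_act: "diamond g B w = act (B ** matrix_inv g) w"
  by (simp add: diamond_def act_def Let_def)

lemma act_add: "act (M + N) w = act M w + act N w"
  by (simp add: vec_eq_iff act_nth sum.distrib[symmetric] algebra_simps)

lemma act_scaleR: "act (c *\<^sub>R M) w = c *\<^sub>R act M w"
  by (simp add: vec_eq_iff act_nth sum_distrib_left algebra_simps)

lemma alternating_act:
  assumes "alternating w" shows "alternating (act M w)"
proof -
  note sw = alternating_swap[OF assms]
  have "act M w $i$j$k = - act M w $j$i$k" for i j k
    unfolding act_nth sum_negf[symmetric]
    by (intro sum.cong refl) (simp add: sw(1)[of i _ k] sw(1)[of _ j k] sw(1)[of i j])
  moreover have "act M w $i$j$k = - act M w $i$k$j" for i j k
    unfolding act_nth sum_negf[symmetric]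
    by (intro sum.cong refl) (simp add: sw(2)[of i j] sw(2)[of i _ k] sw(2)[of _ j k])
  ultimately show ?thesis unfolding alternating_def by blast
qed

text \<open>A finite check. Skewness of both sides in (i, j) and in (a, b) reduces it to 21 times 21
  index choices, each evaluated by the tables.\<close>

lemma phi0_phi0:
  "(\<Sum>k\<in>UNIV. phi0$i$j$k * phi0$a$b$k)
    = (if i = a \<and> j = b then 1 else 0) - (if i = b \<and> j = a then 1 else 0) - star phi0 i j a b"
proof -
  note v = phi0_values alternating_sort[OF alternating_phi0] alternating_repeat[OF alternating_phi0]
  note s = star_sort star_values[OF alternating_phi0]
  note sw = alternating_swap[OF alternating_phi0]
  have inj: "rank7 a = rank7 b \<Longrightarrow> a = b" for a b
    using exhaust_7[of a] exhaust_7[of b] by (elim disjE) simp_all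
  define P where "P i j a b \<longleftrightarrow> (\<Sum>k\<in>UNIV. phi0$i$j$k * phi0$a$b$k)
    = (if i = a \<and> j = b then 1 else 0) - (if i = b \<and> j = a then 1 else 0) - star phi0 i j a b" for i j a b
  have all7: "Q a b" if "Q 0 1" "Q 0 2" "Q 0 3" "Q 0 4" "Q 0 5" "Q 0 6" "Q 1 2" "Q 1 3" "Q 1 4" "Q 1 5" "Q 1 6"
    "Q 2 3" "Q 2 4" "Q 2 5" "Q 2 6" "Q 3 4" "Q 3 5" "Q 3 6" "Q 4 5" "Q 4 6" "Q 5 6" "rank7 a < rank7 b" for Q and a b :: 7
    using exhaust_7[of a] exhaust_7[of b] that by (elim disjE) simp_all
  have base: "P i j a b" if ij: "rank7 i < rank7 j" and ab: "rank7 a < rank7 b" for i j a b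
  proof (rule all7[OF _ _ _ _ _ _ _ _ _ _ _ _ _ _ _ _ _ _ _ _ _ ij])
    show "P 0 1 a b" unfolding P_def by (rule all7[OF _ _ _ _ _ _ _ _ _ _ _ _ _ _ _ _ _ _ _ _ _ ab]) (simp_all add: sum_7 v s)
    show "P 0 2 a b" unfolding P_def by (rule all7[OF _ _ _ _ _ _ _ _ _ _ _ _ _ _ _ _ _ _ _ _ _ ab]) (simp_all add: sum_7 v s)
    show "P 0 3 a b" unfolding P_def by (rule all7[OF _ _ _ _ _ _ _ _ _ _ _ _ _ _ _ _ _ _ _ _ _ ab]) (simp_all add: sum_7 v s)
    show "P 0 4 a b" unfolding P_def by (rule all7[OF _ _ _ _ _ _ _ _ _ _ _ _ _ _ _ _ _ _ _ _ _ ab]) (simp_all add: sum_7 v s)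
    show "P 0 5 a b" unfolding P_def by (rule all7[OF _ _ _ _ _ _ _ _ _ _ _ _ _ _ _ _ _ _ _ _ _ ab]) (simp_all add: sum_7 v s)
    show "P 0 6 a b" unfolding P_def by (rule all7[OF _ _ _ _ _ _ _ _ _ _ _ _ _ _ _ _ _ _ _ _ _ ab]) (simp_all add: sum_7 v s)
    show "P 1 2 a b" unfolding P_def by (rule all7[OF _ _ _ _ _ _ _ _ _ _ _ _ _ _ _ _ _ _ _ _ _ ab]) (simp_all add: sum_7 v s)
    show "P 1 3 a b" unfolding P_def by (rule all7[OF _ _ _ _ _ _ _ _ _ _ _ _ _ _ _ _ _ _ _ _ _ ab]) (simp_all add: sum_7 v s)
    show "P 1 4 a b" unfolding P_def by (rule all7[OF _ _ _ _ _ _ _ _ _ _ _ _ _ _ _ _ _ _ _ _ _ ab]) (simp_all add: sum_7 v s)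
    show "P 1 5 a b" unfolding P_def by (rule all7[OF _ _ _ _ _ _ _ _ _ _ _ _ _ _ _ _ _ _ _ _ _ ab]) (simp_all add: sum_7 v s)
    show "P 1 6 a b" unfolding P_def by (rule all7[OF _ _ _ _ _ _ _ _ _ _ _ _ _ _ _ _ _ _ _ _ _ ab]) (simp_all add: sum_7 v s)
    show "P 2 3 a b" unfolding P_def by (rule all7[OF _ _ _ _ _ _ _ _ _ _ _ _ _ _ _ _ _ _ _ _ _ ab]) (simp_all add: sum_7 v s)
    show "P 2 4 a b" unfolding P_def by (rule all7[OF _ _ _ _ _ _ _ _ _ _ _ _ _ _ _ _ _ _ _ _ _ ab]) (simp_all add: sum_7 v s)
    show "P 2 5 a b" unfolding P_def by (rule all7[OF _ _ _ _ _ _ _ _ _ _ _ _ _ _ _ _ _ _ _ _ _ ab]) (simp_all add: sum_7 v s)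
    show "P 2 6 a b" unfolding P_def by (rule all7[OF _ _ _ _ _ _ _ _ _ _ _ _ _ _ _ _ _ _ _ _ _ ab]) (simp_all add: sum_7 v s)
    show "P 3 4 a b" unfolding P_def by (rule all7[OF _ _ _ _ _ _ _ _ _ _ _ _ _ _ _ _ _ _ _ _ _ ab]) (simp_all add: sum_7 v s)
    show "P 3 5 a b" unfolding P_def by (rule all7[OF _ _ _ _ _ _ _ _ _ _ _ _ _ _ _ _ _ _ _ _ _ ab]) (simp_all add: sum_7 v s)
    show "P 3 6 a b" unfolding P_def by (rule all7[OF _ _ _ _ _ _ _ _ _ _ _ _ _ _ _ _ _ _ _ _ _ ab]) (simp_all add: sum_7 v s)
    show "P 4 5 a b" unfolding P_def by (rule all7[OF _ _ _ _ _ _ _ _ _ _ _ _ _ _ _ _ _ _ _ _ _ ab]) (simp_all add: sum_7 v s)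
    show "P 4 6 a b" unfolding P_def by (rule all7[OF _ _ _ _ _ _ _ _ _ _ _ _ _ _ _ _ _ _ _ _ _ ab]) (simp_all add: sum_7 v s)
    show "P 5 6 a b" unfolding P_def by (rule all7[OF _ _ _ _ _ _ _ _ _ _ _ _ _ _ _ _ _ _ _ _ _ ab]) (simp_all add: sum_7 v s)
  qed
  have s1: "P j i a b" if "P i j a b" for i j a b
  proof -
    have "(\<Sum>k\<in>UNIV. phi0$j$i$k * phi0$a$b$k) = - (\<Sum>k\<in>UNIV. phi0$i$j$k * phi0$a$b$k)"
      by (simp only: sw(1)[of j i] mult_minus_left sum_negf)
    then show ?thesis using that star_swap(1)[of phi0 j i a b]
      unfolding P_def conj_commute[of "j = a"] conj_commute[of "j = b"] by linarith
  qed
  have s2: "P i j b a" if "P i j a b" for i j a b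
  proof -
    have "(\<Sum>k\<in>UNIV. phi0$i$j$k * phi0$b$a$k) = - (\<Sum>k\<in>UNIV. phi0$i$j$k * phi0$a$b$k)"
      by (simp only: sw(1)[of b a] mult_minus_right sum_negf)
    then show ?thesis using that star_swap(3)[of phi0 i j b a]
      unfolding P_def by linarith
  qed
  have r: "P i i a b" "P i j a a" for i j a b
    unfolding P_def by (simp_all add: v)
  have "P i j a b"
    using base[of i j a b] base[of j i a b] base[of i j b a] base[of j i b a] s1 s2 r inj[of i j] inj[of a b]
    by (metis linorder_neqE_nat)
  then show ?thesis by (simp add: P_def)
qed

lemma act_phi0_surj:
  assumes u: "alternating u"
  obtains M where "act M phi0 = u"
proof -
  \<comment> \<open>\<open>U i j\<close> contracts row i of \<open>u\<close> with row j of
    \<open>phi0\<close> over unordered pairs.\<close>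
  define U where "U i = tup (u$i$1$2 + u$i$3$4 - u$i$5$6) (u$i$3$5 + u$i$4$6 - u$i$0$2) (u$i$0$1 + u$i$3$6 - u$i$4$5)
     (- u$i$0$4 - u$i$1$5 - u$i$2$6) (u$i$0$3 - u$i$1$6 + u$i$2$5) (u$i$0$6 + u$i$1$3 - u$i$2$4)
     (- u$i$0$5 + u$i$1$4 + u$i$2$3)" for i
  define t where "t = U 0 0 + U 1 1 + U 2 2 + U 3 3 + U 4 4 + U 5 5 + U 6 6"
  \<comment> \<open>The contraction of \<open>act N phi0\<close> has eigenvalue 9 on multiples of
    the identity, 2 on traceless symmetric matrices and 6 on the 7-dimensional skew component. The
    coefficients invert these: 1/3 + 1/6 = 1/2, 1/3 - 1/6 = 1/6 and 1/2 - 7/18 = 1/9.\<close>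
  define M :: tens2 where "M = (\<chi> i j. U i j / 3 + U j i / 6 - (if i = j then t / 18 else 0))"
  note v = phi0_values alternating_sort[OF alternating_phi0] alternating_repeat[OF alternating_phi0]
  note w = alternating_sort[OF u] alternating_repeat[OF u]
  have c: "act M phi0 $0$1$2 = u$0$1$2" "act M phi0 $0$1$3 = u$0$1$3" "act M phi0 $0$1$4 = u$0$1$4" "act M phi0 $0$1$5 = u$0$1$5" "act M phi0 $0$1$6 = u$0$1$6"
    "act M phi0 $0$2$3 = u$0$2$3" "act M phi0 $0$2$4 = u$0$2$4" "act M phi0 $0$2$5 = u$0$2$5" "act M phi0 $0$2$6 = u$0$2$6" "act M phi0 $0$3$4 = u$0$3$4"
    "act M phi0 $0$3$5 = u$0$3$5" "act M phi0 $0$3$6 = u$0$3$6" "act M phi0 $0$4$5 = u$0$4$5" "act M phi0 $0$4$6 = u$0$4$6" "act M phi0 $0$5$6 = u$0$5$6"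
    "act M phi0 $1$2$3 = u$1$2$3" "act M phi0 $1$2$4 = u$1$2$4" "act M phi0 $1$2$5 = u$1$2$5" "act M phi0 $1$2$6 = u$1$2$6" "act M phi0 $1$3$4 = u$1$3$4"
    "act M phi0 $1$3$5 = u$1$3$5" "act M phi0 $1$3$6 = u$1$3$6" "act M phi0 $1$4$5 = u$1$4$5" "act M phi0 $1$4$6 = u$1$4$6" "act M phi0 $1$5$6 = u$1$5$6"
    "act M phi0 $2$3$4 = u$2$3$4" "act M phi0 $2$3$5 = u$2$3$5" "act M phi0 $2$3$6 = u$2$3$6" "act M phi0 $2$4$5 = u$2$4$5" "act M phi0 $2$4$6 = u$2$4$6"
    "act M phi0 $2$5$6 = u$2$5$6" "act M phi0 $3$4$5 = u$3$4$5" "act M phi0 $3$4$6 = u$3$4$6" "act M phi0 $3$5$6 = u$3$5$6" "act M phi0 $4$5$6 = u$4$5$6"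
    by (simp_all add: act_nth sum_7 v) (simp_all add: M_def t_def U_def w field_simps)
  have "act M phi0 = u"
  proof (rule alternating_eqI[OF alternating_act[OF alternating_phi0] u])
    fix i j k assume "rank7 i < rank7 j" "rank7 j < rank7 k"
    then show "act M phi0 $i$j$k = u$i$j$k"
      using exhaust_7[of i] exhaust_7[of j] exhaust_7[of k]
      by (elim disjE) (simp_all add: c)
  qed
  then show ?thesis by (rule that)
qed

section \<open>The Hodge dual of a G2-form in an adapted coframe\<close>

lemma sum_perms_fixed4:
  "(\<Sum>p | p permutes (UNIV :: 7 set) \<and> p 3 = a \<and> p 4 = b \<and> p 5 = c \<and> p 6 = d. of_int (sign p) * H (p 0) (p 1) (p 2))
    = (\<Sum>x\<in>UNIV. \<Sum>y\<in>UNIV. \<Sum>z\<in>UNIV. eps7 (tup x y z a b c d) * H x y z)" for H :: "7 \<Rightarrow> 7 \<Rightarrow> 7 \<Rightarrow> real"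
proof -
  have "(\<Sum>p | p permutes (UNIV :: 7 set) \<and> p 3 = a \<and> p 4 = b \<and> p 5 = c \<and> p 6 = d. of_int (sign p) * H (p 0) (p 1) (p 2))
    = (\<Sum>p\<in>UNIV. eps7 p * (if p 6 = d then if p 5 = c then if p 4 = b then if p 3 = a then H (p 0) (p 1) (p 2) else 0 else 0 else 0 else 0))"
    unfolding eps7_def by (rule sum.mono_neutral_cong_left) auto
  also have "\<dots> = (\<Sum>x\<in>UNIV. \<Sum>y\<in>UNIV. \<Sum>z\<in>UNIV. eps7 (tup x y z a b c d) * H x y z)"
    unfolding sum_fun7 tup_simps by (simp add: if_distrib[of "\<lambda>x. _ * x"] cong: if_cong)
  finally show ?thesis .
qed

lemma hodge_star3_eq_star:
  assumes "transpose gi = gi" "matrix_inv g = gi"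
  shows "hodge_star3 g v w $a$b$c$d = v * star (pull3 gi w) a b c d"
proof -
  have gs: "gi$i$j = gi$j$i" for i j
    using arg_cong[OF assms(1), of "\<lambda>M. M$i$j"] by (simp add: transpose_def)
  have R: "(\<Sum>i\<in>UNIV. \<Sum>j\<in>UNIV. \<Sum>k\<in>UNIV. gi$x$i * gi$y$j * gi$z$k * w$i$j$k) = pull3 gi w $x$y$z" for x y z
    unfolding pull3_nth gs[of x] gs[of y] gs[of z] by (simp add: mult_ac)
  have "hodge_star3 g v w $a$b$c$d = v * (\<Sum>p | p permutes (UNIV :: 7 set) \<and> p 3 = a \<and> p 4 = b \<and> p 5 = c \<and> p 6 = d.
      of_int (sign p) * pull3 gi w $(p 0)$(p 1)$(p 2)) / 6"
    unfolding hodge_star3_def assms(2) R by (simp add: sum_distrib_left mult_ac)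
  then show ?thesis unfolding sum_perms_fixed4[where H="\<lambda>x y z. pull3 gi w $x$y$z"] star_def by simp
qed

lemma matrix_inv_inverse:
  "invertible A \<Longrightarrow> A ** matrix_inv A = mat 1" "invertible A \<Longrightarrow> matrix_inv A ** A = mat 1"
  unfolding invertible_def matrix_inv_def
  by (drule someI_ex, simp)+

lemma matrix_inv_unique:
  assumes "A ** B = mat 1" shows "matrix_inv A = (B :: real^'n^'n)"
proof -
  have "B ** A = mat 1" using assms by (simp add: matrix_left_right_inverse)
  then have "invertible A" using assms by (auto simp: invertible_def)
  then have "A ** matrix_inv A = mat 1" by (simp add: matrix_inv_inverse)
  then have "B ** (A ** matrix_inv A) = B" by simp
  then show ?thesis using \<open>B ** A = mat 1\<close> by (simp add: matrix_mul_assoc)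
qed

text \<open>\<open>T\<close> is the inverse of the adapted frame. Form, metric and Hodge dual are
  thus all transported from the model by \<open>T\<close>, which reduces statements about an
  arbitrary G2-form to finite checks on \<open>phi0\<close>.\<close>

lemma G2_coframe:
  assumes w: "alternating w" and nd: "nondegenerate w"
  obtains E T where "E ** T = mat 1" "T ** E = mat 1" "w = pull3 T phi0"
    "metric_of w = transpose T ** T" "matrix_inv (metric_of w) = E ** transpose E"
    "psi_of w = (\<chi> a b c d. \<Sum>i\<in>UNIV. \<Sum>j\<in>UNIV. \<Sum>k\<in>UNIV. \<Sum>l\<in>UNIV.
        star phi0 i j k l * (T$i$a * T$j$b * T$k$c * T$l$d))"
proof -
  let ?g = "metric_of w" and ?v = "vol_of w"
  have ind: "induces w ?g ?v" using nd by (rule nondegenerate_induces)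
  obtain E where E: "det E \<noteq> 0" "pull3 E w = phi0" "transpose E ** ?g ** E = mat 1" "det E * ?v = 1"
    using G2_frame[OF w ind] by blast
  define T where "T = matrix_inv E"
  have ET: "E ** T = mat 1" "T ** E = mat 1"
    using E(1) by (simp_all add: T_def invertible_det_nz matrix_inv_inverse)
  have wT: "w = pull3 T phi0" using E(2) ET by (metis pull3_id pull3_pull3)
  have tET: "transpose T ** transpose E = mat 1" "transpose E ** transpose T = mat 1"
    using ET by (simp_all flip: matrix_transpose_mul)
  have "transpose T ** (transpose E ** ?g ** E) ** T = (transpose T ** transpose E) ** ?g ** (E ** T)"
    by (simp add: matrix_mul_assoc)
  then have g: "?g = transpose T ** T" using E(3) by (simp add: tET ET)
  have "?g ** (E ** transpose E) = transpose T ** (T ** E) ** transpose E"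
    by (simp add: g matrix_mul_assoc)
  then have gi: "matrix_inv ?g = E ** transpose E" by (intro matrix_inv_unique) (simp add: ET tET)
  have "pull3 (E ** transpose E) w = pull3 (T ** (E ** transpose E)) phi0"
    by (subst wT) (simp add: pull3_pull3)
  also have "T ** (E ** transpose E) = transpose E" by (simp add: matrix_mul_assoc ET)
  finally have R: "pull3 (E ** transpose E) w = pull3 (transpose E) phi0" .
  have v: "?v = det T"
  proof -
    have "det E * det T = 1" using arg_cong[OF ET(1), of det] by (simp add: det_mul)
    then show ?thesis using E(1,4) by (metis mult_left_cancel)
  qed
  have "psi_of w $a$b$c$d = det T * star (pull3 (transpose E) phi0) a b c d" for a b c d
    unfolding psi_of_def by (subst hodge_star3_eq_star[OF _ gi]) (simp_all add: matrix_transpose_mul R v)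
  then show ?thesis
    using that[OF ET wT g gi] star_pull3_transpose[OF ET(2)] by (simp add: vec_eq_iff)
qed

section \<open>Contraction calculus without frames\<close>

lemma sum_rotate2:
  fixes F :: "'a \<Rightarrow> 'b \<Rightarrow> 'c \<Rightarrow> real"
  shows "(\<Sum>a\<in>A. \<Sum>b\<in>B. \<Sum>c\<in>C. F a b c) = (\<Sum>b\<in>B. \<Sum>c\<in>C. \<Sum>a\<in>A. F a b c)"
proof -
  have "(\<Sum>a\<in>A. \<Sum>b\<in>B. \<Sum>c\<in>C. F a b c) = (\<Sum>b\<in>B. \<Sum>a\<in>A. \<Sum>c\<in>C. F a b c)" by (rule sum.swap)
  also have "\<dots> = (\<Sum>b\<in>B. \<Sum>c\<in>C. \<Sum>a\<in>A. F a b c)" by (intro sum.cong refl sum.swap)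
  finally show ?thesis .
qed

lemma sum_antisym_eq_0:
  fixes f :: "'a \<Rightarrow> 'a \<Rightarrow> real"
  assumes "\<And>i j. f j i = - f i j"
  shows "(\<Sum>i\<in>A. \<Sum>j\<in>A. f i j) = 0"
proof -
  have "(\<Sum>i\<in>A. \<Sum>j\<in>A. f i j) = (\<Sum>j\<in>A. \<Sum>i\<in>A. f i j)" by (rule sum.swap)
  also have "\<dots> = - (\<Sum>i\<in>A. \<Sum>j\<in>A. f i j)" by (subst assms) (simp add: sum_negf)
  finally show ?thesis by simp
qed

text \<open>Besides symmetries and the inverse metric, only the quadratic contraction of \<phi> with
  itself is assumed. The contraction with \<psi> and the cross product identities are consequences
  of it, in arbitrary coordinates.\<close>

locale G2_tensors =
  fixes \<phi> :: tens3 and g gi :: tens2 and \<psi> :: tens4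
  assumes alt: "alternating \<phi>"
    and g_sym: "g$i$j = g$j$i" and gi_sym: "gi$i$j = gi$j$i"
    and gi_g: "(\<Sum>k\<in>UNIV. gi$i$k * g$k$j) = (if i = j then 1 else 0)"
    and psi_swap: "\<psi>$b$a$c$d = - \<psi>$a$b$c$d" "\<psi>$a$c$b$d = - \<psi>$a$b$c$d" "\<psi>$a$b$d$c = - \<psi>$a$b$c$d"
    and phi_phi: "(\<Sum>k\<in>UNIV. \<Sum>l\<in>UNIV. gi$k$l * (\<phi>$i$j$k * \<phi>$a$b$l)) = g$i$a * g$j$b - g$i$b * g$j$a - \<psi>$i$j$a$b"
begin

lemmas phi_swap = alternating_swap[OF alt]

definition cross :: "7 \<Rightarrow> 7 \<Rightarrow> 7 \<Rightarrow> real" where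
  "cross i j k = (\<Sum>l\<in>UNIV. gi$k$l * \<phi>$i$j$l)"

lemma cross_phi: "(\<Sum>k\<in>UNIV. cross i j k * \<phi>$a$b$k) = g$i$a * g$j$b - g$i$b * g$j$a - \<psi>$i$j$a$b"
proof -
  have "(\<Sum>k\<in>UNIV. cross i j k * \<phi>$a$b$k) = (\<Sum>k\<in>UNIV. \<Sum>l\<in>UNIV. gi$l$k * (\<phi>$i$j$l * \<phi>$a$b$k))"
    unfolding cross_def sum_distrib_right by (intro sum.cong refl) (simp add: gi_sym[of _ "_"])
  also have "\<dots> = (\<Sum>l\<in>UNIV. \<Sum>k\<in>UNIV. gi$l$k * (\<phi>$i$j$l * \<phi>$a$b$k))" by (rule sum.swap)
  finally show ?thesis unfolding phi_phi .
qed

lemma cross_g: "(\<Sum>k\<in>UNIV. cross i j k * g$k$l) = \<phi>$i$j$l"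
proof -
  have "(\<Sum>k\<in>UNIV. cross i j k * g$k$l) = (\<Sum>m\<in>UNIV. \<phi>$i$j$m * (\<Sum>k\<in>UNIV. gi$m$k * g$k$l))"
    unfolding cross_def sum_distrib_right sum_distrib_left
    by (subst sum.swap) (intro sum.cong refl, simp add: gi_sym mult_ac)
  also have "\<dots> = (\<Sum>m\<in>UNIV. if m = l then \<phi>$i$j$m else 0)"
    by (intro sum.cong refl) (simp add: gi_g)
  finally show ?thesis by simp
qed

lemma psi_pairs: "\<psi>$n$i$j$k = \<psi>$j$k$n$i"
  using psi_swap(3)[of n i k j] psi_swap(2)[of n j i k] psi_swap(1)[of j n i k] psi_swap(3)[of j n k i] psi_swap(2)[of j k n i]
  by simp

lemma psi_move: "\<psi>$a$b$i$s = - \<psi>$s$a$b$i"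
  using psi_swap(3)[of a b i s] psi_swap(2)[of a b s i] psi_swap(1)[of a s b i] by simp

definition cross_psi :: "7 \<Rightarrow> 7 \<Rightarrow> 7 \<Rightarrow> 7 \<Rightarrow> 7 \<Rightarrow> real" where
  "cross_psi a b i j k = (\<Sum>m\<in>UNIV. cross a b m * \<psi>$m$i$j$k)"

text \<open>The quadratic identity is used twice: first to replace \<psi> by a product of two
  \<phi>, then, after regrouping, to contract the original \<phi> with the other factor. The
  contraction returns with its indices shifted.\<close>

lemma cross_psi_step:
  "cross_psi a b i j k = \<phi>$a$b$j * g$k$i - \<phi>$a$b$k * g$j$i - \<phi>$j$k$b * g$a$i + \<phi>$j$k$a * g$b$i - cross_psi j k a b i"
proof -
  have psi: "\<psi>$n$i$j$k = g$n$j * g$k$i - g$n$k * g$j$i - (\<Sum>r\<in>UNIV. cross j k r * \<phi>$n$i$r)" for n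
    unfolding cross_phi psi_pairs[of n i j k] by (simp add: g_sym)
  have "cross_psi a b i j k = (\<Sum>n\<in>UNIV. cross a b n * g$n$j) * g$k$i - (\<Sum>n\<in>UNIV. cross a b n * g$n$k) * g$j$i
      - (\<Sum>n\<in>UNIV. \<Sum>r\<in>UNIV. cross j k r * (cross a b n * \<phi>$n$i$r))"
    unfolding cross_psi_def psi by (simp add: algebra_simps sum_subtractf sum.distrib sum_distrib_left)
  also have "(\<Sum>n\<in>UNIV. \<Sum>r\<in>UNIV. cross j k r * (cross a b n * \<phi>$n$i$r)) = (\<Sum>r\<in>UNIV. cross j k r * (\<Sum>n\<in>UNIV. cross a b n * \<phi>$i$r$n))"
    by (subst sum.swap, unfold sum_distrib_left, intro sum.cong refl)
      (use phi_swap in \<open>metis minus_minus\<close>)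
  also have "\<dots> = (\<Sum>r\<in>UNIV. cross j k r * g$r$b) * g$a$i - (\<Sum>r\<in>UNIV. cross j k r * g$r$a) * g$b$i + cross_psi j k a b i"
    unfolding cross_phi cross_psi_def psi_move[of a b i] 
    by (simp add: algebra_simps sum_subtractf sum.distrib sum_distrib_left g_sym[of b] g_sym[of a "_::7"])
  finally show ?thesis unfolding cross_g by (simp add: algebra_simps)
qed

text \<open>\<open>cross_psi_step\<close> permutes the five indices cyclically and changes the sign; after five steps one
  is back at the start with the opposite sign, which determines the contraction.\<close>

lemma cross_psi_eq:
  "cross_psi a b i j k = - (g$a$i * \<phi>$b$j$k + g$a$j * \<phi>$i$b$k + g$a$k * \<phi>$i$j$b
    - g$b$i * \<phi>$a$j$k - g$b$j * \<phi>$i$a$k - g$b$k * \<phi>$i$j$a)"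
proof -
  have cyc: "\<phi>$x$y$z = \<phi>$y$z$x" for x y z using phi_swap by (metis minus_minus)
  have e: "\<phi>$j$k$b = \<phi>$b$j$k" "\<phi>$b$i$k = - \<phi>$i$b$k" "\<phi>$b$i$j = \<phi>$i$j$b" "\<phi>$j$k$a = \<phi>$a$j$k"
    "\<phi>$k$a$j = \<phi>$a$j$k" "\<phi>$k$a$i = - \<phi>$i$a$k" "\<phi>$k$a$b = \<phi>$a$b$k" "\<phi>$b$i$a = \<phi>$a$b$i" "\<phi>$j$k$i = \<phi>$i$j$k"
    using cyc phi_swap(1) by (metis, metis, metis, metis, metis, metis, metis, metis, metis)
  note gs = g_sym[of b a] g_sym[of i a] g_sym[of j a] g_sym[of k a] g_sym[of i b] g_sym[of j b] g_sym[of k b] g_sym[of j i] g_sym[of k i] g_sym[of k j]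
  show ?thesis
    using cross_psi_step[of a b i j k] cross_psi_step[of j k a b i] cross_psi_step[of b i j k a]
      cross_psi_step[of k a b i j] cross_psi_step[of i j k a b]
    unfolding e gs by algebra
qed

definition ip :: "vec7 \<Rightarrow> vec7 \<Rightarrow> real" where
  "ip x y = (\<Sum>i\<in>UNIV. \<Sum>j\<in>UNIV. gi$i$j * x$i * y$j)"

text \<open>The cross product of G2-geometry, on covectors and with covector values.\<close>

definition cl :: "vec7 \<Rightarrow> vec7 \<Rightarrow> vec7" where
  "cl x y = (\<chi> k. \<Sum>i\<in>UNIV. \<Sum>j\<in>UNIV. (gi *v x)$i * (gi *v y)$j * \<phi>$i$j$k)"

lemma gi_g_matrix: "gi ** g = mat 1" "g ** gi = mat 1"
proof -
  show "gi ** g = mat 1" by (simp add: vec_eq_iff matrix_matrix_mult_def gi_g mat_def)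
  then show "g ** gi = mat 1" by (simp add: matrix_left_right_inverse)
qed

lemma transpose_gi: "transpose gi = gi"
  by (simp add: vec_eq_iff transpose_def gi_sym)

lemma lower_raise: "(\<Sum>p\<in>UNIV. (gi *v x)$p * g$p$k) = x$k"
proof -
  have "(\<Sum>p\<in>UNIV. (gi *v x)$p * g$p$k) = (g *v (gi *v x))$k"
    by (simp add: matrix_vector_mult_def[of g] g_sym[of k] mult.commute)
  then show ?thesis by (simp add: matrix_vector_mul_assoc gi_g_matrix)
qed

lemma ip_eq: "ip x y = (\<Sum>j\<in>UNIV. (gi *v x)$j * y$j)"
  unfolding ip_def matrix_vector_mult_def
  by (subst sum.swap) (simp add: sum_distrib_right gi_sym)

lemma ip_sym: "ip x y = ip y x"
  unfolding ip_def by (subst sum.swap) (simp add: gi_sym mult_ac)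

lemma raise_cl: "(gi *v cl x y)$m = (\<Sum>a\<in>UNIV. \<Sum>b\<in>UNIV. (gi *v x)$a * (gi *v y)$b * cross a b m)"
proof -
  have "(gi *v cl x y)$m = (\<Sum>k\<in>UNIV. \<Sum>a\<in>UNIV. \<Sum>b\<in>UNIV. (gi *v x)$a * (gi *v y)$b * (gi$m$k * \<phi>$a$b$k))"
    unfolding cl_def by (subst matrix_vector_mult_def) (simp add: sum_distrib_left mult_ac)
  also have "\<dots> = (\<Sum>a\<in>UNIV. \<Sum>b\<in>UNIV. \<Sum>k\<in>UNIV. (gi *v x)$a * (gi *v y)$b * (gi$m$k * \<phi>$a$b$k))"
    by (rule sum_rotate2)
  finally show ?thesis unfolding cross_def by (simp add: sum_distrib_left)
qed

lemma cl_cl: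
  "cl x (cl y z) $ k = y$k * ip x z - ip x y * z$k
    - (\<Sum>a\<in>UNIV. \<Sum>p\<in>UNIV. \<Sum>q\<in>UNIV. (gi *v x)$a * (gi *v y)$p * (gi *v z)$q * \<psi>$p$q$k$a)"
proof -
  have cyc: "\<phi>$a$b$k = \<phi>$k$a$b" for a b k using phi_swap by (metis minus_minus)
  have "cl x (cl y z) $ k = (\<Sum>a\<in>UNIV. \<Sum>b\<in>UNIV. \<Sum>p\<in>UNIV. \<Sum>q\<in>UNIV.
      (gi *v x)$a * (gi *v y)$p * (gi *v z)$q * (cross p q b * \<phi>$k$a$b))"
    unfolding cl_def[of x] vec_lambda_beta raise_cl cyc[of _ _ k]
    by (simp add: sum_distrib_left sum_distrib_right mult_ac)
  also have "\<dots> = (\<Sum>a\<in>UNIV. \<Sum>p\<in>UNIV. \<Sum>q\<in>UNIV. \<Sum>b\<in>UNIV.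
      (gi *v x)$a * (gi *v y)$p * (gi *v z)$q * (cross p q b * \<phi>$k$a$b))"
  proof (rule sum.cong[OF refl])
    fix a :: 7
    show "(\<Sum>b\<in>UNIV. \<Sum>p\<in>UNIV. \<Sum>q\<in>UNIV. (gi *v x)$a * (gi *v y)$p * (gi *v z)$q * (cross p q b * \<phi>$k$a$b))
      = (\<Sum>p\<in>UNIV. \<Sum>q\<in>UNIV. \<Sum>b\<in>UNIV. (gi *v x)$a * (gi *v y)$p * (gi *v z)$q * (cross p q b * \<phi>$k$a$b))"
      by (rule sum_rotate2)
  qed
  also have "\<dots> = (\<Sum>a\<in>UNIV. \<Sum>p\<in>UNIV. \<Sum>q\<in>UNIV.
      (gi *v x)$a * (gi *v y)$p * (gi *v z)$q * (g$p$k * g$q$a - g$p$a * g$q$k - \<psi>$p$q$k$a))"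
    by (simp add: cross_phi flip: sum_distrib_left)
  also have "\<dots> = (\<Sum>a\<in>UNIV. (gi *v x)$a * ((\<Sum>p\<in>UNIV. (gi *v y)$p * g$p$k) * (\<Sum>q\<in>UNIV. (gi *v z)$q * g$q$a)
        - (\<Sum>p\<in>UNIV. (gi *v y)$p * g$p$a) * (\<Sum>q\<in>UNIV. (gi *v z)$q * g$q$k)))
    - (\<Sum>a\<in>UNIV. \<Sum>p\<in>UNIV. \<Sum>q\<in>UNIV. (gi *v x)$a * (gi *v y)$p * (gi *v z)$q * \<psi>$p$q$k$a)"
    unfolding sum_product by (simp add: sum_distrib_left sum_subtractf right_diff_distrib mult_ac)
  also have "\<dots> = y$k * ip x z - ip x y * z$k
    - (\<Sum>a\<in>UNIV. \<Sum>p\<in>UNIV. \<Sum>q\<in>UNIV. (gi *v x)$a * (gi *v y)$p * (gi *v z)$q * \<psi>$p$q$k$a)"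
    unfolding lower_raise ip_eq by (simp add: right_diff_distrib sum_subtractf sum_distrib_left sum_distrib_right mult_ac)
  finally show ?thesis .
qed

text \<open>The \<psi> term of \<open>cl_cl\<close> is skew in the two slots that both carry
  \<open>x\<close>, so only the metric terms survive.\<close>

lemma cl_cl_same: "cl x (cl x z) = ip x z *\<^sub>R x - ip x x *\<^sub>R z"
proof -
  have "(\<Sum>a\<in>UNIV. \<Sum>p\<in>UNIV. \<Sum>q\<in>UNIV. (gi *v x)$a * (gi *v x)$p * (gi *v z)$q * \<psi>$p$q$k$a) = 0" for k
  proof (rule sum_antisym_eq_0)
    fix i j
    have "\<psi>$i$q$k$j = - \<psi>$j$q$k$i" for q
      using psi_move[of i q k j] psi_swap(1)[of j i q k] psi_swap(2)[of i j q k] psi_swap(3)[of i q j k]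
        psi_swap(2)[of j i q k] psi_swap(3)[of j q i k] by simp
    then show "(\<Sum>q\<in>UNIV. (gi *v x)$j * (gi *v x)$i * (gi *v z)$q * \<psi>$i$q$k$j)
      = - (\<Sum>q\<in>UNIV. (gi *v x)$i * (gi *v x)$j * (gi *v z)$q * \<psi>$j$q$k$i)"
      by (simp add: sum_negf[symmetric] mult.commute)
  qed
  then show ?thesis by (simp add: vec_eq_iff cl_cl)
qed

text \<open>Two-forms in the 14-dimensional component act trivially on \<open>\<phi>\<close>; only the contraction with \<open>\<phi>\<close> survives.\<close>

lemma act_wedge:
  "act ((\<chi> i l. x$i * y$l - y$i * x$l) ** gi) \<phi> = hook4 (- (gi *v cl x y)) \<psi>"
proof -
  let ?X = "\<lambda>i j k a b. g$a$i * \<phi>$b$j$k + g$a$j * \<phi>$i$b$k + g$a$k * \<phi>$i$j$b"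
  have "hook4 (- (gi *v cl x y)) \<psi> $i$j$k = act ((\<chi> i l. x$i * y$l - y$i * x$l) ** gi) \<phi> $i$j$k" for i j k
  proof -
    have "hook4 (- (gi *v cl x y)) \<psi> $i$j$k = - (\<Sum>m\<in>UNIV. \<Sum>a\<in>UNIV. \<Sum>b\<in>UNIV.
        (gi *v x)$a * (gi *v y)$b * (cross a b m * \<psi>$m$i$j$k))"
      unfolding hook4_def by (simp add: raise_cl sum_negf sum_distrib_right sum_distrib_left mult_ac)
    also have "\<dots> = - (\<Sum>a\<in>UNIV. \<Sum>b\<in>UNIV. \<Sum>m\<in>UNIV. (gi *v x)$a * (gi *v y)$b * (cross a b m * \<psi>$m$i$j$k))"
      by (subst sum_rotate2) (rule refl)
    also have "\<dots> = (\<Sum>a\<in>UNIV. \<Sum>b\<in>UNIV. (gi *v x)$a * (gi *v y)$b * (?X i j k a b - ?X i j k b a))"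
      unfolding sum_distrib_left[symmetric] cross_psi_def[symmetric] cross_psi_eq sum_negf[symmetric]
      by (intro sum.cong refl) (simp add: algebra_simps)
    also have "\<dots> = (\<Sum>a\<in>UNIV. \<Sum>b\<in>UNIV. (gi *v x)$a * (gi *v y)$b * ?X i j k a b)
       - (\<Sum>a\<in>UNIV. \<Sum>b\<in>UNIV. (gi *v x)$a * (gi *v y)$b * ?X i j k b a)"
      by (simp add: right_diff_distrib sum_subtractf)
    finally have eq: "hook4 (- (gi *v cl x y)) \<psi> $i$j$k = (\<Sum>a\<in>UNIV. \<Sum>b\<in>UNIV. (gi *v x)$a * (gi *v y)$b * ?X i j k a b)
       - (\<Sum>a\<in>UNIV. \<Sum>b\<in>UNIV. (gi *v x)$a * (gi *v y)$b * ?X i j k b a)" .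
    have sw: "(\<Sum>a\<in>UNIV. \<Sum>b\<in>UNIV. (gi *v x)$a * (gi *v y)$b * ?X i j k b a)
       = (\<Sum>a\<in>UNIV. \<Sum>b\<in>UNIV. (gi *v y)$a * (gi *v x)$b * ?X i j k a b)"
      by (subst sum.swap) (simp add: mult.commute)
    have S: "(\<Sum>a\<in>UNIV. \<Sum>b\<in>UNIV. (gi *v x)$a * (gi *v y)$b * ?X i j k a b) =
      (\<Sum>b\<in>UNIV. (gi *v y)$b * (x$i * \<phi>$b$j$k + x$j * \<phi>$i$b$k + x$k * \<phi>$i$j$b))" for x y
    proof -
      have "(\<Sum>a\<in>UNIV. \<Sum>b\<in>UNIV. (gi *v x)$a * (gi *v y)$b * ?X i j k a b)
        = (\<Sum>b\<in>UNIV. (gi *v y)$b * ((\<Sum>a\<in>UNIV. (gi *v x)$a * g$a$i) * \<phi>$b$j$k + (\<Sum>a\<in>UNIV. (gi *v x)$a * g$a$j) * \<phi>$i$b$k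
            + (\<Sum>a\<in>UNIV. (gi *v x)$a * g$a$k) * \<phi>$i$j$b))"
        by (subst sum.swap) (simp add: sum_distrib_left sum_distrib_right sum.distrib distrib_left mult_ac)
      then show ?thesis unfolding lower_raise .
    qed
    have fin: "(\<Sum>b\<in>UNIV. (gi *v y)$b * (x$i * \<phi>$b$j$k + x$j * \<phi>$i$b$k + x$k * \<phi>$i$j$b))
      - (\<Sum>b\<in>UNIV. (gi *v x)$b * (y$i * \<phi>$b$j$k + y$j * \<phi>$i$b$k + y$k * \<phi>$i$j$b))
      = act ((\<chi> i l. x$i * y$l - y$i * x$l) ** gi) \<phi> $i$j$k"
    proof -
      have m: "((\<chi> i l. x$i * y$l - y$i * x$l) ** gi) $i$b = x$i * (gi *v y)$b - y$i * (gi *v x)$b" for i b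
        by (simp add: matrix_matrix_mult_def matrix_vector_mult_def sum_subtractf sum_distrib_left gi_sym[of b] algebra_simps)
      show ?thesis unfolding act_nth m sum_subtractf[symmetric]
        by (intro sum.cong refl) (simp add: algebra_simps)
    qed
    show ?thesis unfolding eq sw S fin ..
  qed
  then show ?thesis by (simp add: vec_eq_iff)
qed

lemma contract_raise12:
  assumes "gi = matrix_inv g"
  shows "(\<Sum>j\<in>UNIV. y$j * raise12 g \<phi> $i$j$k) = cl (axis i 1) y $ k"
proof -
  have gx: "(gi *v axis i 1)$a = gi$i$a" for a
    by (simp add: matrix_vector_mult_basis column_def gi_sym)
  have "(\<Sum>j\<in>UNIV. y$j * raise12 g \<phi> $i$j$k) = (\<Sum>j\<in>UNIV. \<Sum>a\<in>UNIV. \<Sum>b\<in>UNIV. gi$i$a * (gi$b$j * y$j) * \<phi>$a$b$k)"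
    unfolding raise12_def assms[symmetric]
    by (simp add: sum_distrib_left gi_sym[of _ "_::7"] mult_ac)
  also have "\<dots> = (\<Sum>a\<in>UNIV. \<Sum>b\<in>UNIV. \<Sum>j\<in>UNIV. gi$i$a * (gi$b$j * y$j) * \<phi>$a$b$k)"
    by (rule sum_rotate2)
  also have "\<dots> = cl (axis i 1) y $ k"
    unfolding cl_def gx by (simp add: matrix_vector_mult_def[of gi y] sum_distrib_left sum_distrib_right)
  finally show ?thesis .
qed

end

section \<open>The algebra of the symbols\<close>

text \<open>Operations on different slots commute. Both \<open>act\<close> and \<open>pull3\<close>
  are built from them, so equivariance becomes algebra of commuting operators instead of
  manipulations of triple sums.\<close>

definition slot1 :: "tens2 \<Rightarrow> tens3 \<Rightarrow> tens3" where
  "slot1 A p = (\<chi> i j k. \<Sum>l\<in>UNIV. A$i$l * p$l$j$k)"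
definition slot2 :: "tens2 \<Rightarrow> tens3 \<Rightarrow> tens3" where
  "slot2 A p = (\<chi> i j k. \<Sum>l\<in>UNIV. A$j$l * p$i$l$k)"
definition slot3 :: "tens2 \<Rightarrow> tens3 \<Rightarrow> tens3" where
  "slot3 A p = (\<chi> i j k. \<Sum>l\<in>UNIV. A$k$l * p$i$j$l)"

lemmas slot_defs = slot1_def slot2_def slot3_def

lemma act_slots: "act M p = slot1 M p + slot2 M p + slot3 M p"
  by (simp add: vec_eq_iff act_def slot_defs sum.distrib)

lemma pull3_slots: "pull3 T p = slot1 (transpose T) (slot2 (transpose T) (slot3 (transpose T) p))"
  by (simp add: vec_eq_iff pull3_def slot_defs transpose_def sum_distrib_left mult_ac)

lemma slot_mult:
  "slot1 A (slot1 B p) = slot1 (A ** B) p" "slot2 A (slot2 B p) = slot2 (A ** B) p" "slot3 A (slot3 B p) = slot3 (A ** B) p"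
proof -
  have *: "(\<Sum>l\<in>UNIV. A$i$l * (\<Sum>m\<in>UNIV. B$l$m * f m)) = (\<Sum>m\<in>UNIV. (\<Sum>l\<in>UNIV. A$i$l * B$l$m) * f m)"
    for f :: "7 \<Rightarrow> real" and i :: 7
    unfolding sum_distrib_left sum_distrib_right by (subst sum.swap) (simp add: mult.assoc)
  show "slot1 A (slot1 B p) = slot1 (A ** B) p" "slot2 A (slot2 B p) = slot2 (A ** B) p" "slot3 A (slot3 B p) = slot3 (A ** B) p"
    by (simp_all add: vec_eq_iff slot_defs matrix_matrix_mult_def *)
qed

lemma slot_commute:
  "slot2 A (slot1 B p) = slot1 B (slot2 A p)" "slot3 A (slot1 B p) = slot1 B (slot3 A p)" "slot3 A (slot2 B p) = slot2 B (slot3 A p)"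
proof -
  have *: "(\<Sum>l\<in>UNIV. A$i$l * (\<Sum>m\<in>UNIV. B$j$m * f l m)) = (\<Sum>m\<in>UNIV. B$j$m * (\<Sum>l\<in>UNIV. A$i$l * f l m))"
    for f :: "7 \<Rightarrow> 7 \<Rightarrow> real" and i j :: 7
    unfolding sum_distrib_left by (subst sum.swap) (simp add: mult.left_commute)
  show "slot2 A (slot1 B p) = slot1 B (slot2 A p)" "slot3 A (slot1 B p) = slot1 B (slot3 A p)" "slot3 A (slot2 B p) = slot2 B (slot3 A p)"
    by (simp_all add: vec_eq_iff slot_defs *)
qed

lemma slot_add:
  "slot1 A (p + q) = slot1 A p + slot1 A q" "slot2 A (p + q) = slot2 A p + slot2 A q" "slot3 A (p + q) = slot3 A p + slot3 A q"
  by (simp_all add: vec_eq_iff slot_defs distrib_left sum.distrib)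

text \<open>Equivariance of the infinitesimal action: a change of frame conjugates the acting
  matrix.\<close>

lemma act_pull3:
  assumes "T ** E = mat 1"
  shows "act (transpose T ** M ** transpose E) (pull3 T p) = pull3 T (act M p)"
proof -
  have "transpose E ** transpose T = mat 1" using assms by (simp flip: matrix_transpose_mul)
  then have e: "transpose T ** M ** transpose E ** transpose T = transpose T ** M"
    using matrix_mul_assoc[of "transpose T ** M" "transpose E" "transpose T"] by simp
  show ?thesis
    unfolding act_slots pull3_slots slot_commute slot_mult e slot_add by (simp only: slot_commute slot_mult)
qed

lemma act_surj:
  assumes w: "alternating w" and nd: "nondegenerate w" and u: "alternating u"
  obtains M where "act M w = u"
proof -
  obtain E T where ET: "E ** T = mat 1" "T ** E = mat 1" and wT: "w = pull3 T phi0"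
    and g: "metric_of w = transpose T ** T" and gi: "matrix_inv (metric_of w) = E ** transpose E"
    and psi': "psi_of w = (\<chi> a b c d. \<Sum>i\<in>UNIV. \<Sum>j\<in>UNIV. \<Sum>k\<in>UNIV. \<Sum>l\<in>UNIV.
        star phi0 i j k l * (T$i$a * T$j$b * T$k$c * T$l$d))"
    by (rule G2_coframe[OF w nd]) (rule that)
  obtain M where M: "act M phi0 = pull3 E u" using act_phi0_surj[OF alternating_pull3[OF u]] .
  have "act (transpose T ** M ** transpose E) w = pull3 T (pull3 E u)"
    unfolding M[symmetric] act_pull3[OF ET(2), symmetric] wT[symmetric] ..
  also have "\<dots> = u" by (simp add: pull3_pull3 ET)
  finally show ?thesis by (rule that)
qed

lemma sum_pair: "(\<Sum>t\<in>UNIV. F t) = (\<Sum>i\<in>UNIV. \<Sum>j\<in>UNIV. F (i,j))"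
  for F :: "'a::finite \<times> 'b::finite \<Rightarrow> 'd::comm_monoid_add"
  by (simp add: sum.cartesian_product flip: UNIV_Times_UNIV)

lemma hook4_psi_inj:
  assumes w: "alternating w" and nd: "nondegenerate w" and Y: "hook4 Y (psi_of w) = 0"
  shows "Y = 0"
proof -
  obtain E T where ET: "E ** T = mat 1" "T ** E = mat 1" and wT: "w = pull3 T phi0"
    and g: "metric_of w = transpose T ** T" and gi: "matrix_inv (metric_of w) = E ** transpose E"
    and psi': "psi_of w = (\<chi> a b c d. \<Sum>i\<in>UNIV. \<Sum>j\<in>UNIV. \<Sum>k\<in>UNIV. \<Sum>l\<in>UNIV.
        star phi0 i j k l * (T$i$a * T$j$b * T$k$c * T$l$d))"
    by (rule G2_coframe[OF w nd]) (rule that)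
  have psi: "psi_of w $a$b$c$d = (\<Sum>i\<in>UNIV. \<Sum>j\<in>UNIV. \<Sum>k\<in>UNIV. \<Sum>l\<in>UNIV.
        star phi0 i j k l * (T$i$a * T$j$b * T$k$c * T$l$d))" for a b c d
    by (simp add: psi')
  define y where "y = T *v Y"
  define p where "p = (\<chi> j k l. \<Sum>i\<in>UNIV. y$i * star phi0 i j k l)"
  have "hook4 Y (psi_of w) = pull3 T p"
  proof -
    have "hook4 Y (psi_of w) $b$c$d = pull3 T p $b$c$d" for b c d
    proof -
      have "hook4 Y (psi_of w) $b$c$d = (\<Sum>a\<in>UNIV. \<Sum>i\<in>UNIV. \<Sum>j\<in>UNIV. \<Sum>k\<in>UNIV. \<Sum>l\<in>UNIV.
          T$i$a * Y$a * star phi0 i j k l * (T$j$b * T$k$c * T$l$d))"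
        by (simp add: hook4_def psi sum_distrib_left mult_ac)
      also have "\<dots> = (\<Sum>i\<in>UNIV. \<Sum>j\<in>UNIV. \<Sum>k\<in>UNIV. \<Sum>l\<in>UNIV. y$i * star phi0 i j k l * (T$j$b * T$k$c * T$l$d))"
      proof -
        let ?F = "\<lambda>a i j k l. T$i$a * Y$a * star phi0 i j k l * (T$j$b * T$k$c * T$l$d)"
        have "(\<Sum>a\<in>UNIV. \<Sum>i\<in>UNIV. \<Sum>j\<in>UNIV. \<Sum>k\<in>UNIV. \<Sum>l\<in>UNIV. ?F a i j k l)
          = (\<Sum>i\<in>UNIV. \<Sum>a\<in>UNIV. \<Sum>j\<in>UNIV. \<Sum>k\<in>UNIV. \<Sum>l\<in>UNIV. ?F a i j k l)" by (rule sum.swap)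
        also have "\<dots> = (\<Sum>i\<in>UNIV. \<Sum>j\<in>UNIV. \<Sum>k\<in>UNIV. \<Sum>l\<in>UNIV. \<Sum>a\<in>UNIV. ?F a i j k l)"
          by (rule sum.cong[OF refl], rule sum_rotate3)
        finally show ?thesis by (simp add: y_def matrix_vector_mult_def sum_distrib_right)
      qed
      also have "\<dots> = pull3 T p $b$c$d"
        by (subst sum_rotate3) (simp add: pull3_nth p_def sum_distrib_right)
      finally show ?thesis .
    qed
    then show ?thesis by (simp add: vec_eq_iff)
  qed
  then have "pull3 T p = 0" using Y by simp
  then have "pull3 E (pull3 T p) = 0" by (simp add: vec_eq_iff pull3_nth)
  then have p0: "p = 0" by (simp add: pull3_pull3 ET)
  note v = star_sort star_values[OF alternating_phi0] phi0_values alternating_sort[OF alternating_phi0] alternating_repeat[OF alternating_phi0]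
  \<comment> \<open>In the model each coordinate of the contracting vector appears, up to sign, as a
    single component of the contraction.\<close>
  have "p$4$5$6 = y$3" "p$3$5$6 = - y$4" "p$3$4$6 = y$5" "p$3$4$5 = - y$6" "p$1$5$6 = - y$2" "p$2$5$6 = y$1" "p$2$4$6 = y$0 \<or> p$2$4$6 = - y$0"
    by (simp_all add: p_def sum_7 v)
  then have "y = 0" using p0 by (auto simp: vec_eq_iff forall_7)
  then have "E *v (T *v Y) = 0" by (simp add: y_def)
  then show ?thesis by (simp add: matrix_vector_mul_assoc ET)
qed

text \<open>The inverse metric is \<open>E ** transpose E\<close>, so contracting with it is a
  Euclidean contraction in the frame, where \<open>phi0_phi0\<close> applies.\<close>

lemma G2_tensors_of:
  assumes w: "alternating w" and nd: "nondegenerate w"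
  shows "G2_tensors w (metric_of w) (matrix_inv (metric_of w)) (psi_of w)"
proof -
  obtain E T where ET: "E ** T = mat 1" "T ** E = mat 1" and wT: "w = pull3 T phi0"
    and g: "metric_of w = transpose T ** T" and gi: "matrix_inv (metric_of w) = E ** transpose E"
    and psi': "psi_of w = (\<chi> a b c d. \<Sum>i\<in>UNIV. \<Sum>j\<in>UNIV. \<Sum>k\<in>UNIV. \<Sum>l\<in>UNIV.
        star phi0 i j k l * (T$i$a * T$j$b * T$k$c * T$l$d))"
    by (rule G2_coframe[OF w nd]) (rule that)
  have psi: "psi_of w $a$b$c$d = (\<Sum>i\<in>UNIV. \<Sum>j\<in>UNIV. \<Sum>k\<in>UNIV. \<Sum>l\<in>UNIV.
        star phi0 i j k l * (T$i$a * T$j$b * T$k$c * T$l$d))" for a b c d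
    by (simp add: psi')
  have gn: "metric_of w $i$j = (\<Sum>p\<in>UNIV. T$p$i * T$p$j)" for i j
    by (simp add: g matrix_matrix_mult_def transpose_def)
  have gin: "matrix_inv (metric_of w) $i$j = (\<Sum>p\<in>UNIV. E$i$p * E$j$p)" for i j
    unfolding gi by (simp add: matrix_matrix_mult_def transpose_def)
  have TE: "(\<Sum>k\<in>UNIV. T$r$k * E$k$s) = (mat 1 :: tens2)$r$s" for r s
    using arg_cong[OF ET(2), of "\<lambda>M. M$r$s"] by (simp add: matrix_matrix_mult_def)
  have "matrix_inv (metric_of w) ** metric_of w = E ** (transpose E ** transpose T) ** T"
    unfolding gi by (simp add: g matrix_mul_assoc)
  then have gig: "matrix_inv (metric_of w) ** metric_of w = mat 1"
    by (simp add: ET flip: matrix_transpose_mul)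
  show ?thesis
  proof
    show "alternating w" by (rule w)
    show "metric_of w $i$j = metric_of w $j$i" for i j by (simp add: gn mult.commute)
    show "matrix_inv (metric_of w) $i$j = matrix_inv (metric_of w) $j$i" for i j by (simp add: gin mult.commute)
    show "(\<Sum>k\<in>UNIV. matrix_inv (metric_of w) $i$k * metric_of w $k$j) = (if i = j then 1 else 0)" for i j
      using arg_cong[OF gig, of "\<lambda>M. M$i$j"] by (simp add: matrix_matrix_mult_def mat_def)
    fix a b c d
    have "psi_of w $b$a$c$d = (\<Sum>j\<in>UNIV. \<Sum>i\<in>UNIV. \<Sum>k\<in>UNIV. \<Sum>l\<in>UNIV. star phi0 i j k l * (T$i$b * T$j$a * T$k$c * T$l$d))"
      unfolding psi by (rule sum.swap)
    then show "psi_of w $b$a$c$d = - psi_of w $a$b$c$d"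
      unfolding psi sum_negf[symmetric] by (simp only:) (intro sum.cong refl, subst star_swap(1), simp)
    have "psi_of w $a$c$b$d = (\<Sum>i\<in>UNIV. \<Sum>k\<in>UNIV. \<Sum>j\<in>UNIV. \<Sum>l\<in>UNIV. star phi0 i j k l * (T$i$a * T$j$c * T$k$b * T$l$d))"
      unfolding psi by (intro sum.cong refl sum.swap)
    then show "psi_of w $a$c$b$d = - psi_of w $a$b$c$d"
      unfolding psi sum_negf[symmetric] by (simp only:) (intro sum.cong refl, subst star_swap(2), simp)
    have "psi_of w $a$b$d$c = (\<Sum>i\<in>UNIV. \<Sum>j\<in>UNIV. \<Sum>l\<in>UNIV. \<Sum>k\<in>UNIV. star phi0 i j k l * (T$i$a * T$j$b * T$k$d * T$l$c))"
      unfolding psi by (intro sum.cong refl sum.swap)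
    then show "psi_of w $a$b$d$c = - psi_of w $a$b$c$d"
      unfolding psi sum_negf[symmetric] by (simp only:) (intro sum.cong refl, subst star_swap(3), simp)
  next
    fix i j a b
    have wE: "(\<Sum>k\<in>UNIV. w$i$j$k * E$k$s) = (\<Sum>p\<in>UNIV. \<Sum>q\<in>UNIV. phi0$p$q$s * (T$p$i * T$q$j))" for i j s
    proof -
      have "(\<Sum>k\<in>UNIV. w$i$j$k * E$k$s) = (\<Sum>k\<in>UNIV. \<Sum>p\<in>UNIV. \<Sum>q\<in>UNIV. \<Sum>r\<in>UNIV. phi0$p$q$r * (T$p$i * T$q$j) * (T$r$k * E$k$s))"
        by (subst wT) (simp add: pull3_nth sum_distrib_left sum_distrib_right mult_ac)
      also have "\<dots> = (\<Sum>p\<in>UNIV. \<Sum>q\<in>UNIV. \<Sum>r\<in>UNIV. phi0$p$q$r * (T$p$i * T$q$j) * (mat 1 :: tens2)$r$s)"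
        by (subst sum_rotate3) (simp only: sum_distrib_left[symmetric] TE)
      finally show ?thesis by (simp only: sum_mat1)
    qed
    have "(\<Sum>k\<in>UNIV. \<Sum>l\<in>UNIV. matrix_inv (metric_of w)$k$l * (w$i$j$k * w$a$b$l))
      = (\<Sum>k\<in>UNIV. \<Sum>l\<in>UNIV. \<Sum>s\<in>UNIV. (w$i$j$k * E$k$s) * (w$a$b$l * E$l$s))"
      unfolding gin by (simp add: sum_distrib_left sum_distrib_right mult_ac)
    also have "\<dots> = (\<Sum>s\<in>UNIV. \<Sum>k\<in>UNIV. \<Sum>l\<in>UNIV. (w$i$j$k * E$k$s) * (w$a$b$l * E$l$s))"
      by (rule sum_rotate2[symmetric])
    also have "\<dots> = (\<Sum>s\<in>UNIV. (\<Sum>(p,q)\<in>UNIV. phi0$p$q$s * (T$p$i * T$q$j)) * (\<Sum>(p,q)\<in>UNIV. phi0$p$q$s * (T$p$a * T$q$b)))"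
      unfolding sum_product[symmetric] wE by (simp only: sum_pair prod.case)
    also have "\<dots> = (\<Sum>s\<in>UNIV. \<Sum>x\<in>UNIV. \<Sum>y\<in>UNIV. case x of (p,q) \<Rightarrow> case y of (r,t) \<Rightarrow>
        (T$p$i * T$q$j * T$r$a * T$t$b) * (phi0$p$q$s * phi0$r$t$s))"
      unfolding sum_product by (simp add: case_prod_unfold mult_ac)
    also have "\<dots> = (\<Sum>x\<in>UNIV. \<Sum>y\<in>UNIV. case x of (p,q) \<Rightarrow> case y of (r,t) \<Rightarrow>
        (T$p$i * T$q$j * T$r$a * T$t$b) * ((if p = r \<and> q = t then 1 else 0) - (if p = t \<and> q = r then 1 else 0) - star phi0 p q r t))"
      by (subst sum_rotate2) (simp add: case_prod_unfold phi0_phi0 flip: sum_distrib_left)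
    also have "\<dots> = (\<Sum>p\<in>UNIV. \<Sum>q\<in>UNIV. \<Sum>r\<in>UNIV. \<Sum>t\<in>UNIV.
        (if t = q then if r = p then T$p$i * T$q$j * T$p$a * T$q$b else 0 else 0)
         - (if t = p then if r = q then T$p$i * T$q$j * T$q$a * T$p$b else 0 else 0)
         - star phi0 p q r t * (T$p$i * T$q$j * T$r$a * T$t$b))"
      by (simp only: sum_pair prod.case, intro sum.cong refl) (auto simp: algebra_simps)
    also have "\<dots> = metric_of w $i$a * metric_of w $j$b - metric_of w $i$b * metric_of w $j$a - psi_of w $i$j$a$b"
      unfolding gn psi sum_product
      by (simp add: sum_subtractf mult_ac)
    finally show "(\<Sum>k\<in>UNIV. \<Sum>l\<in>UNIV. matrix_inv (metric_of w)$k$l * (w$i$j$k * w$a$b$l))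
      = metric_of w $i$a * metric_of w $j$b - metric_of w $i$b * metric_of w $j$a - psi_of w $i$j$a$b" .
  qed
qed

section \<open>Symbols of connection, torsion, curvature and gauge field as algebra\<close>

lemma matrix_add_distrib_right: "(A + B) ** C = A ** C + B ** C" for A B :: "real^'n^'m"
  by (simp add: vec_eq_iff matrix_matrix_mult_def distrib_right sum.distrib)

lemma hook4_add: "hook4 (X + Y) p = hook4 X p + hook4 Y p"
  by (simp add: vec_eq_iff hook4_def algebra_simps sum.distrib)

lemma hook4_scaleR: "hook4 (c *\<^sub>R X) p = c *\<^sub>R hook4 X p"
  by (simp add: vec_eq_iff hook4_def sum_distrib_left algebra_simps)

lemma hook4_minus: "hook4 (- X) p = - hook4 X p"
  using hook4_scaleR[of "-1"] by simp

text \<open>The symbol of the Christoffel symbols when the metric varies by 2 h, the variation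
  caused by the pair (h, X).\<close>

definition sGam :: "tens2 \<Rightarrow> vec7 \<Rightarrow> tens2 \<Rightarrow> 7 \<Rightarrow> 7 \<Rightarrow> 7 \<Rightarrow> real" where
  "sGam gi x h K I J = (\<Sum>L\<in>UNIV. gi$K$L * (x$I * (2 * h$J$L) + x$J * (2 * h$I$L) - x$L * (2 * h$I$J))) / 2"

definition sNab :: "tens3 \<Rightarrow> tens2 \<Rightarrow> vec7 \<Rightarrow> tens2 \<Rightarrow> tens3 \<Rightarrow> 7 \<Rightarrow> tens3" where
  "sNab p gi x h u M = (\<chi> I J K. x$M * u$I$J$K - (\<Sum>L\<in>UNIV.
      sGam gi x h L M I * p$L$J$K + sGam gi x h L M J * p$I$L$K + sGam gi x h L M K * p$I$J$L))"

context G2_tensors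
begin

lemma linear_cl: "linear (cl x)"
  by (rule linearI) (simp_all add: vec_eq_iff cl_def matrix_vector_right_distrib matrix_vector_mult_scaleR algebra_simps sum.distrib sum_distrib_left)

lemma cl_add: "cl x (y + z) = cl x y + cl x z" and cl_diff: "cl x (y - z) = cl x y - cl x z"
  and cl_scaleR: "cl x (c *\<^sub>R y) = c *\<^sub>R cl x y"
  using linear_cl by (simp_all add: linear_add linear_diff linear_scale)

lemma cl_self: "cl x x = 0"
proof -
  have "(\<Sum>i\<in>UNIV. \<Sum>j\<in>UNIV. (gi *v x)$i * (gi *v x)$j * \<phi>$i$j$k) = 0" for k
  proof (rule sum_antisym_eq_0)
    fix i j
    show "(gi *v x)$j * (gi *v x)$i * \<phi>$j$i$k = - ((gi *v x)$i * (gi *v x)$j * \<phi>$i$j$k)"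
      by (subst phi_swap(1)) (simp add: mult.commute)
  qed
  then show ?thesis by (simp add: vec_eq_iff cl_def)
qed

lemma ip_cl_self: "(\<Sum>k\<in>UNIV. (gi *v x)$k * cl x y $ k) = 0"
proof -
  have "(\<Sum>k\<in>UNIV. (gi *v x)$k * cl x y $ k) = (\<Sum>k\<in>UNIV. \<Sum>i\<in>UNIV. \<Sum>j\<in>UNIV. (gi *v x)$k * (gi *v x)$i * (gi *v y)$j * \<phi>$i$j$k)"
    by (simp add: cl_def sum_distrib_left mult_ac)
  also have "\<dots> = 0"
  proof (rule sum_antisym_eq_0)
    fix i j
    have "\<phi>$i$q$j = - \<phi>$j$q$i" for q using phi_swap by metis
    then show "(\<Sum>q\<in>UNIV. (gi *v x)$j * (gi *v x)$i * (gi *v y)$q * \<phi>$i$q$j)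
      = - (\<Sum>q\<in>UNIV. (gi *v x)$i * (gi *v x)$j * (gi *v y)$q * \<phi>$j$q$i)"
      by (simp add: sum_negf[symmetric] mult.commute)
  qed
  finally show ?thesis .
qed

lemma cl_sum_right: "(\<Sum>j\<in>UNIV. c j * cl x (f j) $ k) = cl x (\<Sum>j\<in>UNIV. c j *\<^sub>R f j) $ k"
  for c :: "7 \<Rightarrow> real" and f :: "7 \<Rightarrow> vec7"
  by (simp add: linear_sum[OF linear_cl] cl_scaleR)

lemma raise_axis: "(gi *v axis i 1)$a = gi$i$a"
  by (simp add: matrix_vector_mult_basis column_def gi_sym)

lemma cl_axis_sum: "(\<Sum>i\<in>UNIV. x$i * cl (axis i 1) y $ k) = cl x y $ k"
proof -
  have "(\<Sum>i\<in>UNIV. x$i * cl (axis i 1) y $ k) = (\<Sum>i\<in>UNIV. \<Sum>a\<in>UNIV. \<Sum>b\<in>UNIV. (gi$a$i * x$i) * (gi *v y)$b * \<phi>$a$b$k)"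
    unfolding cl_def vec_lambda_beta raise_axis by (simp add: sum_distrib_left gi_sym[of _ "_::7"] mult_ac)
  also have "\<dots> = (\<Sum>a\<in>UNIV. \<Sum>b\<in>UNIV. \<Sum>i\<in>UNIV. (gi$a$i * x$i) * (gi *v y)$b * \<phi>$a$b$k)"
    by (rule sum_rotate2)
  finally show ?thesis
    by (simp add: cl_def matrix_vector_mult_def[of gi x] sum_distrib_right)
qed

lemma lower_sGam:
  "(\<Sum>m\<in>UNIV. g$m$l * sGam gi x h m j k) = x$j * h$k$l + x$k * h$j$l - x$l * h$j$k"
proof -
  define Z where "Z = (\<chi> L. x$j * h$k$L + x$k * h$j$L - x$L * h$j$k)"
  have "sGam gi x h m j k = (gi *v Z)$m" for m
    unfolding sGam_def Z_def matrix_vector_mult_def sum_divide_distrib vec_lambda_beta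
    by (intro sum.cong refl) (simp add: field_simps)
  then show ?thesis using lower_raise[of Z l] by (simp add: Z_def mult.commute)
qed

lemma sGam_eq:
  assumes "transpose h = h"
  shows "sGam gi x h K I J = x$I * (h ** gi)$J$K + x$J * (h ** gi)$I$K - (gi *v x)$K * h$I$J"
proof -
  have "sGam gi x h K I J = (\<Sum>L\<in>UNIV. gi$K$L * (x$I * h$J$L + x$J * h$I$L - x$L * h$I$J))"
    unfolding sGam_def sum_divide_distrib by (intro sum.cong refl) (simp add: field_simps)
  then show ?thesis
    by (simp add: matrix_matrix_mult_def matrix_vector_mult_def sum_distrib_left sum_distrib_right algebra_simps
        sum.distrib sum_subtractf gi_sym[of K])
qed

text \<open>The Christoffel matrix splits into \<xi>_M times h and the wedge of \<xi> with row M of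
  h. The first part cancels the contribution of h to the derivative of \<phi>; the second becomes a
  contraction of \<psi> by \<open>act_wedge\<close>. The resulting vector is the symbol of row M of
  the torsion.\<close>

lemma sNab_eq:
  assumes h: "transpose h = h"
  shows "sNab \<phi> gi x h (act (h ** gi) \<phi> + hook4 (gi *v X) \<psi>) M = hook4 (gi *v (x$M *\<^sub>R X + cl x (h$M))) \<psi>"
proof -
  let ?w = "(\<chi> i l. x$i * h$M$l - h$M$i * x$l) :: tens2"
  let ?u = "act (h ** gi) \<phi> + hook4 (gi *v X) \<psi>"
  define G :: tens2 where "G = (\<chi> i l. sGam gi x h l M i)"
  have hs: "h$i$j = h$j$i" for i j using arg_cong[OF h, of "\<lambda>M. M$i$j"] by (simp add: transpose_def)
  have m: "(?w ** gi) $i$b = x$i * (h ** gi)$M$b - h$M$i * (gi *v x)$b" for i b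
    by (simp add: matrix_matrix_mult_def matrix_vector_mult_def sum_subtractf sum_distrib_left gi_sym[of b] algebra_simps)
  have G: "G = x$M *\<^sub>R (h ** gi) + ?w ** gi"
    by (simp add: vec_eq_iff m G_def sGam_eq[OF h])
  have "sNab \<phi> gi x h ?u M = x$M *\<^sub>R ?u - act G \<phi>"
    by (simp add: vec_eq_iff sNab_def act_nth G_def)
  also have "\<dots> = x$M *\<^sub>R hook4 (gi *v X) \<psi> + hook4 (gi *v cl x (h$M)) \<psi>"
    unfolding G act_add act_scaleR act_wedge hook4_minus by (simp add: scaleR_add_right)
  finally show ?thesis
    by (simp add: matrix_vector_right_distrib matrix_vector_mult_scaleR hook4_add hook4_scaleR)
qed

definition tr :: "tens2 \<Rightarrow> real" where "tr h = (\<Sum>i\<in>UNIV. \<Sum>j\<in>UNIV. gi$i$j * h$i$j)"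

definition sV :: "real^7 \<Rightarrow> tens2 \<Rightarrow> vec7 \<Rightarrow> vec7" where
  "sV x h X = cl x X + tr h *\<^sub>R x - h *v (gi *v x)"

text \<open>The double cross products e_i \<times> (x \<times> h_i) are expanded by
  \<open>cl_cl\<close>. Their \<psi> terms cancel because they pair the symmetric h, with indices
  raised, with two skew slots of \<psi>.\<close>

lemma sV_eq:
  assumes gi: "gi = matrix_inv g" and h: "transpose h = h"
  shows "(\<Sum>i\<in>UNIV. \<Sum>j\<in>UNIV. (x$i * X$j + cl x (h$i) $ j) * raise12 g \<phi> $i$j$k) = sV x h X $ k"
proof -
  have hs: "h$i$j = h$j$i" for i j using arg_cong[OF h, of "\<lambda>M. M$i$j"] by (simp add: transpose_def)
  have "(\<Sum>i\<in>UNIV. \<Sum>j\<in>UNIV. (x$i * X$j + cl x (h$i) $ j) * raise12 g \<phi> $i$j$k)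
     = (\<Sum>i\<in>UNIV. x$i * (\<Sum>j\<in>UNIV. X$j * raise12 g \<phi> $i$j$k)) + (\<Sum>i\<in>UNIV. \<Sum>j\<in>UNIV. cl x (h$i) $ j * raise12 g \<phi> $i$j$k)"
    by (simp add: distrib_right sum.distrib sum_distrib_left mult.assoc)
  also have "\<dots> = cl x X $ k + (\<Sum>i\<in>UNIV. cl (axis i 1) (cl x (h$i)) $ k)"
    by (simp add: contract_raise12[OF gi] cl_axis_sum)
  also have "(\<Sum>i\<in>UNIV. cl (axis i 1) (cl x (h$i)) $ k) = tr h * x$k - (h *v (gi *v x)) $ k"
  proof -
    have 1: "ip (axis i 1) y = (gi *v y)$i" for i y
    proof -
      have "ip (axis i 1) y = ip y (axis i 1)" by (rule ip_sym)
      also have "\<dots> = (gi *v y)$i" unfolding ip_eq by (simp add: axis_def if_distrib cong: if_cong)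
      finally show ?thesis .
    qed
    have "(\<Sum>i\<in>UNIV. \<Sum>a\<in>UNIV. \<Sum>p\<in>UNIV. \<Sum>q\<in>UNIV. (gi *v axis i 1)$a * (gi *v x)$p * (gi *v h$i)$q * \<psi>$p$q$k$a) = 0"
    proof -
      define H where "H a q = (\<Sum>i\<in>UNIV. gi$i$a * (gi *v h$i)$q)" for a q
      have H: "H a q = H q a" for a q
        unfolding H_def matrix_vector_mult_def sum_distrib_left vec_lambda_beta
        by (subst sum.swap) (simp add: gi_sym[of _ q] gi_sym[of _ a] hs mult_ac)
      have "(\<Sum>i\<in>UNIV. \<Sum>a\<in>UNIV. \<Sum>p\<in>UNIV. \<Sum>q\<in>UNIV. (gi *v axis i 1)$a * (gi *v x)$p * (gi *v h$i)$q * \<psi>$p$q$k$a)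
        = (\<Sum>a\<in>UNIV. \<Sum>p\<in>UNIV. \<Sum>q\<in>UNIV. H a q * ((gi *v x)$p * \<psi>$p$q$k$a))"
        by (subst sum_rotate3) (simp add: H_def raise_axis sum_distrib_left sum_distrib_right mult_ac)
      also have "\<dots> = (\<Sum>p\<in>UNIV. \<Sum>q\<in>UNIV. \<Sum>a\<in>UNIV. H a q * ((gi *v x)$p * \<psi>$p$q$k$a))" by (rule sum_rotate2)
      also have "\<dots> = (\<Sum>p\<in>(UNIV :: 7 set). 0)"
      proof (rule sum.cong[OF refl])
        fix p
        show "(\<Sum>q\<in>UNIV. \<Sum>a\<in>UNIV. H a q * ((gi *v x)$p * \<psi>$p$q$k$a)) = 0"
      proof (rule sum_antisym_eq_0)
        fix q a
        have "\<psi>$p$a$k$q = - \<psi>$p$q$k$a"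
          using psi_swap(3)[of p a k q] psi_swap(2)[of p a q k] psi_swap(3)[of p q a k] by simp
        then show "H q a * ((gi *v x)$p * \<psi>$p$a$k$q) = - (H a q * ((gi *v x)$p * \<psi>$p$q$k$a))"
          by (simp add: H[of q a])
      qed
      qed
      finally show ?thesis by simp
    qed
    moreover have "(\<Sum>i\<in>UNIV. x$k * ip (axis i 1) (h$i)) = tr h * x$k"
      unfolding 1 matrix_vector_mult_def tr_def by (simp add: sum_distrib_left sum_distrib_right mult_ac)
    moreover have "(\<Sum>i\<in>UNIV. ip (axis i 1) x * h$i$k) = (h *v (gi *v x)) $ k"
      unfolding 1 by (simp add: matrix_vector_mult_def[of h] hs[of k] mult.commute)
    ultimately show ?thesis by (simp add: cl_cl sum_subtractf)
  qed
  finally show ?thesis by (simp add: sV_def)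
qed

text \<open>Contracting \<xi> with the first index collects the rows of h into h \<xi> inside the
  cross product. Contracting it with the second index kills the cross product, which is orthogonal
  to \<xi>.\<close>

lemma sdiv_eq:
  assumes h: "transpose h = h"
  shows "(\<Sum>i\<in>UNIV. \<Sum>j\<in>UNIV. gi$i$j * (x$i * (x$j * X$k + cl x (h$j) $ k)))
      = (ip x x *\<^sub>R X + cl x (h *v (gi *v x))) $ k"
    and "(\<Sum>i\<in>UNIV. \<Sum>j\<in>UNIV. gi$i$j * (x$i * (x$k * X$j + cl x (h$k) $ j))) = (ip x X *\<^sub>R x) $ k"
proof -
  have hs: "h$i$j = h$j$i" for i j using arg_cong[OF h, of "\<lambda>M. M$i$j"] by (simp add: transpose_def)
  have c: "(\<Sum>i\<in>UNIV. \<Sum>j\<in>UNIV. gi$i$j * (x$i * f j)) = (\<Sum>j\<in>UNIV. (gi *v x)$j * f j)" for f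
    by (subst sum.swap) (simp add: matrix_vector_mult_def sum_distrib_left sum_distrib_right gi_sym mult_ac)
  have hx: "(\<Sum>j\<in>UNIV. (gi *v x)$j *\<^sub>R h$j) = h *v (gi *v x)"
    by (simp add: vec_eq_iff matrix_vector_mult_def[of h] hs mult.commute)
  show "(\<Sum>i\<in>UNIV. \<Sum>j\<in>UNIV. gi$i$j * (x$i * (x$j * X$k + cl x (h$j) $ k))) = (ip x x *\<^sub>R X + cl x (h *v (gi *v x))) $ k"
    unfolding c distrib_left sum.distrib cl_sum_right hx by (simp add: ip_eq sum_distrib_right mult.assoc)
  show "(\<Sum>i\<in>UNIV. \<Sum>j\<in>UNIV. gi$i$j * (x$i * (x$k * X$j + cl x (h$k) $ j))) = (ip x X *\<^sub>R x) $ k"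
    unfolding c distrib_left sum.distrib ip_cl_self by (simp add: ip_eq sum_distrib_left sum_distrib_right mult_ac)
qed

definition sRm :: "vec7 \<Rightarrow> tens2 \<Rightarrow> 7 \<Rightarrow> 7 \<Rightarrow> 7 \<Rightarrow> 7 \<Rightarrow> real" where
  "sRm x h i j k l = x$i * x$k * h$j$l - x$i * x$l * h$j$k - x$j * x$k * h$i$l + x$j * x$l * h$i$k"

lemma sRm_eq:
  "(\<Sum>m\<in>UNIV. g$m$l * (x$i * sGam gi x h m j k - x$j * sGam gi x h m i k)) = sRm x h i j k l"
proof -
  have "(\<Sum>m\<in>UNIV. g$m$l * (x$i * sGam gi x h m j k - x$j * sGam gi x h m i k))
    = x$i * (\<Sum>m\<in>UNIV. g$m$l * sGam gi x h m j k) - x$j * (\<Sum>m\<in>UNIV. g$m$l * sGam gi x h m i k)"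
    by (simp add: sum_distrib_left right_diff_distrib sum_subtractf mult_ac)
  then show ?thesis unfolding lower_sGam by (simp add: sRm_def algebra_simps)
qed

definition sRc :: "vec7 \<Rightarrow> tens2 \<Rightarrow> tens2" where
  "sRc x h = (\<chi> j k. x$k * (h *v (gi *v x))$j + x$j * (h *v (gi *v x))$k - ip x x * h$j$k - tr h * (x$j * x$k))"

lemma sRc_eq:
  assumes h: "transpose h = h"
  shows "(\<Sum>l\<in>UNIV. \<Sum>m\<in>UNIV. gi$l$m * sRm x h l j k m) = sRc x h $j$k"
proof -
  have hs: "h$i$j = h$j$i" for i j using arg_cong[OF h, of "\<lambda>M. M$i$j"] by (simp add: transpose_def)
  have c: "(\<Sum>i\<in>UNIV. \<Sum>j\<in>UNIV. gi$i$j * (x$i * f j)) = (\<Sum>j\<in>UNIV. (gi *v x)$j * f j)" for f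
    by (subst sum.swap) (simp add: matrix_vector_mult_def sum_distrib_left sum_distrib_right gi_sym mult_ac)
  have "(\<Sum>l\<in>UNIV. \<Sum>m\<in>UNIV. gi$l$m * sRm x h l j k m) =
     (\<Sum>l\<in>UNIV. \<Sum>m\<in>UNIV. gi$l$m * (x$l * (x$k * h$j$m))) - (\<Sum>l\<in>UNIV. \<Sum>m\<in>UNIV. gi$l$m * (x$l * (x$m * h$j$k)))
     - (\<Sum>l\<in>UNIV. \<Sum>m\<in>UNIV. gi$l$m * h$l$m) * (x$j * x$k) + (\<Sum>l\<in>UNIV. \<Sum>m\<in>UNIV. gi$l$m * (x$m * (x$j * h$l$k)))"
    by (simp add: sRm_def sum_distrib_left sum_distrib_right sum.distrib sum_subtractf algebra_simps)
  also have "(\<Sum>l\<in>UNIV. \<Sum>m\<in>UNIV. gi$l$m * (x$m * (x$j * h$l$k))) = (\<Sum>l\<in>UNIV. \<Sum>m\<in>UNIV. gi$l$m * (x$l * (x$j * h$m$k)))"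
    by (subst sum.swap) (simp add: gi_sym)
  finally show ?thesis
    unfolding c by (simp add: sRc_def tr_def ip_eq matrix_vector_mult_def[of h] sum_distrib_left sum_distrib_right hs mult_ac)
qed

definition sF :: "vec7 \<Rightarrow> tens2 \<Rightarrow> tens2" where
  "sF x h = (let S = \<chi> j p. \<Sum>i\<in>UNIV. x$i * raise12 g \<phi> $i$j$p in 4 *\<^sub>R (transpose S ** h ** S))"

text \<open>The four terms of \<open>sRm\<close> arise from one another by swapping i, j or k, l,
  and the raised \<phi> is skew under the same swaps. They contribute equally, whence the factor 4
  in \<open>sF\<close> and in the bound on \<lambda>.\<close>

lemma sF_eq:
  "(\<Sum>i\<in>UNIV. \<Sum>j\<in>UNIV. \<Sum>k\<in>UNIV. \<Sum>l\<in>UNIV. sRm x h i j k l * raise12 g \<phi> $i$j$p * raise12 g \<phi> $k$l$q) = sF x h $p$q"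
proof -
  define u where "u = raise12 g \<phi>"
  have us: "u$i$j$p = - u$j$i$p" for i j p
  proof -
    have "u$i$j$p = (\<Sum>b\<in>UNIV. \<Sum>a\<in>UNIV. matrix_inv g $i$a * matrix_inv g $j$b * \<phi>$a$b$p)"
      unfolding u_def raise12_def by simp (rule sum.swap)
    also have "\<dots> = - u$j$i$p"
      unfolding u_def raise12_def by (simp add: sum_negf[symmetric]) (intro sum.cong refl, subst phi_swap(1), simp)
    finally show ?thesis .
  qed
  define A where "A i j k l = x$i * x$k * h$j$l * (u$i$j$p * u$k$l$q)" for i j k l
  let ?S = "\<lambda>f. \<Sum>i\<in>UNIV. \<Sum>j\<in>UNIV. \<Sum>k\<in>UNIV. \<Sum>l\<in>UNIV. (f i j k l :: real)"
  have e: "sRm x h i j k l * u$i$j$p * u$k$l$q = A i j k l + A i j l k + A j i k l + A j i l k" for i j k l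
    unfolding A_def sRm_def us[of j i] us[of l k] by (simp add: algebra_simps)
  have s1: "?S (\<lambda>i j k l. A i j l k) = ?S A"
    by (rule sum.cong[OF refl], rule sum.cong[OF refl], rule sum.swap)
  have s2: "?S (\<lambda>i j k l. A j i k l) = ?S A"
    by (rule sum.swap)
  have s3: "?S (\<lambda>i j k l. A j i l k) = ?S A"
    by (rule trans[OF sum.swap s1])
  have "?S (\<lambda>i j k l. sRm x h i j k l * u$i$j$p * u$k$l$q) = 4 * ?S A"
    unfolding e sum.distrib s1 s2 s3 by simp
  also have "?S A = (\<Sum>l\<in>UNIV. \<Sum>j\<in>UNIV. (\<Sum>i\<in>UNIV. x$i * u$i$j$p) * h$j$l * (\<Sum>k\<in>UNIV. x$k * u$k$l$q))"
  proof -
    have "?S A = (\<Sum>j\<in>UNIV. \<Sum>i\<in>UNIV. \<Sum>k\<in>UNIV. \<Sum>l\<in>UNIV. A i j k l)" by (rule sum.swap)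
    also have "\<dots> = (\<Sum>j\<in>UNIV. \<Sum>l\<in>UNIV. \<Sum>i\<in>UNIV. \<Sum>k\<in>UNIV. A i j k l)"
      by (rule sum.cong[OF refl], rule sum_rotate2[symmetric])
    also have "\<dots> = (\<Sum>l\<in>UNIV. \<Sum>j\<in>UNIV. \<Sum>i\<in>UNIV. \<Sum>k\<in>UNIV. A i j k l)" by (rule sum.swap)
    finally show ?thesis unfolding A_def by (simp add: sum_distrib_left sum_distrib_right mult_ac)
  qed
  finally have eq: "?S (\<lambda>i j k l. sRm x h i j k l * u$i$j$p * u$k$l$q)
    = 4 * (\<Sum>l\<in>UNIV. \<Sum>j\<in>UNIV. (\<Sum>i\<in>UNIV. x$i * u$i$j$p) * h$j$l * (\<Sum>k\<in>UNIV. x$k * u$k$l$q))" .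
  have "(transpose S ** h ** S)$p$q = (\<Sum>l\<in>UNIV. \<Sum>j\<in>UNIV. S$j$p * h$j$l * S$l$q)" for S :: tens2
    by (simp add: matrix_matrix_mult_def transpose_def sum_distrib_right)
  then show ?thesis
    unfolding sF_def Let_def u_def[symmetric] by (simp add: eq)
qed

definition sW :: "real \<Rightarrow> vec7 \<Rightarrow> tens2 \<Rightarrow> vec7 \<Rightarrow> vec7" where
  "sW a x h X = 2 *\<^sub>R (h *v (gi *v x)) - tr h *\<^sub>R x - (2 * a) *\<^sub>R sV x h X"

lemma sW_eq:
  assumes h: "transpose h = h"
  shows "(\<Sum>i\<in>UNIV. \<Sum>j\<in>UNIV. gi$i$j * sGam gi x h k i j) = (gi *v (2 *\<^sub>R (h *v (gi *v x)) - tr h *\<^sub>R x)) $ k"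
proof -
  have hs: "h$i$j = h$j$i" for i j using arg_cong[OF h, of "\<lambda>M. M$i$j"] by (simp add: transpose_def)
  have c: "(\<Sum>i\<in>UNIV. \<Sum>j\<in>UNIV. gi$i$j * (x$i * f j)) = (\<Sum>j\<in>UNIV. (gi *v x)$j * f j)" for f
    by (subst sum.swap) (simp add: matrix_vector_mult_def sum_distrib_left sum_distrib_right gi_sym mult_ac)
  have c': "(\<Sum>i\<in>UNIV. \<Sum>j\<in>UNIV. gi$i$j * (x$j * f i)) = (\<Sum>j\<in>UNIV. (gi *v x)$j * f j)" for f
    by (simp add: matrix_vector_mult_def sum_distrib_left sum_distrib_right mult_ac)
  have d: "(\<Sum>j\<in>UNIV. (gi *v x)$j * (h ** gi)$j$k) = (gi *v (h *v (gi *v x)))$k"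
  proof -
    have "(\<Sum>j\<in>UNIV. (gi *v x)$j * (h ** gi)$j$k) = (transpose (h ** gi) *v (gi *v x))$k"
      unfolding matrix_vector_mult_def by (simp add: transpose_def mult.commute)
    then show ?thesis by (simp add: matrix_transpose_mul h transpose_gi matrix_vector_mul_assoc matrix_mul_assoc)
  qed
  have "(\<Sum>i\<in>UNIV. \<Sum>j\<in>UNIV. gi$i$j * sGam gi x h k i j) =
    (\<Sum>i\<in>UNIV. \<Sum>j\<in>UNIV. gi$i$j * (x$i * (h ** gi)$j$k)) + (\<Sum>i\<in>UNIV. \<Sum>j\<in>UNIV. gi$i$j * (x$j * (h ** gi)$i$k))
     - (gi *v x)$k * (\<Sum>i\<in>UNIV. \<Sum>j\<in>UNIV. gi$i$j * h$i$j)"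
    unfolding sGam_eq[OF h] by (simp add: sum_distrib_left sum.distrib sum_subtractf algebra_simps)
  then show ?thesis
    unfolding c c' d by (simp add: tr_def matrix_vector_mult_diff_distrib matrix_vector_mult_scaleR)
qed

text \<open>The matrix \<xi> \<otimes> W is split into symmetric and skew halves. The symmetric half
  cancels all terms of the Ricci and Lie derivative symbols except |\<xi>|^2 h, as in the trick of
  DeTurck. The skew half contracts \<psi> with - (1/2) \<xi> \<times> W, where the double cross
  product in \<xi> \<times> (\<xi> \<times> X) shifts b1 and b2 by the terms in a.\<close>

lemma symbol_total:
  assumes gi: "gi = matrix_inv g"
  shows "diamond g (- sRc x h + a *\<^sub>R (\<chi> i j. x$i * sV x h X $j + x$j * sV x h X $i) + l *\<^sub>R sF x h) \<phi>
      + hook4 (sharp g (b1 *\<^sub>R (ip x x *\<^sub>R X + cl x (h *v (gi *v x))) + b2 *\<^sub>R (ip x X *\<^sub>R x))) \<psi>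
      + act (\<chi> i l. x$i * (gi *v sW a x h X)$l) \<phi>
    = diamond g (ip x x *\<^sub>R h + l *\<^sub>R sF x h) \<phi>
      + hook4 (sharp g (((b1 - a) * ip x x) *\<^sub>R X + ((b2 + a) * ip x X) *\<^sub>R x
          + (b1 - a - 1) *\<^sub>R cl x (h *v (gi *v x)))) \<psi>"
proof -
  define y where "y = h *v (gi *v x)"
  define W where "W = sW a x h X"
  let ?w = "(\<chi> i l. x$i * W$l - W$i * x$l) :: tens2"
  let ?s = "(\<chi> i l. x$i * W$l + W$i * x$l) :: tens2"
  have 1: "(\<chi> i l. x$i * (gi *v W)$l) = (1/2) *\<^sub>R (?s ** gi) + (1/2) *\<^sub>R (?w ** gi)"
  proof -
    have "(?s ** gi) $i$b = x$i * (gi *v W)$b + W$i * (gi *v x)$b" "(?w ** gi) $i$b = x$i * (gi *v W)$b - W$i * (gi *v x)$b" for i b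
      by (simp_all add: matrix_matrix_mult_def matrix_vector_mult_def sum_subtractf sum.distrib sum_distrib_left gi_sym[of b] algebra_simps)
    then show ?thesis by (simp add: vec_eq_iff add_divide_distrib diff_divide_distrib)
  qed
  have clV: "cl x (sV x h X) = ip x X *\<^sub>R x - ip x x *\<^sub>R X - cl x y"
    unfolding sV_def y_def[symmetric] by (simp add: cl_add cl_diff cl_scaleR cl_self cl_cl_same)
  have clW: "cl x W = (2 * (1 + a)) *\<^sub>R cl x y - (2 * a * ip x X) *\<^sub>R x + (2 * a * ip x x) *\<^sub>R X"
    unfolding W_def sW_def y_def[symmetric] cl_diff cl_scaleR cl_self clV
    by (simp add: algebra_simps)
  have neg: "gi *v (- z) = - (gi *v z)" for z using matrix_vector_mult_scaleR[of gi "-1" z] by simp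
  have 2: "act (\<chi> i l. x$i * (gi *v W)$l) \<phi> = diamond g ((1/2) *\<^sub>R ?s) \<phi> + hook4 (sharp g (- (1/2) *\<^sub>R cl x W)) \<psi>"
    unfolding 1 act_add act_scaleR[of _ "?w ** gi"] act_wedge diamond_act sharp_def gi[symmetric] scaleR_matrix_left
    by (simp add: hook4_minus hook4_scaleR matrix_vector_mult_scaleR neg)
  have 3: "- sRc x h + a *\<^sub>R (\<chi> i j. x$i * sV x h X $j + x$j * sV x h X $i) + l *\<^sub>R sF x h + (1/2) *\<^sub>R ?s
     = ip x x *\<^sub>R h + l *\<^sub>R sF x h"
    by (simp add: vec_eq_iff sRc_def W_def sW_def algebra_simps)
  have dadd: "diamond g (A + B) \<phi> = diamond g A \<phi> + diamond g B \<phi>" for A B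
    by (simp add: diamond_act matrix_add_distrib_right act_add)
  have sadd: "hook4 (sharp g (A + B)) \<psi> = hook4 (sharp g A) \<psi> + hook4 (sharp g B) \<psi>" for A B
    by (simp add: sharp_def matrix_vector_right_distrib hook4_add)
  have 4: "b1 *\<^sub>R (ip x x *\<^sub>R X + cl x y) + b2 *\<^sub>R (ip x X *\<^sub>R x) + (- (1/2) *\<^sub>R cl x W)
    = ((b1 - a) * ip x x) *\<^sub>R X + ((b2 + a) * ip x X) *\<^sub>R x + (b1 - a - 1) *\<^sub>R cl x y"
    unfolding clW by (simp add: algebra_simps)
  show ?thesis
    unfolding W_def[symmetric] y_def[symmetric] 2 3[symmetric] 4[symmetric] dadd sadd by (simp add: add_ac)
qed

end

section \<open>Smooth dependence of the induced tensors\<close>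

text \<open>Functions obtained by the operations that lead from a 3-tensor to its metric, volume and
  Hodge dual. \<open>sf_cong\<close> makes membership a matter of the values on \<open>U\<close>, so
  that definite descriptions may be replaced by formulas there.\<close>

inductive_set sf :: "tens3 set \<Rightarrow> (tens3 \<Rightarrow> real) set" for U where
  sf_const: "(\<lambda>_. c) \<in> sf U"
| sf_nth: "(\<lambda>p. p$i$j$k) \<in> sf U"
| sf_add: "f \<in> sf U \<Longrightarrow> g \<in> sf U \<Longrightarrow> (\<lambda>p. f p + g p) \<in> sf U"
| sf_mult: "f \<in> sf U \<Longrightarrow> g \<in> sf U \<Longrightarrow> (\<lambda>p. f p * g p) \<in> sf U"
| sf_inverse: "f \<in> sf U \<Longrightarrow> (\<And>p. p \<in> U \<Longrightarrow> f p \<noteq> 0) \<Longrightarrow> (\<lambda>p. inverse (f p)) \<in> sf U"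
| sf_root: "f \<in> sf U \<Longrightarrow> (\<And>p. p \<in> U \<Longrightarrow> f p \<noteq> 0) \<Longrightarrow> (\<lambda>p. root 9 (f p)) \<in> sf U"
| sf_cong: "f \<in> sf U \<Longrightarrow> (\<And>p. p \<in> U \<Longrightarrow> h p = f p) \<Longrightarrow> h \<in> sf U"

lemma sf_mono: "f \<in> sf U \<Longrightarrow> V \<subseteq> U \<Longrightarrow> f \<in> sf V"
  by (induction rule: sf.induct) (auto intro: sf.intros)

lemma sf_minus: "f \<in> sf U \<Longrightarrow> (\<lambda>p. - f p) \<in> sf U"
  using sf_mult[OF sf_const[of "-1"], of f] by simp

lemma sf_diff: "f \<in> sf U \<Longrightarrow> g \<in> sf U \<Longrightarrow> (\<lambda>p. f p - g p) \<in> sf U"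
  using sf_add[OF _ sf_minus, of f U g] by simp

lemma sf_divide: "f \<in> sf U \<Longrightarrow> g \<in> sf U \<Longrightarrow> (\<And>p. p \<in> U \<Longrightarrow> g p \<noteq> 0) \<Longrightarrow> (\<lambda>p. f p / g p) \<in> sf U"
  unfolding divide_inverse by (intro sf_mult sf_inverse)

lemma sf_divide_const: "f \<in> sf U \<Longrightarrow> (\<lambda>p. f p / c) \<in> sf U"
  unfolding divide_inverse by (intro sf_mult sf_const)

lemma sf_sum: "(\<And>i. i \<in> A \<Longrightarrow> f i \<in> sf U) \<Longrightarrow> (\<lambda>p. \<Sum>i\<in>A. f i p) \<in> sf U"
proof (cases "finite A")
  case True
  then show "(\<And>i. i \<in> A \<Longrightarrow> f i \<in> sf U) \<Longrightarrow> (\<lambda>p. \<Sum>i\<in>A. f i p) \<in> sf U"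
    by (induction A) (auto intro: sf_const sf_add)
qed (simp add: sf_const)

lemma sf_prod: "(\<And>i. i \<in> A \<Longrightarrow> f i \<in> sf U) \<Longrightarrow> (\<lambda>p. \<Prod>i\<in>A. f i p) \<in> sf U"
proof (cases "finite A")
  case True
  then show "(\<And>i. i \<in> A \<Longrightarrow> f i \<in> sf U) \<Longrightarrow> (\<lambda>p. \<Prod>i\<in>A. f i p) \<in> sf U"
    by (induction A) (auto intro: sf_const sf_mult)
qed (simp add: sf_const)

lemmas sf_intros = sf_const sf_nth sf_add sf_mult sf_minus sf_diff sf_divide_const sf_sum sf_prod

lemma sf_det: "(\<And>i j. (\<lambda>p. M p $ i $ j) \<in> sf U) \<Longrightarrow> (\<lambda>p. det (M p :: real^'n^'n)) \<in> sf U"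
  unfolding det_def by (intro sf_sum sf_mult sf_const sf_prod) auto

lemma matrix_inv_cramer:
  fixes A :: "real^'n^'n"
  assumes "det A \<noteq> 0"
  shows "matrix_inv A $ k $ j = det (\<chi> r s. if s = k then axis j 1 $ r else A $ r $ s) / det A"
proof -
  have "A *v (matrix_inv A *v axis j 1) = axis j 1"
    using assms by (simp add: matrix_vector_mul_assoc matrix_inv_inverse invertible_det_nz)
  then have "matrix_inv A *v axis j 1 = (\<chi> k. det (\<chi> r s. if s = k then axis j 1 $ r else A $ r $ s) / det A)"
    by (simp add: cramer[OF assms])
  then show ?thesis by (simp add: matrix_vector_mult_basis column_def vec_eq_iff)
qed

lemma sf_matrix_inv:
  assumes "\<And>i j. (\<lambda>p. M p $ i $ j) \<in> sf U" "\<And>p. p \<in> U \<Longrightarrow> det (M p :: real^'n^'n) \<noteq> 0"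
  shows "(\<lambda>p. matrix_inv (M p) $ i $ j) \<in> sf U"
proof -
  have "(\<lambda>p. (\<chi> r s. if s = i then axis j 1 $ r else M p $ r $ s) $ a $ b) \<in> sf U" for a b
    using assms(1)[of a b] by (cases "b = i") (simp_all add: sf_const)
  then have 1: "(\<lambda>p. det (\<chi> r s. if s = i then axis j 1 $ r else M p $ r $ s)) \<in> sf U"
    by (rule sf_det)
  have 2: "(\<lambda>p. det (M p)) \<in> sf U" by (rule sf_det, rule assms(1))
  have "(\<lambda>p. det (\<chi> r s. if s = i then axis j 1 $ r else M p $ r $ s) / det (M p)) \<in> sf U"
    by (rule sf_divide[OF 1 2 assms(2)])
  then show ?thesis by (rule sf_cong) (simp add: matrix_inv_cramer assms)
qed

text \<open>Every directional derivative of a function in \<open>sf U\<close> is again in \<open>sf U\<close>; so its members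
  are smooth on the open set \<open>U\<close>.\<close>

lemma sf_has_derivative:
  assumes U: "open U" and f: "f \<in> sf U"
  shows "\<exists>f'. (\<forall>e. f' e \<in> sf U) \<and> (\<forall>p\<in>U. (f has_derivative (\<lambda>e. f' e p)) (at p))"
  using f
proof induction
  case (sf_const c)
  then show ?case by (intro exI[of _ "\<lambda>e p. 0"]) (auto intro: sf.sf_const)
next
  case (sf_nth i j k)
  have "bounded_linear (\<lambda>p::tens3. p$i$j$k)"
    using bounded_linear_compose[OF bounded_linear_vec_nth[of k] bounded_linear_compose[OF bounded_linear_vec_nth[of j] bounded_linear_vec_nth[of i]]]
    by (simp add: o_def)
  then show ?case
    by (intro exI[of _ "\<lambda>e p. e$i$j$k"]) (auto intro: sf.sf_const bounded_linear_imp_has_derivative)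
next
  case (sf_add f g)
  then obtain f' g' where "\<forall>e. f' e \<in> sf U" "\<forall>p\<in>U. (f has_derivative (\<lambda>e. f' e p)) (at p)"
    "\<forall>e. g' e \<in> sf U" "\<forall>p\<in>U. (g has_derivative (\<lambda>e. g' e p)) (at p)" by blast
  then show ?case
    by (intro exI[of _ "\<lambda>e p. f' e p + g' e p"]) (auto intro!: sf.sf_add has_derivative_add)
next
  case (sf_mult f g)
  then obtain f' g' where "\<forall>e. f' e \<in> sf U" "\<forall>p\<in>U. (f has_derivative (\<lambda>e. f' e p)) (at p)"
    "\<forall>e. g' e \<in> sf U" "\<forall>p\<in>U. (g has_derivative (\<lambda>e. g' e p)) (at p)" by blast
  with sf_mult(1,2) show ?case
    by (intro exI[of _ "\<lambda>e p. f p * g' e p + f' e p * g p"])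
      (auto intro!: sf.sf_add sf.sf_mult has_derivative_mult)
next
  case (sf_inverse f)
  then obtain f' where f': "\<forall>e. f' e \<in> sf U" "\<forall>p\<in>U. (f has_derivative (\<lambda>e. f' e p)) (at p)" by blast
  have i: "(\<lambda>p. inverse (f p)) \<in> sf U" using sf_inverse by (intro sf.sf_inverse) auto
  show ?case
  proof (intro exI[of _ "\<lambda>e p. - (inverse (f p) * f' e p * inverse (f p))"] conjI allI ballI)
    show "(\<lambda>p. - (inverse (f p) * f' e p * inverse (f p))) \<in> sf U" for e
      using i f' by (intro sf_minus sf.sf_mult) auto
    show "((\<lambda>p. inverse (f p)) has_derivative (\<lambda>e. - (inverse (f p) * f' e p * inverse (f p)))) (at p)" if "p \<in> U" for p
      using f'(2) sf_inverse(2)[OF that] that by (intro Deriv.has_derivative_inverse) auto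
  qed
next
  case (sf_root f)
  then obtain f' where f': "\<forall>e. f' e \<in> sf U" "\<forall>p\<in>U. (f has_derivative (\<lambda>e. f' e p)) (at p)" by blast
  have i: "(\<lambda>p. root 9 (f p)) \<in> sf U" "(\<lambda>p. inverse (9 * f p)) \<in> sf U"
    using sf_root by (intro sf.sf_root sf.sf_inverse sf.sf_mult sf.sf_const; simp)+
  show ?case
  proof (intro exI[of _ "\<lambda>e p. (root 9 (f p) * inverse (9 * f p)) * f' e p"] conjI allI ballI)
    show "(\<lambda>p. (root 9 (f p) * inverse (9 * f p)) * f' e p) \<in> sf U" for e
      using i f' by (intro sf.sf_mult) auto
    fix p assume p: "p \<in> U"
    define r where "r = root 9 (f p)"
    have r9: "r ^ 9 = f p" "r \<noteq> 0" using sf_root(2)[OF p] by (simp_all add: r_def odd_real_root_pow)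
    \<comment> \<open>Writing the derivative of the ninth root r of f as r / (9 f) keeps it inside
      the class.\<close>
    have "inverse (9 * r ^ 8) = r * inverse (9 * f p)"
      using r9 by (simp add: field_simps flip: r9(1)) (simp add: eval_nat_numeral)
    then have "DERIV (root 9) (f p) :> r * inverse (9 * f p)"
      using DERIV_odd_real_root[of 9 "f p"] sf_root(2)[OF p] by (simp add: r_def)
    then show "((\<lambda>p. root 9 (f p)) has_derivative (\<lambda>e. (root 9 (f p) * inverse (9 * f p)) * f' e p)) (at p)"
      using has_derivative_compose[OF f'(2)[rule_format, OF p], of "root 9" "(*) (r * inverse (9 * f p))"]
      by (simp add: has_field_derivative_def r_def)
  qed
next
  case (sf_cong f h)
  then obtain f' where f': "\<forall>e. f' e \<in> sf U" "\<forall>p\<in>U. (f has_derivative (\<lambda>e. f' e p)) (at p)" by blast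
  show ?case
    by (intro exI[of _ f'] conjI f'(1) ballI has_derivative_transform_within_open[OF f'(2)[rule_format] U])
      (simp_all add: sf_cong)
qed

lemma sf_differentiable: "open U \<Longrightarrow> f \<in> sf U \<Longrightarrow> p \<in> U \<Longrightarrow> f differentiable (at p)"
  using sf_has_derivative unfolding differentiable_def by blast

lemma sf_continuous: "open U \<Longrightarrow> f \<in> sf U \<Longrightarrow> continuous_on U f"
  by (meson sf_differentiable continuous_at_imp_continuous_on differentiable_imp_continuous_within)

definition dsf :: "tens3 set \<Rightarrow> (tens3 \<Rightarrow> real) \<Rightarrow> tens3 \<Rightarrow> tens3 \<Rightarrow> real" where
  "dsf U f = (SOME f'. (\<forall>e. f' e \<in> sf U) \<and> (\<forall>p\<in>U. (f has_derivative (\<lambda>e. f' e p)) (at p)))"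

lemma dsf:
  assumes "open U" "f \<in> sf U"
  shows "dsf U f e \<in> sf U" "p \<in> U \<Longrightarrow> (f has_derivative (\<lambda>e. dsf U f e p)) (at p)"
  using someI_ex[OF sf_has_derivative[OF assms]] unfolding dsf_def by blast+

section \<open>Explicit metric and volume on an open set of tensors\<close>

lemma hook_wedge_sym: "hook_wedge w $i$j = hook_wedge w $j$i"
proof -
  have s: "star w c d a b = star w a b c d" for a b c d
    using star_swap(2)[of w c a d b] star_swap(1)[of w a c d b] star_swap(3)[of w a c b d] star_swap(2)[of w a b c d] star_swap(1)
    by (metis star_swap(2) star_swap(3) minus_minus)
  have "(\<Sum>a\<in>UNIV. \<Sum>b\<in>UNIV. \<Sum>c\<in>UNIV. \<Sum>d\<in>UNIV. w$i$a$b * w$j$c$d * star w a b c d)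
    = (\<Sum>x\<in>UNIV. \<Sum>y\<in>UNIV. case x of (a,b) \<Rightarrow> case y of (c,d) \<Rightarrow> w$i$a$b * w$j$c$d * star w a b c d)" for i j
    by (simp only: sum_pair prod.case)
  note e = this
  show ?thesis
    unfolding hook_wedge_eq_star e
    by (subst sum.swap, rule arg_cong[where f="\<lambda>x. x / 4"], intro sum.cong refl)
      (simp add: case_prod_unfold, subst s, simp)
qed

definition metricx :: "tens3 \<Rightarrow> tens2" where
  "metricx w = (- 1 / (6 * volx w)) *\<^sub>R hook_wedge w"

lemma nondegenerate_metricx:
  assumes "nondegenerate w"
  shows "metric_of w = metricx w" "vol_of w = volx w" "det (hook_wedge w) \<noteq> 0" "inner_product_matrix (metricx w)"
proof -
  have ind: "induces w (metric_of w) (vol_of w)" using assms by (rule nondegenerate_induces)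
  show "metric_of w = metricx w" using induces_metric[OF ind] by (simp add: metricx_def)
  then show "inner_product_matrix (metricx w)" using ind by (simp add: induces_def)
  show "vol_of w = volx w" using induces_vol[OF ind] .
  show "det (hook_wedge w) \<noteq> 0"
    using induces_nz[OF ind] induces_vol[OF ind] by (auto simp: volx_def)
qed

text \<open>Once the determinant is nonzero, \<open>volx\<close> and \<open>metricx\<close> satisfy
  the normalisation automatically: the relation for the ninth power yields
  \<open>v\<^sup>2 = det g\<close> after cancelling v^7. What remains is positivity, an open
  condition.\<close>

lemma nondegenerate_iff:
  "nondegenerate w \<longleftrightarrow> det (hook_wedge w) \<noteq> 0 \<and> (\<forall>x. x \<noteq> 0 \<longrightarrow> 0 < x \<bullet> (metricx w *v x))"
proof
  assume "nondegenerate w"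
  then show "det (hook_wedge w) \<noteq> 0 \<and> (\<forall>x. x \<noteq> 0 \<longrightarrow> 0 < x \<bullet> (metricx w *v x))"
    using nondegenerate_metricx[of w] by (simp add: inner_product_matrix_def)
next
  assume h: "det (hook_wedge w) \<noteq> 0 \<and> (\<forall>x. x \<noteq> 0 \<longrightarrow> 0 < x \<bullet> (metricx w *v x))"
  then have v: "volx w \<noteq> 0" "volx w ^ 9 = - det (hook_wedge w) / 6^7"
    by (simp_all add: volx_def odd_real_root_pow)
  have hm: "hook_wedge w = (- 6 * volx w) *\<^sub>R metricx w" using v(1) by (simp add: metricx_def)
  have "det (hook_wedge w) = - (6^7 * volx w ^ 7 * det (metricx w))"
    by (subst hm) (simp only: det_scaleR7 power_mult_distrib, simp)
  then have "volx w ^ 7 * (volx w)\<^sup>2 = volx w ^ 7 * det (metricx w)"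
    using v(2) by (simp flip: power_add)
  then have "(volx w)\<^sup>2 = det (metricx w)" using v(1) by (simp only: mult_cancel_left power_eq_0_iff) auto
  moreover have "transpose (metricx w) = metricx w"
    by (simp add: vec_eq_iff transpose_def metricx_def hook_wedge_sym)
  moreover have "hook_wedge w $i$j = - 6 * metricx w $i$j * volx w" for i j
    using arg_cong[OF hm, of "\<lambda>M. M$i$j"] by simp
  ultimately have "induces w (metricx w) (volx w)"
    using h unfolding induces_def inner_product_matrix_def by blast
  then show "nondegenerate w" by (auto simp: nondegenerate_def)
qed

lemma sf_hook_wedge: "(\<lambda>w. hook_wedge w $i$j) \<in> sf U"
  unfolding hook_wedge_def vec_lambda_beta by (intro sf_intros)

abbreviation U0 :: "tens3 set" where "U0 \<equiv> {w. det (hook_wedge w) \<noteq> 0}"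

lemma sf_volx: "volx \<in> sf U0"
proof -
  have "(\<lambda>w. - root 9 (det (hook_wedge w) / 6^7)) \<in> sf U0"
    by (intro sf_minus sf_root sf_divide_const sf_det sf_hook_wedge) auto
  then show ?thesis by (rule sf_cong) (simp add: volx_def)
qed

lemma volx_nz: "w \<in> U0 \<Longrightarrow> volx w \<noteq> 0"
  by (simp add: volx_def)

lemma sf_metricx: "(\<lambda>w. metricx w $i$j) \<in> sf U0"
proof -
  have "(\<lambda>w. (- 1 / (6 * volx w)) * hook_wedge w $i$j) \<in> sf U0"
    by (intro sf_mult sf_hook_wedge sf_divide sf_const sf_volx) (use volx_nz in auto)
  then show ?thesis by (rule sf_cong) (simp add: metricx_def)
qed

lemma open_U0: "open U0"
proof -
  have "continuous_on UNIV (\<lambda>w. det (hook_wedge w))"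
    by (rule sf_continuous[OF open_UNIV sf_det[OF sf_hook_wedge]])
  then have "open ((\<lambda>w. det (hook_wedge w)) -` (- {0}))" by (intro open_vimage) auto
  then show ?thesis by (simp add: vimage_def)
qed

lemma positive_definite_open:
  fixes A :: tens2
  assumes "\<And>x. x \<noteq> 0 \<Longrightarrow> 0 < x \<bullet> (A *v x)"
  obtains e where "e > 0" "\<And>B x. (\<And>i j. \<bar>B$i$j - A$i$j\<bar> < e) \<Longrightarrow> x \<noteq> 0 \<Longrightarrow> 0 < x \<bullet> (B *v x)"
proof -
  have "compact (sphere (0::vec7) 1)" by simp
  moreover have "sphere (0::vec7) 1 \<noteq> {}" by simp
  moreover have "continuous_on (sphere (0::vec7) 1) (\<lambda>x. x \<bullet> (A *v x))"
    by (intro continuous_intros linear_continuous_on matrix_vector_mul_bounded_linear)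
  ultimately obtain z where z: "z \<in> sphere 0 1" "\<And>x. x \<in> sphere 0 1 \<Longrightarrow> z \<bullet> (A *v z) \<le> x \<bullet> (A *v x)"
    using continuous_attains_inf[of "sphere (0::vec7) 1" "\<lambda>x. x \<bullet> (A *v x)"] by metis
  define m where "m = z \<bullet> (A *v z)"
  have m: "m > 0" unfolding m_def by (rule assms) (use z(1) in auto)
  \<comment> \<open>With m the minimum of the quadratic form on the unit sphere, each of the 49
    entries changes the form there by at most m / 50.\<close>
  show ?thesis
  proof (rule that[of "m / 50"])
    show "m / 50 > 0" using m by simp
    fix B x assume B: "\<And>i j. \<bar>B$i$j - A$i$j\<bar> < m / 50" and x: "x \<noteq> (0::vec7)"
    have unit: "0 < y \<bullet> (B *v y)" if y: "norm y = 1" for y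
    proof -
      have "\<bar>y \<bullet> (B *v y) - y \<bullet> (A *v y)\<bar> = \<bar>\<Sum>i\<in>UNIV. \<Sum>j\<in>UNIV. (B$i$j - A$i$j) * (y$i * y$j)\<bar>"
        by (simp add: inner_vec_def matrix_vector_mult_def sum_distrib_left sum_subtractf[symmetric] algebra_simps)
      also have "\<dots> \<le> (\<Sum>i\<in>(UNIV::7 set). \<Sum>j\<in>(UNIV::7 set). m / 50)"
      proof (intro order_trans[OF sum_abs] sum_mono)
        fix i j
        have "\<bar>y$i\<bar> \<le> 1" "\<bar>y$j\<bar> \<le> 1" using component_le_norm_cart[of y] y by auto
        then have "\<bar>y$i * y$j\<bar> \<le> 1" by (simp add: abs_mult mult_le_one)
        then show "\<bar>(B$i$j - A$i$j) * (y$i * y$j)\<bar> \<le> m / 50"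
          using B[of i j] m mult_mono[of "\<bar>B$i$j - A$i$j\<bar>" "m / 50" "\<bar>y$i * y$j\<bar>" 1] by (simp add: abs_mult)
      qed
      also have "\<dots> < m" using m by simp
      finally have "\<bar>y \<bullet> (B *v y) - y \<bullet> (A *v y)\<bar> < m" .
      moreover have "m \<le> y \<bullet> (A *v y)" using z(2)[of y] y by (simp add: m_def)
      ultimately show ?thesis by linarith
    qed
    have "0 < (x /\<^sub>R norm x) \<bullet> (B *v (x /\<^sub>R norm x))" by (rule unit) (use x in simp)
    then show "0 < x \<bullet> (B *v x)" using x by (simp add: matrix_vector_mult_scaleR zero_less_mult_iff)
  qed
qed

lemma open_nondegenerate: "open {w. nondegenerate w}"
  unfolding open_dist
proof (intro ballI)
  fix w assume "w \<in> {w. nondegenerate w}"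
  then have w: "w \<in> U0" "\<And>x. x \<noteq> 0 \<Longrightarrow> 0 < x \<bullet> (metricx w *v x)" by (auto simp: nondegenerate_iff)
  obtain e where e: "e > 0" "\<And>B x. (\<And>i j. \<bar>B$i$j - metricx w$i$j\<bar> < e) \<Longrightarrow> x \<noteq> 0 \<Longrightarrow> 0 < x \<bullet> (B *v x)"
    by (rule positive_definite_open[OF w(2)]) blast+
  have "eventually (\<lambda>u. \<bar>metricx u$i$j - metricx w$i$j\<bar> < e) (nhds w)" for i j
  proof -
    have "isCont (\<lambda>u. metricx u$i$j) w"
      using sf_continuous[OF open_U0 sf_metricx] w(1) open_U0 continuous_on_eq_continuous_at by blast
    then have "((\<lambda>u. metricx u$i$j) \<longlongrightarrow> metricx w$i$j) (nhds w)"
      unfolding isCont_def tendsto_at_iff_tendsto_nhds[of "\<lambda>u. metricx u$i$j" w] .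
    from tendstoD[OF this e(1)] show ?thesis by (simp add: dist_real_def)
  qed
  then have "eventually (\<lambda>u. \<forall>i j. \<bar>metricx u$i$j - metricx w$i$j\<bar> < e) (nhds w)"
    by (simp add: eventually_all_finite)
  moreover have "eventually (\<lambda>u. u \<in> U0) (nhds w)" using open_U0 w(1) by (rule eventually_nhds_in_open)
  ultimately have "eventually (\<lambda>u. nondegenerate u) (nhds w)"
    by eventually_elim (auto simp: nondegenerate_iff intro: e(2))
  then show "\<exists>e>0. \<forall>y. dist y w < e \<longrightarrow> y \<in> {w. nondegenerate w}"
    by (simp add: eventually_nhds_metric)
qed

abbreviation ND :: "tens3 set" where "ND \<equiv> {w. nondegenerate w}"

lemma sf_metric_of: "(\<lambda>w. metric_of w $i$j) \<in> sf ND"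
proof -
  have "(\<lambda>w. metricx w $i$j) \<in> sf ND"
    by (rule sf_mono[OF sf_metricx]) (auto simp: nondegenerate_iff)
  then show ?thesis by (rule sf_cong) (simp add: nondegenerate_metricx)
qed

lemma sf_vol_of: "vol_of \<in> sf ND"
proof -
  have "volx \<in> sf ND" by (rule sf_mono[OF sf_volx]) (auto simp: nondegenerate_iff)
  then show ?thesis by (rule sf_cong) (simp add: nondegenerate_metricx)
qed

lemma nondegenerate_metric:
  assumes "nondegenerate w"
  shows "inner_product_matrix (metric_of w)" "det (metric_of w) \<noteq> 0"
  using nondegenerate_metricx[OF assms] inner_product_matrix_det by simp_all

lemma sf_metric_inv: "(\<lambda>w. matrix_inv (metric_of w) $i$j) \<in> sf ND"
  by (rule sf_matrix_inv[OF sf_metric_of]) (simp add: nondegenerate_metric)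

lemma sf_psi_of: "(\<lambda>w. psi_of w $a$b$c$d) \<in> sf ND"
  unfolding psi_of_def hodge_star3_def vec_lambda_beta
  by (intro sf_intros sf_metric_inv sf_vol_of)

text \<open>The Gram matrix of the map from Y to \<open>hook4 Y (psi_of w)\<close> for the Euclidean
  product of components. Its inverse yields an explicit left inverse of that map, and thereby a
  formula for the torsion.\<close>

definition gram :: "tens3 \<Rightarrow> tens2" where
  "gram w = (\<chi> p q. \<Sum>a\<in>UNIV. \<Sum>b\<in>UNIV. \<Sum>c\<in>UNIV. psi_of w $p$a$b$c * psi_of w $q$a$b$c)"

lemma sf_gram: "(\<lambda>w. gram w $p$q) \<in> sf ND"
  unfolding gram_def vec_lambda_beta by (intro sf_intros sf_psi_of)

abbreviation NG :: "tens3 set" where "NG \<equiv> {w. nondegenerate w \<and> det (gram w) \<noteq> 0}"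

lemma open_NG: "open NG"
proof -
  have "open (ND \<inter> (\<lambda>w. det (gram w)) -` (- {0}))"
    by (intro continuous_open_preimage sf_continuous sf_det sf_gram open_nondegenerate) auto
  also have "ND \<inter> (\<lambda>w. det (gram w)) -` (- {0}) = NG" by auto
  finally show ?thesis .
qed

text \<open>The quadratic form of the Gram matrix at Y is the Euclidean square norm of the
  contraction of \<psi> with Y, and this contraction is injective by
  \<open>hook4_psi_inj\<close>.\<close>

lemma alternating_NG:
  assumes w: "alternating w" and nd: "nondegenerate w"
  shows "w \<in> NG"
proof -
  have "Y = 0" if "gram w *v Y = 0" for Y
  proof -
    define h where "h = hook4 Y (psi_of w)"
    have "(\<Sum>a\<in>UNIV. \<Sum>b\<in>UNIV. \<Sum>c\<in>UNIV. (h$a$b$c)\<^sup>2)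
      = (\<Sum>a\<in>UNIV. \<Sum>b\<in>UNIV. \<Sum>c\<in>UNIV. \<Sum>p\<in>UNIV. \<Sum>q\<in>UNIV. Y$p * Y$q * (psi_of w $p$a$b$c * psi_of w $q$a$b$c))"
      by (simp add: h_def hook4_def power2_eq_square sum_product mult_ac)
    also have "\<dots> = (\<Sum>p\<in>UNIV. \<Sum>q\<in>UNIV. Y$p * Y$q * gram w $p$q)"
    proof -
      let ?F = "\<lambda>a b c p q. Y$p * Y$q * (psi_of w $p$a$b$c * psi_of w $q$a$b$c)"
      have "(\<Sum>a\<in>UNIV. \<Sum>b\<in>UNIV. \<Sum>c\<in>UNIV. \<Sum>p\<in>UNIV. \<Sum>q\<in>UNIV. ?F a b c p q)
        = (\<Sum>p\<in>UNIV. \<Sum>a\<in>UNIV. \<Sum>b\<in>UNIV. \<Sum>c\<in>UNIV. \<Sum>q\<in>UNIV. ?F a b c p q)"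
        by (rule sum_rotate3[symmetric])
      also have "\<dots> = (\<Sum>p\<in>UNIV. \<Sum>q\<in>UNIV. \<Sum>a\<in>UNIV. \<Sum>b\<in>UNIV. \<Sum>c\<in>UNIV. ?F a b c p q)"
        by (rule sum.cong[OF refl], rule sum_rotate3[symmetric])
      finally show ?thesis by (simp add: gram_def sum_distrib_left)
    qed
    also have "\<dots> = Y \<bullet> (gram w *v Y)"
      by (simp add: inner_vec_def matrix_vector_mult_def sum_distrib_left mult_ac)
    finally have "(\<Sum>a\<in>UNIV. \<Sum>b\<in>UNIV. \<Sum>c\<in>UNIV. (h$a$b$c)\<^sup>2) = 0" by (simp add: that)
    then have "h = 0"
      by (simp add: sum_nonneg_eq_0_iff sum_nonneg vec_eq_iff)
    then show "Y = 0" using hook4_psi_inj[OF w nd] by (simp add: h_def)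
  qed
  then have "invertible (gram w)" by (simp add: invertible_left_inverse matrix_left_invertible_ker)
  then show ?thesis using nd by (simp add: invertible_det_nz)
qed

text \<open>The left inverse built from the Gram matrix, followed by lowering the index; see
  \<open>TK_hook4\<close>.\<close>

definition TK :: "tens3 \<Rightarrow> 7 \<Rightarrow> 7 \<Rightarrow> 7 \<Rightarrow> 7 \<Rightarrow> real" where
  "TK w p i j k = (\<Sum>r\<in>UNIV. (metric_of w ** matrix_inv (gram w))$p$r * psi_of w $r$i$j$k)"

lemma sf_TK: "(\<lambda>w. TK w p i j k) \<in> sf NG"
proof -
  have ND: "f \<in> sf ND \<Longrightarrow> f \<in> sf NG" for f by (erule sf_mono) auto
  show ?thesis
    unfolding TK_def matrix_matrix_mult_def vec_lambda_beta
    by (intro sf_intros sf_matrix_inv ND[OF sf_metric_of] ND[OF sf_gram] ND[OF sf_psi_of]) auto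
qed

lemma TK_hook4:
  assumes w: "alternating w" and nd: "nondegenerate w"
  shows "(\<Sum>i\<in>UNIV. \<Sum>j\<in>UNIV. \<Sum>k\<in>UNIV. TK w p i j k * hook4 Y (psi_of w) $i$j$k) = (metric_of w *v Y)$p"
proof -
  let ?A = "metric_of w ** matrix_inv (gram w)"
  have inv: "invertible (gram w)" using alternating_NG[OF w nd] by (simp add: invertible_det_nz)
  have "(\<Sum>i\<in>UNIV. \<Sum>j\<in>UNIV. \<Sum>k\<in>UNIV. TK w p i j k * hook4 Y (psi_of w) $i$j$k)
    = (\<Sum>i\<in>UNIV. \<Sum>j\<in>UNIV. \<Sum>k\<in>UNIV. \<Sum>r\<in>UNIV. \<Sum>m\<in>UNIV. ?A$p$r * (psi_of w$r$i$j$k * psi_of w$m$i$j$k) * Y$m)"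
    unfolding TK_def hook4_def vec_lambda_beta sum_product by (simp add: mult_ac)
  also have "\<dots> = (\<Sum>r\<in>UNIV. \<Sum>m\<in>UNIV. \<Sum>i\<in>UNIV. \<Sum>j\<in>UNIV. \<Sum>k\<in>UNIV. ?A$p$r * (psi_of w$r$i$j$k * psi_of w$m$i$j$k) * Y$m)"
    by (rule trans[OF sum_rotate3[symmetric]], rule sum.cong[OF refl], rule sum_rotate3[symmetric])
  also have "\<dots> = (?A *v (gram w *v Y))$p"
  proof -
    have gn: "gram w $r$m = (\<Sum>i\<in>UNIV. \<Sum>j\<in>UNIV. \<Sum>k\<in>UNIV. psi_of w$r$i$j$k * psi_of w$m$i$j$k)" for r m
      by (simp add: gram_def)
    show ?thesis
      unfolding matrix_vector_mult_def vec_lambda_beta gn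
      by (simp add: sum_distrib_left sum_distrib_right mult_ac)
  qed
  also have "\<dots> = (metric_of w *v Y)$p"
    using matrix_inv_inverse(2)[OF inv] by (simp add: matrix_vector_mul_assoc flip: matrix_mul_assoc)
  finally show ?thesis .
qed

section \<open>Equivariance of the metric in infinitesimal form\<close>

lemma slot_one_plus:
  "slot1 (mat 1 + t *\<^sub>R M) p = p + t *\<^sub>R slot1 M p" "slot2 (mat 1 + t *\<^sub>R M) p = p + t *\<^sub>R slot2 M p"
  "slot3 (mat 1 + t *\<^sub>R M) p = p + t *\<^sub>R slot3 M p"
proof -
  have *: "(\<Sum>l\<in>UNIV. (mat 1$i$l + t * M$i$l) * f l) = f i + t * (\<Sum>l\<in>UNIV. M$i$l * f l)" for f :: "7 \<Rightarrow> real" and i :: 7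
  proof -
    have "(\<Sum>l\<in>UNIV. mat 1$i$l * f l) = (\<Sum>l\<in>UNIV. if l = i then f l else 0)"
      by (rule sum.cong) (auto simp: mat_def)
    then show ?thesis by (simp add: distrib_right sum.distrib sum_distrib_left mult.assoc)
  qed
  show "slot1 (mat 1 + t *\<^sub>R M) p = p + t *\<^sub>R slot1 M p" "slot2 (mat 1 + t *\<^sub>R M) p = p + t *\<^sub>R slot2 M p"
    "slot3 (mat 1 + t *\<^sub>R M) p = p + t *\<^sub>R slot3 M p"
    by (simp_all add: vec_eq_iff slot_defs *)
qed

lemma slot_scaleR:
  "slot1 M (c *\<^sub>R p) = c *\<^sub>R slot1 M p" "slot2 M (c *\<^sub>R p) = c *\<^sub>R slot2 M p"
  by (simp_all add: vec_eq_iff slot_defs sum_distrib_left mult_ac)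

text \<open>The derivative is taken along the pullbacks of \<open>w\<close> by the transpose of 1 +
  t M, whose velocity at 0 is \<open>act M w\<close>. By naturality their metric is (1 + t M) g (1 +
  t M)^t, which is differentiated directly.\<close>

lemma dsf_metric_act:
  assumes nd: "nondegenerate w"
  shows "dsf ND (\<lambda>w. metric_of w $i$j) (act M w) w
    = (\<Sum>l\<in>UNIV. M$i$l * metric_of w $l$j + M$j$l * metric_of w $i$l)"
proof -
  let ?g = "metric_of w"
  let ?T = "\<lambda>t. transpose (mat 1 + t *\<^sub>R M) :: tens2"
  define c where "c t = pull3 (?T t) w" for t
  define Q where "Q = slot2 M (slot3 M w) + slot1 M (slot3 M w) + slot1 M (slot2 M w)"
  define R where "R = slot1 M (slot2 M (slot3 M w))"
  have c: "c t = w + t *\<^sub>R act M w + t^2 *\<^sub>R Q + t^3 *\<^sub>R R" for t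
    unfolding c_def pull3_slots transpose_transpose slot_one_plus
    by (simp add: slot_add slot_scaleR act_slots Q_def R_def scaleR_add_right algebra_simps power2_eq_square power3_eq_cube)
  have dc: "(c has_vector_derivative act M w) (at 0)"
    unfolding c by (auto intro!: derivative_eq_intros simp: has_vector_derivative_def)
  have c0: "c 0 = w" by (simp add: c)
  have "((\<lambda>w. metric_of w $i$j) has_derivative (\<lambda>e. dsf ND (\<lambda>w. metric_of w $i$j) e w)) (at (c 0))"
    using dsf(2)[OF open_nondegenerate sf_metric_of] nd by (simp add: c0)
  note dm = this
  have "((\<lambda>t. metric_of (c t) $i$j) has_derivative (\<lambda>t. dsf ND (\<lambda>w. metric_of w $i$j) (t *\<^sub>R act M w) w)) (at 0)"
    using has_derivative_compose[OF dc[unfolded has_vector_derivative_def] dm] .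
  then have 1: "((\<lambda>t. metric_of (c t) $i$j) has_real_derivative dsf ND (\<lambda>w. metric_of w $i$j) (act M w) w) (at 0)"
    using linear_scale[OF has_derivative_linear[OF dm]] by (simp add: has_field_derivative_def mult_commute_abs)
  have ind: "induces w ?g (vol_of w)" using nd by (rule nondegenerate_induces)
  have "isCont (\<lambda>t. det (?T t)) 0"
    unfolding det_def transpose_def vec_lambda_beta vector_add_component vector_scaleR_component
    by (intro continuous_intros)
  moreover have "det (?T 0) \<noteq> 0" by simp
  ultimately have "\<forall>\<^sub>F t in nhds 0. det (?T t) \<noteq> 0"
    using tendsto_imp_eventually_ne[of "\<lambda>t. det (?T t)" "det (?T 0)" "nhds 0" 0]
    unfolding isCont_def tendsto_at_iff_tendsto_nhds[of "\<lambda>t. det (?T t)" 0] by blast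
  then have ev: "\<forall>\<^sub>F t in nhds 0. metric_of (c t) $i$j = (?g + t *\<^sub>R (M ** ?g + ?g ** transpose M) + t^2 *\<^sub>R (M ** ?g ** transpose M))$i$j"
  proof eventually_elim
    case (elim t)
    have "metric_of (c t) = transpose (?T t) ** ?g ** ?T t"
      unfolding c_def using induces_unique(1)[OF induces_pull3[OF ind elim]] .
    moreover have "transpose (?T t) ** ?g ** ?T t = ?g + t *\<^sub>R (M ** ?g + ?g ** transpose M) + t^2 *\<^sub>R (M ** ?g ** transpose M)"
    proof -
      have tT: "?T t = mat 1 + t *\<^sub>R transpose M" by (simp add: vec_eq_iff transpose_def mat_def eq_commute)
      have dl: "A ** (B + C) = A ** B + A ** C" "A ** (t *\<^sub>R B) = t *\<^sub>R (A ** B)" for A B C :: tens2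
        by (simp_all add: vec_eq_iff matrix_matrix_mult_def distrib_left sum.distrib sum_distrib_left mult_ac)
      show ?thesis
        unfolding transpose_transpose unfolding tT
        by (simp add: matrix_add_distrib_right dl scaleR_matrix_left scaleR_add_right power2_eq_square add_ac)
    qed
    ultimately show ?case by simp
  qed
  have "((\<lambda>t. (?g + t *\<^sub>R (M ** ?g + ?g ** transpose M) + t^2 *\<^sub>R (M ** ?g ** transpose M))$i$j)
      has_real_derivative (M ** ?g + ?g ** transpose M)$i$j) (at 0)"
    by (auto intro!: derivative_eq_intros)
  then have "((\<lambda>t. metric_of (c t) $i$j) has_real_derivative (M ** ?g + ?g ** transpose M)$i$j) (at 0)"
    by (rule DERIV_cong_ev[THEN iffD2, OF refl ev refl])
  from DERIV_unique[OF 1 this] show ?thesis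
    by (simp add: matrix_matrix_mult_def transpose_def sum.distrib mult.commute)
qed

section \<open>The torsion of a field of G2-forms\<close>

lemma pd_eq: "(f has_derivative f') (at y) \<Longrightarrow> pd i f y = f' (axis i 1)"
  unfolding pd_def by (metis frechet_derivative_at)

lemma pd_works: "f differentiable (at y) \<Longrightarrow> (f has_derivative frechet_derivative f (at y)) (at y)"
  by (simp add: frechet_derivative_works)

lemma pd_nth:
  assumes "f differentiable (at y)"
  shows "pd i f y $ a = pd i (\<lambda>z. f z $ a) y"
  using pd_eq[OF bounded_linear.has_derivative[OF bounded_linear_vec_nth pd_works[OF assms]], of i a]
  by (simp add: pd_def)

lemma differentiable_nth: "f differentiable (at y) \<Longrightarrow> (\<lambda>z. f z $ a) differentiable (at y)"
  unfolding differentiable_def using bounded_linear.has_derivative[OF bounded_linear_vec_nth] by blast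

lemma bounded_linear_axis: "bounded_linear (axis i :: 'b::real_normed_vector \<Rightarrow> 'b^7)"
proof
  show "axis i (x + y) = axis i x + (axis i y :: 'b^7)" for x y by (simp add: vec_eq_iff axis_def)
  show "axis i (r *\<^sub>R x) = r *\<^sub>R (axis i x :: 'b^7)" for r x by (simp add: vec_eq_iff axis_def)
  show "\<exists>K. \<forall>x. norm (axis i x :: 'b^7) \<le> norm x * K" 
  proof (rule exI[of _ 1], rule allI)
    fix x :: 'b
    have "(\<Sum>j\<in>UNIV. (norm ((axis i x :: 'b^7) $ j))\<^sup>2) = (\<Sum>j\<in>UNIV. if j = i then (norm x)\<^sup>2 else 0)"
      by (rule sum.cong) (auto simp: axis_def)
    then show "norm (axis i x :: 'b^7) \<le> norm x * 1" by (simp add: norm_vec_def L2_set_def)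
  qed
qed

lemma differentiable_vecI:
  fixes f :: "'a::real_normed_vector \<Rightarrow> 'b::real_normed_vector^7"
  assumes "\<And>a. (\<lambda>z. f z $ a) differentiable (at y)"
  shows "f differentiable (at y)"
proof -
  have "f z = (\<Sum>a\<in>UNIV. axis a (f z $ a))" for z
    by (simp add: vec_eq_iff axis_def)
  moreover have "(\<lambda>z. axis a (f z $ a)) differentiable (at y)" for a
    using assms[of a] bounded_linear.has_derivative[OF bounded_linear_axis] unfolding differentiable_def by blast
  ultimately show ?thesis
    using differentiable_sum[of UNIV "\<lambda>a z. axis a (f z $ a)" "at y"] by (simp add: fun_eq_iff[symmetric])
qed

lemma has_derivative_eventually_cong:
  assumes "\<forall>\<^sub>F z in nhds y. f z = g z"
  shows "(f has_derivative f') (at y) \<longleftrightarrow> (g has_derivative f') (at y)"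
proof -
  have *: "(f has_derivative f') (at y) \<Longrightarrow> (g has_derivative f') (at y)" if "\<forall>\<^sub>F z in nhds y. f z = g z" for f g :: "'a \<Rightarrow> 'b"
    using that has_derivative_transform_eventually[of f f' y UNIV g] eventually_nhds_x_imp_x[OF that]
    by (simp add: eventually_at_filter eventually_mono)
  have "\<forall>\<^sub>F z in nhds y. g z = f z" using assms by (simp add: eq_commute)
  with assms show ?thesis using * by blast
qed

lemma pd_cong:
  assumes "\<forall>\<^sub>F z in nhds y. f z = g z" shows "pd i f y = pd i g y"
  unfolding pd_def frechet_derivative_def has_derivative_eventually_cong[OF assms] ..

lemma differentiable_cong:
  assumes "\<forall>\<^sub>F z in nhds y. f z = g z" shows "f differentiable (at y) \<longleftrightarrow> g differentiable (at y)"
  unfolding differentiable_def has_derivative_eventually_cong[OF assms] ..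

text \<open>The regularity that the second-order operators use, on an open set that is left free:
  nondegeneracy of a perturbed form is known only near a point.\<close>

definition g2field :: "vec7 set \<Rightarrow> (vec7 \<Rightarrow> tens3) \<Rightarrow> bool" where
  "g2field V w \<longleftrightarrow> open V \<and> (\<forall>z\<in>V. w differentiable (at z) \<and> (\<forall>j. pd j w differentiable (at z))
     \<and> alternating (w z) \<and> nondegenerate (w z))"

lemma sf_field:
  assumes "open U" "f \<in> sf U" "w differentiable (at z)" "w z \<in> U"
  shows "(\<lambda>z. f (w z)) differentiable (at z)" "pd i (\<lambda>z. f (w z)) z = dsf U f (pd i w z) (w z)"
proof -
  have d: "((\<lambda>z. f (w z)) has_derivative (\<lambda>e. dsf U f (frechet_derivative w (at z) e) (w z))) (at z)"
    using has_derivative_compose[OF pd_works[OF assms(3)] dsf(2)[OF assms(1,2,4)]] .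
  then show "(\<lambda>z. f (w z)) differentiable (at z)" unfolding differentiable_def by blast
  show "pd i (\<lambda>z. f (w z)) z = dsf U f (pd i w z) (w z)"
    unfolding pd_eq[OF d] by (simp add: pd_def)
qed

lemma dsf_linear: "open U \<Longrightarrow> f \<in> sf U \<Longrightarrow> p \<in> U \<Longrightarrow> linear (\<lambda>e. dsf U f e p)"
  by (rule has_derivative_linear[OF dsf(2)])

lemma act_zero: "act 0 w = 0" and hook4_zero: "hook4 0 p = 0"
  by (simp_all add: vec_eq_iff act_nth hook4_def)

text \<open>A skew matrix is the sum over a of the wedges of the a-th basis covector with half of
  its row a, and \<open>act_wedge\<close> treats each wedge.\<close>

lemma (in G2_tensors) act_antisym:
  assumes A: "\<And>i j. A$j$i = - A$i$j"
  obtains Y where "act (A ** gi) \<phi> = hook4 Y \<psi>"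
proof -
  define P where "P M \<longleftrightarrow> (\<exists>Y. act (M ** gi) \<phi> = hook4 Y \<psi>)" for M
  have P0: "P 0"
  proof -
    have "(0 :: tens2) ** gi = 0" by (simp add: vec_eq_iff matrix_matrix_mult_def)
    then show ?thesis unfolding P_def using act_zero hook4_zero by metis
  qed
  have Padd: "P (M + N)" if "P M" "P N" for M N
    using that unfolding P_def by (metis act_add hook4_add matrix_add_distrib_right)
  have Psum: "P (\<Sum>a\<in>S. M a)" if "\<And>a. P (M a)" for M and S :: "7 set"
    using finite[of S] by (induction S) (auto intro: P0 Padd that)
  have "P (\<chi> i l. axis a 1 $ i * ((1/2) *\<^sub>R A$a) $ l - ((1/2) *\<^sub>R A$a) $ i * axis a 1 $ l)" for a
    unfolding P_def act_wedge by blast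
  then have "P (\<Sum>a\<in>UNIV. (\<chi> i l. axis a 1 $ i * ((1/2) *\<^sub>R A$a) $ l - ((1/2) *\<^sub>R A$a) $ i * axis a 1 $ l))" by (rule Psum)
  also have "(\<Sum>a\<in>UNIV. (\<chi> i l. axis a 1 $ i * ((1/2) *\<^sub>R A$a) $ l - ((1/2) *\<^sub>R A$a) $ i * axis a 1 $ l)) = A"
  proof -
    have "(\<Sum>a\<in>UNIV. axis a 1 $ i * ((1/2) *\<^sub>R A$a) $ l - ((1/2) *\<^sub>R A$a) $ i * axis a 1 $ l) = ((1/2) *\<^sub>R A$i)$l - ((1/2) *\<^sub>R A$l)$i" for i l
    proof -
      have "(\<Sum>a\<in>UNIV. axis a (1::real) $ i * f a) = (\<Sum>a\<in>UNIV. if a = i then f a else 0)" for f :: "7 \<Rightarrow> real" and i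
        by (rule sum.cong) (auto simp: axis_def)
      then have ax: "(\<Sum>a\<in>UNIV. axis a (1::real) $ i * f a) = f i" for f :: "7 \<Rightarrow> real" and i
        by simp
      show ?thesis
        unfolding sum_subtractf ax mult.commute[of _ "axis _ _ $ _"] ..
    qed
    then have "(\<Sum>a\<in>UNIV. (\<chi> i l. axis a 1 $ i * ((1/2) *\<^sub>R A$a) $ l - ((1/2) *\<^sub>R A$a) $ i * axis a 1 $ l)) $i$l = A$i$l" for i l
      using A[of i l] by (simp only: sum_component vec_lambda_beta) simp
    then show ?thesis unfolding vec_eq_iff by blast
  qed
  finally show ?thesis unfolding P_def using that by blast
qed

locale g2_field =
  fixes V w assumes g2: "g2field V w"
begin

lemma field:
  assumes "z \<in> V"
  shows "w differentiable (at z)" "pd j w differentiable (at z)" "alternating (w z)" "nondegenerate (w z)"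
    "\<forall>\<^sub>F z in nhds z. z \<in> V"
  using g2 assms by (auto simp: g2field_def eventually_nhds)

lemma tensors: "z \<in> V \<Longrightarrow> G2_tensors (w z) (metric_field w z) (matrix_inv (metric_field w z)) (psi_of (w z))"
  unfolding metric_field_def by (intro G2_tensors_of field)

lemma metric_differentiable: "z \<in> V \<Longrightarrow> metric_field w differentiable (at z)"
  unfolding metric_field_def[abs_def]
  by (rule differentiable_vecI, rule differentiable_vecI, rule sf_field(1)[OF open_nondegenerate sf_metric_of])
    (auto intro: field)

lemma pd_metric_nth: "z \<in> V \<Longrightarrow> pd m (metric_field w) z $i$j = pd m (\<lambda>z. metric_field w z $i$j) z"
  using pd_nth[OF metric_differentiable, of z m i] pd_nth[OF differentiable_nth[OF metric_differentiable], of z m i j] by simp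

lemma pd_metric: "z \<in> V \<Longrightarrow> pd m (metric_field w) z $i$j = dsf ND (\<lambda>w. metric_of w $i$j) (pd m w z) (w z)"
  using sf_field(2)[OF open_nondegenerate sf_metric_of[of i j] field(1), of z m] field(4)
  by (simp add: pd_metric_nth) (simp add: metric_field_def)

lemma pd_metric_sym: "z \<in> V \<Longrightarrow> pd m (metric_field w) z $i$j = pd m (metric_field w) z $j$i"
proof -
  assume z: "z \<in> V"
  have "\<forall>\<^sub>F z in nhds z. metric_field w z $i$j = metric_field w z $j$i"
    using field(5)[OF z] by eventually_elim (rule G2_tensors.g_sym[OF tensors])
  from pd_cong[OF this, of m] show ?thesis
    by (simp add: pd_metric_nth z)
qed

lemma alternating_pd:
  assumes z: "z \<in> V" shows "alternating (pd m w z)"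
proof -
  have n: "pd m w z $i$j$k = pd m (\<lambda>z. w z$i$j$k) z" for i j k
    by (simp add: pd_nth differentiable_nth field z)
  have neg: "pd m (\<lambda>z. - f z) z = - pd m f z" if "f differentiable (at z)" for f :: "vec7 \<Rightarrow> real"
    using pd_eq[OF has_derivative_minus[OF pd_works[OF that]]] by (simp add: pd_def)
  have d: "(\<lambda>z. w z$i$j$k) differentiable (at z)" for i j k by (intro differentiable_nth field z)
  have e1: "\<forall>\<^sub>F z in nhds z. w z$i$j$k = - w z$j$i$k" for i j k
    using field(5)[OF z] by eventually_elim (rule alternating_swap(1)[OF field(3)])
  have e2: "\<forall>\<^sub>F z in nhds z. w z$i$j$k = - w z$i$k$j" for i j k
    using field(5)[OF z] by eventually_elim (rule alternating_swap(2)[OF field(3)])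
  have "pd m (\<lambda>z. w z$i$j$k) z = - pd m (\<lambda>z. w z$j$i$k) z" "pd m (\<lambda>z. w z$i$j$k) z = - pd m (\<lambda>z. w z$i$k$j) z" for i j k
    using pd_cong[OF e1, of m i j k] pd_cong[OF e2, of m i j k] neg[OF d, of j i k] neg[OF d, of i k j] by simp_all
  then show ?thesis unfolding alternating_def n by blast
qed

lemma christoffel_lower:
  assumes z: "z \<in> V"
  shows "(\<Sum>l\<in>UNIV. christoffel (metric_field w) z $l$m$i * metric_field w z $l$j)
    = (pd m (metric_field w) z $i$j + pd i (metric_field w) z $m$j - pd j (metric_field w) z $m$i) / 2"
proof -
  interpret G2_tensors "w z" "metric_field w z" "matrix_inv (metric_field w z)" "psi_of (w z)" by (rule tensors[OF z])
  define Z where "Z = (\<chi> l. (pd m (metric_field w) z $i$l + pd i (metric_field w) z $m$l - pd l (metric_field w) z $m$i) / 2)"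
  have "christoffel (metric_field w) z $l$m$i = (matrix_inv (metric_field w z) *v Z)$l" for l
    by (simp add: christoffel_def Z_def matrix_vector_mult_def sum_divide_distrib)
  then show ?thesis using lower_raise[of Z j] by (simp add: Z_def)
qed

lemma nabla3_act:
  "nabla3 (metric_field w) w z $m = pd m w z - act (\<chi> i l. christoffel (metric_field w) z $l$m$i) (w z)"
  by (simp add: vec_eq_iff nabla3_def act_nth)

text \<open>The existence of the torsion. The covariant derivative of \<phi> is alternating, so it
  is the action of some matrix M. The derivative of the metric map in this direction is the
  covariant derivative of g, which vanishes; by \<open>dsf_metric_act\<close> M is skew after
  lowering, and \<open>act_antisym\<close> applies.\<close>

lemma nabla3_hook4:
  assumes z: "z \<in> V"
  obtains Y where "nabla3 (metric_field w) w z $m = hook4 Y (psi_of (w z))"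
proof -
  interpret G2_tensors "w z" "metric_field w z" "matrix_inv (metric_field w z)" "psi_of (w z)" by (rule tensors[OF z])
  let ?g = "metric_field w z" and ?G = "\<chi> i l. christoffel (metric_field w) z $l$m$i"
  let ?D = "\<lambda>i j e. dsf ND (\<lambda>w. metric_of w $i$j) e (w z)"
  have lin: "linear (?D i j)" for i j
    by (rule dsf_linear[OF open_nondegenerate sf_metric_of]) (simp add: field z)
  have alt: "alternating (nabla3 (metric_field w) w z $m)"
  proof -
    have diff: "alternating (a - b)" if "alternating a" "alternating b" for a b
    proof -
      have "(a - b)$i$j$k = - (a - b)$j$i$k" "(a - b)$i$j$k = - (a - b)$i$k$j" for i j k
        using alternating_swap(1)[OF that(1), of i j k] alternating_swap(1)[OF that(2), of i j k]
          alternating_swap(2)[OF that(1), of i j k] alternating_swap(2)[OF that(2), of i j k] by simp_all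
      then show ?thesis unfolding alternating_def by blast
    qed
    show ?thesis unfolding nabla3_act by (intro diff alternating_pd alternating_act field z)
  qed
  obtain M where M: "act M (w z) = nabla3 (metric_field w) w z $m"
    using act_surj[OF field(3)[OF z] field(4)[OF z] alt] .
  have "(\<Sum>l\<in>UNIV. M$i$l * ?g$l$j + M$j$l * ?g$i$l) = 0" for i j
  proof -
    have "(\<Sum>l\<in>UNIV. M$i$l * ?g$l$j + M$j$l * ?g$i$l) = ?D i j (act M (w z))"
      using dsf_metric_act[OF field(4)[OF z], of i j M] by (simp add: metric_field_def)
    also have "\<dots> = ?D i j (pd m w z) - ?D i j (act ?G (w z))"
      unfolding M nabla3_act by (rule linear_diff[OF lin])
    also have "?D i j (act ?G (w z)) = (\<Sum>l\<in>UNIV. ?G$i$l * ?g$l$j + ?G$j$l * ?g$i$l)"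
      using dsf_metric_act[OF field(4)[OF z], of i j ?G] by (simp add: metric_field_def)
    also have "\<dots> = pd m (metric_field w) z $i$j"
      using christoffel_lower[OF z, of m i j] christoffel_lower[OF z, of m j i]
        pd_metric_sym[OF z, of m j i] pd_metric_sym[OF z, of i m j] pd_metric_sym[OF z, of j m i]
      by (simp add: sum.distrib g_sym[of i] pd_metric_sym[OF z])
    finally show ?thesis by (simp add: pd_metric[OF z])
  qed
  then have "(M ** ?g)$j$i = - (M ** ?g)$i$j" for i j
    by (simp add: matrix_matrix_mult_def sum.distrib g_sym[of _ i] eq_neg_iff_add_eq_0 add.commute)
  then obtain Y where "act (M ** ?g ** matrix_inv ?g) (w z) = hook4 Y (psi_of (w z))"
    using act_antisym[of "M ** ?g"] by blast
  then have "act M (w z) = hook4 Y (psi_of (w z))"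
    by (simp add: gi_g_matrix flip: matrix_mul_assoc)
  then show ?thesis using that M by simp
qed

text \<open>\<open>nabla3_hook4\<close> gives existence and \<open>hook4_psi_inj\<close> uniqueness,
  so the definite description denotes; \<open>TK_hook4\<close> then extracts its components by a
  formula smooth in the form.\<close>

lemma torsion_eq:
  assumes z: "z \<in> V"
  shows "torsion w z $m$p = (\<Sum>i\<in>UNIV. \<Sum>j\<in>UNIV. \<Sum>k\<in>UNIV. TK (w z) p i j k * nabla3 (metric_field w) w z $m$i$j$k)"
proof -
  interpret G2_tensors "w z" "metric_field w z" "matrix_inv (metric_field w z)" "psi_of (w z)" by (rule tensors[OF z])
  let ?g = "metric_field w z" and ?gi = "matrix_inv (metric_field w z)" and ?N = "nabla3 (metric_field w) w z"
  have "\<exists>Y. ?N $m = hook4 Y (psi_of (w z))" for m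
    by (rule nabla3_hook4[OF z, of m]) (rule exI)
  then have "\<exists>Y. \<forall>m. ?N $m = hook4 (Y m) (psi_of (w z))"
    by (intro choice) blast
  then obtain Y where Y: "\<And>m. ?N $m = hook4 (Y m) (psi_of (w z))" by blast
  define T :: tens2 where "T = (\<chi> m. ?g *v Y m)"
  have h: "(\<Sum>p\<in>UNIV. \<Sum>q\<in>UNIV. S$m$p * ?gi$p$q * psi_of (w z) $q$i$j$k) = hook4 (?gi *v S$m) (psi_of (w z)) $i$j$k" for S :: tens2 and m i j k
    by (subst sum.swap) (simp add: hook4_def matrix_vector_mult_def sum_distrib_left sum_distrib_right gi_sym mult_ac)
  have giT: "?gi *v T$m = Y m" for m by (simp add: T_def matrix_vector_mul_assoc gi_g_matrix)
  have "torsion w z = T"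
    unfolding torsion_def h
  proof (rule the_equality)
    show "\<forall>m i j k. ?N$m$i$j$k = hook4 (?gi *v T$m) (psi_of (w z)) $i$j$k" by (simp add: giT Y)
    fix S :: tens2 assume S: "\<forall>m i j k. ?N$m$i$j$k = hook4 (?gi *v S$m) (psi_of (w z)) $i$j$k"
    have "S$m = T$m" for m
    proof -
      have "hook4 (?gi *v S$m) (psi_of (w z)) = hook4 (Y m) (psi_of (w z))"
        using S Y by (simp add: vec_eq_iff)
      then have "hook4 (?gi *v S$m + - Y m) (psi_of (w z)) = 0" unfolding hook4_add hook4_minus by simp
      then have "?gi *v S$m = Y m" using hook4_psi_inj[OF field(3)[OF z] field(4)[OF z]] by fastforce
      then have "?g *v (?gi *v S$m) = T$m" by (simp add: T_def)
      then show ?thesis by (simp add: matrix_vector_mul_assoc gi_g_matrix)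
    qed
    then show "S = T" by (simp add: vec_eq_iff)
  qed
  then have "torsion w z $m$p = (?g *v Y m)$p" by (simp add: T_def)
  then show ?thesis
    unfolding Y using TK_hook4[OF field(3)[OF z] field(4)[OF z]] by (simp add: metric_field_def)
qed

end

section \<open>Linearization at a point\<close>

definition jet2 :: "(vec7 \<Rightarrow> tens3) \<Rightarrow> vec7 \<Rightarrow> (tens3^7^7) \<times> (tens3^7) \<times> tens3" where
  "jet2 h y = ((\<chi> i j. pd i (pd j h) y), (\<chi> i. pd i h y), h y)"

text \<open>A linear function of the 2-jet evaluated here is its principal symbol: only the
  second-order slot is filled.\<close>

definition sjet :: "vec7 \<Rightarrow> tens3 \<Rightarrow> (tens3^7^7) \<times> (tens3^7) \<times> tens3" where
  "sjet \<xi> u = ((\<chi> i j. (\<xi>$i * \<xi>$j) *\<^sub>R u), 0, 0)"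

lemma alternating_add_scaleR:
  assumes "alternating a" "alternating b" shows "alternating (a + t *\<^sub>R b)"
proof -
  have "(a + t *\<^sub>R b)$i$j$k = - (a + t *\<^sub>R b)$j$i$k" "(a + t *\<^sub>R b)$i$j$k = - (a + t *\<^sub>R b)$i$k$j" for i j k
    using alternating_swap(1)[OF assms(1), of i j k] alternating_swap(1)[OF assms(2), of i j k]
      alternating_swap(2)[OF assms(1), of i j k] alternating_swap(2)[OF assms(2), of i j k] by simp_all
  then show ?thesis unfolding alternating_def by blast
qed

lemma smooth_on_differentiable:
  assumes "smooth_on S h" "z \<in> S"
  shows "h differentiable (at z)" "pd i h differentiable (at z)"
proof -
  have "\<forall>is. iter_pd is h differentiable (at z)" using assms by (simp add: smooth_on_def)
  from spec[OF this, of "[]"] spec[OF this, of "[i]"]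
  show "h differentiable (at z)" "pd i h differentiable (at z)" by simp_all
qed

lemma pd_add_scaleR:
  assumes "f differentiable (at z)" "h differentiable (at z)"
  shows "pd i (\<lambda>z. f z + t *\<^sub>R h z) z = pd i f z + t *\<^sub>R pd i h z"
  using pd_eq[OF has_derivative_add[OF pd_works[OF assms(1)] has_derivative_scaleR_right[OF pd_works[OF assms(2)]]]]
  by (simp add: pd_def)

lemma pd_mult:
  fixes f g :: "vec7 \<Rightarrow> real"
  assumes "f differentiable (at z)" "g differentiable (at z)"
  shows "pd i (\<lambda>z. f z * g z) z = f z * pd i g z + pd i f z * g z"
  using pd_eq[OF has_derivative_mult[OF pd_works[OF assms(1)] pd_works[OF assms(2)]]]
  by (simp add: pd_def)

lemma pd_add:
  assumes "f differentiable (at z)" "h differentiable (at z)"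
  shows "pd i (\<lambda>z. f z + h z) z = pd i f z + pd i h z"
  using pd_add_scaleR[OF assms, of i 1] by simp

lemma pd_const: "pd i (\<lambda>z. c) z = 0"
  by (rule pd_eq[OF has_derivative_const])

locale base =
  fixes S :: "vec7 set" and y :: vec7 and w0 :: "vec7 \<Rightarrow> tens3"
  assumes S: "open S" and y: "y \<in> S" and w0: "smooth_on S w0"
    and w0_alt: "z \<in> S \<Longrightarrow> alternating (w0 z)" and w0_nd: "z \<in> S \<Longrightarrow> nondegenerate (w0 z)"
begin

definition adm :: "(vec7 \<Rightarrow> tens3) \<Rightarrow> bool" where
  "adm h \<longleftrightarrow> smooth_on S h \<and> (\<forall>z\<in>S. alternating (h z))"

definition fam :: "(vec7 \<Rightarrow> tens3) \<Rightarrow> real \<Rightarrow> vec7 \<Rightarrow> tens3" where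
  "fam h t = (\<lambda>z. w0 z + t *\<^sub>R h z)"

lemma fam0: "fam h 0 = w0"
  by (simp add: fam_def)

lemma eventually_S: "z \<in> S \<Longrightarrow> \<forall>\<^sub>F z in nhds z. z \<in> S"
  using S by (rule eventually_nhds_in_open)

lemma pd_fam: "adm h \<Longrightarrow> z \<in> S \<Longrightarrow> pd i (fam h t) z = pd i w0 z + t *\<^sub>R pd i h z"
  unfolding fam_def adm_def by (intro pd_add_scaleR smooth_on_differentiable[of S] w0) auto

lemma pd_pd_fam:
  assumes "adm h"
  shows "pd j (fam h t) differentiable (at y)" "pd i (pd j (fam h t)) y = pd i (pd j w0) y + t *\<^sub>R pd i (pd j h) y"
proof -
  have e: "\<forall>\<^sub>F z in nhds y. pd j (fam h t) z = pd j w0 z + t *\<^sub>R pd j h z"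
    using eventually_S[OF y] by eventually_elim (rule pd_fam[OF assms])
  have d: "pd j w0 differentiable (at y)" "pd j h differentiable (at y)"
    using assms w0 y smooth_on_differentiable(2) by (auto simp: adm_def)
  then show "pd j (fam h t) differentiable (at y)" unfolding differentiable_cong[OF e]
    by (intro differentiable_add differentiable_scaleR differentiable_const)
  show "pd i (pd j (fam h t)) y = pd i (pd j w0) y + t *\<^sub>R pd i (pd j h) y"
    unfolding pd_cong[OF e] by (rule pd_add_scaleR[OF d])
qed

text \<open>Near \<open>y\<close> the form stays within r / 2 of its value and \<open>h\<close> is
  bounded by K, so |t| < r / (2 K) keeps the perturbed form within the radius r of nondegenerate
  tensors. No compactness of the manifold is involved.\<close>

lemma fam_g2field:
  assumes h: "adm h"
  shows "\<forall>\<^sub>F t in nhds 0. \<exists>V. y \<in> V \<and> g2field V (fam h t)"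
proof -
  have hs: "smooth_on S h" "\<And>z. z \<in> S \<Longrightarrow> alternating (h z)" using h by (auto simp: adm_def)
  obtain r where r: "r > 0" "\<And>u. dist u (w0 y) < r \<Longrightarrow> nondegenerate u"
    using open_nondegenerate w0_nd[OF y] unfolding open_dist by auto
  define K where "K = norm (h y) + 1"
  have K: "K > 0" by (simp add: K_def add_nonneg_pos)
  have "isCont w0 y" "isCont h y"
    using smooth_on_differentiable(1)[OF w0 y] smooth_on_differentiable(1)[OF hs(1) y]
    by (auto intro: differentiable_imp_continuous_within)
  then have lim: "(w0 \<longlongrightarrow> w0 y) (nhds y)" "((\<lambda>z. norm (h z)) \<longlongrightarrow> norm (h y)) (nhds y)"
    using tendsto_at_iff_tendsto_nhds[of w0 y] tendsto_at_iff_tendsto_nhds[of h y]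
    by (auto simp: isCont_def intro: tendsto_norm)
  have "\<forall>\<^sub>F z in nhds y. dist (w0 z) (w0 y) < r / 2" "\<forall>\<^sub>F z in nhds y. norm (h z) < K"
    by (rule tendstoD[OF lim(1)], use r(1) in simp, rule order_tendstoD(2)[OF lim(2)], simp add: K_def)
  with eventually_S[OF y] have "\<forall>\<^sub>F z in nhds y. z \<in> S \<and> dist (w0 z) (w0 y) < r / 2 \<and> norm (h z) < K"
    by eventually_elim simp
  then obtain V where V: "open V" "y \<in> V" "\<And>z. z \<in> V \<Longrightarrow> z \<in> S \<and> dist (w0 z) (w0 y) < r / 2 \<and> norm (h z) < K"
    unfolding eventually_nhds by blast
  have "\<forall>\<^sub>F t in nhds (0::real). dist t 0 < r / (2 * K)"
    using r(1) K by (intro eventually_nhds_metric[THEN iffD2] exI[of _ "r / (2 * K)"]) auto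
  then show ?thesis
  proof eventually_elim
    case (elim t)
    have "g2field V (fam h t)"
      unfolding g2field_def
    proof (intro conjI ballI allI V(1))
      fix z assume z: "z \<in> V"
      then have zS: "z \<in> S" using V(3) by simp
      note d = smooth_on_differentiable[OF w0 zS] smooth_on_differentiable[OF hs(1) zS]
      show "fam h t differentiable (at z)" unfolding fam_def
        by (intro differentiable_add differentiable_scaleR differentiable_const d)
      show "pd j (fam h t) differentiable (at z)" for j
      proof -
        have e: "\<forall>\<^sub>F z in nhds z. pd j (fam h t) z = pd j w0 z + t *\<^sub>R pd j h z"
          using eventually_S[OF zS] by eventually_elim (rule pd_fam[OF h])
        show ?thesis unfolding differentiable_cong[OF e]
          by (intro differentiable_add differentiable_scaleR differentiable_const d)
      qed
      show "alternating (fam h t z)" unfolding fam_def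
        by (intro alternating_add_scaleR w0_alt hs(2) zS)
      have "dist (fam h t z) (w0 y) \<le> dist (w0 z) (w0 y) + \<bar>t\<bar> * norm (h z)"
        unfolding fam_def dist_norm using norm_triangle_ineq[of "w0 z - w0 y" "t *\<^sub>R h z"] by (simp add: algebra_simps)
      also have "\<dots> \<le> dist (w0 z) (w0 y) + \<bar>t\<bar> * K"
        using V(3)[OF z] by (intro add_left_mono mult_left_mono) auto
      also have "\<dots> < r / 2 + r / (2 * K) * K"
        using V(3)[OF z] elim K by (intro add_strict_mono mult_strict_right_mono) auto
      also have "\<dots> = r" using K by simp
      finally show "nondegenerate (fam h t z)" by (rule r(2))
    qed
    with V(2) show ?case by blast
  qed
qed

text \<open>Bundles differentiability along all admissible families, linearity of the derivative in
  the 2-jet, and the symbol. It is stable under sums and products, so symbols can be computed along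
  the formula of an operator.\<close>

definition sym2 :: "((vec7 \<Rightarrow> tens3) \<Rightarrow> real) \<Rightarrow> (vec7 \<Rightarrow> tens3 \<Rightarrow> real) \<Rightarrow> bool" where
  "sym2 N s \<longleftrightarrow> (\<exists>L. linear L \<and> (\<forall>h. adm h \<longrightarrow> ((\<lambda>t. N (fam h t)) has_real_derivative L (jet2 h y)) (at 0))
     \<and> (\<forall>\<xi> u. s \<xi> u = L (sjet \<xi> u)))"

lemma sym2I:
  assumes "linear L" "\<And>h. adm h \<Longrightarrow> ((\<lambda>t. N (fam h t)) has_real_derivative L (jet2 h y)) (at 0)"
    "\<And>\<xi> u. s \<xi> u = L (sjet \<xi> u)"
  shows "sym2 N s"
  using assms unfolding sym2_def by blast

lemma sym2E:
  assumes "sym2 N s"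
  obtains L where "linear L" "\<And>h. adm h \<Longrightarrow> ((\<lambda>t. N (fam h t)) has_real_derivative L (jet2 h y)) (at 0)"
    "\<And>\<xi> u. s \<xi> u = L (sjet \<xi> u)"
  using assms unfolding sym2_def by blast

lemma sym2_eqI: "sym2 N s \<Longrightarrow> (\<And>\<xi> u. s \<xi> u = s' \<xi> u) \<Longrightarrow> sym2 N s'"
  by (metis ext)

lemma sym2_ev:
  assumes "sym2 N' s" and "\<And>h. adm h \<Longrightarrow> \<forall>\<^sub>F t in nhds 0. N (fam h t) = N' (fam h t)"
  shows "sym2 N s"
proof -
  obtain L where L: "linear L" "\<And>h. adm h \<Longrightarrow> ((\<lambda>t. N' (fam h t)) has_real_derivative L (jet2 h y)) (at 0)"
    "\<And>\<xi> u. s \<xi> u = L (sjet \<xi> u)" by (rule sym2E[OF assms(1)]) (rule that)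
  show ?thesis
    by (rule sym2I[OF L(1) _ L(3)]) (rule DERIV_cong_ev[THEN iffD2, OF refl assms(2) refl L(2)])
qed

text \<open>Admits identities that hold only for fields of G2-forms, such as
  \<open>torsion_eq\<close>, since the family consists of such fields near \<open>y\<close> for
  small t.\<close>

lemma sym2_near:
  assumes "sym2 N' s" and "\<And>V w. g2field V w \<Longrightarrow> y \<in> V \<Longrightarrow> N w = N' w"
  shows "sym2 N s"
proof (rule sym2_ev[OF assms(1)])
  fix h assume "adm h"
  from fam_g2field[OF this] show "\<forall>\<^sub>F t in nhds 0. N (fam h t) = N' (fam h t)"
    by eventually_elim (use assms(2) in blast)
qed

lemma sym2_const: "sym2 (\<lambda>w. c) (\<lambda>\<xi> u. 0)"
  by (rule sym2I[of "\<lambda>_. 0"]) (auto simp: linear_iff)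

lemma sym2_mult:
  assumes "sym2 N1 s1" "sym2 N2 s2"
  shows "sym2 (\<lambda>w. N1 w * N2 w) (\<lambda>\<xi> u. s1 \<xi> u * N2 w0 + N1 w0 * s2 \<xi> u)"
proof -
  obtain L1 where L1: "linear L1" "\<And>h. adm h \<Longrightarrow> ((\<lambda>t. N1 (fam h t)) has_real_derivative L1 (jet2 h y)) (at 0)"
    "\<And>\<xi> u. s1 \<xi> u = L1 (sjet \<xi> u)" by (rule sym2E[OF assms(1)]) (rule that)
  obtain L2 where L2: "linear L2" "\<And>h. adm h \<Longrightarrow> ((\<lambda>t. N2 (fam h t)) has_real_derivative L2 (jet2 h y)) (at 0)"
    "\<And>\<xi> u. s2 \<xi> u = L2 (sjet \<xi> u)" by (rule sym2E[OF assms(2)]) (rule that)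
  show ?thesis
  proof (rule sym2I[of "\<lambda>x. L1 x * N2 w0 + N1 w0 * L2 x"])
    show "linear (\<lambda>x. L1 x * N2 w0 + N1 w0 * L2 x)"
      using L1(1) L2(1) by (simp add: linear_iff algebra_simps)
    show "((\<lambda>t. N1 (fam h t) * N2 (fam h t)) has_real_derivative L1 (jet2 h y) * N2 w0 + N1 w0 * L2 (jet2 h y)) (at 0)"
      if "adm h" for h
      using DERIV_mult[OF L1(2)[OF that] L2(2)[OF that]] by (simp add: fam0 mult.commute)
  qed (simp add: L1(3) L2(3))
qed

lemma sym2_add:
  assumes "sym2 N1 s1" "sym2 N2 s2"
  shows "sym2 (\<lambda>w. N1 w + N2 w) (\<lambda>\<xi> u. s1 \<xi> u + s2 \<xi> u)"
proof -
  obtain L1 where L1: "linear L1" "\<And>h. adm h \<Longrightarrow> ((\<lambda>t. N1 (fam h t)) has_real_derivative L1 (jet2 h y)) (at 0)"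
    "\<And>\<xi> u. s1 \<xi> u = L1 (sjet \<xi> u)" by (rule sym2E[OF assms(1)]) (rule that)
  obtain L2 where L2: "linear L2" "\<And>h. adm h \<Longrightarrow> ((\<lambda>t. N2 (fam h t)) has_real_derivative L2 (jet2 h y)) (at 0)"
    "\<And>\<xi> u. s2 \<xi> u = L2 (sjet \<xi> u)" by (rule sym2E[OF assms(2)]) (rule that)
  show ?thesis
  proof (rule sym2I[of "\<lambda>x. L1 x + L2 x"])
    show "linear (\<lambda>x. L1 x + L2 x)" using L1(1) L2(1) by (rule linear_compose_add)
  qed (simp_all add: L1(2,3) L2(2,3) DERIV_add)
qed

lemma sym2_cmult: "sym2 N s \<Longrightarrow> sym2 (\<lambda>w. c * N w) (\<lambda>\<xi> u. c * s \<xi> u)"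
  by (rule sym2_eqI[OF sym2_mult[OF sym2_const]]) auto

lemma sym2_minus: "sym2 N s \<Longrightarrow> sym2 (\<lambda>w. - N w) (\<lambda>\<xi> u. - s \<xi> u)"
  using sym2_cmult[of N s "-1"] by simp

lemma sym2_diff: "sym2 N1 s1 \<Longrightarrow> sym2 N2 s2 \<Longrightarrow> sym2 (\<lambda>w. N1 w - N2 w) (\<lambda>\<xi> u. s1 \<xi> u - s2 \<xi> u)"
  using sym2_add[OF _ sym2_minus, of N1 s1 N2 s2] by simp

lemma sym2_sum:
  assumes "\<And>x. x \<in> A \<Longrightarrow> sym2 (N x) (s x)"
  shows "sym2 (\<lambda>w. \<Sum>x\<in>A. N x w) (\<lambda>\<xi> u. \<Sum>x\<in>A. s x \<xi> u)"
proof (cases "finite A")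
  case True
  then show ?thesis using assms by (induction A) (auto intro: sym2_const sym2_add)
qed (simp add: sym2_const)

lemma sym2_pd: "sym2 (\<lambda>w. pd i w y $a$b$c) (\<lambda>\<xi> u. 0)"
proof (rule sym2I[of "\<lambda>(r,q,p). q$i$a$b$c"])
  show "((\<lambda>t. pd i (fam h t) y $a$b$c) has_real_derivative (case jet2 h y of (r, q, p) \<Rightarrow> q$i$a$b$c)) (at 0)" if "adm h" for h
    unfolding pd_fam[OF that y] jet2_def by (auto intro!: derivative_eq_intros)
qed (auto simp: linear_iff sjet_def)

lemma sym2_pd_pd: "sym2 (\<lambda>w. pd i (pd j w) y $a$b$c) (\<lambda>\<xi> u. \<xi>$i * (\<xi>$j * u$a$b$c))"
proof (rule sym2I[of "\<lambda>(r,q,p). r$i$j$a$b$c"])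
  show "((\<lambda>t. pd i (pd j (fam h t)) y $a$b$c) has_real_derivative (case jet2 h y of (r, q, p) \<Rightarrow> r$i$j$a$b$c)) (at 0)" if "adm h" for h
    unfolding pd_pd_fam(2)[OF that] jet2_def by (auto intro!: derivative_eq_intros)
qed (auto simp: linear_iff sjet_def)

lemma sym2_sf:
  assumes U: "open U" "f \<in> sf U" and yU: "w0 y \<in> U"
  shows "sym2 (\<lambda>w. f (w y)) (\<lambda>\<xi> u. 0)"
proof (rule sym2I[of "\<lambda>(r,q,p). dsf U f p (w0 y)"])
  have lin: "linear (\<lambda>e. dsf U f e (w0 y))" by (rule dsf_linear[OF U yU])
  then show "linear (\<lambda>(r::tens3^7^7,q::tens3^7,p). dsf U f p (w0 y))" by (auto simp: linear_iff)
  show "(0::real) = (case sjet \<xi> u of (r, q, p) \<Rightarrow> dsf U f p (w0 y))" for \<xi> u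
    using linear_0[OF lin] by (simp add: sjet_def)
  fix h
  have "((\<lambda>t. w0 y + t *\<^sub>R h y) has_derivative (\<lambda>t. t *\<^sub>R h y)) (at 0)"
    by (auto intro!: derivative_eq_intros)
  from has_derivative_compose[OF this, of f "\<lambda>e. dsf U f e (w0 y)"] dsf(2)[OF U yU]
  have "((\<lambda>t. f (fam h t y)) has_derivative (\<lambda>t. dsf U f (t *\<^sub>R h y) (w0 y))) (at 0)"
    by (simp add: fam_def)
  then show "((\<lambda>t. f (fam h t y)) has_real_derivative (case jet2 h y of (r, q, p) \<Rightarrow> dsf U f p (w0 y))) (at 0)"
    unfolding linear_scale[OF lin] jet2_def has_field_derivative_def
    by (simp only: real_scaleR_def prod.case mult_commute_abs)
qed

text \<open>Quantities of differential order at most one: their value has no second-order symbol,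
  and s is their first-order symbol, visible after one further derivative. The product rule for s
  involves only values at \<open>w0\<close>.\<close>

definition ord1 :: "((vec7 \<Rightarrow> tens3) \<Rightarrow> vec7 \<Rightarrow> real) \<Rightarrow> (vec7 \<Rightarrow> tens3 \<Rightarrow> real) \<Rightarrow> bool" where
  "ord1 F s \<longleftrightarrow> (\<forall>h. adm h \<longrightarrow> (\<forall>\<^sub>F t in nhds 0. F (fam h t) differentiable (at y)))
     \<and> sym2 (\<lambda>w. F w y) (\<lambda>\<xi> u. 0) \<and> (\<forall>i. sym2 (\<lambda>w. pd i (F w) y) (\<lambda>\<xi> u. \<xi>$i * s \<xi> u))"

lemma ord1_diff: "ord1 F s \<Longrightarrow> adm h \<Longrightarrow> \<forall>\<^sub>F t in nhds 0. F (fam h t) differentiable (at y)"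
  and ord1_val: "ord1 F s \<Longrightarrow> sym2 (\<lambda>w. F w y) (\<lambda>\<xi> u. 0)"
  and ord1_pd: "ord1 F s \<Longrightarrow> sym2 (\<lambda>w. pd i (F w) y) (\<lambda>\<xi> u. \<xi>$i * s \<xi> u)"
  by (auto simp: ord1_def)

lemma ord1_eqI: "ord1 F s \<Longrightarrow> (\<And>\<xi> u. s \<xi> u = s' \<xi> u) \<Longrightarrow> ord1 F s'"
  by (metis ext)

lemma ord1_near:
  assumes F': "ord1 F' s" and eq: "\<And>V w z. g2field V w \<Longrightarrow> z \<in> V \<Longrightarrow> F w z = F' w z"
  shows "ord1 F s"
  unfolding ord1_def
proof (intro conjI allI impI)
  have ev: "\<forall>\<^sub>F z in nhds y. F w z = F' w z" if "g2field V w" "y \<in> V" for V w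
  proof -
    have "\<forall>\<^sub>F z in nhds y. z \<in> V" using that by (intro eventually_nhds_in_open) (auto simp: g2field_def)
    then show ?thesis by eventually_elim (rule eq[OF that(1)])
  qed
  show "sym2 (\<lambda>w. F w y) (\<lambda>\<xi> u. 0)"
    by (rule sym2_near[OF ord1_val[OF F']]) (rule eq)
  show "sym2 (\<lambda>w. pd i (F w) y) (\<lambda>\<xi> u. \<xi>$i * s \<xi> u)" for i
    by (rule sym2_near[OF ord1_pd[OF F']]) (rule pd_cong[OF ev])
  fix h assume h: "adm h"
  from ord1_diff[OF F' h] fam_g2field[OF h] show "\<forall>\<^sub>F t in nhds 0. F (fam h t) differentiable (at y)"
    by eventually_elim (use differentiable_cong[OF ev] in blast)
qed

lemma ord1_mult:
  assumes F: "ord1 F s" and G: "ord1 G s'"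
  shows "ord1 (\<lambda>w z. F w z * G w z) (\<lambda>\<xi> u. s \<xi> u * G w0 y + F w0 y * s' \<xi> u)"
  unfolding ord1_def
proof (intro conjI allI impI)
  fix h assume h: "adm h"
  from ord1_diff[OF F h] ord1_diff[OF G h]
  show "\<forall>\<^sub>F t in nhds 0. (\<lambda>z. F (fam h t) z * G (fam h t) z) differentiable (at y)"
    by eventually_elim (rule differentiable_mult)
next
  show "sym2 (\<lambda>w. F w y * G w y) (\<lambda>\<xi> u. 0)"
    by (rule sym2_eqI[OF sym2_mult[OF ord1_val[OF F] ord1_val[OF G]]]) simp
  show "sym2 (\<lambda>w. pd i (\<lambda>z. F w z * G w z) y) (\<lambda>\<xi> u. \<xi>$i * (s \<xi> u * G w0 y + F w0 y * s' \<xi> u))" for i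
  proof (rule sym2_ev)
    show "sym2 (\<lambda>w. F w y * pd i (G w) y + pd i (F w) y * G w y) (\<lambda>\<xi> u. \<xi>$i * (s \<xi> u * G w0 y + F w0 y * s' \<xi> u))"
      by (rule sym2_eqI[OF sym2_add[OF sym2_mult[OF ord1_val[OF F] ord1_pd[OF G]] sym2_mult[OF ord1_pd[OF F] ord1_val[OF G]]]])
        (simp add: algebra_simps)
    fix h assume h: "adm h"
    from ord1_diff[OF F h] ord1_diff[OF G h]
    show "\<forall>\<^sub>F t in nhds 0. pd i (\<lambda>z. F (fam h t) z * G (fam h t) z) y
        = F (fam h t) y * pd i (G (fam h t)) y + pd i (F (fam h t)) y * G (fam h t) y"
      by eventually_elim (rule pd_mult)
  qed
qed

lemma ord1_add:
  assumes F: "ord1 F s" and G: "ord1 G s'"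
  shows "ord1 (\<lambda>w z. F w z + G w z) (\<lambda>\<xi> u. s \<xi> u + s' \<xi> u)"
  unfolding ord1_def
proof (intro conjI allI impI)
  fix h assume h: "adm h"
  from ord1_diff[OF F h] ord1_diff[OF G h]
  show "\<forall>\<^sub>F t in nhds 0. (\<lambda>z. F (fam h t) z + G (fam h t) z) differentiable (at y)"
    by eventually_elim (rule differentiable_add)
next
  show "sym2 (\<lambda>w. F w y + G w y) (\<lambda>\<xi> u. 0)"
    by (rule sym2_eqI[OF sym2_add[OF ord1_val[OF F] ord1_val[OF G]]]) simp
  show "sym2 (\<lambda>w. pd i (\<lambda>z. F w z + G w z) y) (\<lambda>\<xi> u. \<xi>$i * (s \<xi> u + s' \<xi> u))" for i
  proof (rule sym2_ev)
    show "sym2 (\<lambda>w. pd i (F w) y + pd i (G w) y) (\<lambda>\<xi> u. \<xi>$i * (s \<xi> u + s' \<xi> u))"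
      by (rule sym2_eqI[OF sym2_add[OF ord1_pd[OF F] ord1_pd[OF G]]]) (simp add: algebra_simps)
    fix h assume h: "adm h"
    from ord1_diff[OF F h] ord1_diff[OF G h]
    show "\<forall>\<^sub>F t in nhds 0. pd i (\<lambda>z. F (fam h t) z + G (fam h t) z) y = pd i (F (fam h t)) y + pd i (G (fam h t)) y"
      by eventually_elim (rule pd_add)
  qed
qed

lemma ord1_fixed: "f differentiable (at y) \<Longrightarrow> ord1 (\<lambda>w z. f z) (\<lambda>\<xi> u. 0)"
  unfolding ord1_def using sym2_const by auto

lemma ord1_cmult: "ord1 F s \<Longrightarrow> ord1 (\<lambda>w z. c * F w z) (\<lambda>\<xi> u. c * s \<xi> u)"
  by (rule ord1_eqI[OF ord1_mult[OF ord1_fixed[OF differentiable_const]]]) auto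

lemma ord1_minus: "ord1 F s \<Longrightarrow> ord1 (\<lambda>w z. - F w z) (\<lambda>\<xi> u. - s \<xi> u)"
  using ord1_cmult[of F s "-1"] by simp

lemma ord1_sub: "ord1 F s \<Longrightarrow> ord1 G s' \<Longrightarrow> ord1 (\<lambda>w z. F w z - G w z) (\<lambda>\<xi> u. s \<xi> u - s' \<xi> u)"
  using ord1_add[OF _ ord1_minus, of F s G s'] by simp

lemma ord1_divide: "ord1 F s \<Longrightarrow> ord1 (\<lambda>w z. F w z / c) (\<lambda>\<xi> u. s \<xi> u / c)"
  using ord1_cmult[of F s "1/c"] by simp

lemma ord1_sum:
  assumes "\<And>x. x \<in> A \<Longrightarrow> ord1 (F x) (s x)"
  shows "ord1 (\<lambda>w z. \<Sum>x\<in>A. F x w z) (\<lambda>\<xi> u. \<Sum>x\<in>A. s x \<xi> u)"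
proof (cases "finite A")
  case True
  then show ?thesis using assms
    by (induction A) (auto intro: ord1_fixed[OF differentiable_const] ord1_add)
qed (simp add: ord1_fixed[OF differentiable_const])

end

section \<open>The symbol of the gauge-fixed operator\<close>

definition basis3 :: "7 \<Rightarrow> 7 \<Rightarrow> 7 \<Rightarrow> tens3" where
  "basis3 a b c = axis a (axis b (axis c 1))"

lemma linear_basis3:
  fixes f :: "tens3 \<Rightarrow> real"
  assumes f: "linear f"
  shows "f u = (\<Sum>a\<in>UNIV. \<Sum>b\<in>UNIV. \<Sum>c\<in>UNIV. u$a$b$c * f (basis3 a b c))"
proof -
  have ax: "axis i x $ j = (if i = j then x else 0)" for i j and x :: "'b::zero" by (simp add: axis_def)
  have z: "(if P then x else 0) $ j = (if P then x $ j else 0)" for P and x :: "'b::zero^7" and j by simp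
  have s: "(\<Sum>x\<in>A. if P then f x else 0) = (if P then (\<Sum>x\<in>A. f x) else 0)" for P and A :: "7 set" and f :: "7 \<Rightarrow> real"
    by simp
  have "u = (\<Sum>a\<in>UNIV. \<Sum>b\<in>UNIV. \<Sum>c\<in>UNIV. u$a$b$c *\<^sub>R basis3 a b c)"
    by (simp add: vec_eq_iff basis3_def ax z s if_distrib[of "\<lambda>x. _ * x"] cong: if_cong)
  then have "f u = f (\<Sum>a\<in>UNIV. \<Sum>b\<in>UNIV. \<Sum>c\<in>UNIV. u$a$b$c *\<^sub>R basis3 a b c)" by simp
  then show ?thesis by (simp add: linear_sum[OF f] linear_scale[OF f])
qed

lemma eventually_all_7: "(\<And>a::7. eventually (P a) F) \<Longrightarrow> eventually (\<lambda>t. \<forall>a. P a t) F"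
  by (rule eventually_all_finite)

context base
begin

lemma w0_V: "g2field S w0"
  using S smooth_on_differentiable[OF w0] w0_alt w0_nd by (auto simp: g2field_def)

lemma ord1_const: "ord1 (\<lambda>w z. c) (\<lambda>\<xi> u. 0)"
  by (rule ord1_fixed[OF differentiable_const])

lemma ord1_sf:
  assumes U: "open U" "f \<in> sf U" and yU: "w0 y \<in> U"
  shows "ord1 (\<lambda>w z. f (w z)) (\<lambda>\<xi> u. 0)"
  unfolding ord1_def
proof (intro conjI allI impI)
  have ev: "\<forall>\<^sub>F t in nhds 0. fam h t differentiable (at y) \<and> fam h t y \<in> U" if h: "adm h" for h
  proof -
    have "((\<lambda>t. w0 y + t *\<^sub>R h y) \<longlongrightarrow> w0 y + 0 *\<^sub>R h y) (nhds 0)"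
      by (intro tendsto_intros filterlim_ident)
    then have "\<forall>\<^sub>F t in nhds 0. fam h t y \<in> U" using U(1) yU by (auto simp: fam_def dest: topological_tendstoD)
    with fam_g2field[OF h] show ?thesis by eventually_elim (auto simp: g2field_def)
  qed
  show "\<forall>\<^sub>F t in nhds 0. (\<lambda>z. f (fam h t z)) differentiable (at y)" if "adm h" for h
    using ev[OF that] by eventually_elim (blast intro: sf_field(1)[OF U])
  show "sym2 (\<lambda>w. f (w y)) (\<lambda>\<xi> u. 0)" by (rule sym2_sf[OF U yU])
  fix i
  \<comment> \<open>A directional derivative belongs to \<open>sf U\<close> only for a fixed
    direction; the direction \<open>pd i w y\<close> depends on w and is therefore expanded in the
    basis.\<close>
  have N: "sym2 (\<lambda>w. \<Sum>a\<in>UNIV. \<Sum>b\<in>UNIV. \<Sum>c\<in>UNIV. pd i w y$a$b$c * dsf U f (basis3 a b c) (w y)) (\<lambda>\<xi> u. \<xi>$i * 0)"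
    by (rule sym2_eqI, ((rule sym2_sum sym2_mult sym2_pd sym2_sf[OF U(1) dsf(1)[OF U] yU])+)[1], simp)
  show "sym2 (\<lambda>w. pd i (\<lambda>z. f (w z)) y) (\<lambda>\<xi> u. \<xi>$i * 0)"
  proof (rule sym2_ev[OF N])
    fix h assume "adm h"
    from ev[OF this] show "\<forall>\<^sub>F t in nhds 0. pd i (\<lambda>z. f (fam h t z)) y
      = (\<Sum>a\<in>UNIV. \<Sum>b\<in>UNIV. \<Sum>c\<in>UNIV. pd i (fam h t) y$a$b$c * dsf U f (basis3 a b c) (fam h t y))"
    proof eventually_elim
      case (elim t)
      then have d: "fam h t differentiable (at y)" and yt: "fam h t y \<in> U" by auto
      show ?case unfolding sf_field(2)[OF U d yt] by (rule linear_basis3[OF dsf_linear[OF U yt]])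
    qed
  qed
qed

lemma w0_ND: "w0 y \<in> ND"
  using w0_nd[OF y] by simp

lemmas ord1_ND = ord1_sf[OF open_nondegenerate _ w0_ND]

lemma ord1_TK: "ord1 (\<lambda>w z. TK (w z) p i j k) (\<lambda>\<xi> u. 0)"
  by (rule ord1_sf[OF open_NG sf_TK alternating_NG[OF w0_alt[OF y] w0_nd[OF y]]])

lemma ord1_nth: "ord1 (\<lambda>w z. w z$i$j$k) (\<lambda>\<xi> u. 0)"
  by (rule ord1_ND[OF sf_nth])

lemma ord1_metric: "ord1 (\<lambda>w z. metric_field w z$i$j) (\<lambda>\<xi> u. 0)"
  unfolding metric_field_def by (rule ord1_ND[OF sf_metric_of])

lemma ord1_inv: "ord1 (\<lambda>w z. matrix_inv (metric_field w z)$i$j) (\<lambda>\<xi> u. 0)"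
  unfolding metric_field_def by (rule ord1_ND[OF sf_metric_inv])

lemma ord1_psi: "ord1 (\<lambda>w z. psi_of (w z)$i$j$k$l) (\<lambda>\<xi> u. 0)"
  by (rule ord1_ND[OF sf_psi_of])

lemma ord1_raise: "ord1 (\<lambda>w z. raise12 (metric_field w z) (w z)$i$j$k) (\<lambda>\<xi> u. 0)"
  unfolding raise12_def vec_lambda_beta
  by (rule ord1_eqI, ((rule ord1_sum ord1_mult ord1_inv ord1_nth)+)[1], simp)

lemma ord1_pd_nth: "ord1 (\<lambda>w z. pd m w z$a$b$c) (\<lambda>\<xi> u. \<xi>$m * u$a$b$c)"
  unfolding ord1_def
proof (intro conjI allI impI)
  show "\<forall>\<^sub>F t in nhds 0. (\<lambda>z. pd m (fam h t) z$a$b$c) differentiable (at y)" if "adm h" for h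
    by (intro always_eventually allI differentiable_nth pd_pd_fam that)
  show "sym2 (\<lambda>w. pd m w y$a$b$c) (\<lambda>\<xi> u. 0)" by (rule sym2_pd)
  show "sym2 (\<lambda>w. pd i (\<lambda>z. pd m w z$a$b$c) y) (\<lambda>\<xi> u. \<xi>$i * (\<xi>$m * u$a$b$c))" for i
    by (rule sym2_near[OF sym2_pd_pd]) (simp add: pd_nth differentiable_nth g2field_def)
qed

text \<open>The first variation of the metric at the base form; it is 2 h on
  \<open>form_of_pair\<close> of (h, X), by \<open>dsf_metric_form_of_pair\<close>.\<close>

definition K :: "tens3 \<Rightarrow> tens2" where
  "K u = (\<chi> i j. dsf ND (\<lambda>w. metric_of w$i$j) u (w0 y))"

lemma ord1_pd_metric: "ord1 (\<lambda>w z. pd m (metric_field w) z$i$j) (\<lambda>\<xi> u. \<xi>$m * K u$i$j)"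
proof (rule ord1_near)
  have lin: "linear (\<lambda>u. dsf ND (\<lambda>w. metric_of w$i$j) u p)" if "p \<in> ND" for p
    by (rule dsf_linear[OF open_nondegenerate sf_metric_of that])
  show "pd m (metric_field w) z$i$j
      = (\<Sum>a\<in>UNIV. \<Sum>b\<in>UNIV. \<Sum>c\<in>UNIV. pd m w z$a$b$c * dsf ND (\<lambda>w. metric_of w$i$j) (basis3 a b c) (w z))"
    if "g2field V w" "z \<in> V" for V w z
  proof -
    have "w z \<in> ND" using that by (simp add: g2field_def)
    from linear_basis3[OF lin[OF this]] show ?thesis
      unfolding g2_field.pd_metric[OF g2_field.intro[OF that(1)] that(2)] .
  qed
  have Ke: "K u$i$j = (\<Sum>a\<in>UNIV. \<Sum>b\<in>UNIV. \<Sum>c\<in>UNIV. u$a$b$c * dsf ND (\<lambda>w. metric_of w$i$j) (basis3 a b c) (w0 y))" for u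
    unfolding K_def vec_lambda_beta by (rule linear_basis3[OF lin[OF w0_ND]])
  have "ord1 (\<lambda>w z. dsf ND (\<lambda>w. metric_of w$i$j) e (w z)) (\<lambda>\<xi> u. 0)" for e
    by (rule ord1_ND[OF dsf(1)[OF open_nondegenerate sf_metric_of]])
  note leaf = this
  show "ord1 (\<lambda>w z. \<Sum>a\<in>UNIV. \<Sum>b\<in>UNIV. \<Sum>c\<in>UNIV. pd m w z$a$b$c * dsf ND (\<lambda>w. metric_of w$i$j) (basis3 a b c) (w z))
    (\<lambda>\<xi> u. \<xi>$m * K u$i$j)"
    by (rule ord1_eqI, ((rule ord1_sum ord1_mult ord1_pd_nth leaf)+)[1])
      (simp add: Ke sum_distrib_left mult.assoc)
qed

lemma ord1_differentiable1:
  assumes "\<And>a. ord1 (\<lambda>w z. F w z$a) (s a)" "adm h"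
  shows "\<forall>\<^sub>F t in nhds 0. (\<lambda>z. F (fam h t) z :: vec7) differentiable (at y)"
  using eventually_all_7[OF ord1_diff[OF assms]]
  by eventually_elim (rule differentiable_vecI, erule spec)

lemma ord1_differentiable2:
  assumes "\<And>a b. ord1 (\<lambda>w z. F w z$a$b) (s a b)" "adm h"
  shows "\<forall>\<^sub>F t in nhds 0. (\<lambda>z. F (fam h t) z :: tens2) differentiable (at y)"
  using eventually_all_7[OF ord1_differentiable1[OF assms]]
  by eventually_elim (rule differentiable_vecI, erule spec)

lemma ord1_differentiable3:
  assumes "\<And>a b c. ord1 (\<lambda>w z. F w z$a$b$c) (s a b c)" "adm h"
  shows "\<forall>\<^sub>F t in nhds 0. (\<lambda>z. F (fam h t) z :: tens3) differentiable (at y)"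
  using eventually_all_7[OF ord1_differentiable2[OF assms]]
  by eventually_elim (rule differentiable_vecI, erule spec)

lemma sym2_pd1:
  assumes "\<And>a. ord1 (\<lambda>w z. F w z$a) (s a)"
  shows "sym2 (\<lambda>w. pd i (\<lambda>z. F w z :: vec7) y$a) (\<lambda>\<xi> u. \<xi>$i * s a \<xi> u)"
proof (rule sym2_ev[OF ord1_pd[OF assms]])
  show "\<forall>\<^sub>F t in nhds 0. pd i (\<lambda>z. F (fam h t) z) y$a = pd i (\<lambda>z. F (fam h t) z$a) y" if "adm h" for h
    using ord1_differentiable1[of F, OF assms that] by eventually_elim (simp add: pd_nth differentiable_nth)
qed

lemma sym2_pd2:
  assumes "\<And>a b. ord1 (\<lambda>w z. F w z$a$b) (s a b)"
  shows "sym2 (\<lambda>w. pd i (\<lambda>z. F w z :: tens2) y$a$b) (\<lambda>\<xi> u. \<xi>$i * s a b \<xi> u)"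
proof (rule sym2_ev[OF ord1_pd[OF assms]])
  show "\<forall>\<^sub>F t in nhds 0. pd i (\<lambda>z. F (fam h t) z) y$a$b = pd i (\<lambda>z. F (fam h t) z$a$b) y" if "adm h" for h
    using ord1_differentiable2[of F, OF assms that] by eventually_elim (simp add: pd_nth differentiable_nth)
qed

lemma sym2_pd3:
  assumes "\<And>a b c. ord1 (\<lambda>w z. F w z$a$b$c) (s a b c)"
  shows "sym2 (\<lambda>w. pd i (\<lambda>z. F w z :: tens3) y$a$b$c) (\<lambda>\<xi> u. \<xi>$i * s a b c \<xi> u)"
proof (rule sym2_ev[OF ord1_pd[OF assms]])
  show "\<forall>\<^sub>F t in nhds 0. pd i (\<lambda>z. F (fam h t) z) y$a$b$c = pd i (\<lambda>z. F (fam h t) z$a$b$c) y" if "adm h" for h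
    using ord1_differentiable3[of F, OF assms that] by eventually_elim (simp add: pd_nth differentiable_nth)
qed

section \<open>Symbols of the individual terms for an arbitrary variation\<close>

abbreviation "\<phi> \<equiv> w0 y"
abbreviation "g \<equiv> metric_field w0 y"
abbreviation "gi \<equiv> matrix_inv (metric_field w0 y)"
abbreviation "\<psi> \<equiv> psi_of (w0 y)"

definition CH :: "vec7 \<Rightarrow> tens3 \<Rightarrow> tens3" where
  "CH \<xi> u = (\<chi> k i j. (\<Sum>l\<in>UNIV. gi$k$l * (\<xi>$i * K u$j$l + \<xi>$j * K u$i$l - \<xi>$l * K u$i$j)) / 2)"

lemma ord1_christoffel: "ord1 (\<lambda>w z. christoffel (metric_field w) z$k$i$j) (\<lambda>\<xi> u. CH \<xi> u$k$i$j)"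
  unfolding christoffel_def vec_lambda_beta
  by (rule ord1_eqI, ((rule ord1_divide ord1_sum ord1_add ord1_sub ord1_mult ord1_inv ord1_pd_metric)+)[1])
    (simp add: CH_def)

definition NB :: "vec7 \<Rightarrow> tens3 \<Rightarrow> tens4" where
  "NB \<xi> u = (\<chi> m i j k. \<xi>$m * u$i$j$k - (\<Sum>l\<in>UNIV.
      CH \<xi> u$l$m$i * \<phi>$l$j$k + CH \<xi> u$l$m$j * \<phi>$i$l$k + CH \<xi> u$l$m$k * \<phi>$i$j$l))"

lemma ord1_nabla3: "ord1 (\<lambda>w z. nabla3 (metric_field w) w z$m$i$j$k) (\<lambda>\<xi> u. NB \<xi> u$m$i$j$k)"
  unfolding nabla3_def vec_lambda_beta
  by (rule ord1_eqI, ((rule ord1_sum ord1_add ord1_sub ord1_mult ord1_christoffel ord1_nth ord1_pd_nth)+)[1])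
    (simp add: NB_def)

definition TO :: "vec7 \<Rightarrow> tens3 \<Rightarrow> tens2" where
  "TO \<xi> u = (\<chi> m p. \<Sum>i\<in>UNIV. \<Sum>j\<in>UNIV. \<Sum>k\<in>UNIV. TK \<phi> p i j k * NB \<xi> u$m$i$j$k)"

lemma ord1_torsion: "ord1 (\<lambda>w z. torsion w z$m$p) (\<lambda>\<xi> u. TO \<xi> u$m$p)"
proof (rule ord1_near[OF _ g2_field.torsion_eq[OF g2_field.intro]])
  show "ord1 (\<lambda>w z. \<Sum>i\<in>UNIV. \<Sum>j\<in>UNIV. \<Sum>k\<in>UNIV. TK (w z) p i j k * nabla3 (metric_field w) w z$m$i$j$k)
    (\<lambda>\<xi> u. TO \<xi> u$m$p)"
    by (rule ord1_eqI, ((rule ord1_sum ord1_mult ord1_TK ord1_nabla3)+)[1]) (simp add: TO_def)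
qed

definition SV :: "vec7 \<Rightarrow> tens3 \<Rightarrow> vec7" where
  "SV \<xi> u = gi *v (\<chi> k. \<Sum>i\<in>UNIV. \<Sum>j\<in>UNIV. TO \<xi> u$i$j * raise12 g \<phi>$i$j$k)"

lemma ord1_VT: "ord1 (\<lambda>w z. VT w z$k) (\<lambda>\<xi> u. SV \<xi> u$k)"
  unfolding VT_def sharp_def matrix_vector_mult_def vec_lambda_beta
  by (rule ord1_eqI, ((rule ord1_sum ord1_mult ord1_inv ord1_torsion ord1_raise)+)[1])
    (simp add: SV_def matrix_vector_mult_def)

definition WW :: "real \<Rightarrow> vec7 \<Rightarrow> tens3 \<Rightarrow> vec7" where
  "WW a \<xi> u = (\<chi> k. \<Sum>i\<in>UNIV. \<Sum>j\<in>UNIV. gi$i$j * CH \<xi> u$k$i$j) - (2 * a) *\<^sub>R SV \<xi> u"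

lemma ord1_W: "ord1 (\<lambda>w z. W_local a w w0 z$k) (\<lambda>\<xi> u. WW a \<xi> u$k)"
proof -
  have fixed: "ord1 (\<lambda>w z. christoffel (metric_field w0) z$k$i$j) (\<lambda>\<xi> u. 0)" for k i j
  proof (rule ord1_fixed)
    \<comment> \<open>The background connection does not vary. Its differentiability is read off
      from \<open>ord1_christoffel\<close> along the constant family.\<close>
    have "adm (\<lambda>z. 0)"
    proof -
      have "pd i (\<lambda>z. 0::tens3) = (\<lambda>z. 0)" for i
        by (rule ext) (rule pd_const)
      then have "iter_pd is (\<lambda>z::vec7. 0::tens3) = (\<lambda>z. 0)" for "is"
        by (induction "is") simp_all
      then show ?thesis by (simp add: adm_def smooth_on_def alternating_def)
    qed
    from eventually_nhds_x_imp_x[OF ord1_diff[OF ord1_christoffel this]]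
    show "(\<lambda>z. christoffel (metric_field w0) z$k$i$j) differentiable (at y)" by (simp add: fam0)
  qed
  show ?thesis
    unfolding W_local_def vec_lambda_beta vector_minus_component vector_scaleR_component real_scaleR_def
    by (rule ord1_eqI, ((rule ord1_sum ord1_sub ord1_mult ord1_const ord1_inv fixed ord1_christoffel ord1_VT)+)[1])
      (simp add: WW_def)
qed

definition RM :: "vec7 \<Rightarrow> tens3 \<Rightarrow> tens4" where
  "RM \<xi> u = (\<chi> i j k l. \<Sum>m\<in>UNIV. g$m$l * (\<xi>$i * CH \<xi> u$m$j$k - \<xi>$j * CH \<xi> u$m$i$k))"

lemma sym2_riemann: "sym2 (\<lambda>w. riemann (metric_field w) y$i$j$k$l) (\<lambda>\<xi> u. RM \<xi> u$i$j$k$l)"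
  unfolding riemann_def vec_lambda_beta
  by (rule sym2_eqI, ((rule sym2_sum sym2_add sym2_diff sym2_mult ord1_val[OF ord1_metric]
      ord1_val[OF ord1_christoffel] sym2_pd3[OF ord1_christoffel])+)[1]) (simp add: RM_def)

definition RC :: "vec7 \<Rightarrow> tens3 \<Rightarrow> tens2" where
  "RC \<xi> u = (\<chi> j k. \<Sum>l\<in>UNIV. \<Sum>m\<in>UNIV. gi$l$m * RM \<xi> u$l$j$k$m)"

lemma sym2_ricci: "sym2 (\<lambda>w. ricci (metric_field w) y$j$k) (\<lambda>\<xi> u. RC \<xi> u$j$k)"
  unfolding ricci_def vec_lambda_beta
  by (rule sym2_eqI, ((rule sym2_sum sym2_mult ord1_val[OF ord1_inv] sym2_riemann)+)[1]) (simp add: RC_def)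

definition FF :: "vec7 \<Rightarrow> tens3 \<Rightarrow> tens2" where
  "FF \<xi> u = (\<chi> p q. \<Sum>i\<in>UNIV. \<Sum>j\<in>UNIV. \<Sum>k\<in>UNIV. \<Sum>l\<in>UNIV.
     RM \<xi> u$i$j$k$l * raise12 g \<phi>$i$j$p * raise12 g \<phi>$k$l$q)"

lemma sym2_F: "sym2 (\<lambda>w. F_tensor w y$p$q) (\<lambda>\<xi> u. FF \<xi> u$p$q)"
  unfolding F_tensor_def Let_def vec_lambda_beta
  by (rule sym2_eqI, ((rule sym2_sum sym2_mult ord1_val[OF ord1_raise] sym2_riemann)+)[1]) (simp add: FF_def)

definition LL :: "vec7 \<Rightarrow> tens3 \<Rightarrow> tens2" where
  "LL \<xi> u = (\<chi> i j. \<Sum>l\<in>UNIV. \<xi>$i * SV \<xi> u$l * g$l$j + \<xi>$j * SV \<xi> u$l * g$i$l)"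

lemma sym2_lie2: "sym2 (\<lambda>w. lie2 (VT w) (metric_field w) y$i$j) (\<lambda>\<xi> u. LL \<xi> u$i$j)"
  unfolding lie2_def vec_lambda_beta
  by (rule sym2_eqI, ((rule sym2_sum sym2_add sym2_mult ord1_val[OF ord1_metric] ord1_val[OF ord1_VT]
      ord1_val[OF ord1_pd_metric] sym2_pd1[OF ord1_VT])+)[1]) (simp add: LL_def)

lemma sym2_divergence:
  assumes B: "\<And>i j. ord1 (\<lambda>w z. B w z$i$j) (s i j)"
  shows "sym2 (\<lambda>w. divergence2 (metric_field w) (\<lambda>z. B w z) y$k) (\<lambda>\<xi> u. \<Sum>i\<in>UNIV. \<Sum>j\<in>UNIV. gi$i$j * (\<xi>$i * s j k \<xi> u))"
  unfolding divergence2_def nabla2_def vec_lambda_beta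
  by (rule sym2_eqI, ((rule sym2_sum sym2_add sym2_diff sym2_mult ord1_val[OF ord1_inv]
      ord1_val[OF ord1_christoffel] ord1_val[OF B] sym2_pd2[OF B])+)[1]) simp

lemma ord1_torsion_transpose: "ord1 (\<lambda>w z. transpose (torsion w z)$p$m) (\<lambda>\<xi> u. TO \<xi> u$m$p)"
  unfolding transpose_def vec_lambda_beta by (rule ord1_torsion)

lemma sym2_lie3:
  "sym2 (\<lambda>w. lie3 (W_local a w w0) w y$i$j$k) (\<lambda>\<xi> u. act (\<chi> i l. \<xi>$i * WW a \<xi> u$l) \<phi>$i$j$k)"
  unfolding lie3_def vec_lambda_beta
  by (rule sym2_eqI, ((rule sym2_sum sym2_add sym2_mult ord1_val[OF ord1_W]
      sym2_pd ord1_val[OF ord1_nth] sym2_pd1[OF ord1_W])+)[1]) (simp add: act_nth)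

definition Qsym :: "real \<Rightarrow> real \<Rightarrow> real \<Rightarrow> real \<Rightarrow> vec7 \<Rightarrow> tens3 \<Rightarrow> tens3" where
  "Qsym a l b1 b2 \<xi> u = diamond g (- RC \<xi> u + a *\<^sub>R LL \<xi> u + l *\<^sub>R FF \<xi> u) \<phi>
    + hook4 (sharp g (b1 *\<^sub>R (\<chi> k. \<Sum>i\<in>UNIV. \<Sum>j\<in>UNIV. gi$i$j * (\<xi>$i * TO \<xi> u$j$k))
        + b2 *\<^sub>R (\<chi> k. \<Sum>i\<in>UNIV. \<Sum>j\<in>UNIV. gi$i$j * (\<xi>$i * TO \<xi> u$k$j)))) \<psi>
    + act (\<chi> i l. \<xi>$i * WW a \<xi> u$l) \<phi>"

lemma sym2_Q:
  "sym2 (\<lambda>w. (P_local a l b1 b2 w y + lie3 (W_local a w w0) w y)$i$j$k) (\<lambda>\<xi> u. Qsym a l b1 b2 \<xi> u$i$j$k)"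
proof -
  note comps = vec_lambda_beta vector_add_component vector_minus_component vector_uminus_component
    vector_scaleR_component real_scaleR_def
  have M: "sym2 (\<lambda>w. ((- ricci (metric_field w) y + a *\<^sub>R lie2 (VT w) (metric_field w) y + l *\<^sub>R F_tensor w y) **
        matrix_inv (metric_field w y))$i$p)
      (\<lambda>\<xi> u. ((- RC \<xi> u + a *\<^sub>R LL \<xi> u + l *\<^sub>R FF \<xi> u) ** gi)$i$p)" for i p
    unfolding matrix_matrix_mult_def comps
    by (rule sym2_eqI, ((rule sym2_sum sym2_add sym2_minus sym2_mult sym2_const ord1_val[OF ord1_inv]
        sym2_ricci sym2_lie2 sym2_F)+)[1]) simp
  have d: "sym2 (\<lambda>w. (b1 *\<^sub>R divergence2 (metric_field w) (torsion w) y
          + b2 *\<^sub>R divergence2 (metric_field w) (\<lambda>z. transpose (torsion w z)) y)$k)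
      (\<lambda>\<xi> u. (b1 *\<^sub>R (\<chi> k. \<Sum>i\<in>UNIV. \<Sum>j\<in>UNIV. gi$i$j * (\<xi>$i * TO \<xi> u$j$k))
        + b2 *\<^sub>R (\<chi> k. \<Sum>i\<in>UNIV. \<Sum>j\<in>UNIV. gi$i$j * (\<xi>$i * TO \<xi> u$k$j)))$k)" for k
    unfolding comps
    by (rule sym2_eqI, ((rule sym2_add sym2_mult sym2_const sym2_divergence[OF ord1_torsion]
        sym2_divergence[OF ord1_torsion_transpose])+)[1]) simp
  have nth: "(A + B + C)$i$j$k = A$i$j$k + B$i$j$k + C$i$j$k" for A B C :: tens3 by simp
  show ?thesis
    unfolding P_local_def nth diamond_act hook4_def sharp_def act_nth vec_lambda_beta
      matrix_vector_mult_def[of "matrix_inv _"]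
    by (rule sym2_eqI, ((rule sym2_sum sym2_add sym2_mult ord1_val[OF ord1_inv] ord1_val[OF ord1_nth]
        ord1_val[OF ord1_psi] M d sym2_lie3)+)[1])
      (simp add: Qsym_def diamond_act hook4_def sharp_def act_nth[of _ _ i j k] matrix_vector_mult_def[of "matrix_inv _"])
qed

end

section \<open>The ellipticity estimate\<close>

lemma ip_frame:
  fixes E :: tens2
  assumes "gi = E ** transpose E"
  shows "(\<Sum>i\<in>UNIV. \<Sum>j\<in>UNIV. gi$i$j * x$i * z$j) = (transpose E *v x) \<bullet> (transpose E *v z)"
proof -
  have "(\<Sum>i\<in>UNIV. \<Sum>j\<in>UNIV. gi$i$j * x$i * z$j) = x \<bullet> (gi *v z)"
    by (simp add: inner_vec_def matrix_vector_mult_def sum_distrib_left mult_ac)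
  then show ?thesis
    by (simp add: assms dot_lmul_matrix[symmetric] inner_commute flip: matrix_vector_mul_assoc)
qed

lemma ip_pos:
  assumes w: "alternating w" and nd: "nondegenerate w" and x: "x \<noteq> 0"
  shows "G2_tensors.ip (matrix_inv (metric_of w)) x x > 0"
proof -
  obtain E T where ET: "E ** T = mat 1" "T ** E = mat 1" and wT: "w = pull3 T phi0"
    and g: "metric_of w = transpose T ** T" and gi: "matrix_inv (metric_of w) = E ** transpose E"
    and psi': "psi_of w = (\<chi> a b c d. \<Sum>i\<in>UNIV. \<Sum>j\<in>UNIV. \<Sum>k\<in>UNIV. \<Sum>l\<in>UNIV.
        star phi0 i j k l * (T$i$a * T$j$b * T$k$c * T$l$d))"
    by (rule G2_coframe[OF w nd]) (rule that)
  have "transpose T ** transpose E = mat 1" using ET(1) by (simp flip: matrix_transpose_mul)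
  then have "transpose T *v (transpose E *v x) = x" by (simp only: matrix_vector_mul_assoc matrix_vector_mul_lid)
  with x have "transpose E *v x \<noteq> 0" by auto
  then show ?thesis
    unfolding G2_tensors.ip_def[OF G2_tensors_of[OF w nd]] ip_frame[OF gi] by simp
qed

text \<open>A converse to \<open>act_wedge\<close>: for x orthogonal to Z, \<open>cl_cl_same\<close>
  gives x \<times> (x \<times> Z) = - |x|^2 Z, so every covector Z is a cross product and its
  contraction with \<psi> is the action of a wedge.\<close>

lemma hook4_act_antisym:
  assumes w: "alternating w" and nd: "nondegenerate w"
  obtains A where "\<And>i j. A$j$i = - A$i$j" "hook4 Y (psi_of w) = act (A ** matrix_inv (metric_of w)) w"
proof -
  interpret G2_tensors w "metric_of w" "matrix_inv (metric_of w)" "psi_of w" by (rule G2_tensors_of[OF w nd])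
  define Z where "Z = metric_of w *v Y"
  have Z: "matrix_inv (metric_of w) *v Z = Y" by (simp add: Z_def matrix_vector_mul_assoc gi_g_matrix)
  \<comment> \<open>A nonzero covector annihilating \<open>Y\<close>, found within the first two
    coordinates.\<close>
  define x :: vec7 where "x = (if Y$0 = 0 then axis 0 1 else Y$1 *\<^sub>R axis 0 1 - Y$0 *\<^sub>R axis 1 1)"
  have "x \<noteq> 0"
    by (auto simp: x_def vec_eq_iff axis_def forall_7)
  from ip_pos[OF w nd this] have pos: "ip x x > 0" .
  have "Y \<bullet> x = 0" by (auto simp: x_def inner_diff_right inner_axis)
  then have "ip Z x = 0" unfolding ip_eq Z by (simp add: inner_vec_def)
  then have xZ: "ip x Z = 0" by (simp add: ip_sym)
  define z where "z = (1 / ip x x) *\<^sub>R cl x Z"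
  have "cl x z = - Z"
    using pos by (simp add: z_def linear_scale[OF linear_cl] cl_cl_same xZ)
  then have "- (matrix_inv (metric_of w) *v cl x z) = Y"
    using Z matrix_vector_mult_scaleR[of "matrix_inv (metric_of w)" "-1" Z] by simp
  then have "act ((\<chi> i l. x$i * z$l - z$i * x$l) ** matrix_inv (metric_of w)) w = hook4 Y (psi_of w)"
    by (simp add: act_wedge)
  then show ?thesis by (intro that[of "\<chi> i l. x$i * z$l - z$i * x$l"]) simp_all
qed

lemma form_of_pair_act:
  "form_of_pair w (h, X) = act (h ** matrix_inv (metric_of w)) w + hook4 (matrix_inv (metric_of w) *v X) (psi_of w)"
  by (simp add: form_of_pair_def diamond_act sharp_def)

text \<open>The X-part is the action of a skew matrix and does not move the metric; the h-part
  contributes h and its transpose.\<close>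

lemma dsf_metric_form_of_pair:
  assumes w: "alternating w" and nd: "nondegenerate w" and h: "transpose h = h"
  shows "dsf ND (\<lambda>w. metric_of w$i$j) (form_of_pair w (h, X)) w = 2 * h$i$j"
proof -
  interpret G2_tensors w "metric_of w" "matrix_inv (metric_of w)" "psi_of w" by (rule G2_tensors_of[OF w nd])
  obtain A where A: "\<And>i j. A$j$i = - A$i$j"
    and hook: "hook4 (matrix_inv (metric_of w) *v X) (psi_of w) = act (A ** matrix_inv (metric_of w)) w"
    using hook4_act_antisym[OF w nd] by metis
  let ?M = "(h + A) ** matrix_inv (metric_of w)"
  have "form_of_pair w (h, X) = act ?M w"
    unfolding form_of_pair_act hook by (simp add: act_add matrix_add_distrib_right)
  then have "dsf ND (\<lambda>w. metric_of w$i$j) (form_of_pair w (h, X)) w = (?M ** metric_of w)$i$j + (?M ** metric_of w)$j$i"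
    using dsf_metric_act[OF nd, of i j ?M]
    by (simp add: matrix_matrix_mult_def[of ?M] sum.distrib g_sym[of i])
  also have "?M ** metric_of w = h + A" by (simp add: gi_g_matrix flip: matrix_mul_assoc)
  finally show ?thesis using A[of i j] arg_cong[OF h, of "\<lambda>M. M$i$j"] by (simp add: transpose_def)
qed

text \<open>h is recovered as half the variation of the metric, and then X by injectivity of the
  contraction with \<psi>.\<close>

lemma form_of_pair_inj:
  assumes w: "alternating w" and nd: "nondegenerate w"
  shows "inj_on (form_of_pair w) sym_pairs"
proof (rule inj_onI)
  interpret G2_tensors w "metric_of w" "matrix_inv (metric_of w)" "psi_of w" by (rule G2_tensors_of[OF w nd])
  fix s s' assume s: "s \<in> sym_pairs" "s' \<in> sym_pairs" and eq: "form_of_pair w s = form_of_pair w s'"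
  obtain h X h' X' where hX: "s = (h, X)" "s' = (h', X')" by (cases s, cases s')
  have sym: "transpose h = h" "transpose h' = h'" using s by (auto simp: hX sym_pairs_def)
  have "h$i$j = h'$i$j" for i j
    using dsf_metric_form_of_pair[OF w nd sym(1), of i j X] dsf_metric_form_of_pair[OF w nd sym(2), of i j X'] eq
    by (simp add: hX)
  then have h: "h = h'" by (simp add: vec_eq_iff)
  let ?gi = "matrix_inv (metric_of w)"
  have "hook4 (?gi *v X) (psi_of w) = hook4 (?gi *v X') (psi_of w)"
    using eq unfolding hX form_of_pair_act h by simp
  then have "hook4 (?gi *v X + - (?gi *v X')) (psi_of w) = 0" unfolding hook4_add hook4_minus by simp
  then have "?gi *v X = ?gi *v X'" using hook4_psi_inj[OF w nd] by fastforce
  then have "metric_of w *v (?gi *v X) = metric_of w *v (?gi *v X')" by simp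
  then show "s = s'" by (simp add: matrix_vector_mul_assoc gi_g_matrix hX h)
qed

lemma (in G2_tensors) sF_sym: "transpose h = h \<Longrightarrow> transpose (sF x h) = sF x h"
proof -
  assume h: "transpose h = h"
  have "transpose (c *\<^sub>R A) = c *\<^sub>R transpose A" for c and A :: tens2 by (simp add: vec_eq_iff transpose_def)
  then show ?thesis by (simp add: sF_def Let_def matrix_transpose_mul h matrix_mul_assoc)
qed

context base
begin

text \<open>The result is again a value of \<open>form_of_pair\<close>, so
  \<open>pair_of_form\<close> can be evaluated on it by injectivity.\<close>

lemma Qsym_form_of_pair:
  assumes h: "transpose h = h"
  shows "Qsym a l b1 b2 \<xi> (form_of_pair \<phi> (h, X)) = form_of_pair \<phi>
     (G2_tensors.ip gi \<xi> \<xi> *\<^sub>R h + l *\<^sub>R G2_tensors.sF \<phi> g \<xi> h,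
      ((b1 - a) * G2_tensors.ip gi \<xi> \<xi>) *\<^sub>R X + ((b2 + a) * G2_tensors.ip gi \<xi> X) *\<^sub>R \<xi>
        + (b1 - a - 1) *\<^sub>R G2_tensors.cl \<phi> gi \<xi> (h *v (gi *v \<xi>)))"
proof -
  interpret T: G2_tensors \<phi> g gi \<psi> by (rule g2_field.tensors[OF g2_field.intro[OF w0_V] y])
  have alt: "alternating \<phi>" "nondegenerate \<phi>" using w0_alt w0_nd y by auto
  let ?u = "form_of_pair \<phi> (h, X)"
  have u: "?u = act (h ** gi) \<phi> + hook4 (gi *v X) \<psi>" by (simp add: form_of_pair_act metric_field_def)
  have K: "K ?u$i$j = 2 * h$i$j" for i j
    unfolding K_def vec_lambda_beta by (rule dsf_metric_form_of_pair[OF alt h])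
  have CH: "CH \<xi> ?u$k$i$j = sGam gi \<xi> h k i j" for k i j
    unfolding CH_def sGam_def vec_lambda_beta K ..
  have NB: "NB \<xi> ?u$m = hook4 (gi *v (\<xi>$m *\<^sub>R X + T.cl \<xi> (h$m))) \<psi>" for m
  proof -
    have "NB \<xi> ?u$m = sNab \<phi> gi \<xi> h ?u m"
      by (simp add: vec_eq_iff NB_def sNab_def CH)
    then show ?thesis unfolding u T.sNab_eq[OF h] .
  qed
  have TO: "TO \<xi> ?u$m$p = \<xi>$m * X$p + T.cl \<xi> (h$m)$p" for m p
  proof -
    have "TO \<xi> ?u$m$p = (g *v (gi *v (\<xi>$m *\<^sub>R X + T.cl \<xi> (h$m))))$p"
      unfolding TO_def vec_lambda_beta NB TK_hook4[OF alt] by (simp add: metric_field_def)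
    then show ?thesis by (simp add: matrix_vector_mul_assoc T.gi_g_matrix)
  qed
  have SV: "SV \<xi> ?u = gi *v T.sV \<xi> h X"
    unfolding SV_def TO T.sV_eq[OF refl h] by (simp add: vec_lambda_eta)
  have WW: "WW a \<xi> ?u = gi *v T.sW a \<xi> h X"
    unfolding WW_def CH SV T.sW_eq[OF h] T.sW_def
    by (simp add: vec_lambda_eta matrix_vector_mult_diff_distrib matrix_vector_mult_scaleR) (simp add: vec_eq_iff)
  have RM: "RM \<xi> ?u$i$j$k$m = T.sRm \<xi> h i j k m" for i j k m
    unfolding RM_def vec_lambda_beta CH T.sRm_eq ..
  have RC: "RC \<xi> ?u = T.sRc \<xi> h"
    unfolding RC_def RM T.sRc_eq[OF h] by (simp add: vec_lambda_eta)
  have FF: "FF \<xi> ?u = T.sF \<xi> h"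
    unfolding FF_def RM T.sF_eq by (simp add: vec_lambda_eta)
  have LL: "LL \<xi> ?u = (\<chi> i j. \<xi>$i * T.sV \<xi> h X $j + \<xi>$j * T.sV \<xi> h X $i)"
  proof -
    have "LL \<xi> ?u$i$j = \<xi>$i * (\<Sum>l\<in>UNIV. (gi *v T.sV \<xi> h X)$l * g$l$j) + \<xi>$j * (\<Sum>l\<in>UNIV. (gi *v T.sV \<xi> h X)$l * g$l$i)" for i j
      by (simp add: LL_def SV sum.distrib sum_distrib_left mult.assoc T.g_sym[of i])
    then show ?thesis by (simp add: vec_eq_iff T.lower_raise)
  qed
  show ?thesis
    unfolding Qsym_def RC FF LL WW TO T.sdiv_eq[OF h] vec_lambda_eta T.symbol_total[OF refl]
    by (simp add: form_of_pair_def metric_field_def)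
qed

end

section \<open>Euclidean estimates for matrices\<close>

lemma inner_transpose: "transpose A \<bullet> transpose B = (A::tens2) \<bullet> B"
  unfolding inner_vec_def transpose_def by simp (rule sum.swap)

lemma inner_matrix_mult_left: "((N::tens2) ** A) \<bullet> B = A \<bullet> (transpose N ** B)"
proof -
  have "(N ** A) \<bullet> B = (\<Sum>i\<in>UNIV. \<Sum>k\<in>UNIV. \<Sum>j\<in>UNIV. N$i$j * A$j$k * B$i$k)"
    by (simp add: inner_vec_def matrix_matrix_mult_def sum_distrib_right)
  also have "\<dots> = (\<Sum>i\<in>UNIV. \<Sum>j\<in>UNIV. \<Sum>k\<in>UNIV. N$i$j * A$j$k * B$i$k)"
    by (rule sum.cong[OF refl]) (rule sum.swap)
  also have "\<dots> = (\<Sum>j\<in>UNIV. \<Sum>i\<in>UNIV. \<Sum>k\<in>UNIV. N$i$j * A$j$k * B$i$k)"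
    by (rule sum.swap)
  also have "\<dots> = A \<bullet> (transpose N ** B)"
    unfolding inner_vec_def by (rule sum.cong[OF refl], subst sum.swap)
      (simp add: matrix_matrix_mult_def transpose_def sum_distrib_left mult_ac)
  finally show ?thesis .
qed

lemma inner_matrix_mult_right:
  fixes A N B :: tens2
  shows "(A ** N) \<bullet> B = A \<bullet> (B ** transpose N)"
proof -
  have "(A ** N) \<bullet> B = (transpose N ** transpose A) \<bullet> transpose B"
    by (simp add: inner_transpose flip: matrix_transpose_mul)
  also have "\<dots> = transpose A \<bullet> transpose (B ** transpose N)"
    by (simp add: inner_matrix_mult_left matrix_transpose_mul)
  finally show ?thesis by (simp only: inner_transpose)
qed

lemma norm_matrix_mult_le:
  fixes N A :: tens2
  assumes N: "\<And>x. (N *v x) \<bullet> (N *v x) \<le> c * (x \<bullet> x)"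
  shows "(N ** A) \<bullet> (N ** A) \<le> c * (A \<bullet> A)"
proof -
  have cols: "M \<bullet> M = (\<Sum>k\<in>UNIV. column k M \<bullet> column k M)" for M :: tens2
    unfolding inner_vec_def column_def by simp (rule sum.swap)
  have "column k (N ** A) = N *v column k A" for k
    by (simp add: column_def vec_eq_iff matrix_matrix_mult_def matrix_vector_mult_def)
  then have "(N ** A) \<bullet> (N ** A) = (\<Sum>k\<in>UNIV. (N *v column k A) \<bullet> (N *v column k A))"
    unfolding cols by simp
  also have "\<dots> \<le> (\<Sum>k\<in>UNIV. c * (column k A \<bullet> column k A))" by (intro sum_mono N)
  finally show ?thesis unfolding cols[of A] by (simp add: sum_distrib_left)
qed

lemma norm_matrix_vector_le:
  fixes A :: tens2
  shows "(A *v x) \<bullet> (A *v x) \<le> (A \<bullet> A) * (x \<bullet> x)"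
proof -
  have "(A *v x) \<bullet> (A *v x) = (\<Sum>i\<in>UNIV. (A$i \<bullet> x)\<^sup>2)"
    by (simp add: inner_vec_def[of "A *v x"] matrix_vector_mul_component power2_eq_square)
  also have "\<dots> \<le> (\<Sum>i\<in>UNIV. (A$i \<bullet> A$i) * (x \<bullet> x))" by (intro sum_mono Cauchy_Schwarz_ineq)
  finally show ?thesis by (simp add: inner_vec_def[of A] sum_distrib_right)
qed

text \<open>For skew N and symmetric A the product equals minus the inner product of N A with its
  own transpose. By Cauchy-Schwarz this is at most |N A|^2, which is bounded column by
  column.\<close>

lemma skew_conj_inner_le:
  fixes N A :: tens2
  assumes N: "\<And>x. (N *v x) \<bullet> (N *v x) \<le> c * (x \<bullet> x)" and skew: "transpose N = - N" and A: "transpose A = A"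
  shows "\<bar>(N ** A ** transpose N) \<bullet> A\<bar> \<le> c * (A \<bullet> A)"
proof -
  have neg: "- N ** A = - (N ** A)" by (simp add: vec_eq_iff matrix_matrix_mult_def sum_negf)
  have "(N ** A ** transpose N) \<bullet> A = (A ** transpose N) \<bullet> (transpose N ** A)"
    by (simp add: inner_matrix_mult_left flip: matrix_mul_assoc)
  also have "\<dots> = - (transpose (N ** A) \<bullet> (N ** A))"
    by (simp add: skew neg matrix_transpose_mul A)
  finally have eq: "(N ** A ** transpose N) \<bullet> A = - (transpose (N ** A) \<bullet> (N ** A))" .
  have "\<bar>transpose (N ** A) \<bullet> (N ** A)\<bar> \<le> norm (transpose (N ** A)) * norm (N ** A)"
    by (rule Cauchy_Schwarz_ineq2)
  also have "\<dots> = (N ** A) \<bullet> (N ** A)"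
    by (simp add: norm_eq_sqrt_inner inner_transpose)
  also have "\<dots> \<le> c * (A \<bullet> A)" by (rule norm_matrix_mult_le[OF N])
  finally show ?thesis by (simp add: eq)
qed

context G2_tensors
begin

lemma ip_cl: "ip (cl x a) b = - ip a (cl x b)"
proof -
  have t: "ip (cl x a) b = (\<Sum>i\<in>UNIV. \<Sum>j\<in>UNIV. \<Sum>k\<in>UNIV. (gi *v x)$i * (gi *v a)$j * (gi *v b)$k * \<phi>$i$j$k)" for a b
  proof -
    have "ip (cl x a) b = (\<Sum>k\<in>UNIV. \<Sum>i\<in>UNIV. \<Sum>j\<in>UNIV. (gi *v x)$i * (gi *v a)$j * (gi *v b)$k * \<phi>$i$j$k)"
      using ip_eq[of b "cl x a"] by (subst ip_sym) (simp add: cl_def sum_distrib_left mult_ac)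
    from trans[OF this sum_rotate2] show ?thesis .
  qed
  have "ip (cl x b) a = (\<Sum>i\<in>UNIV. \<Sum>k\<in>UNIV. \<Sum>j\<in>UNIV. (gi *v x)$i * (gi *v b)$j * (gi *v a)$k * \<phi>$i$j$k)"
    unfolding t by (rule sum.cong[OF refl]) (rule sum.swap)
  also have "\<dots> = - ip (cl x a) b"
    unfolding t sum_negf[symmetric]
  proof (intro sum.cong refl)
    fix i j k
    show "(gi *v x)$i * (gi *v b)$k * (gi *v a)$j * \<phi>$i$k$j = - ((gi *v x)$i * (gi *v a)$j * (gi *v b)$k * \<phi>$i$j$k)"
      by (subst phi_swap(2)) simp
  qed
  finally show ?thesis by (simp add: ip_sym[of a])
qed

lemma transpose_S: "transpose (\<chi> j p. \<Sum>i\<in>UNIV. x$i * raise12 g \<phi> $i$j$p) *v y = cl x y"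
  if "gi = matrix_inv g"
proof -
  have "(transpose (\<chi> j p. \<Sum>i\<in>UNIV. x$i * raise12 g \<phi> $i$j$p) *v y)$p = cl x y$p" for p
  proof -
    have "(transpose (\<chi> j p. \<Sum>i\<in>UNIV. x$i * raise12 g \<phi> $i$j$p) *v y)$p
      = (\<Sum>j\<in>UNIV. \<Sum>i\<in>UNIV. x$i * (y$j * raise12 g \<phi> $i$j$p))"
      by (simp add: transpose_def matrix_vector_mult_def sum_distrib_left mult_ac)
    also have "\<dots> = (\<Sum>i\<in>UNIV. x$i * (\<Sum>j\<in>UNIV. y$j * raise12 g \<phi> $i$j$p))"
      by (subst sum.swap) (simp add: sum_distrib_left)
    also have "\<dots> = (\<Sum>i\<in>UNIV. x$i * cl (axis i 1) y $ p)" unfolding contract_raise12[OF that] ..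
    finally show ?thesis unfolding cl_axis_sum .
  qed
  then show ?thesis by (simp add: vec_eq_iff)
qed

lemma ip_cl_cl: "ip (cl x v) (cl x v) = ip x x * ip v v - (ip x v)\<^sup>2" and ip_x_cl: "ip x (cl x v) = 0"
proof -
  have lin: "ip v (c *\<^sub>R a - d *\<^sub>R b) = c * ip v a - d * ip v b" for c d a b
    by (simp add: ip_eq right_diff_distrib sum_subtractf sum_distrib_left mult_ac)
  show "ip (cl x v) (cl x v) = ip x x * ip v v - (ip x v)\<^sup>2"
    unfolding ip_cl[of x v] cl_cl_same lin by (simp add: ip_sym[of v x] power2_eq_square)
  show "ip x (cl x v) = 0" by (simp add: ip_eq ip_cl_self)
qed

end

lemma scaleR_matrix_right: "(A :: tens2) ** (c *\<^sub>R B) = c *\<^sub>R (A ** B :: tens2)"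
  by (simp add: vec_eq_iff matrix_matrix_mult_def sum_distrib_left mult_ac)

lemma pair_inner_frame:
  fixes E :: tens2
  assumes gi: "matrix_inv g = E ** transpose E"
  shows "pair_inner g (h1, X1) (h2, X2) = (transpose E ** h1 ** E) \<bullet> (transpose E ** h2 ** E)
    + (transpose E *v X1) \<bullet> (transpose E *v X2)"
proof -
  let ?gi = "matrix_inv g"
  have sym: "transpose ?gi = ?gi" by (simp add: gi matrix_transpose_mul)
  have "(\<Sum>i\<in>UNIV. \<Sum>j\<in>UNIV. \<Sum>a\<in>UNIV. \<Sum>b\<in>UNIV. ?gi$i$a * ?gi$j$b * h1$i$j * h2$a$b) = h1 \<bullet> (?gi ** h2 ** ?gi)"
  proof -
    have "(?gi ** h2 ** transpose ?gi)$i$j = (\<Sum>b\<in>UNIV. \<Sum>a\<in>UNIV. ?gi$i$a * ?gi$j$b * h2$a$b)" for i j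
      by (simp add: matrix_matrix_mult_def transpose_def sum_distrib_right sum_distrib_left mult_ac)
    then have "(?gi ** h2 ** transpose ?gi)$i$j = (\<Sum>a\<in>UNIV. \<Sum>b\<in>UNIV. ?gi$i$a * ?gi$j$b * h2$a$b)" for i j
      by (rule trans) (rule sum.swap)
    then have "(?gi ** h2 ** ?gi)$i$j = (\<Sum>a\<in>UNIV. \<Sum>b\<in>UNIV. ?gi$i$a * ?gi$j$b * h2$a$b)" for i j
      unfolding sym .
    then show ?thesis by (simp add: inner_vec_def sum_distrib_left mult_ac)
  qed
  also have "\<dots> = (transpose E ** h1 ** E) \<bullet> (transpose E ** h2 ** E)"
    by (simp only: gi inner_matrix_mult_right[of "transpose E ** h1" E] inner_matrix_mult_left[of "transpose E" h1]
      transpose_transpose matrix_mul_assoc)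
  finally show ?thesis by (simp add: pair_inner_def covector_inner_def ip_frame[OF gi])
qed

text \<open>The square of C/2 + |Z|^2 X - \<langle>Z,X\<rangle> Z is nonnegative. The last two terms
  are |Z|^2 times the component of X orthogonal to Z, and C is orthogonal to Z; dividing by |Z|^2
  gives the bound, with 1/4 from halving C.\<close>

lemma cross_term_bound:
  fixes C X Z :: vec7
  assumes p: "0 < Z \<bullet> Z" and C: "C \<bullet> C \<le> (Z \<bullet> Z) * ((Z \<bullet> Z) * H)" and Z: "Z \<bullet> C = 0"
  shows "- ((Z \<bullet> Z) * H / 4 + ((Z \<bullet> Z) * (X \<bullet> X) - (Z \<bullet> X)\<^sup>2)) \<le> C \<bullet> X"
proof -
  let ?p = "Z \<bullet> Z" and ?q = "X \<bullet> X" and ?r = "Z \<bullet> X"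
  let ?v = "(1/2) *\<^sub>R C + ?p *\<^sub>R X - ?r *\<^sub>R Z"
  have "0 \<le> ?v \<bullet> ?v" by simp
  also have "?v \<bullet> ?v = C \<bullet> C / 4 + ?p * (?p * ?q - ?r\<^sup>2) + ?p * (C \<bullet> X)"
    using Z by (simp add: inner_add_left inner_add_right inner_diff_left inner_diff_right inner_commute power2_eq_square algebra_simps)
  also have "\<dots> \<le> ?p * (?p * H / 4 + (?p * ?q - ?r\<^sup>2) + C \<bullet> X)"
    using C by (simp add: algebra_simps)
  finally have "0 \<le> ?p * H / 4 + (?p * ?q - ?r\<^sup>2) + C \<bullet> X"
    using p by (simp add: zero_le_mult_iff)
  then show ?thesis by simp
qed

text \<open>In the orthonormal frame the fibre product is Euclidean. The \<lambda>-term costs at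
  most 4 |\<lambda>| |\<xi>|^2 |h|^2. With B = b1 - a - 1, the mixed term costs B/4 of |\<xi>|^2
  |h|^2 and B times |\<xi>|^2 |X|^2 - \<langle>\<xi>,X\<rangle>^2, and the coefficient B + 1 of X
  pays for the latter.\<close>

lemma symbol_lower_bound:
  assumes w: "alternating w" and nd: "nondegenerate w" and h: "transpose h = h" and xi: "\<xi> \<noteq> 0"
    and b: "b1 + b2 \<ge> 1" "0 \<le> b1 - a - 1"
  shows "(1 - 4 * \<bar>l\<bar> - (b1 - a - 1) / 4) * covector_inner (metric_of w) \<xi> \<xi> * pair_inner (metric_of w) (h, X) (h, X)
    \<le> pair_inner (metric_of w)
     (G2_tensors.ip (matrix_inv (metric_of w)) \<xi> \<xi> *\<^sub>R h + l *\<^sub>R G2_tensors.sF w (metric_of w) \<xi> h,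
      ((b1 - a) * G2_tensors.ip (matrix_inv (metric_of w)) \<xi> \<xi>) *\<^sub>R X
        + ((b2 + a) * G2_tensors.ip (matrix_inv (metric_of w)) \<xi> X) *\<^sub>R \<xi>
        + (b1 - a - 1) *\<^sub>R G2_tensors.cl w (matrix_inv (metric_of w)) \<xi> (h *v (matrix_inv (metric_of w) *v \<xi>))) (h, X)"
proof -
  interpret G2_tensors w "metric_of w" "matrix_inv (metric_of w)" "psi_of w" by (rule G2_tensors_of[OF w nd])
  obtain E T where ET: "E ** T = mat 1" "T ** E = mat 1" and wT: "w = pull3 T phi0"
    and g: "metric_of w = transpose T ** T" and gi: "matrix_inv (metric_of w) = E ** transpose E"
    and psi': "psi_of w = (\<chi> a b c d. \<Sum>i\<in>UNIV. \<Sum>j\<in>UNIV. \<Sum>k\<in>UNIV. \<Sum>l\<in>UNIV.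
        star phi0 i j k l * (T$i$a * T$j$b * T$k$c * T$l$d))"
    by (rule G2_coframe[OF w nd]) (rule that)
  define F where "F = transpose E"
  define U where "U = transpose T"
  have tF: "transpose F = E" and FU: "F ** U = mat 1" "U ** F = mat 1" and tU: "transpose U = T"
    using ET by (simp_all add: F_def U_def flip: matrix_transpose_mul)
  have ip: "ip x z = (F *v x) \<bullet> (F *v z)" for x z unfolding ip_def ip_frame[OF gi] F_def ..
  define B where "B = b1 - a - 1"
  define H where "H = F ** h ** E"
  define Z where "Z = F *v \<xi>"
  define v where "v = h *v (matrix_inv (metric_of w) *v \<xi>)"
  define C where "C = F *v cl \<xi> v"
  define Y where "Y = F *v X"
  define S where "S = (\<chi> j p. \<Sum>i\<in>UNIV. \<xi>$i * raise12 (metric_of w) w $i$j$p)"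
  define N where "N = F ** transpose S ** U"
  have St: "transpose S *v x = cl \<xi> x" for x unfolding S_def by (rule transpose_S) simp
  have hh: "transpose H = H" by (simp add: H_def matrix_transpose_mul tF h matrix_mul_assoc F_def)
  have p: "0 < Z \<bullet> Z" using ip_pos[OF w nd xi] by (simp add: ip Z_def)
  have Fv: "F *v v = H *v Z"
    by (simp add: v_def gi H_def Z_def matrix_vector_mul_assoc matrix_mul_assoc F_def del: transpose_matrix_vector)
  have CC: "C \<bullet> C \<le> (Z \<bullet> Z) * ((Z \<bullet> Z) * (H \<bullet> H))"
  proof -
    have "C \<bullet> C \<le> (Z \<bullet> Z) * ((H *v Z) \<bullet> (H *v Z))"
      using ip_cl_cl[of \<xi> v] unfolding ip C_def[symmetric] Z_def[symmetric] Fv by simp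
    also have "\<dots> \<le> (Z \<bullet> Z) * ((H \<bullet> H) * (Z \<bullet> Z))" by (intro mult_left_mono norm_matrix_vector_le) simp
    finally show ?thesis by (simp add: mult_ac)
  qed
  have ZC: "Z \<bullet> C = 0" using ip_x_cl[of \<xi> v] by (simp add: ip Z_def C_def)
  have m: "- ((Z \<bullet> Z) * (H \<bullet> H) / 4 + ((Z \<bullet> Z) * (Y \<bullet> Y) - (Z \<bullet> Y)\<^sup>2)) \<le> C \<bullet> Y"
    by (rule cross_term_bound[OF p CC ZC])
  have Nx: "N *v x = F *v cl \<xi> (U *v x)" for x
    unfolding N_def by (simp only: matrix_vector_mul_assoc[symmetric] St)
  have FUx: "F *v (U *v x) = x" for x by (simp add: matrix_vector_mul_assoc FU)
  have N_le: "(N *v x) \<bullet> (N *v x) \<le> (Z \<bullet> Z) * (x \<bullet> x)" for x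
    using ip_cl_cl[of \<xi> "U *v x"] unfolding ip Nx FUx Z_def by simp
  have skew: "transpose N = - N"
  proof -
    have "(N *v x) \<bullet> z = - (x \<bullet> (N *v z))" for x z
      using ip_cl[of \<xi> "U *v x" "U *v z"] unfolding ip Nx FUx .
    note sk = this
    have n: "N$j$i = - N$i$j" for i j
    proof -
      have e: "N$j$i = (N *v axis i 1) \<bullet> axis j 1" for i j
        by (simp add: matrix_vector_mult_basis column_def inner_axis)
      have "N$j$i = - (axis i 1 \<bullet> (N *v axis j 1))" unfolding e[of j i] by (rule sk)
      also have "axis i 1 \<bullet> (N *v axis j 1) = N$i$j" unfolding e[of i j] by (rule inner_commute)
      finally show ?thesis .
    qed
    show ?thesis unfolding vec_eq_iff transpose_def vec_lambda_beta vector_uminus_component by (intro allI, rule n)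
  qed
  have FF: "F ** sF \<xi> h ** E = 4 *\<^sub>R (N ** H ** transpose N)"
  proof -
    have "N ** H ** transpose N = F ** transpose S ** (U ** F) ** h ** (E ** T) ** S ** E"
      by (simp add: N_def H_def matrix_transpose_mul matrix_mul_assoc tF tU F_def[symmetric])
    then have "N ** H ** transpose N = F ** (transpose S ** h ** S) ** E"
      by (simp add: FU ET matrix_mul_assoc)
    then show ?thesis unfolding sF_def S_def[symmetric] Let_def
      by (simp add: scaleR_matrix_left scaleR_matrix_right)
  qed
  have f: "\<bar>(N ** H ** transpose N) \<bullet> H\<bar> \<le> (Z \<bullet> Z) * (H \<bullet> H)"
    by (rule skew_conj_inner_le[OF N_le skew hh])
  let ?p = "Z \<bullet> Z" and ?H = "H \<bullet> H" and ?q = "Y \<bullet> Y" and ?r = "Z \<bullet> Y" and ?f = "(N ** H ** transpose N) \<bullet> H"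
  have lhs: "covector_inner (metric_of w) \<xi> \<xi> = ?p" "pair_inner (metric_of w) (h, X) (h, X) = ?H + ?q"
    by (simp_all only: covector_inner_def ip_frame[OF gi] pair_inner_frame[OF gi] F_def[symmetric] Z_def[symmetric] H_def[symmetric] Y_def[symmetric])
  have h1: "F ** (ip \<xi> \<xi> *\<^sub>R h + l *\<^sub>R sF \<xi> h) ** E = ?p *\<^sub>R H + (4 * l) *\<^sub>R (N ** H ** transpose N)"
    using FF by (simp add: matrix_add_ldistrib matrix_add_distrib_right scaleR_matrix_left scaleR_matrix_right ip Z_def H_def)
  have x1: "F *v (((b1 - a) * ip \<xi> \<xi>) *\<^sub>R X + ((b2 + a) * ip \<xi> X) *\<^sub>R \<xi> + (b1 - a - 1) *\<^sub>R cl \<xi> v)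
     = ((B + 1) * ?p) *\<^sub>R Y + ((b2 + a) * ?r) *\<^sub>R Z + B *\<^sub>R C"
    by (simp only: matrix_vector_right_distrib matrix_vector_mult_scaleR ip Y_def[symmetric] Z_def[symmetric] C_def[symmetric])
      (simp add: B_def)
  \<comment> \<open>Every product is replaced by a variable, so the final combination is
    linear.\<close>
  have lin: "z \<le> u + 4 * lf + (k + e + bm)"
    if "x \<le> bm" "x = br - bs - bu / 4" "- lu \<le> lf" "0 \<le> d" "e = d - br" "0 \<le> ls" "0 \<le> bs"
      "z = u + s - 4 * lu - 4 * ls - bu / 4 - bs / 4" "k = bs + s"
    for x bm br bs bu lu lf d e ls z k u s :: real
    using that by linarith
  define u where "u = ?p * ?H"
  define s where "s = ?p * ?q"
  have "B * - (u / 4 + (s - ?r\<^sup>2)) \<le> B * (C \<bullet> Y)"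
    using b(2) m by (intro mult_left_mono) (simp_all add: B_def u_def s_def)
  moreover have "B * - (u / 4 + (s - ?r\<^sup>2)) = B * ?r\<^sup>2 - B * s - B * u / 4" by (simp add: field_simps)
  moreover have "- (\<bar>l\<bar> * u) \<le> l * ?f"
  proof -
    have "\<bar>l * ?f\<bar> \<le> \<bar>l\<bar> * u" unfolding abs_mult u_def by (intro mult_left_mono f) simp
    then show ?thesis by linarith
  qed
  moreover have "0 \<le> (b1 + b2 - 1) * ?r\<^sup>2" using b(1) by simp
  \<comment> \<open>The mixed term returns B times \<langle>\<xi>,X\<rangle>^2; together with b2 + a
    this makes b1 + b2 - 1, which is where the first inequality on the coefficients enters.\<close>
  moreover have "(b2 + a) * ?r\<^sup>2 = (b1 + b2 - 1) * ?r\<^sup>2 - B * ?r\<^sup>2" by (simp add: B_def algebra_simps)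
  moreover have "0 \<le> \<bar>l\<bar> * s" "0 \<le> B * s" using b(2) by (simp_all add: B_def s_def)
  moreover have "(1 - 4 * \<bar>l\<bar> - B / 4) * (u + s) = u + s - 4 * (\<bar>l\<bar> * u) - 4 * (\<bar>l\<bar> * s) - B * u / 4 - B * s / 4"
    by (simp add: field_simps)
  moreover have "(B + 1) * s = B * s + s" by (simp add: algebra_simps)
  ultimately have "(1 - 4 * \<bar>l\<bar> - B / 4) * (u + s) \<le> u + 4 * (l * ?f) + ((B + 1) * s + (b2 + a) * ?r\<^sup>2 + B * (C \<bullet> Y))"
    by (rule lin)
  then have "(1 - 4 * \<bar>l\<bar> - B / 4) * ?p * (?H + ?q)
      \<le> ?p * ?H + 4 * (l * ?f) + ((B + 1) * ?p * ?q + (b2 + a) * ?r\<^sup>2 + B * (C \<bullet> Y))"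
    by (simp add: u_def s_def distrib_left mult.assoc)
  also have "\<dots> = (?p *\<^sub>R H + (4 * l) *\<^sub>R (N ** H ** transpose N)) \<bullet> H
      + (((B + 1) * ?p) *\<^sub>R Y + ((b2 + a) * ?r) *\<^sub>R Z + B *\<^sub>R C) \<bullet> Y"
    by (simp add: inner_add_left power2_eq_square)
  finally show ?thesis
    unfolding lhs pair_inner_frame[OF gi] F_def[symmetric] v_def[symmetric] h1 x1 H_def[symmetric] Y_def[symmetric] B_def .
qed

section \<open>From components to the linearized operator and its ellipticity\<close>

lemma axis_sum: "(x :: 'b::real_normed_vector^7) = (\<Sum>i\<in>UNIV. axis i (x$i))"
  by (simp add: vec_eq_iff axis_def)

lemma has_vector_derivative_vecI:
  fixes f :: "real \<Rightarrow> 'b::real_normed_vector^7"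
  assumes "\<And>i. ((\<lambda>t. f t$i) has_vector_derivative d$i) F"
  shows "(f has_vector_derivative d) F"
proof -
  have "((\<lambda>t. \<Sum>i\<in>UNIV. axis i (f t$i)) has_vector_derivative (\<Sum>i\<in>UNIV. axis i (d$i))) F"
    by (intro has_vector_derivative_sum bounded_linear.has_vector_derivative[OF bounded_linear_axis] assms)
  then show ?thesis unfolding axis_sum[symmetric] .
qed

lemmas linear_axis = bounded_linear.linear[OF bounded_linear_axis]

text \<open>Splitting a 2-jet along the axes yields the coefficient maps of orders two, one and zero
  demanded by \<open>is_principal_symbol\<close>.\<close>

lemma linear_jet:
  fixes L :: "(tens3^7^7) \<times> (tens3^7) \<times> tens3 \<Rightarrow> tens3"
  assumes L: "linear L"
  shows "linear (\<lambda>u. L (axis i (axis j u), 0, 0))" "linear (\<lambda>u. L (0, axis i u, 0))" "linear (\<lambda>u. L (0, 0, u))"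
    and "L (r, q, p) = (\<Sum>i\<in>UNIV. \<Sum>j\<in>UNIV. L (axis i (axis j (r$i$j)), 0, 0)) + (\<Sum>i\<in>UNIV. L (0, axis i (q$i), 0)) + L (0, 0, p)"
proof -
  have l1: "linear (\<lambda>r. L (r, 0, 0))" and l2: "linear (\<lambda>q. L (0, q, 0))" and l3: "linear (\<lambda>p. L (0, 0, p))"
    by (auto intro!: linearI simp flip: linear_add[OF L] linear_scale[OF L])
  note ax = linear_add[OF linear_axis] linear_scale[OF linear_axis]
  show "linear (\<lambda>u. L (axis i (axis j u), 0, 0))"
    by (intro linearI) (simp_all add: ax linear_add[OF l1] linear_scale[OF l1])
  show "linear (\<lambda>u. L (0, axis i u, 0))"
    by (intro linearI) (simp_all add: ax linear_add[OF l2] linear_scale[OF l2])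
  show "linear (\<lambda>u. L (0, 0, u))" by (rule l3)
  have "r = (\<Sum>i\<in>UNIV. \<Sum>j\<in>UNIV. axis i (axis j (r$i$j)))"
    unfolding linear_sum[OF linear_axis, symmetric] axis_sum[symmetric] ..
  then have "L (r, 0, 0) = (\<Sum>i\<in>UNIV. \<Sum>j\<in>UNIV. L (axis i (axis j (r$i$j)), 0, 0))"
    by (metis (no_types, lifting) linear_sum[OF l1] sum.cong)
  moreover have "L (0, q, 0) = (\<Sum>i\<in>UNIV. L (0, axis i (q$i), 0))"
    unfolding linear_sum[OF l2, symmetric] axis_sum[symmetric] ..
  moreover have "L (r, q, p) = L (r, 0, 0) + L (0, q, 0) + L (0, 0, p)"
    by (simp flip: linear_add[OF L])
  ultimately show "L (r, q, p) = (\<Sum>i\<in>UNIV. \<Sum>j\<in>UNIV. L (axis i (axis j (r$i$j)), 0, 0)) + (\<Sum>i\<in>UNIV. L (0, axis i (q$i), 0)) + L (0, 0, p)"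
    by simp
qed

lemma (in base) Q_linearization:
  "\<exists>L. linear L \<and> (\<forall>h. adm h \<longrightarrow> ((\<lambda>t. P_local a l b1 b2 (fam h t) y + lie3 (W_local a (fam h t) w0) (fam h t) y)
      has_vector_derivative L (jet2 h y)) (at 0)) \<and> (\<forall>\<xi> u. Qsym a l b1 b2 \<xi> u = L (sjet \<xi> u))"
proof -
  let ?N = "\<lambda>w. P_local a l b1 b2 w y + lie3 (W_local a w w0) w y"
  let ?R = "\<lambda>i j k L. linear L \<and> (\<forall>h. adm h \<longrightarrow> ((\<lambda>t. ?N (fam h t)$i$j$k) has_real_derivative L (jet2 h y)) (at 0))
     \<and> (\<forall>\<xi> u. Qsym a l b1 b2 \<xi> u$i$j$k = L (sjet \<xi> u))"
  define L where "L i j k = (SOME L. ?R i j k L)" for i j k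
  have "?R i j k (L i j k)" for i j k
    unfolding L_def by (rule someI_ex[of "?R i j k", OF sym2_Q[unfolded sym2_def]])
  then have L: "linear (L i j k)"
    "adm h \<Longrightarrow> ((\<lambda>t. ?N (fam h t)$i$j$k) has_real_derivative L i j k (jet2 h y)) (at 0)"
    "Qsym a l b1 b2 \<xi> u$i$j$k = L i j k (sjet \<xi> u)" for i j k h \<xi> u
    by simp_all
  show ?thesis
  proof (intro exI conjI allI impI)
    show "linear (\<lambda>x. \<chi> i j k. L i j k x)"
      by (intro linearI) (simp_all add: vec_eq_iff linear_add[OF L(1)] linear_scale[OF L(1)])
    show "Qsym a l b1 b2 \<xi> u = (\<chi> i j k. L i j k (sjet \<xi> u))" for \<xi> u
      by (simp add: vec_eq_iff L(3))
    show "((\<lambda>t. ?N (fam h t)) has_vector_derivative (\<chi> i j k. L i j k (jet2 h y))) (at 0)" if "adm h" for h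
      using L(2)[OF that] unfolding has_real_derivative_iff_has_vector_derivative
      by (intro has_vector_derivative_vecI) simp
  qed
qed

theorem proposition6p72:
  fixes A :: "'m::{t2_space, second_countable_topology} chart set"
    and phit :: "'m form3"
    and a l b1 b2 :: real
  assumes "smooth_atlas A"
    and "G2_structure A phit"
    and "b1 + b2 \<ge> 1"
    and "0 \<le> b1 - a - 1" and "b1 - a - 1 < 4"
    and "\<bar>l\<bar> < 1/4 * (1 - 1/4 * (b1 - a - 1))"
  shows "strongly_elliptic_at A (Q_hat a l b1 b2 phit) phit"
proof -
  have base: "base (chart_image C) y (phit C)" if "C \<in> A" "y \<in> chart_image C" for C y
    using assms(1,2) that
    by (auto simp: base_def smooth_atlas_def topological_chart_def G2_structure_def smooth_form3_def)
  have adm: "base.adm (chart_image C) (h C)" if "C \<in> A" "y \<in> chart_image C" "smooth_form3 A h" for C y h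
    using that by (auto simp: base.adm_def[OF base[OF that(1,2)]] smooth_form3_def)
  let ?P = "\<lambda>C y L. linear L \<and> (\<forall>h. base.adm (chart_image C) h \<longrightarrow>
      ((\<lambda>t. P_local a l b1 b2 (base.fam (phit C) h t) y + lie3 (W_local a (base.fam (phit C) h t) (phit C)) (base.fam (phit C) h t) y)
      has_vector_derivative L (jet2 h y)) (at 0)) \<and> (\<forall>\<xi> u. base.Qsym y (phit C) a l b1 b2 \<xi> u = L (sjet \<xi> u))"
  \<comment> \<open>The linearization is known pointwise; the choice turns it into one operator
    defined for all charts and points.\<close>
  define L where "L C y = (SOME L. ?P C y L)" for C y
  have P: "?P C y (L C y)" if "C \<in> A" "y \<in> chart_image C" for C y
    unfolding L_def by (rule someI_ex[of "?P C y", OF base.Q_linearization[OF base[OF that]]])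
  define D where "D = (\<lambda>(h :: 'm form3) C y. L C y (jet2 (h C) y))"
  define \<sigma> where "\<sigma> C y \<xi> u = L C y (sjet \<xi> u)" for C y \<xi> u
  have lin: "is_linearization A (Q_hat a l b1 b2 phit) phit D"
    unfolding is_linearization_def
  proof (intro allI impI ballI)
    fix h :: "'m form3" and C y assume h: "smooth_form3 A h" and Cy: "C \<in> A" "y \<in> chart_image C"
    have "Q_hat a l b1 b2 phit (\<lambda>D z. phit D z + t *\<^sub>R h D z) C y =
      P_local a l b1 b2 (base.fam (phit C) (h C) t) y
       + lie3 (W_local a (base.fam (phit C) (h C) t) (phit C)) (base.fam (phit C) (h C) t) y" for t
      by (simp add: Q_hat_def P_hat_def base.fam_def[OF base[OF Cy]])
    then show "((\<lambda>t. Q_hat a l b1 b2 phit (\<lambda>D z. phit D z + t *\<^sub>R h D z) C y) has_vector_derivative D h C y) (at 0)"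
      using P[OF Cy] adm[OF Cy h] by (simp add: D_def)
  qed
  have symb: "is_principal_symbol A D \<sigma>"
    unfolding is_principal_symbol_def
  proof (intro ballI exI conjI allI impI)
    fix C y assume Cy: "C \<in> A" "y \<in> chart_image C"
    have L: "linear (L C y)" using P[OF Cy] by blast
    note j = linear_jet[OF L]
    show "linear (\<lambda>u. L C y (axis i (axis j u), 0, 0))" "linear (\<lambda>u. L C y (0, axis i u, 0))" "linear (\<lambda>u. L C y (0, 0, u))" for i j
      by (rule j)+
    show "D h C y = (\<Sum>i\<in>UNIV. \<Sum>j\<in>UNIV. L C y (axis i (axis j (pd i (pd j (h C)) y)), 0, 0))
        + (\<Sum>i\<in>UNIV. L C y (0, axis i (pd i (h C) y), 0)) + L C y (0, 0, h C y)" for h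
      unfolding D_def jet2_def by (rule trans[OF j(4)]) simp
    show "\<sigma> C y \<xi> u = (\<Sum>i\<in>UNIV. \<Sum>j\<in>UNIV. (\<xi>$i * \<xi>$j) *\<^sub>R L C y (axis i (axis j u), 0, 0))" for \<xi> u
    proof -
      have "L C y (axis i (axis j ((\<xi>$i * \<xi>$j) *\<^sub>R u)), 0, 0) = (\<xi>$i * \<xi>$j) *\<^sub>R L C y (axis i (axis j u), 0, 0)" for i j
        by (rule linear_scale[OF j(1)])
      moreover have "L C y (0, axis i 0, 0) = 0" for i by (rule linear_0[OF j(2)])
      moreover have "L C y (0, 0, 0) = 0" using linear_0[OF j(3)] .
      ultimately show ?thesis unfolding \<sigma>_def sjet_def by (intro trans[OF j(4)]) simp
    qed
  qed
  \<comment> \<open>Built from the coefficients alone, hence uniform over all charts and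
    points.\<close>
  define c where "c = 1 - 4 * \<bar>l\<bar> - (b1 - a - 1) / 4"
  have "c > 0" using assms(6) by (simp add: c_def field_simps)
  moreover have "c * covector_inner (metric_of (phit C y)) \<xi> \<xi> * pair_inner (metric_of (phit C y)) s s
      \<le> pair_inner (metric_of (phit C y)) (pair_of_form (phit C y) (\<sigma> C y \<xi> (form_of_pair (phit C y) s))) s"
    if Cy: "C \<in> A" "y \<in> chart_image C" and \<xi>: "\<xi> \<noteq> 0" and s: "s \<in> sym_pairs" for C y \<xi> s
  proof -
    interpret base "chart_image C" y "phit C" by (rule base[OF Cy])
    have alt: "alternating (phit C y)" "nondegenerate (phit C y)" using w0_alt w0_nd y by auto
    interpret T: G2_tensors "phit C y" "metric_of (phit C y)" "matrix_inv (metric_of (phit C y))" "psi_of (phit C y)"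
      by (rule G2_tensors_of[OF alt])
    obtain h X where hX: "s = (h, X)" and h: "transpose h = h" using s by (auto simp: sym_pairs_def)
    have \<sigma>: "\<sigma> C y \<xi> u = Qsym a l b1 b2 \<xi> u" for u using P[OF Cy] by (simp add: \<sigma>_def)
    have tr: "transpose (A + B) = transpose A + transpose B" "transpose (c *\<^sub>R A) = c *\<^sub>R transpose A" for A B :: tens2 and c
      by (simp_all add: vec_eq_iff transpose_def)
    \<comment> \<open>The inverse is taken on symmetric pairs, so the h-component of the symbol must
      be checked to be symmetric.\<close>
    have "pair_of_form (phit C y) (form_of_pair (phit C y) s') = s'" if "s' \<in> sym_pairs" for s'
      unfolding pair_of_form_def by (rule inv_into_f_f[OF form_of_pair_inj[OF alt] that])
    moreover have "(T.ip \<xi> \<xi> *\<^sub>R h + l *\<^sub>R T.sF \<xi> h, Z) \<in> sym_pairs" for Z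
      by (simp add: sym_pairs_def tr h T.sF_sym)
    ultimately have "pair_of_form (phit C y) (\<sigma> C y \<xi> (form_of_pair (phit C y) s)) =
      (T.ip \<xi> \<xi> *\<^sub>R h + l *\<^sub>R T.sF \<xi> h, ((b1 - a) * T.ip \<xi> \<xi>) *\<^sub>R X + ((b2 + a) * T.ip \<xi> X) *\<^sub>R \<xi>
        + (b1 - a - 1) *\<^sub>R T.cl \<xi> (h *v (matrix_inv (metric_of (phit C y)) *v \<xi>)))"
      unfolding \<sigma> hX Qsym_form_of_pair[OF h] metric_field_def by blast
    then show ?thesis
      using symbol_lower_bound[OF alt h \<xi> assms(3,4), of l X] by (simp add: c_def hX)
  qed
  ultimately show ?thesis
    unfolding strongly_elliptic_at_def Let_def using lin symb by blast
qed

end
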